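(* The properties $\mathrm{PD}_{\mathbb Z}$ and $\mathrm{PD}_{\mathbb Q}$ (Poincaré duality for the Chow ring with integer, resp. rational, coefficients) are both $\mathcal T$-stable in the class of div-faithful unimodular tropical fans.
   Context: **Fans.** $N$ is a free abelian group of finite rank, $M=\mathrm{Hom}(N,\mathbb Z)$, $N_{\mathbb R}=N\otimes\mathbb R$. A rational fan $\Sigma$ in $N_{\mathbb R}$ is a non-empty finite collection of strongly convex rational polyhedral cones, closed under taking faces, any two of which meet in a common face; $|\Sigma|$ is its support, $\Sigma_k$ the set of its $k$-dimensional cones, $\underline 0=\{0\}$; facets are maximal cones, rays are elements of $\Sigma_1$, and $e_\rho$ is the primitive vector of a ray $\rho$. For a cone $\sigma$, $N_\sigma=N\cap\mathrm{span}(\sigma)$ and $N^\sigma=N/N_\sigma$. $\Sigma$ is unimodular if each $\sigma\in\Sigma$ is generated by a basis of $N_\sigma$. If $\tau$ is a codimension one face of $\sigma$, $\mathfrak n_{\sigma/\tau}\in N_\sigma$ denotes any vector lying on the same side of $\mathrm{span}(\tau)$ as $\sigma$ with $N_\tau+\mathbb Z\,\mathfrak n_{\sigma/\tau}=N_\sigma$, and $e^\tau_\sigma$ is its image in $N^\tau$. The star fan $\Sigma^\sigma$ is the fan in $N^\sigma_{\mathbb R}$ formed by the images $\eta^\sigma$ of the cones $\eta\in\Sigma$ containing $\sigma$. **Tropical fans.** $\mathrm{MW}_p(\Sigma)$ is the group of Minkowski weights: maps $w\colon\Sigma_p\to\mathbb Z$ with $\sum_{\sigma\supset\tau,\,\sigma\in\Sigma_p}w(\sigma)e^\tau_\sigma=0$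 in $N^\tau$ for all $\tau\in\Sigma_{p-1}$. A tropical fan $(\Sigma,\omega_\Sigma)$ of dimension $d$ is a rational fan of pure dimension $d$ with an orientation, i.e. an element $\omega_\Sigma\in\mathrm{MW}_d(\Sigma)$ taking only non-zero values. Star fans carry the induced orientation $\omega_{\Sigma^\sigma}(\eta^\sigma)=\omega_\Sigma(\eta)$; products carry $\omega(\sigma\times\sigma')=\omega_\Sigma(\sigma)\omega_{\Sigma'}(\sigma')$. Tropical fans are considered up to isomorphism (integral linear isomorphisms of the lattices $N\cap\mathrm{span}|\Sigma|$ matching cones and orientations). **Chow ring, Poincaré duality.** For $\Sigma$ unimodular, $A^\bullet(\Sigma)=\mathbb Z[\mathrm x_\zeta]_{\zeta\in\Sigma_1}/(I+J)$, with $I$ generated by the products $\mathrm x_{\rho_1}\cdots\mathrm x_{\rho_k}$ for rays $\rho_1,\dots,\rho_k$ not contained in a common cone of $\Sigma$, and $J$ generated by $\sum_{\zeta\in\Sigma_1}m(e_\zeta)\mathrm x_\zeta$, $m\in M$. $x_\zeta$ is the class of $\mathrm x_\zeta$, and $x_\sigma$ is the product of the $x_\zeta$ over the rays $\zeta$ of $\sigma$. $A^\bullet(\Sigma,\mathbb Q)=A^\bullet(\Sigma)\otimes\mathbb Q$. For a unimodular tropical fan of dimension $d$, the degree map $\deg_\Sigma\colon A^d(\Sigma)\to\mathbb Z$ is the well-defined homomorphism with $\deg_\Sigma(x_\sigma)=\omega_\Sigma(\sigma)$, $\sigma\in\Sigma_d$. $\Sigma$ verifies $\mathrm{PD}_{\mathbb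 Z}$ if for all $0\le k\le d$ the pairing $A^k(\Sigma)\times A^{d-k}(\Sigma)\to\mathbb Z$, $(\alpha,\beta)\mapsto\deg_\Sigma(\alpha\beta)$, is perfect; it verifies $\mathrm{PD}_{\mathbb Q}$ if these pairings become perfect after tensoring with $\mathbb Q$. **Meromorphic functions, divisors, tropical modifications.** A meromorphic function $f$ on $\Sigma$ is a continuous function $|\Sigma|\to\mathbb R$ whose restriction to each cone $\sigma$ is given by an integral linear form $f_\sigma\in\mathrm{Hom}(N_\sigma,\mathbb Z)$. For $\tau\in\Sigma_{d-1}$, $\mathrm{ord}_\tau(f)=-\sum_{\sigma\supset\tau}\omega_\Sigma(\sigma)f_\sigma(\mathfrak n_{\sigma/\tau})+f_\tau\bigl(\sum_{\sigma\supset\tau}\omega_\Sigma(\sigma)\mathfrak n_{\sigma/\tau}\bigr)$ (sums over $\sigma\in\Sigma_d$), and $\mathrm{div}(f)\in\mathrm{MW}_{d-1}(\Sigma)$ is $\tau\mapsto\mathrm{ord}_\tau(f)$. When not identically zero, $\mathrm{div}(f)$ is identified with the tropical fan $\Delta$ consisting of all $\tau\in\Sigma_{d-1}$ with $\mathrm{ord}_\tau(f)\ne0$ and their faces, oriented by $\mathrm{ord}(f)$; when zero, $\mathrm{div}(f)$ is called trivial and $\Delta=\varnothing$. The tropical modification $\mathrm{TM}_f(\Sigma)$ is the tropical fan in $(N\times\mathbb Z)_{\mathbb R}$ with cones $\sigma_o=\{(x,f(x)):x\in\sigma\}$ for $\sigma\in\Sigma$ and $\delta_\uparrow=\delta_o+\mathbb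 R_{\ge0}(0,1)$ for $\delta\in\Delta$, with orientation $\sigma_o\mapsto\omega_\Sigma(\sigma)$ ($\sigma\in\Sigma_d$), $\delta_\uparrow\mapsto\mathrm{ord}_\delta(f)$ ($\delta\in\Delta_{d-1}$). **Div-faithfulness.** $\Sigma$ is div-faithful if for every $\eta\in\Sigma$, every meromorphic function on the tropical fan $\Sigma^\eta$ with trivial divisor is the restriction to $|\Sigma^\eta|$ of a linear form on $N^\eta_{\mathbb R}$. **Blow-ups.** For $\sigma\in\Sigma$ and a rational ray $\rho$ in the relative interior of $\sigma$, the blow-up (stellar subdivision) $\Sigma_{(\rho)}$ is obtained by removing all cones containing $\sigma$ and adding the cones $\tau+\rho$ for $\tau$ a face, not containing $\sigma$, of some $\eta\in\Sigma$ with $\eta\supseteq\sigma$; each facet gets the weight of the facet of $\Sigma$ containing it. **$\mathcal T$-stability.** Let $\mathscr C$ be a class of tropical fans. A subclass $\mathscr S\subseteq\mathscr C$ is $\mathcal T$-stable in $\mathscr C$ if: (i) if $\Sigma,\Sigma'\in\mathscr S$ and $\Sigma\times\Sigma'\in\mathscr C$, then $\Sigma\times\Sigma'\in\mathscr S$; (ii) if $\Sigma\in\mathscr S$, $f$ is meromorphic on $\Sigma$ with $\mathrm{div}(f)$ trivial or in $\mathscr S$, and $\mathrm{TM}_f(\Sigma)\in\mathscr C$, then $\mathrm{TM}_f(\Sigma)\in\mathscr S$; (iii) if $\Sigma\in\mathscr C$, $\sigma\in\Sigma$, $\rho$ is a rational ray in the relative interior of $\sigma$, $\Sigma^\sigma\in\mathscr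 S$ and $\Sigma_{(\rho)}\in\mathscr C$, then $\Sigma\in\mathscr S\Leftrightarrow\Sigma_{(\rho)}\in\mathscr S$. A property is $\mathcal T$-stable in $\mathscr C$ if the subclass of elements of $\mathscr C$ having it is $\mathcal T$-stable in $\mathscr C$. *)

theory Defs
  imports "HOL-Analysis.Analysis" "HOL-Analysis.Finite_Function_Topology" "HOL-Algebra.Free_Abelian_Groups"
    "HOL-Algebra.QuotRing" "HOL-Algebra.Generated_Groups"
begin

section \<open>Lattices and cones\<close>

text \<open>
  A free abelian group of rank \<open>n\<close> is given by coordinates, as \<open>\<int>\<^sup>n\<close>. All the spaces \<open>\<real>\<^sup>n\<close> are
  realized in the single real (normed) vector space of finitely supported real sequences, as the
  subspace of the vectors whose coordinates vanish from index \<open>n\<close> on. This allows lattices of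
  different ranks (products, graphs, quotients) to occur in one formula.
\<close>

type_synonym vec = "nat \<Rightarrow>\<^sub>0 real"

definition Zlat :: "nat \<Rightarrow> vec set" where
  "Zlat n = {v. (\<forall>i. Poly_Mapping.lookup v i \<in> \<int>) \<and> (\<forall>i\<ge>n. Poly_Mapping.lookup v i = 0)}"

definition Rspace :: "nat \<Rightarrow> vec set" where
  "Rspace n = {v. \<forall>i\<ge>n. Poly_Mapping.lookup v i = 0}"

definition lat_group :: "vec set \<Rightarrow> vec monoid" where
  "lat_group L = \<lparr>carrier = L, monoid.mult = (+), one = 0\<rparr>"

text \<open>The lattice \<open>N\<^sub>\<sigma>\<close>.\<close>

definition Nsub :: "nat \<Rightarrow> vec set \<Rightarrow> vec set" where
  "Nsub n \<sigma> = Zlat n \<inter> span \<sigma>"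

text \<open>For subsets of \<open>\<int>\<^sup>n\<close>, linear independence over \<open>\<int>\<close> and over \<open>\<real>\<close> agree.\<close>

definition lattice_basis :: "vec set \<Rightarrow> vec set \<Rightarrow> bool" where
  "lattice_basis B L \<longleftrightarrow> finite B \<and> independent B \<and>
     L = {\<Sum>b\<in>B. of_int (c b) *\<^sub>R b |c :: vec \<Rightarrow> int. True}"

definition rational_cone :: "nat \<Rightarrow> vec set \<Rightarrow> bool" where
  "rational_cone n \<sigma> \<longleftrightarrow> (\<exists>S. finite S \<and> S \<subseteq> Zlat n \<and> \<sigma> = convex_cone hull S)"

definition strongly_convex :: "vec set \<Rightarrow> bool" where
  "strongly_convex \<sigma> \<longleftrightarrow> (\<forall>x. x \<in> \<sigma> \<and> - x \<in> \<sigma> \<longrightarrow> x = 0)"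

text \<open>The library relation \<open>face_of\<close> also admits the empty set, which is not a face of a cone here.\<close>

definition cone_face :: "vec set \<Rightarrow> vec set \<Rightarrow> bool" where
  "cone_face \<tau> \<sigma> \<longleftrightarrow> \<tau> face_of \<sigma> \<and> \<tau> \<noteq> {}"

definition mink_sum :: "vec set \<Rightarrow> vec set \<Rightarrow> vec set" where
  "mink_sum \<sigma> \<tau> = {x + y |x y. x \<in> \<sigma> \<and> y \<in> \<tau>}"

text \<open>The vectors that can serve as \<open>\<nn>\<^bsub>\<sigma>/\<tau>\<^esub>\<close>, for \<open>\<tau>\<close> a codimension one face of \<open>\<sigma>\<close>: the open
  half-space of \<open>span \<sigma>\<close> bounded by \<open>span \<tau>\<close> and on the side of \<open>\<sigma>\<close> is
  \<open>(\<sigma> + span \<tau>) - span \<tau>\<close>.\<close>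

definition is_normal_vec :: "nat \<Rightarrow> vec set \<Rightarrow> vec set \<Rightarrow> vec \<Rightarrow> bool" where
  "is_normal_vec n \<sigma> \<tau> v \<longleftrightarrow>
     v \<in> Nsub n \<sigma> \<and> v \<in> mink_sum \<sigma> (span \<tau>) - span \<tau> \<and>
     Nsub n \<sigma> = {u + of_int k *\<^sub>R v |u k. u \<in> Nsub n \<tau>}"

definition normal_vec :: "nat \<Rightarrow> vec set \<Rightarrow> vec set \<Rightarrow> vec" where
  "normal_vec n \<sigma> \<tau> = (SOME v. is_normal_vec n \<sigma> \<tau> v)"

text \<open>The primitive vector \<open>e\<^sub>\<rho>\<close> of a rational ray.\<close>

definition prim_vec :: "nat \<Rightarrow> vec set \<Rightarrow> vec" where
  "prim_vec n \<rho> = (THE e. e \<noteq> 0 \<and> \<rho> \<inter> Zlat n = range (\<lambda>k::nat. of_nat k *\<^sub>R e))"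


section \<open>Tropical fans\<close>

text \<open>A fan in \<open>\<real>\<^sup>n\<close>, \<open>n = lat_rank \<Sigma>\<close>, together with integers attached to cones. Only the values
  of \<open>wt\<close> on the cones of top dimension are meaningful.\<close>

record tfan =
  lat_rank :: nat
  cones :: "vec set set"
  wt :: "vec set \<Rightarrow> int"

definition rational_fan :: "tfan \<Rightarrow> bool" where
  "rational_fan \<Sigma> \<longleftrightarrow> cones \<Sigma> \<noteq> {} \<and> finite (cones \<Sigma>) \<and>
     (\<forall>\<sigma>\<in>cones \<Sigma>. rational_cone (lat_rank \<Sigma>) \<sigma> \<and> strongly_convex \<sigma>) \<and>
     (\<forall>\<sigma>\<in>cones \<Sigma>. \<forall>\<tau>. cone_face \<tau> \<sigma> \<longrightarrow> \<tau> \<in> cones \<Sigma>) \<and>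
     (\<forall>\<sigma>\<in>cones \<Sigma>. \<forall>\<tau>\<in>cones \<Sigma>. cone_face (\<sigma> \<inter> \<tau>) \<sigma> \<and> cone_face (\<sigma> \<inter> \<tau>) \<tau>)"

definition support :: "tfan \<Rightarrow> vec set" where
  "support \<Sigma> = \<Union> (cones \<Sigma>)"

definition cones_dim :: "tfan \<Rightarrow> nat \<Rightarrow> vec set set" where
  "cones_dim \<Sigma> k = {\<sigma> \<in> cones \<Sigma>. dim \<sigma> = k}"

definition fan_dim :: "tfan \<Rightarrow> nat" where
  "fan_dim \<Sigma> = Max (dim ` cones \<Sigma>)"

definition pure_dim :: "tfan \<Rightarrow> nat \<Rightarrow> bool" where
  "pure_dim \<Sigma> d \<longleftrightarrow> (\<forall>\<sigma>\<in>cones \<Sigma>. (\<forall>\<eta>\<in>cones \<Sigma>. \<sigma> \<subseteq> \<eta> \<longrightarrow> \<eta> = \<sigma>) \<longrightarrow> dim \<sigma> = d)"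

text \<open>The balancing condition holds in \<open>N\<^sup>\<tau> = N/N\<^sub>\<tau>\<close>, so the sum of the representatives has to lie
  in \<open>N\<^sub>\<tau>\<close>.\<close>

definition minkowski_weight :: "tfan \<Rightarrow> nat \<Rightarrow> (vec set \<Rightarrow> int) \<Rightarrow> bool" where
  "minkowski_weight \<Sigma> p w \<longleftrightarrow>
     (\<forall>\<tau>\<in>cones \<Sigma>. dim \<tau> + 1 = p \<longrightarrow>
        (\<Sum>\<sigma> | \<sigma> \<in> cones_dim \<Sigma> p \<and> \<tau> \<subseteq> \<sigma>. of_int (w \<sigma>) *\<^sub>R normal_vec (lat_rank \<Sigma>) \<sigma> \<tau>)
          \<in> Nsub (lat_rank \<Sigma>) \<tau>)"

definition tropical_fan :: "tfan \<Rightarrow> bool" where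
  "tropical_fan \<Sigma> \<longleftrightarrow> rational_fan \<Sigma> \<and> pure_dim \<Sigma> (fan_dim \<Sigma>) \<and>
     minkowski_weight \<Sigma> (fan_dim \<Sigma>) (wt \<Sigma>) \<and>
     (\<forall>\<sigma>\<in>cones_dim \<Sigma> (fan_dim \<Sigma>). wt \<Sigma> \<sigma> \<noteq> 0)"

definition unimodular :: "tfan \<Rightarrow> bool" where
  "unimodular \<Sigma> \<longleftrightarrow>
     (\<forall>\<sigma>\<in>cones \<Sigma>. \<exists>B. lattice_basis B (Nsub (lat_rank \<Sigma>) \<sigma>) \<and> \<sigma> = convex_cone hull B)"

definition tropical_iso :: "tfan \<Rightarrow> tfan \<Rightarrow> bool" where
  "tropical_iso \<Sigma> \<Sigma>' \<longleftrightarrow> (\<exists>\<phi>::vec \<Rightarrow> vec. linear \<phi> \<and> inj_on \<phi> (span (support \<Sigma>)) \<and>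
     \<phi> ` (Zlat (lat_rank \<Sigma>) \<inter> span (support \<Sigma>))
       = Zlat (lat_rank \<Sigma>') \<inter> span (support \<Sigma>') \<and>
     (\<lambda>\<sigma>. \<phi> ` \<sigma>) ` cones \<Sigma> = cones \<Sigma>' \<and>
     (\<forall>\<sigma>\<in>cones_dim \<Sigma> (fan_dim \<Sigma>). wt \<Sigma>' (\<phi> ` \<sigma>) = wt \<Sigma> \<sigma>))"


section \<open>Star fans, products, blow-ups\<close>

text \<open>A linear presentation \<open>\<int>\<^sup>n \<rightarrow> \<int>\<^sup>n\<^sup>-\<^sup>k\<close> of the quotient \<open>N \<rightarrow> N\<^sup>\<sigma> = N/N\<^sub>\<sigma>\<close>, where
  \<open>k = dim \<sigma>\<close>. Two choices differ by an automorphism of \<open>\<int>\<^sup>n\<^sup>-\<^sup>k\<close>, so the star fan is well defined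
  up to isomorphism.\<close>

definition is_quot_map :: "tfan \<Rightarrow> vec set \<Rightarrow> (vec \<Rightarrow> vec) \<Rightarrow> bool" where
  "is_quot_map \<Sigma> \<sigma> \<pi> \<longleftrightarrow> linear \<pi> \<and>
     \<pi> ` Zlat (lat_rank \<Sigma>) = Zlat (lat_rank \<Sigma> - dim \<sigma>) \<and>
     {v \<in> Rspace (lat_rank \<Sigma>). \<pi> v = 0} = span \<sigma>"

definition quot_map :: "tfan \<Rightarrow> vec set \<Rightarrow> vec \<Rightarrow> vec" where
  "quot_map \<Sigma> \<sigma> = (SOME \<pi>. is_quot_map \<Sigma> \<sigma> \<pi>)"

definition star_fan :: "tfan \<Rightarrow> vec set \<Rightarrow> tfan" where
  "star_fan \<Sigma> \<sigma> =
     \<lparr>lat_rank = lat_rank \<Sigma> - dim \<sigma>,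
      cones = {quot_map \<Sigma> \<sigma> ` \<eta> |\<eta>. \<eta> \<in> cones \<Sigma> \<and> \<sigma> \<subseteq> \<eta>},
      wt = (\<lambda>\<kappa>. THE w. \<exists>\<eta>\<in>cones \<Sigma>. \<sigma> \<subseteq> \<eta> \<and> \<kappa> = quot_map \<Sigma> \<sigma> ` \<eta> \<and> w = wt \<Sigma> \<eta>)\<rparr>"

text \<open>The second factor of \<open>\<real>\<^sup>n \<times> \<real>\<^sup>m = \<real>\<^sup>n\<^sup>+\<^sup>m\<close>.\<close>

definition shift :: "nat \<Rightarrow> vec \<Rightarrow> vec" where
  "shift n y = (\<Sum>i\<in>Poly_Mapping.keys y. Poly_Mapping.single (n + i) (Poly_Mapping.lookup y i))"

definition cone_prod :: "nat \<Rightarrow> vec set \<Rightarrow> vec set \<Rightarrow> vec set" where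
  "cone_prod n \<sigma> \<sigma>' = {x + shift n y |x y. x \<in> \<sigma> \<and> y \<in> \<sigma>'}"

definition fan_prod :: "tfan \<Rightarrow> tfan \<Rightarrow> tfan" where
  "fan_prod \<Sigma> \<Sigma>' =
     \<lparr>lat_rank = lat_rank \<Sigma> + lat_rank \<Sigma>',
      cones = {cone_prod (lat_rank \<Sigma>) \<sigma> \<sigma>' |\<sigma> \<sigma>'. \<sigma> \<in> cones \<Sigma> \<and> \<sigma>' \<in> cones \<Sigma>'},
      wt = (\<lambda>\<kappa>. THE w. \<exists>\<sigma>\<in>cones_dim \<Sigma> (fan_dim \<Sigma>). \<exists>\<sigma>'\<in>cones_dim \<Sigma>' (fan_dim \<Sigma>').
                 \<kappa> = cone_prod (lat_rank \<Sigma>) \<sigma> \<sigma>' \<and> w = wt \<Sigma> \<sigma> * wt \<Sigma>' \<sigma>')\<rparr>"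

definition rational_ray :: "nat \<Rightarrow> vec set \<Rightarrow> bool" where
  "rational_ray n \<rho> \<longleftrightarrow> (\<exists>v\<in>Zlat n. v \<noteq> 0 \<and> \<rho> = convex_cone hull {v})"

definition ray_in_relint :: "tfan \<Rightarrow> vec set \<Rightarrow> vec set \<Rightarrow> bool" where
  "ray_in_relint \<Sigma> \<sigma> \<rho> \<longleftrightarrow> rational_ray (lat_rank \<Sigma>) \<rho> \<and> \<rho> - {0} \<subseteq> rel_interior \<sigma>"

definition blow_up :: "tfan \<Rightarrow> vec set \<Rightarrow> vec set \<Rightarrow> tfan" where
  "blow_up \<Sigma> \<sigma> \<rho> =
     \<lparr>lat_rank = lat_rank \<Sigma>,
      cones = {\<tau> \<in> cones \<Sigma>. \<not> \<sigma> \<subseteq> \<tau>} \<union>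
        {mink_sum \<tau> \<rho> |\<tau>. \<not> \<sigma> \<subseteq> \<tau> \<and> (\<exists>\<eta>\<in>cones \<Sigma>. \<sigma> \<subseteq> \<eta> \<and> cone_face \<tau> \<eta>)},
      wt = (\<lambda>\<kappa>. THE w. \<exists>\<eta>\<in>cones_dim \<Sigma> (fan_dim \<Sigma>). \<kappa> \<subseteq> \<eta> \<and> w = wt \<Sigma> \<eta>)\<rparr>"


section \<open>Meromorphic functions, divisors, tropical modifications\<close>

text \<open>An element of \<open>Hom(N\<^sub>\<sigma>, \<int>)\<close> is represented by a linear form which is integral on \<open>N\<^sub>\<sigma>\<close>; only
  its values on \<open>span \<sigma>\<close> matter, and these are determined by the values on \<open>\<sigma>\<close>.\<close>

definition is_local_form :: "tfan \<Rightarrow> (vec \<Rightarrow> real) \<Rightarrow> vec set \<Rightarrow> (vec \<Rightarrow> real) \<Rightarrow> bool" where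
  "is_local_form \<Sigma> f \<sigma> l \<longleftrightarrow>
     linear l \<and> (\<forall>v\<in>Nsub (lat_rank \<Sigma>) \<sigma>. l v \<in> \<int>) \<and> (\<forall>x\<in>\<sigma>. f x = l x)"

text \<open>A function on \<open>|\<Sigma>|\<close> is represented by any extension to the whole space.\<close>

definition meromorphic_fun :: "tfan \<Rightarrow> (vec \<Rightarrow> real) \<Rightarrow> bool" where
  "meromorphic_fun \<Sigma> f \<longleftrightarrow>
     continuous_on (support \<Sigma>) f \<and> (\<forall>\<sigma>\<in>cones \<Sigma>. \<exists>l. is_local_form \<Sigma> f \<sigma> l)"

definition local_form :: "tfan \<Rightarrow> (vec \<Rightarrow> real) \<Rightarrow> vec set \<Rightarrow> vec \<Rightarrow> real" where
  "local_form \<Sigma> f \<sigma> = (SOME l. is_local_form \<Sigma> f \<sigma> l)"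

text \<open>The floor is only a coercion from \<open>real\<close> to \<open>int\<close>: the expression is an integer.\<close>

definition ord_at :: "tfan \<Rightarrow> (vec \<Rightarrow> real) \<Rightarrow> vec set \<Rightarrow> int" where
  "ord_at \<Sigma> f \<tau> =
     (let F = {\<sigma> \<in> cones_dim \<Sigma> (fan_dim \<Sigma>). \<tau> \<subseteq> \<sigma>}; nv = (\<lambda>\<sigma>. normal_vec (lat_rank \<Sigma>) \<sigma> \<tau>)
      in \<lfloor>- (\<Sum>\<sigma>\<in>F. of_int (wt \<Sigma> \<sigma>) * local_form \<Sigma> f \<sigma> (nv \<sigma>))
          + local_form \<Sigma> f \<tau> (\<Sum>\<sigma>\<in>F. of_int (wt \<Sigma> \<sigma>) *\<^sub>R nv \<sigma>)\<rfloor>)"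

definition codim1_cones :: "tfan \<Rightarrow> vec set set" where
  "codim1_cones \<Sigma> = {\<tau> \<in> cones \<Sigma>. dim \<tau> + 1 = fan_dim \<Sigma>}"

definition div_trivial :: "tfan \<Rightarrow> (vec \<Rightarrow> real) \<Rightarrow> bool" where
  "div_trivial \<Sigma> f \<longleftrightarrow> (\<forall>\<tau>\<in>codim1_cones \<Sigma>. ord_at \<Sigma> f \<tau> = 0)"

text \<open>If the divisor is trivial, the set of cones below is empty.\<close>

definition div_fan :: "tfan \<Rightarrow> (vec \<Rightarrow> real) \<Rightarrow> tfan" where
  "div_fan \<Sigma> f =
     \<lparr>lat_rank = lat_rank \<Sigma>,
      cones = {\<delta>. \<exists>\<tau>\<in>codim1_cones \<Sigma>. ord_at \<Sigma> f \<tau> \<noteq> 0 \<and> cone_face \<delta> \<tau>},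
      wt = ord_at \<Sigma> f\<rparr>"

text \<open>The new coordinate of \<open>\<real>\<^sup>n \<times> \<real> = \<real>\<^sup>n\<^sup>+\<^sup>1\<close> has index \<open>n\<close>.\<close>

definition graph_cone :: "tfan \<Rightarrow> (vec \<Rightarrow> real) \<Rightarrow> vec set \<Rightarrow> vec set" where
  "graph_cone \<Sigma> f \<sigma> = {x + Poly_Mapping.single (lat_rank \<Sigma>) (f x) |x. x \<in> \<sigma>}"

definition up_cone :: "tfan \<Rightarrow> (vec \<Rightarrow> real) \<Rightarrow> vec set \<Rightarrow> vec set" where
  "up_cone \<Sigma> f \<delta> =
     mink_sum (graph_cone \<Sigma> f \<delta>) {Poly_Mapping.single (lat_rank \<Sigma>) t |t. t \<ge> 0}"

definition trop_mod :: "tfan \<Rightarrow> (vec \<Rightarrow> real) \<Rightarrow> tfan" where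
  "trop_mod \<Sigma> f =
     \<lparr>lat_rank = lat_rank \<Sigma> + 1,
      cones = graph_cone \<Sigma> f ` cones \<Sigma> \<union> up_cone \<Sigma> f ` cones (div_fan \<Sigma> f),
      wt = (\<lambda>\<kappa>. THE w.
        (\<exists>\<sigma>\<in>cones_dim \<Sigma> (fan_dim \<Sigma>). \<kappa> = graph_cone \<Sigma> f \<sigma> \<and> w = wt \<Sigma> \<sigma>) \<or>
        (\<exists>\<delta>\<in>cones (div_fan \<Sigma> f) \<inter> codim1_cones \<Sigma>. \<kappa> = up_cone \<Sigma> f \<delta> \<and> w = ord_at \<Sigma> f \<delta>))\<rparr>"

definition div_faithful :: "tfan \<Rightarrow> bool" where
  "div_faithful \<Sigma> \<longleftrightarrow>
     (\<forall>\<eta>\<in>cones \<Sigma>. \<forall>f. meromorphic_fun (star_fan \<Sigma> \<eta>) f \<and> div_trivial (star_fan \<Sigma> \<eta>) f \<longrightarrow>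
        (\<exists>l::vec \<Rightarrow> real. linear l \<and> (\<forall>x\<in>support (star_fan \<Sigma> \<eta>). f x = l x)))"


section \<open>Chow rings\<close>

text \<open>Polynomials over \<open>\<int>\<close> with variables indexed by cones: finitely supported maps from
  exponents to coefficients. Sum and product are those of the type.\<close>

type_synonym cone_poly = "(vec set \<Rightarrow>\<^sub>0 nat) \<Rightarrow>\<^sub>0 int"

definition poly_ring :: "vec set set \<Rightarrow> cone_poly ring" where
  "poly_ring V =
     \<lparr>carrier = {p. \<forall>m\<in>Poly_Mapping.keys p. Poly_Mapping.keys m \<subseteq> V},
      monoid.mult = (*), one = 1, zero = 0, add = (+)\<rparr>"

definition pvar :: "vec set \<Rightarrow> cone_poly" where
  "pvar \<zeta> = Poly_Mapping.single (Poly_Mapping.single \<zeta> 1) 1"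

definition homogeneous :: "nat \<Rightarrow> cone_poly \<Rightarrow> bool" where
  "homogeneous k p \<longleftrightarrow>
     (\<forall>m\<in>Poly_Mapping.keys p. (\<Sum>\<zeta>\<in>Poly_Mapping.keys m. Poly_Mapping.lookup m \<zeta>) = k)"

definition chow_poly_ring :: "tfan \<Rightarrow> cone_poly ring" where
  "chow_poly_ring \<Sigma> = poly_ring (cones_dim \<Sigma> 1)"

definition gens_I :: "tfan \<Rightarrow> cone_poly set" where
  "gens_I \<Sigma> = {\<Prod>\<rho>\<in>R. pvar \<rho> |R. R \<subseteq> cones_dim \<Sigma> 1 \<and> \<not> (\<exists>\<sigma>\<in>cones \<Sigma>. \<forall>\<rho>\<in>R. \<rho> \<subseteq> \<sigma>)}"

definition gens_J :: "tfan \<Rightarrow> cone_poly set" where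
  "gens_J \<Sigma> = {\<Sum>\<zeta>\<in>cones_dim \<Sigma> 1. of_int (m (prim_vec (lat_rank \<Sigma>) \<zeta>)) * pvar \<zeta> |m.
     m \<in> hom (lat_group (Zlat (lat_rank \<Sigma>))) integer_group}"

definition chow_ideal :: "tfan \<Rightarrow> cone_poly set" where
  "chow_ideal \<Sigma> = (Idl\<^bsub>chow_poly_ring \<Sigma>\<^esub> gens_I \<Sigma>) <+>\<^bsub>chow_poly_ring \<Sigma>\<^esub> (Idl\<^bsub>chow_poly_ring \<Sigma>\<^esub> gens_J \<Sigma>)"

definition chow_ring :: "tfan \<Rightarrow> cone_poly set ring" where
  "chow_ring \<Sigma> = chow_poly_ring \<Sigma> Quot chow_ideal \<Sigma>"

definition chow_class :: "tfan \<Rightarrow> cone_poly \<Rightarrow> cone_poly set" where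
  "chow_class \<Sigma> p = chow_ideal \<Sigma> +>\<^bsub>chow_poly_ring \<Sigma>\<^esub> p"

text \<open>The additive group \<open>A\<^sup>k(\<Sigma>)\<close>.\<close>

definition chow_group :: "tfan \<Rightarrow> nat \<Rightarrow> cone_poly set monoid" where
  "chow_group \<Sigma> k =
     \<lparr>carrier = chow_class \<Sigma> ` {p \<in> carrier (chow_poly_ring \<Sigma>). homogeneous k p},
      monoid.mult = add (chow_ring \<Sigma>), one = zero (chow_ring \<Sigma>)\<rparr>"

definition x_cone :: "tfan \<Rightarrow> vec set \<Rightarrow> cone_poly set" where
  "x_cone \<Sigma> \<sigma> =
     finprod (chow_ring \<Sigma>) (\<lambda>\<zeta>. chow_class \<Sigma> (pvar \<zeta>)) {\<zeta> \<in> cones_dim \<Sigma> 1. \<zeta> \<subseteq> \<sigma>}"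

text \<open>The degree map is determined on \<open>A\<^sup>d(\<Sigma>)\<close>, and is arbitrary elsewhere.\<close>

definition chow_deg :: "tfan \<Rightarrow> cone_poly set \<Rightarrow> int" where
  "chow_deg \<Sigma> = (SOME h. h \<in> hom (chow_group \<Sigma> (fan_dim \<Sigma>)) integer_group \<and>
     (\<forall>\<sigma>\<in>cones_dim \<Sigma> (fan_dim \<Sigma>). h (x_cone \<Sigma> \<sigma>) = wt \<Sigma> \<sigma>))"


section \<open>Poincare duality\<close>

text \<open>Both induced maps \<open>A \<rightarrow> Hom(B, H)\<close> and \<open>B \<rightarrow> Hom(A, H)\<close> are isomorphisms. Homomorphisms are
  cut off outside the domain, so that they are compared on the domain only.\<close>

definition perfect_pairing ::
  "'a monoid \<Rightarrow> 'b monoid \<Rightarrow> 'c monoid \<Rightarrow> ('a \<Rightarrow> 'b \<Rightarrow> 'c) \<Rightarrow> bool" where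
  "perfect_pairing A B H b \<longleftrightarrow>
     (\<forall>x\<in>carrier A. b x \<in> hom B H) \<and> (\<forall>y\<in>carrier B. (\<lambda>x. b x y) \<in> hom A H) \<and>
     bij_betw (\<lambda>x. \<lambda>y\<in>carrier B. b x y) (carrier A) (hom B H \<inter> extensional (carrier B)) \<and>
     bij_betw (\<lambda>y. \<lambda>x\<in>carrier A. b x y) (carrier B) (hom A H \<inter> extensional (carrier A))"

definition deg_pairing :: "tfan \<Rightarrow> cone_poly set \<Rightarrow> cone_poly set \<Rightarrow> int" where
  "deg_pairing \<Sigma> \<alpha> \<beta> = chow_deg \<Sigma> (\<alpha> \<otimes>\<^bsub>chow_ring \<Sigma>\<^esub> \<beta>)"

definition PD_Z :: "tfan \<Rightarrow> bool" where
  "PD_Z \<Sigma> \<longleftrightarrow> (\<forall>k\<le>fan_dim \<Sigma>.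
     perfect_pairing (chow_group \<Sigma> k) (chow_group \<Sigma> (fan_dim \<Sigma> - k)) integer_group
       (deg_pairing \<Sigma>))"

text \<open>The tensor product of two abelian groups, as the free abelian group on pairs modulo
  biadditivity.\<close>

definition tensor_rels :: "'a monoid \<Rightarrow> 'b monoid \<Rightarrow> ('a \<times> 'b \<Rightarrow>\<^sub>0 int) set" where
  "tensor_rels A B =
     {frag_of (a \<otimes>\<^bsub>A\<^esub> a', b) - frag_of (a, b) - frag_of (a', b) |a a' b.
        a \<in> carrier A \<and> a' \<in> carrier A \<and> b \<in> carrier B} \<union>
     {frag_of (a, b \<otimes>\<^bsub>B\<^esub> b') - frag_of (a, b) - frag_of (a, b') |a b b'.
        a \<in> carrier A \<and> b \<in> carrier B \<and> b' \<in> carrier B}"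

definition tensor_kernel :: "'a monoid \<Rightarrow> 'b monoid \<Rightarrow> ('a \<times> 'b \<Rightarrow>\<^sub>0 int) set" where
  "tensor_kernel A B = generate (free_Abelian_group (carrier A \<times> carrier B)) (tensor_rels A B)"

definition tensor :: "'a monoid \<Rightarrow> 'b monoid \<Rightarrow> ('a \<times> 'b \<Rightarrow>\<^sub>0 int) set monoid" where
  "tensor A B = free_Abelian_group (carrier A \<times> carrier B) Mod tensor_kernel A B"

definition pure_tensor :: "'a monoid \<Rightarrow> 'b monoid \<Rightarrow> 'a \<Rightarrow> 'b \<Rightarrow> ('a \<times> 'b \<Rightarrow>\<^sub>0 int) set" where
  "pure_tensor A B a b =
     tensor_kernel A B #>\<^bsub>free_Abelian_group (carrier A \<times> carrier B)\<^esub> frag_of (a, b)"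

definition rat_group :: "rat monoid" where
  "rat_group = \<lparr>carrier = UNIV, monoid.mult = (+), one = 0\<rparr>"

abbreviation tensor_Q :: "'a monoid \<Rightarrow> ('a \<times> rat \<Rightarrow>\<^sub>0 int) set monoid" where
  "tensor_Q A \<equiv> tensor A rat_group"

text \<open>The pairing \<open>A\<^sub>\<rat> \<times> B\<^sub>\<rat> \<rightarrow> \<rat>\<close> induced by a biadditive \<open>A \<times> B \<rightarrow> \<int>\<close>: the biadditive map with
  \<open>(a \<otimes> q, b \<otimes> r) \<mapsto> q r \<langle>a, b\<rangle>\<close>, unique on the carriers.\<close>

definition rat_pairing :: "'a monoid \<Rightarrow> 'b monoid \<Rightarrow> ('a \<Rightarrow> 'b \<Rightarrow> int) \<Rightarrow>
    ('a \<times> rat \<Rightarrow>\<^sub>0 int) set \<Rightarrow> ('b \<times> rat \<Rightarrow>\<^sub>0 int) set \<Rightarrow> rat" where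
  "rat_pairing A B b = (SOME g.
     (\<forall>x\<in>carrier (tensor_Q A). g x \<in> hom (tensor_Q B) rat_group) \<and>
     (\<forall>y\<in>carrier (tensor_Q B). (\<lambda>x. g x y) \<in> hom (tensor_Q A) rat_group) \<and>
     (\<forall>a\<in>carrier A. \<forall>c\<in>carrier B. \<forall>q r.
        g (pure_tensor A rat_group a q) (pure_tensor B rat_group c r) = q * r * of_int (b a c)))"

text \<open>Additive maps between rational vector spaces are automatically linear over \<open>\<rat>\<close>.\<close>

definition PD_Q :: "tfan \<Rightarrow> bool" where
  "PD_Q \<Sigma> \<longleftrightarrow> (\<forall>k\<le>fan_dim \<Sigma>.
     perfect_pairing (tensor_Q (chow_group \<Sigma> k)) (tensor_Q (chow_group \<Sigma> (fan_dim \<Sigma> - k))) rat_group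
       (rat_pairing (chow_group \<Sigma> k) (chow_group \<Sigma> (fan_dim \<Sigma> - k)) (deg_pairing \<Sigma>)))"


section \<open>Stability\<close>

text \<open>Tropical fans are considered up to isomorphism, so a class of tropical fans is closed under
  isomorphism.\<close>

definition tropical_class :: "tfan set \<Rightarrow> bool" where
  "tropical_class \<C> \<longleftrightarrow> (\<forall>\<Sigma>\<in>\<C>. tropical_fan \<Sigma>) \<and>
     (\<forall>\<Sigma>\<in>\<C>. \<forall>\<Sigma>'. tropical_fan \<Sigma>' \<and> tropical_iso \<Sigma> \<Sigma>' \<longrightarrow> \<Sigma>' \<in> \<C>)"

definition T_stable :: "tfan set \<Rightarrow> tfan set \<Rightarrow> bool" where
  "T_stable \<C> \<S> \<longleftrightarrow> tropical_class \<C> \<and> tropical_class \<S> \<and> \<S> \<subseteq> \<C> \<and>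
     (\<forall>\<Sigma>\<in>\<S>. \<forall>\<Sigma>'\<in>\<S>. fan_prod \<Sigma> \<Sigma>' \<in> \<C> \<longrightarrow> fan_prod \<Sigma> \<Sigma>' \<in> \<S>) \<and>
     (\<forall>\<Sigma>\<in>\<S>. \<forall>f. meromorphic_fun \<Sigma> f \<and> (div_trivial \<Sigma> f \<or> div_fan \<Sigma> f \<in> \<S>) \<and> trop_mod \<Sigma> f \<in> \<C>
        \<longrightarrow> trop_mod \<Sigma> f \<in> \<S>) \<and>
     (\<forall>\<Sigma>\<in>\<C>. \<forall>\<sigma>\<in>cones \<Sigma>. \<forall>\<rho>. ray_in_relint \<Sigma> \<sigma> \<rho> \<and> star_fan \<Sigma> \<sigma> \<in> \<S> \<and> blow_up \<Sigma> \<sigma> \<rho> \<in> \<C>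
        \<longrightarrow> (\<Sigma> \<in> \<S> \<longleftrightarrow> blow_up \<Sigma> \<sigma> \<rho> \<in> \<S>))"

definition T_stable_property :: "(tfan \<Rightarrow> bool) \<Rightarrow> tfan set \<Rightarrow> bool" where
  "T_stable_property P \<C> \<longleftrightarrow> T_stable \<C> {\<Sigma> \<in> \<C>. P \<Sigma>}"

definition div_faithful_unimodular_fans :: "tfan set" where
  "div_faithful_unimodular_fans = {\<Sigma>. tropical_fan \<Sigma> \<and> unimodular \<Sigma> \<and> div_faithful \<Sigma>}"

end

theory Submission
imports Defs "HOL-Computational_Algebra.Polynomial" "HOL-Computational_Algebra.Field_as_Ring"
begin

text \<open>Both duality statements are reduced to one statement about polynomials. A unimodular fan
  is recorded by the simplicial complex \<open>fcx\<close> of its primitive ray vectors. Over a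
  coefficient ring R its Chow ring is a polynomial ring modulo \<open>CI K L\<close>, the ideal of
  the monomials of non-faces and of the linear forms from the dual lattice. Every face has linear
  forms dual to its vertices, so classes are combinations of square-free monomials of faces
  (\<open>moving\<close>). Hence a degree functional is determined by its values on facets
  (\<open>deg_unique\<close>); balancing makes it exist (\<open>ex_deg\<close>). Duality becomes
  \<open>PD_on\<close>: in complementary degrees only zero pairs to zero with everything, and every
  functional is the pairing with some class. \<open>PD_Z_iff\<close> and \<open>PD_Q_iff\<close>
  identify \<open>PD_Z\<close> and \<open>PD_Q\<close> with this property for R the integers and the
  rationals, so that one argument over R serves both.

  Products. Duality makes the graded pieces torsion-free. They are finitely generated, hence free
  over a Euclidean ring, and duality provides dual bases (\<open>ex_dual_system\<close>). The degree
  of a product of classes of the two factors is the product of the degrees, so products of dual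
  systems are dual systems of the product fan (\<open>PD_product\<close>).

  Modifications. The new coordinate gives a linear relation that replaces the variable of the
  vertical ray by -F, where F is the sum of f(v) x_v. The degree of F x_A, for A of codimension one,
  is minus the order of f at A. Above a cone A outside the divisor all orders vanish, so F x_A pairs
  to zero with everything and is zero by duality. The new relations thus hold already, and the Chow
  ring with its degree does not change (\<open>PDc_modification\<close>).

  Blow-ups. Let sigma have k rays. For k = 1 nothing changes. For k at least 2, unimodularity of the
  blow-up forces the new primitive vector to be the sum of the vectors of sigma
  (\<open>e_sum\<close>). With t the new variable, the Chow ring of the blow-up arises from that of
  the fan by adjoining t with the relations prod (x_i - t) = 0, over the rays i of sigma, and t J =
  0, where J is the ideal presenting the Chow ring of the star. So every class is a sum of a_i t^i
  with i < k, where for i > 0 the coefficient a_i counts only modulo J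
  (\<open>decomposition\<close>). The degree of a t^i is that of a for i = 0, it is zero for 0 < i <
  k, and for i = k it is, up to sign, the degree of a x_sigma, that is, the degree on the star. The
  pairing is therefore block triangular, with the pairing of the fan and pairings of the star as
  blocks. If the star has duality, then the fan has it exactly when the blow-up does
  (\<open>PD_blowup_iff\<close>).

  Finally, duality and div-faithfulness are carried along isomorphisms of tropical fans
  (\<open>PD_over_iso\<close>, \<open>div_faithful_iso\<close>), so the classes involved are closed
  under isomorphism.\<close>

abbreviation (input) iff_ascii :: "bool => bool => bool" (infixr "<->" 25) where "A <-> B == A = B"

section \<open>Polynomial rings over arbitrary variables: grading, evaluation, ideals, linear
  functionals\<close>

section \<open>Polynomials, substitutions and ideals\<close>

type_synonym ('v, 'a) mp = "('v \<Rightarrow>\<^sub>0 nat) \<Rightarrow>\<^sub>0 'a"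

abbreviation "keys == Poly_Mapping.keys"
abbreviation "lookup == Poly_Mapping.lookup"
abbreviation "single == Poly_Mapping.single"

lemma poly_mapping_sum_single: "p = (SUM m:keys p. single m (lookup p m))"
proof (rule poly_mapping_eqI)
fix k
have "lookup (SUM m:keys p. single m (lookup p m)) k = (SUM m:keys p. if m = k then lookup p m else 0)"
unfolding lookup_sum by (intro sum.cong refl) (simp add: lookup_single when_def)
also have "... = lookup p k"
by (simp add: in_keys_iff)
finally show "lookup p k = lookup (SUM m:keys p. single m (lookup p m)) k" by simp
qed

lemma pm_induct [case_names zero add]:
fixes p :: "'m \<Rightarrow>\<^sub>0 'a::comm_monoid_add"
assumes z: "P 0" and a: "!!m c p. P p ==> P (single m c + p)"
shows "P p"
proof -
have "P (SUM m:S. single m (lookup p m))" if "finite S" for S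
using that by (induction S rule: finite_induct) (auto simp: z a)
from this[of "keys p"] show ?thesis using poly_mapping_sum_single[of p] by simp
qed

definition Cst :: "'a::zero => ('v, 'a) mp" where "Cst c = single 0 c"
definition Var :: "'v => ('v, 'a::comm_ring_1) mp" where "Var v = single (single v 1) 1"
definition xprod :: "'v set => ('v, 'a::comm_ring_1) mp" where "xprod A = (PROD v:A. Var v)"

lemma Cst_0 [simp]: "Cst 0 = 0" by (simp add: Cst_def)
lemma Cst_1 [simp]: "Cst 1 = 1" by (simp add: Cst_def)
lemma Cst_add: "Cst (a + b) = Cst a + Cst b" by (simp add: Cst_def single_add)
lemma Cst_mult: "Cst (a * b) = Cst a * Cst (b::'a::comm_ring_1)" by (simp add: Cst_def mult_single)
lemma Cst_uminus: "Cst (- a) = - Cst (a::'a::comm_ring_1)" by (simp add: Cst_def single_uminus)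
lemma Cst_mult_single: "Cst a * single m (b::'a::comm_ring_1) = single m (a * b)"
by (simp add: Cst_def mult_single)
lemma single_Cst: "single m (c::'a::comm_ring_1) = Cst c * single m 1"
by (simp add: Cst_mult_single)
lemma Cst_sum: "Cst (sum f A) = (SUM a:A. Cst (f a))"
by (induction A rule: infinite_finite_induct) (auto simp: Cst_add)

definition mdeg :: "('v \<Rightarrow>\<^sub>0 nat) => nat" where
"mdeg m = (SUM v:keys m. lookup m v)"

lemma mdeg_alt: "finite S ==> keys m <= S ==> mdeg m = (SUM v:S. lookup m v)"
unfolding mdeg_def by (rule sum.mono_neutral_left) (auto simp: in_keys_iff)

lemma mdeg_add: "mdeg (m + m') = mdeg m + mdeg m'"
using keys_add[of m m']
by (simp add: mdeg_alt[of "keys m Un keys m'"] lookup_add sum.distrib)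

lemma mdeg_0 [simp]: "mdeg 0 = 0" by (simp add: mdeg_def)
lemma mdeg_single [simp]: "mdeg (single v k) = k" by (simp add: mdeg_def)
lemma mdeg_eq_0: "mdeg m = 0 <-> m = 0"
unfolding mdeg_def
by (metis finite_keys in_keys_iff keys_eq_empty ex_in_conv poly_mapping_eqI lookup_zero sum_eq_0_iff)

lemma mdeg_Suc_decomp:
assumes "mdeg m = Suc k" obtains v m' where "m = single v 1 + m'" "mdeg m' = k"
proof -
obtain v where v: "v : keys m" using assms unfolding mdeg_def by fastforce
define m' where "m' = m - single v 1"
have "m = single v 1 + m'"
by (rule poly_mapping_eqI)
  (use v in "auto simp: m'_def lookup_add lookup_minus lookup_single when_def in_keys_iff")
thus ?thesis using that[of v m'] assms by (simp add: mdeg_add)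
qed

definition homog :: "nat => ('v, 'a::zero) mp => bool" where
"homog k p <-> (ALL m:keys p. mdeg m = k)"

lemma homog_0 [simp]: "homog k 0" by (simp add: homog_def)
lemma homog_single: "mdeg m = k ==> homog k (single m c)"
by (auto simp: homog_def split: if_splits)
lemma homog_Cst [simp]: "homog 0 (Cst c)" by (simp add: Cst_def homog_single)
lemma homog_1 [simp]: "homog 0 1" by (simp add: homog_single flip: single_one)
lemma homog_Var [simp]: "homog (Suc 0) (Var v)" by (simp add: Var_def homog_single)
lemma homog_add: "homog k p ==> homog k q ==> homog k (p + q)"
using keys_add[of p q] unfolding homog_def by blast
lemma homog_uminus: "homog k (p::('v,'a::comm_ring_1) mp) ==> homog k (- p)"
by (auto simp: homog_def in_keys_iff)
lemma homog_diff: "homog k p ==> homog k q ==> homog k (p - q::('v,'a::comm_ring_1) mp)"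
using homog_add[of k p "- q"] homog_uminus[of k q] by simp
lemma homog_mult: "homog k p ==> homog j q ==> homog (k + j) (p * q)"
using keys_mult[of p q] unfolding homog_def by (force simp: mdeg_add)
lemma homog_mult_Suc: "homog (Suc 0) p ==> homog j q ==> homog (Suc j) (p * q)"
using homog_mult[of "Suc 0"] by simp
lemma homog_sum: "(!!a. a : A ==> homog k (f a)) ==> homog k (sum f A)"
by (induction A rule: infinite_finite_induct) (auto simp: homog_add)
lemma homog_prod:
"(!!a. a : A ==> homog (Suc 0) (f a)) ==> finite A ==> homog (card A) (PROD a:A. (f a :: ('v,'a::comm_ring_1) mp))"
by (induction A rule: infinite_finite_induct) (auto intro: homog_mult_Suc)
lemma homog_power: "homog k p ==> homog (n * k) ((p :: ('v,'a::comm_ring_1) mp) ^ n)"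
by (induction n) (auto simp: homog_mult)
lemma homog_xprod: "finite A ==> homog (card A) (xprod A :: ('v,'a::comm_ring_1) mp)"
unfolding xprod_def by (rule homog_prod) auto
lemma homog_Cst_mult: "homog k p ==> homog k (Cst c * p)"
using homog_mult[of 0 "Cst c" k p] by simp

lemma homog_induct [consumes 1, case_names zero add]:
fixes p :: "('v,'a::comm_ring_1) mp"
assumes "homog k p" and z: "P 0"
and a: "!!m c p. P p ==> mdeg m = k ==> homog k p ==> P (single m c + p)"
shows "P p"
proof -
have "P (SUM m:S. single m (lookup p m)) & homog k (SUM m:S. single m (lookup p m))" if "finite S" "S <= keys p" for S
using that
proof (induction S rule: finite_induct)
case (insert x F)
hence "mdeg x = k" using assms(1) by (auto simp: homog_def)
with insert show ?case by (auto intro!: a homog_add homog_single)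
qed (auto simp: z)
from this[of "keys p"] show ?thesis using poly_mapping_sum_single[of p] by simp
qed

definition hcomp :: "nat => ('v, 'a::comm_ring_1) mp => ('v, 'a) mp" where
"hcomp k p = (SUM m:keys p. if mdeg m = k then single m (lookup p m) else 0)"

lemma lookup_hcomp: "lookup (hcomp k p) m = (if mdeg m = k then lookup p m else 0)"
proof -
have "lookup (hcomp k p) m = (SUM m':keys p. if m' = m then if mdeg m = k then lookup p m else 0 else 0)"
unfolding hcomp_def lookup_sum by (intro sum.cong refl) (auto simp: lookup_single when_def)
also have "... = (if mdeg m = k then lookup p m else 0)" by (simp add: in_keys_iff)
finally show ?thesis .
qed

lemma hcomp_add: "hcomp k (p + q) = hcomp k p + hcomp k q"
by (rule poly_mapping_eqI) (simp add: lookup_hcomp lookup_add)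
lemma hcomp_0 [simp]: "hcomp k 0 = 0"
by (rule poly_mapping_eqI) (simp add: lookup_hcomp)
lemma hcomp_single: "hcomp k (single m c) = (if mdeg m = k then single m c else 0)"
by (rule poly_mapping_eqI) (auto simp: lookup_hcomp lookup_single when_def)
lemma hcomp_homog: "homog j p ==> hcomp k p = (if j = k then p else 0)"
by (rule poly_mapping_eqI) (auto simp: lookup_hcomp homog_def in_keys_iff)
lemma homog_hcomp [simp]: "homog k (hcomp k p)"
by (auto simp: homog_def in_keys_iff lookup_hcomp split: if_splits)
lemma hcomp_mult_homog:
fixes p g :: "('v,'a::comm_ring_1) mp"
assumes g: "homog j g"
shows "hcomp k (p * g) = (if j <= k then hcomp (k - j) p * g else 0)"
proof (induction p rule: pm_induct)
case (add m c p)
have "homog (mdeg m + j) (single m c * g)" by (intro homog_mult homog_single g) auto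
hence "hcomp k (single m c * g) = (if j <= k then hcomp (k - j) (single m c) * g else 0)"
by (auto simp: hcomp_homog hcomp_single)
with add show ?case by (simp add: distrib_right hcomp_add)
qed auto
lemma hcomp_Cst_mult: "hcomp k (Cst c * p) = Cst c * hcomp k p"
using hcomp_mult_homog[of 0 "Cst c" k p] by (simp add: mult.commute)

definition mval :: "('v => 'b) => ('v \<Rightarrow>\<^sub>0 nat) => 'b::comm_ring_1" where
"mval g m = (PROD v:keys m. g v ^ lookup m v)"

lemma mval_alt: "finite S ==> keys m <= S ==> mval g m = (PROD v:S. g v ^ lookup m v)"
unfolding mval_def by (rule prod.mono_neutral_left) (auto simp: in_keys_iff)
lemma mval_add: "mval g (m + m') = mval g m * mval g m'"
using keys_add[of m m']
by (simp add: mval_alt[of "keys m Un keys m'"] lookup_add power_add prod.distrib)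
lemma mval_0 [simp]: "mval g 0 = 1" by (simp add: mval_def)
lemma mval_single [simp]: "mval g (single v k) = g v ^ k"
by (simp add: mval_def)

lemma mval_induct [case_names zero add]:
assumes "P 0" "!!v m. P m ==> P (single v 1 + m)"
shows "P (m :: 'v \<Rightarrow>\<^sub>0 nat)"
proof (induction "mdeg m" arbitrary: m)
case 0
hence "m = 0" using mdeg_eq_0[of m] by linarith
thus ?case using assms(1) by simp
next
case (Suc k)
from Suc(2)[symmetric] obtain v m' where "m = single v 1 + m'" "mdeg m' = k"
by (rule mdeg_Suc_decomp)
with Suc(1)[of m'] assms(2) show ?case by simp
qed

lemma single_eq_mval: "single m (1::'b::comm_ring_1) = mval Var m"
proof (induction m rule: mval_induct)
case (add v m)
have "single (single v 1 + m) (1::'b) = Var v * single m 1" by (simp add: Var_def mult_single)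
thus ?case unfolding mval_add mval_single add by simp
qed auto

text \<open>Evaluation with a change of coefficients: substitution, the passage from integral to
  rational coefficients and the map into polynomials in one more variable are all instances.\<close>

definition peval :: "('a::zero => 'b) => ('v => 'b) => ('v, 'a) mp => 'b::comm_ring_1" where
"peval h g p = (SUM m:keys p. h (lookup p m) * mval g m)"

definition ringhom :: "('a::comm_ring_1 => 'b::comm_ring_1) => bool" where
"ringhom h <-> (ALL x y. h (x + y) = h x + h y) & (ALL x y. h (x * y) = h x * h y) & h 1 = 1"

lemma rh_simps:
assumes "ringhom h"
shows "h (x + y) = h x + h y" "h (x * y) = h x * h y" "h 1 = 1" "h 0 = 0" "h (- x) = - h x"
"h (x - y) = h x - h y" "h (sum f A) = (SUM a:A. h (f a))" "h (prod f A) = (PROD a:A. h (f a))"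
"h (x ^ n) = h x ^ n"
proof -
show a: "!!x y. h (x + y) = h x + h y" and m: "!!x y. h (x * y) = h x * h y" and o: "h 1 = 1"
using assms by (auto simp: ringhom_def)
show z: "h 0 = 0" using a[of 0 0] by simp
show n: "!!x. h (- x) = - h x" using a z by (metis add.inverse_unique add.right_inverse)
show "h (x - y) = h x - h y" using a[of x "- y"] n by simp
show "h (sum f A) = (SUM a:A. h (f a))"
by (induction A rule: infinite_finite_induct) (auto simp: z a)
show "h (prod f A) = (PROD a:A. h (f a))"
by (induction A rule: infinite_finite_induct) (auto simp: o m)
show "h (x ^ n) = h x ^ n" by (induction n) (auto simp: o m)
qed

lemma ringhom_Cst: "ringhom (Cst :: 'a::comm_ring_1 => ('v,'a) mp)"
by (simp add: ringhom_def Cst_add Cst_mult)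

lemma ringhom_comp: "ringhom f ==> ringhom g ==> ringhom (%x. f (g x))"
by (simp add: ringhom_def)

lemma peval_alt:
assumes "ringhom h" "finite S" "keys p <= S"
shows "peval h g p = (SUM m:S. h (lookup p m) * mval g m)"
unfolding peval_def
by (rule sum.mono_neutral_left) (use assms in "auto simp: in_keys_iff rh_simps")

context
fixes h :: "'a::comm_ring_1 => 'b::comm_ring_1" and g :: "'v => 'b"
assumes h: "ringhom h"
begin

lemma peval_single: "peval h g (single m c) = h c * mval g m"
by (simp add: peval_def rh_simps[OF h])

lemma peval_add: "peval h g (p + q) = peval h g p + peval h g q"
using keys_add[of p q]
by (simp add: peval_alt[OF h, of "keys p Un keys q"] lookup_add rh_simps[OF h] distrib_right sum.distrib)

lemma peval_mult: "peval h g (p * q) = peval h g p * peval h g q"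
proof (induction p rule: pm_induct)
case (add m c p)
have "peval h g (single m c * q) = peval h g (single m c) * peval h g q"
proof (induction q rule: pm_induct)
case (add m' c' q)
thus ?case
 by (simp add: distrib_left peval_add mult_single peval_single mval_add rh_simps[OF h])
qed (simp add: peval_def)
with add show ?case by (simp add: distrib_right peval_add)
qed (simp add: peval_def)

lemma ringhom_peval: "ringhom (peval h g)"
unfolding ringhom_def using peval_single[of 0 1] by (simp add: peval_add peval_mult rh_simps[OF h])

lemma peval_Cst [simp]: "peval h g (Cst c) = h c"
by (simp add: Cst_def peval_single)

lemma peval_Var [simp]: "peval h g (Var v) = g v"
by (simp add: Var_def peval_single rh_simps[OF h])

end

lemma ringhom_unique:
fixes f1 f2 :: "('v,'a::comm_ring_1) mp => 'b::comm_ring_1"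
assumes f1: "ringhom f1" and f2: "ringhom f2"
and "!!c. f1 (Cst c) = f2 (Cst c)" and "!!v. f1 (Var v) = f2 (Var v)"
shows "f1 p = f2 p"
proof (induction p rule: pm_induct)
case (add m c p)
have "f1 (single m c) = f2 (single m c)"
by (subst (1 2) single_Cst)
  (simp add: single_eq_mval mval_def rh_simps[OF f1] rh_simps[OF f2] assms)
with add show ?case by (simp add: rh_simps[OF f1] rh_simps[OF f2])
qed (simp add: rh_simps[OF f1] rh_simps[OF f2])

text \<open>Substitution of polynomials for the variables.\<close>

definition subst :: "('v => ('u, 'a::comm_ring_1) mp) => ('v, 'a) mp => ('u, 'a) mp" where
"subst g = peval Cst g"

lemma ringhom_subst: "ringhom (subst g)" by (simp add: subst_def ringhom_peval ringhom_Cst)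
lemmas subst_simps [simp] = rh_simps[OF ringhom_subst]
lemma subst_Cst [simp]: "subst g (Cst c) = Cst c" by (simp add: subst_def ringhom_Cst)
lemma subst_Var [simp]: "subst g (Var v) = g v" by (simp add: subst_def ringhom_Cst)
lemma subst_xprod: "subst g (xprod A) = (PROD v:A. g v)" by (simp add: xprod_def)

lemma subst_homog:
assumes "!!v. homog (Suc 0) (g v)" "homog k p" shows "homog k (subst g p)"
using assms(2)
proof (induction rule: homog_induct)
case (add m c p)
have "homog (mdeg m') (mval g m')" for m'
by (induction m' rule: mval_induct)
  (use assms(1) in "auto simp: mval_add mdeg_add intro: homog_mult_Suc")
hence "homog k (subst g (single m c))"
using add by (auto simp: subst_def peval_single[OF ringhom_Cst] intro!: homog_Cst_mult)
with add show ?case by (simp add: homog_add)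
qed simp

lemma subst_subst: "subst g (subst f p) = subst (%v. subst g (f v)) p"
by (rule ringhom_unique[OF ringhom_comp[OF ringhom_subst ringhom_subst] ringhom_subst]) auto

lemma subst_Var_id: "subst Var p = p"
by (rule ringhom_unique[OF ringhom_subst]) (auto simp: ringhom_def)

inductive_set pideal :: "'r::comm_ring_1 set => 'r set" for G where
zero: "0 : pideal G"
| add: "p : pideal G ==> q : pideal G ==> p + q : pideal G"
| gen: "g : G ==> r * g : pideal G"

definition is_ideal :: "'r::comm_ring_1 set => bool" where
"is_ideal I <-> 0 : I & (ALL p:I. ALL q:I. p + q : I) & (ALL p:I. ALL r. r * p : I)"

lemma is_idealD:
assumes "is_ideal I"
shows "0 : I" "p : I ==> q : I ==> p + q : I" "p : I ==> r * p : I" "p : I ==> p * r : I"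
"p : I ==> - p : I" "p : I ==> q : I ==> p - q : I"
"(!!a. a : A ==> f a : I) ==> sum f A : I"
proof -
show 0: "0 : I" and a: "!!p q. p : I ==> q : I ==> p + q : I" and m: "!!p r. p : I ==> r * p : I"
using assms by (auto simp: is_ideal_def)
show "p : I ==> p * r : I" using m[of p r] by (simp add: mult.commute)
show n: "!!p. p : I ==> - p : I" using m[of _ "-1"] by simp
show "p : I ==> q : I ==> p - q : I" using a[of p "- q"] n by simp
show "(!!a. a : A ==> f a : I) ==> sum f A : I"
by (induction A rule: infinite_finite_induct) (auto simp: 0 a)
qed

lemma idiff_cancel: "is_ideal I ==> p - q : I ==> p : I <-> q : I"
using is_idealD(2)[of I "p - q" q] is_idealD(6)[of I p "p - q"] by auto

lemma pideal_mult: "p : pideal G ==> r * p : pideal G"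
by (induction rule: pideal.induct)
 (auto simp: distrib_left intro: pideal.intros simp flip: mult.assoc)

lemma is_ideal_pideal: "is_ideal (pideal G)"
by (auto simp: is_ideal_def pideal_mult intro: pideal.intros)

lemma pideal_gen: "g : G ==> g : pideal G"
using pideal.gen[of g G 1] by simp

lemma pideal_image:
assumes "p : pideal G" "ringhom f" "is_ideal I" "!!g. g : G ==> f g : I"
shows "f p : I"
using assms(1)
by (induction rule: pideal.induct) (auto simp: rh_simps[OF assms(2)] is_idealD[OF assms(3)] assms(4))

lemma pideal_minimal:
assumes "is_ideal I" "G <= I" shows "pideal G <= I"
using pideal_image[of _ G "%x. x" I] assms by (auto simp: ringhom_def)

definition linfun :: "(('v, 'a::comm_ring_1) mp => 'a) => bool" where
"linfun D <-> (ALL p q. D (p + q) = D p + D q) & (ALL c p. D (Cst c * p) = c * D p)"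

lemma lf_simps:
assumes "linfun D"
shows "D (p + q) = D p + D q" "D (Cst c * p) = c * D p" "D 0 = 0" "D (- p) = - D p" "D (p - q) = D p - D q"
"D (sum f A) = (SUM a:A. D (f a))"
proof -
show a: "!!p q. D (p + q) = D p + D q" and "D (Cst c * p) = c * D p"
using assms by (auto simp: linfun_def)
show z: "D 0 = 0" using a[of 0 0] by simp
show n: "!!x. D (- x) = - D x" using a z by (metis add.inverse_unique add.right_inverse)
show "D (p - q) = D p - D q" using a[of p "- q"] n by simp
show "D (sum f A) = (SUM a:A. D (f a))"
by (induction A rule: infinite_finite_induct) (auto simp: z a)
qed

lemma linfunI:
assumes "!!p q. D (p + q) = D p + D q" "!!c p. D (Cst c * p) = c * D p"
shows "linfun D"
using assms by (simp add: linfun_def)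

lemma linfun_mult:
assumes D: "linfun D" shows "linfun (%p. D (r * p))"
proof (rule linfunI)
show "D (r * (Cst c * p)) = c * D (r * p)" for c p
using lf_simps(2)[OF D, of c "r * p"] by (simp add: ac_simps)
qed (simp add: distrib_left lf_simps[OF D])

lemma linfun_comp_subst: "linfun D ==> linfun (%p. D (subst g p))"
by (auto simp: linfun_def)

lemma lf_eq_mod: "linfun D ==> (!!p. p : I ==> D p = 0) ==> p - q : I ==> D p = D q"
using lf_simps(5)[of D p q] by force

text \<open>A linear functional is determined by its values on monomials, which can be prescribed.\<close>

definition monfun :: "(('v \<Rightarrow>\<^sub>0 nat) => 'a) => ('v, 'a::comm_ring_1) mp => 'a" where
"monfun F p = (SUM m:keys p. lookup p m * F m)"

lemma monfun_single [simp]: "monfun F (single m c) = c * F m"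
by (simp add: monfun_def)

lemma linfun_monfun: "linfun (monfun F)"
proof (rule linfunI)
have alt: "finite S ==> keys p <= S ==> monfun F p = (SUM m:S. lookup p m * F m)" for S p
unfolding monfun_def by (rule sum.mono_neutral_left) (auto simp: in_keys_iff)
show *: "monfun F (p + q) = monfun F p + monfun F q" for p q
using keys_add[of p q]
by (simp add: alt[of "keys p Un keys q"] lookup_add distrib_right sum.distrib)
show "monfun F (Cst c * p) = c * monfun F p" for c p
by (induction p rule: pm_induct)
  (auto simp: * distrib_left Cst_mult_single mult.assoc, simp add: monfun_def)
qed

section \<open>Simplicial complexes with linear forms: square-free generation and Poincare
  duality\<close>

section \<open>Chow rings of simplicial complexes with linear relations\<close>

definition lin_form :: "'v set set => ('v => 'a::comm_ring_1) => ('v, 'a) mp" where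
"lin_form K l = (SUM v:\<Union>K. Cst (l v) * Var v)"

definition chow_gens :: "'v set set => ('v => 'a::comm_ring_1) set => ('v, 'a) mp set" where
"chow_gens K L = {xprod R |R. finite R & R ~: K} Un lin_form K ` L"

definition CI :: "'v set set => ('v => 'a::comm_ring_1) set => ('v, 'a) mp set" where
"CI K L = pideal (chow_gens K L)"

text \<open>The degree map is a functional on all polynomials that vanishes on the ideal; only in
  degree \<open>d\<close> are its values prescribed.\<close>

definition is_deg ::
"'v set set => ('v => 'a::comm_ring_1) set => nat => ('v set => 'a) => (('v, 'a) mp => 'a) => bool" where
"is_deg K L d w D <-> linfun D & (ALL p:CI K L. D p = 0) & (ALL A:K. card A = d --> D (xprod A) = w A)"

text \<open>For each \<open>k\<close> only one side of the pairing is constrained; the other side is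
  the condition for \<open>d - k\<close>. Functionals on a graded piece are represented by
  functionals on all polynomials that vanish on \<open>I\<close>, so quotients need not be
  formed.\<close>

definition PD_on :: "('v, 'a::comm_ring_1) mp set => (('v, 'a) mp => 'a) => nat => bool" where
"PD_on I D d <-> (ALL k<=d.
 (ALL p. homog k p & (ALL q. homog (d - k) q --> D (p * q) = 0) --> p : I) &
 (ALL ph. linfun ph & (ALL p:I. ph p = 0) -->
  (EX p. homog k p & (ALL q. homog (d - k) q --> ph q = D (p * q)))))"

definition PDc ::
"'v set set => ('v => 'a::comm_ring_1) set => nat => ('v set => 'a) => bool" where
"PDc K L d w <-> (EX D. is_deg K L d w D & PD_on (CI K L) D d)"

lemma PD_on_inj:
"PD_on I D d ==> k + j = d ==> homog k p ==> (!!q. homog j q ==> D (p * q) = 0) ==> p : I"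
unfolding PD_on_def by (metis diff_add_inverse le_add1)

lemma PD_on_surj:
assumes "PD_on I D d" "k + j = d" "linfun ph" "!!p. p : I ==> ph p = 0"
obtains p where "homog k p" "!!q. homog j q ==> ph q = D (p * q)"
using assms unfolding PD_on_def by (metis diff_add_inverse le_add1)

lemma PD_onI:
assumes "!!k j p. k + j = d ==> homog k p ==> (!!q. homog j q ==> D (p * q) = 0) ==> p : I"
and "!!k j ph. k + j = d ==> linfun ph ==> (!!p. p : I ==> ph p = 0) ==>
  EX p. homog k p & (ALL q. homog j q --> ph q = D (p * q))"
shows "PD_on I D d"
unfolding PD_on_def using assms by (metis le_add_diff_inverse)

lemma PD_on_cong:
assumes "PD_on I D d" "!!p. homog d p ==> D p = D' p"
shows "PD_on I D' d"
proof (rule PD_onI)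
have eq: "D (p * q) = D' (p * q)" if "k + j = d" "homog k p" "homog j q" for k j p q
using that homog_mult[of k p j q] assms(2) by simp
show "p : I" if "k + j = d" "homog k p" "!!q. homog j q ==> D' (p * q) = 0" for k j p
using PD_on_inj[OF assms(1) that(1,2)] that(3) eq[OF that(1,2)] by simp
show "EX p. homog k p & (ALL q. homog j q --> ph q = D' (p * q))"
if "k + j = d" "linfun ph" "!!p. p : I ==> ph p = 0" for k j ph
using PD_on_surj[OF assms(1) that] eq[OF that(1)] by metis
qed

text \<open>Since \<open>io\<close> inverts \<open>th\<close> modulo \<open>I'\<close>, pairings on
  the target can be computed on the source: classes are moved back by \<open>io\<close>, functionals
  are composed with \<open>th\<close>, and \<open>DD'\<close> compares the degrees.\<close>

lemma PD_on_transfer: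
fixes th :: "('v, 'a::comm_ring_1) mp => ('u, 'a) mp" and io :: "('u, 'a) mp => ('v, 'a) mp"
assumes PD: "PD_on I D d"
and th: "ringhom th" "!!c. th (Cst c) = Cst c" "!!k p. homog k p ==> homog k (th p)"
 "!!p. p : I ==> th p : I'"
and io: "!!k p. homog k p ==> homog k (io p)"
 "!!p. p - th (io p) : I'"
and I': "is_ideal I'" and D': "linfun D'" "!!p. p : I' ==> D' p = 0"
and DD': "!!p. homog d p ==> D p = D' (th p)"
shows "PD_on I' D' d"
proof (rule PD_onI)
fix k j and p :: "('u, 'a) mp" assume kj: "k + j = d" and p: "homog k p" and z: "!!q. homog j q ==> D' (p * q) = 0"
have "io p : I"
proof (rule PD_on_inj[OF PD kj io(1)[OF p]])
fix q :: "('v, 'a) mp" assume q: "homog j q"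
have "D (io p * q) = D' (th (io p * q))"
 using homog_mult[OF io(1)[OF p] q] kj DD' by simp
also have "... = D' (p * th q)"
 by (rule sym, rule lf_eq_mod[OF D'(1), of I'])
   (use io(2)[of p] D'(2) in "auto simp: rh_simps[OF th(1)] is_idealD[OF I'] simp flip: left_diff_distrib")
also have "... = 0" using z th(3) q by blast
finally show "D (io p * q) = 0" .
qed
hence "th (io p) : I'" by (rule th(4))
thus "p : I'" using idiff_cancel[OF I' io(2)] by blast
next
fix k j ph assume kj: "k + j = d" and ph: "linfun ph" and z: "!!p. p : I' ==> ph p = 0"
have "linfun (%p. ph (th p))"
using ph by (auto simp: linfun_def rh_simps[OF th(1)] th(2))
then obtain p where p: "homog k p" "!!q. homog j q ==> ph (th q) = D (p * q)"
using PD_on_surj[OF PD kj, of "%p. ph (th p)"] th(4) z by metis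
have "ph q = D' (th p * q)" if q: "homog j q" for q
proof -
have "ph q = ph (th (io q))" by (rule lf_eq_mod[OF ph z io(2)])
also have "... = D (p * io q)" using p(2) io(1) q by blast
also have "... = D' (th p * th (io q))"
 using DD'[of "p * io q"] homog_mult[OF p(1) io(1)[OF q]] kj by (simp add: rh_simps[OF th(1)])
also have "... = D' (th p * q)"
 by (rule sym, rule lf_eq_mod[OF D'(1), of I'])
   (use io(2)[of q] D'(2) in "auto simp: is_idealD[OF I'] simp flip: right_diff_distrib")
finally show ?thesis .
qed
with p(1) th(3) show "EX p. homog k p & (ALL q. homog j q --> ph q = D' (p * q))" by blast
qed

text \<open>The assumption \<open>dual\<close> is unimodularity of the cones in algebraic form: a
  lattice basis of a cone extends to the whole lattice, so some form of the dual lattice is 1 on one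
  ray of the cone and 0 on the others.\<close>

locale ucx =
fixes K :: "'v set set" and L :: "('v => 'a::idom) set"
assumes finite_K: "finite K" and empty_face: "{} : K"
and finite_face: "A : K ==> finite A"
and down_closed: "A : K ==> B <= A ==> B : K"
and dual: "A : K ==> v : A ==> EX l:L. l v = 1 & (ALL u:A - {v}. l u = 0)"
begin

abbreviation "V == \<Union>K"

lemma finite_V: "finite V" using finite_K finite_face by auto

lemma is_ideal_CI: "is_ideal (CI K L)" by (simp add: CI_def is_ideal_pideal)
lemmas CI_closed = is_idealD[OF is_ideal_CI]

lemma xprod_CI: "finite R ==> R ~: K ==> xprod R : CI K L"
by (auto simp: CI_def chow_gens_def intro!: pideal_gen)

lemma lin_CI: "l : L ==> lin_form K l : CI K L"
by (auto simp: CI_def chow_gens_def intro!: pideal_gen)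

lemma Var_in_CI: "v ~: V ==> Var v : CI K L"
using xprod_CI[of "{v}"] by (auto simp: xprod_def)

lemma xprod_insert: "finite A ==> v ~: A ==> xprod (insert v A) = Var v * xprod A"
by (simp add: xprod_def)

text \<open>Induction on the degree, splitting off one variable. A variable outside \<open>A\<close>
  either enlarges the face or produces a non-face monomial. A variable inside \<open>A\<close> is
  first exchanged, by its dual form, for variables outside \<open>A\<close>. The submodule
  \<open>T\<close> is left open: it will be the kernel of a functional, the ideal itself, or the
  span of square-free monomials.\<close>

lemma moving:
assumes T: "!!p q. p : T ==> q : T ==> p + q : T" "!!c p. p : T ==> Cst c * p : T"
 "CI K L <= T"
and "!!B. B : K ==> A <= B ==> card B = card A + a ==> xprod B : T"
and "A : K" "homog a p"
shows "xprod A * p : T"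
proof -
have T_sum: "(!!x. x : S ==> f x : T) ==> sum f S : T" for f :: "'v => _" and S
by (induction S rule: infinite_finite_induct) (use T CI_closed(1) in auto)
have main: "xprod A * single m 1 : T"
if "mdeg m = a" "A : K" "!!B. B : K ==> A <= B ==> card B = card A + a ==> xprod B : T"
for m A a
using that
proof (induction a arbitrary: m A)
case 0
thus ?case by (simp add: mdeg_eq_0)
next
case (Suc a)
from Suc.prems(1) obtain v m' where m: "m = single v 1 + m'" "mdeg m' = a"
 by (rule mdeg_Suc_decomp)
have s: "single m 1 = Var v * single m' (1::'a)" by (simp add: m Var_def mult_single)
have finA: "finite A" using finite_face Suc.prems(2) .
have step: "xprod A * (Var u * single m' 1) : T" if "u ~: A" for u
proof (cases "insert u A : K")
 case True
 have "xprod (insert u A) * single m' 1 : T"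
  by (rule Suc.IH[OF m(2) True]) (use Suc.prems(3) finA that in auto)
 thus ?thesis using finA that by (simp add: xprod_insert mult.assoc mult.left_commute)
next
 case False
 hence "xprod (insert u A) : CI K L" using finA by (intro xprod_CI) auto
 hence "xprod (insert u A) * single m' 1 : CI K L" by (rule CI_closed(4))
 thus ?thesis using finA that T(3) by (auto simp add: xprod_insert mult.assoc mult.left_commute)
qed
show ?case
proof (cases "v : A")
 case True
 obtain l where l: "l : L" "l v = 1" "!!u. u : A - {v} ==> l u = 0"
  using dual[OF Suc.prems(2) True] by blast
 have vV: "v : V" using True Suc.prems(2) by blast
 have "lin_form K l = (SUM u:V - A. Cst (l u) * Var u) + (SUM u:A. Cst (l u) * Var u)"
  unfolding lin_form_def
  by (rule sum.subset_diff) (use Suc.prems(2) finite_V in auto)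
 also have "(SUM u:A. Cst (l u) * Var u) = Var v"
  using l(2,3) True finA by (subst sum.remove[of A v]) auto
 finally have v: "Var v = lin_form K l - (SUM u:V - A. Cst (l u) * Var u)" by simp
 have "xprod A * (Var v * single m' 1) = lin_form K l * (xprod A * single m' 1)
   + (SUM u:V - A. Cst (- l u) * (xprod A * (Var u * single m' 1)))"
  unfolding v by (simp add: algebra_simps sum_distrib_left sum_distrib_right sum_negf Cst_uminus)
 moreover have "lin_form K l * (xprod A * single m' 1) : T"
  using T(3) CI_closed(4)[OF lin_CI[OF l(1)]] by auto
 moreover have "(SUM u:V - A. Cst (- l u) * (xprod A * (Var u * single m' 1))) : T"
  by (intro T_sum T(2) step) auto
 ultimately show ?thesis unfolding s using T(1) by simp
qed (use step s in simp)
qed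
from assms(6) show ?thesis
proof (induction rule: homog_induct)
case (add m c p)
have "xprod A * (single m c + p) = Cst c * (xprod A * single m 1) + xprod A * p"
 by (subst single_Cst) (simp add: algebra_simps)
moreover have "Cst c * (xprod A * single m 1) : T"
 by (intro T(2) main[OF add(2)] assms)
ultimately show ?case using T(1) add by simp
qed (use T(3) CI_closed(1) in auto)
qed

lemma functional_moving:
assumes ph: "linfun ph" "!!p. p : CI K L ==> ph p = 0"
and "!!B. B : K ==> A <= B ==> card B = card A + a ==> ph (xprod B) = 0" "A : K" "homog a p"
shows "ph (xprod A * p) = 0"
using moving[of "{p. ph p = 0}" A a p] assms by (auto simp: lf_simps[OF ph(1)])

lemma xprod_empty [simp]: "xprod {} = 1" by (simp add: xprod_def)

text \<open>The square-free monomials of faces of size \<open>a\<close> span degree \<open>a\<close>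
  modulo the ideal.\<close>

lemma deg_unique:
assumes "linfun ph" "!!p. p : CI K L ==> ph p = 0" "linfun ps" "!!p. p : CI K L ==> ps p = 0"
and "!!B. B : K ==> card B = a ==> ph (xprod B) = ps (xprod B)" "homog a p"
shows "ph p = ps p"
proof -
have "linfun (%p. ph p - ps p)"
by (rule linfunI) (simp_all add: lf_simps[OF assms(1)] lf_simps[OF assms(3)] right_diff_distrib)
hence "ph (xprod {} * p) - ps (xprod {} * p) = 0"
by (rule functional_moving[where a = a]) (use assms empty_face in simp_all)
thus ?thesis by simp
qed

text \<open>There is no face of size \<open>a\<close>, so the requirement on faces in
  \<open>moving\<close> is vacuous.\<close>

lemma above_dim:
assumes "!!B. B : K ==> card B <= d" "homog a p" "d < a"
shows "p : CI K L"
proof -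
have "xprod {} * p : CI K L"
proof (rule moving[where a = a])
show "xprod B : CI K L" if "B : K" "card B = card {} + a" for B
 using assms(1)[OF that(1)] that(2) assms(3) by simp
qed (use assms(2) empty_face CI_closed(2,3) in auto)
thus ?thesis by simp
qed

text \<open>Duality sees the degree map only in degree \<open>d\<close>, where it is unique; the
  existential in \<open>PDc\<close> may be tested on any degree map.\<close>

lemma PDc_iff:
assumes "is_deg K L d w D"
shows "PDc K L d w <-> PD_on (CI K L) D d"
proof
assume "PDc K L d w"
then obtain D' where D': "is_deg K L d w D'" "PD_on (CI K L) D' d" by (auto simp: PDc_def)
show "PD_on (CI K L) D d"
by (rule PD_on_cong[OF D'(2)], rule deg_unique) (use D' assms in "auto simp: is_deg_def")
qed (use assms in "auto simp: PDc_def")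

end

section \<open>Minkowski weights as a module over the polynomial ring, and the degree map\<close>

section \<open>Existence of the degree map\<close>

context ucx
begin

definition dl :: "'v set => 'v => 'v => 'a" where
"dl A v = (SOME l. l : L & l v = 1 & (ALL u:A - {v}. l u = 0))"

lemma dl:
assumes "A : K" "v : A"
shows "dl A v : L" "dl A v v = 1" "u : A ==> u ~= v ==> dl A v u = 0"
proof -
have "EX l. l : L & l v = 1 & (ALL u:A - {v}. l u = 0)" using dual[OF assms] by blast
hence "dl A v : L & dl A v v = 1 & (ALL u:A - {v}. dl A v u = 0)"
unfolding dl_def by (rule someI_ex)
thus "dl A v : L" "dl A v v = 1" "u : A ==> u ~= v ==> dl A v u = 0" by auto
qed

text \<open>Balancing of \<open>c\<close> at \<open>A\<close> provides a unique linear relation between the vertices whose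
coefficients outside \<open>A\<close> are the values of \<open>c\<close>. Multiplication by the variable of \<open>v\<close> sends \<open>c\<close>
to the coefficients of \<open>v\<close> in these relations.\<close>

definition mw_ext :: "('v set => 'a) => 'v set => 'v => 'a" where
"mw_ext c A v = (if v : A then - (SUM u:V - A. dl A v u * c (insert u A)) else c (insert v A))"

text \<open>Minkowski weights, set to zero off the faces of size \<open>a\<close>. For a fan the
  second condition says that the coefficients \<open>mw_ext c A\<close> are a linear relation
  between the primitive vectors, which is balancing at \<open>A\<close>.\<close>

definition mink_wt :: "nat => ('v set => 'a) => bool" where
"mink_wt a c <-> (ALL B. c B ~= 0 --> B : K & card B = a) &
 (ALL A:K. Suc (card A) = a --> (ALL l:L. (SUM v:V. l v * mw_ext c A v) = 0))"

lemma mink_wt_zero: "mink_wt a (%_. 0)"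
by (auto simp: mink_wt_def mw_ext_def intro!: sum.neutral)

lemma mw_ext_eq_0:
assumes "mink_wt a c" "~ (A : K & Suc (card A) = a)"
shows "mw_ext c A v = 0"
proof -
have "c (insert u A) = 0" if "u ~: A" for u
proof (rule ccontr)
assume "c (insert u A) ~= 0"
hence *: "insert u A : K" "card (insert u A) = a" using assms(1) by (auto simp: mink_wt_def)
hence "finite A" using finite_face by fastforce
with * that assms(2) show False using down_closed[of "insert u A" A] by auto
qed
thus ?thesis by (auto simp: mw_ext_def)
qed

lemma mw_ext_relation:
assumes "mink_wt a c" "l : L" shows "(SUM v:V. l v * mw_ext c A v) = 0"
proof (cases "A : K & Suc (card A) = a")
case False
thus ?thesis using mw_ext_eq_0[OF assms(1)] by simp
qed (use assms in "auto simp: mink_wt_def")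

context
fixes c a ka
assumes c: "mink_wt a c" and ka: "ka : K"
begin

lemma G_sym: "u ~: ka ==> v ~: ka ==> mw_ext c (insert u ka) v = mw_ext c (insert v ka) u"
by (cases "u = v") (simp_all add: mw_ext_def insert_commute)

lemma G_in:
assumes "u ~: ka" "v : ka"
shows "mw_ext c (insert u ka) v = - (SUM w:V - ka. dl ka v w * mw_ext c (insert u ka) w)"
proof -
have "0 = (SUM w:V. dl ka v w * mw_ext c (insert u ka) w)"
using mw_ext_relation[OF c dl(1)[OF ka assms(2)]] by simp
also have "... = (SUM w:V - ka. dl ka v w * mw_ext c (insert u ka) w) + (SUM w:ka. dl ka v w * mw_ext c (insert u ka) w)"
by (rule sum.subset_diff) (use ka finite_V in auto)
also have "(SUM w:ka. dl ka v w * mw_ext c (insert u ka) w) = mw_ext c (insert u ka) v"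
using dl[OF ka assms(2)] assms(2) finite_face[OF ka] by (subst sum.remove[of ka v]) auto
finally show ?thesis by (simp add: eq_neg_iff_add_eq_0 add.commute)
qed

text \<open>The value at \<open>ka\<close> after multiplying \<open>c\<close> by the variable of
  \<open>v\<close> and then by that of \<open>w\<close>. The aim is that the order does not matter
  and that the result is balanced.\<close>

definition H where "H v w = mw_ext (%A. mw_ext c A v) ka w"

lemma H_out: "w ~: ka ==> H v w = mw_ext c (insert w ka) v"
by (simp add: H_def mw_ext_def[of _ ka])
lemma H_in: "w : ka ==> H v w = - (SUM u:V - ka. dl ka w u * mw_ext c (insert u ka) v)"
by (simp add: H_def mw_ext_def[of _ ka])

lemma H_out_in: "v ~: ka ==> w : ka ==> H v w = mw_ext c (insert v ka) w"
unfolding H_in by (subst G_in) (auto simp: G_sym[of v] intro!: sum.cong)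

text \<open>For distinct vertices outside \<open>ka\<close> both orders give the value of
  \<open>c\<close> at \<open>ka\<close> enlarged by the two. A vertex inside \<open>ka\<close> is
  eliminated by its dual form; if both lie inside, this leaves a double sum with a symmetric
  summand.\<close>

lemma H_sym: "H v w = H w v"
proof (cases "v : ka"; cases "w : ka")
assume vw: "v : ka" "w : ka"
have *: "H v w = (SUM u:V - ka. SUM x:V - ka. dl ka w u * dl ka v x * mw_ext c (insert u ka) x)"
if "v : ka" "w : ka" for v w
unfolding H_in[OF that(2)] sum_negf[symmetric]
by (intro sum.cong refl) (use that in "simp add: G_in sum_distrib_left mult.assoc")
show ?thesis
unfolding *[OF vw] *[OF vw(2,1)]
by (subst sum.swap) (auto simp: G_sym mult.commute mult.left_commute intro!: sum.cong)
next
assume "v ~: ka" "w ~: ka" thus ?thesis by (simp add: H_out G_sym)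
next
assume "v ~: ka" "w : ka" thus ?thesis by (simp add: H_out_in H_out)
next
assume "v : ka" "w ~: ka" thus ?thesis by (simp add: H_out_in[of w v] H_out)
qed

text \<open>For \<open>v\<close> outside \<open>ka\<close> these coefficients are the relation of
  \<open>c\<close> at \<open>insert v ka\<close>. For \<open>v\<close> inside \<open>ka\<close>, the
  dual form of \<open>v\<close> writes them as a combination of such relations.\<close>

lemma H_balanced:
assumes l: "l : L" shows "(SUM w:V. l w * H v w) = 0"
proof -
have out: "(SUM w:V. l w * H v w) = 0" if "v ~: ka" for v
proof -
have "H v w = mw_ext c (insert v ka) w" for w
 using that by (cases "w : ka") (auto simp: H_out_in H_out G_sym)
thus ?thesis using mw_ext_relation[OF c l] by simp
qed
show ?thesis
proof (cases "v : ka")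
case True
have "H v w = - (SUM x:V - ka. dl ka v x * H x w)" for w
 by (subst H_sym, subst H_in[OF True]) (auto simp: H_sym[of _ w] H_out intro!: sum.cong)
hence "(SUM w:V. l w * H v w) = - (SUM w:V. SUM x:V - ka. dl ka v x * (l w * H x w))"
 by (simp add: sum_distrib_left sum_negf mult.left_commute)
also have "... = - (SUM x:V - ka. dl ka v x * (SUM w:V. l w * H x w))"
 by (subst sum.swap) (simp add: sum_distrib_left)
finally show ?thesis using out by simp
qed (rule out)
qed

end

text \<open>The size drops by one, except that a weight of size 0 is multiplied to the zero weight;
  this is why the new size is only asserted to exist.\<close>

lemma mink_wt_mult:
assumes c: "mink_wt a c" shows "EX b. mink_wt b (%A. mw_ext c A v)"
proof (cases a)
case 0
hence "(%A. mw_ext c A v) = (%_. 0)" using mw_ext_eq_0[OF c] by auto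
thus ?thesis using mink_wt_zero by simp
next
case (Suc b)
have "mink_wt b (%A. mw_ext c A v)"
unfolding mink_wt_def using mw_ext_eq_0[OF c] H_balanced[OF c] Suc
by (auto simp: H_def[OF c])
thus ?thesis ..
qed

lemma mw_ext_commute:
assumes c: "mink_wt a c"
shows "mw_ext (%A. mw_ext c A v) B w = mw_ext (%A. mw_ext c A w) B v"
proof (cases "B : K")
case True
thus ?thesis using H_sym[OF c] by (simp add: H_def[OF c])
next
case False
obtain b where "mink_wt b (%A. mw_ext c A v)" using mink_wt_mult[OF c] by blast
moreover obtain b' where "mink_wt b' (%A. mw_ext c A w)" using mink_wt_mult[OF c] by blast
ultimately show ?thesis using False mw_ext_eq_0 by metis
qed

text \<open>Set to zero off the Minkowski weights, so that the operators commute on all functions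
  and can be folded over a multiset of variables.\<close>

definition mwX :: "'v => ('v set => 'a) => ('v set => 'a)" where
"mwX v c = (if EX a. mink_wt a c then (%A. mw_ext c A v) else (%_. 0))"

lemma mink_wt_mwX: "EX a. mink_wt a (mwX v c)"
using mink_wt_mult mink_wt_zero by (auto simp: mwX_def)

lemma mwX_commute: "mwX v (mwX w c) = mwX w (mwX v c)"
proof (cases "EX a. mink_wt a c")
case True
thus ?thesis using mink_wt_mwX[of v c] mink_wt_mwX[of w c] mw_ext_commute
by (auto simp: mwX_def)
next
case False
hence "mwX v c = (%_. 0)" "mwX w c = (%_. 0)" by (auto simp: mwX_def)
thus ?thesis by (auto simp: mwX_def mw_ext_def)
qed

sublocale mwX: comp_fun_commute mwX
by standard (auto simp: fun_eq_iff mwX_commute)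

definition emset :: "('v \<Rightarrow>\<^sub>0 nat) => 'v multiset" where
"emset m = (SUM v:keys m. replicate_mset (lookup m v) v)"

lemma count_emset: "count (emset m) v = lookup m v"
by (auto simp: emset_def count_sum count_replicate_mset in_keys_iff if_distrib cong: if_cong)

lemma emset_add_single: "emset (single v 1 + m) = add_mset v (emset m)"
by (rule multiset_eqI) (auto simp: count_emset lookup_add lookup_single when_def)

lemma emset_0 [simp]: "emset 0 = {#}" by (simp add: emset_def)

text \<open>The cap product of a monomial with a Minkowski weight.\<close>

definition mw_act :: "('v set => 'a) => ('v \<Rightarrow>\<^sub>0 nat) => 'v set => 'a" where
"mw_act c m = fold_mset mwX c (emset m)"

lemma mw_act_0 [simp]: "mw_act c 0 = c" by (simp add: mw_act_def)
lemma mw_act_add: "mw_act c (single v 1 + m) = mwX v (mw_act c m)"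
unfolding mw_act_def emset_add_single by simp

context
fixes c d assumes c: "mink_wt d c"
begin

lemma mink_wt_act: "EX a. mink_wt a (mw_act c m)"
by (induction m rule: mval_induct) (use c mink_wt_mwX in "auto simp: mw_act_add simp del: One_nat_def")

lemma mw_act_add': "mw_act c (single v 1 + m) A = mw_ext (mw_act c m) A v"
using mink_wt_act[of m] by (simp add: mw_act_add mwX_def del: One_nat_def)

text \<open>Multiplication by the variable of \<open>v\<close> reads values only at faces that
  contain \<open>v\<close> and the given face. A nonzero value therefore leads back to a face
  containing \<open>A\<close> and all variables of the monomial, which makes non-face monomials act
  as zero at the empty face.\<close>

lemma mw_act_support: "mw_act c m A ~= 0 ==> EX B:K. A Un keys m <= B"
proof (induction m arbitrary: A rule: mval_induct)
case zero
thus ?case using c by (auto simp: mink_wt_def)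
next
case (add v m)
from add.prems have nz: "mw_ext (mw_act c m) A v ~= 0" by (simp add: mw_act_add' del: One_nat_def)
have "EX u. mw_act c m (insert u A) ~= 0 & v : insert u A"
proof (cases "v : A")
case True
show ?thesis
proof (rule ccontr)
 assume "~ ?thesis"
 with True have "!!u. mw_act c m (insert u A) = 0" by blast
 with True nz show False by (simp add: mw_ext_def)
qed
qed (use nz in "auto simp: mw_ext_def")
then obtain u where "mw_act c m (insert u A) ~= 0" "v : insert u A" by blast
with add.IH[of "insert u A"] obtain B where B: "B : K" "insert u A Un keys m <= B" "v : B" by blast
moreover have "keys (single v 1 + m) <= insert v (keys m)"
using keys_add[of "single v (1::nat)" m] by simp
ultimately show ?case by blast
qed

lemma mw_act_face:
assumes "finite B" "A Int B = {}"
shows "mw_act c (SUM v:B. single v 1) A = c (A Un B)"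
using assms
proof (induction B arbitrary: A rule: finite_induct)
case (insert v B)
have "mw_act c (SUM v:insert v B. single v 1) A = mw_ext (mw_act c (SUM v:B. single v 1)) A v"
using insert(1,2) by (simp add: mw_act_add' del: One_nat_def)
also have "... = c (insert v A Un B)"
using insert by (simp add: mw_ext_def del: One_nat_def)
finally show ?case by simp
qed simp

end

lemma xprod_single: "xprod B = single (SUM v:B. single v 1) (1::'a)"
proof (induction B rule: infinite_finite_induct)
case (insert v B)
hence "xprod (insert v B) = Var v * single (SUM v:B. single v 1) (1::'a)" by (simp add: xprod_def)
thus ?case using insert by (simp add: Var_def mult_single del: One_nat_def)
qed (auto simp: xprod_def)

text \<open>The degree of a monomial is the value at the empty face after it has acted on the
  weight. Linear forms go to zero because they annihilate every relation \<open>mw_ext\<close>, and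
  non-face monomials go to zero by \<open>mw_act_support\<close>. The hypothesis is balancing, as a
  relation with prescribed coefficients outside \<open>A\<close>.\<close>

theorem ex_deg:
assumes bal: "!!A. A : K ==> Suc (card A) = d ==>
 EX gm. (ALL v:V - A. gm v = (if insert v A : K then w (insert v A) else 0)) &
   (ALL l:L. (SUM v:V. l v * gm v) = 0)"
shows "EX D. is_deg K L d w D"
proof -
define c where "c B = (if B : K & card B = d then w B else 0)" for B
have c: "mink_wt d c"
unfolding mink_wt_def
proof (intro conjI allI impI ballI)
fix A l assume A: "A : K" "Suc (card A) = d" and l: "l : L"
from bal[OF A] obtain gm where "ALL v:V - A. gm v = (if insert v A : K then w (insert v A) else 0)"
 "ALL l:L. (SUM v:V. l v * gm v) = 0" by (elim exE conjE)
note gm = bspec[OF this(1)] bspec[OF this(2)]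
have gmc: "gm v = c (insert v A)" if "v : V - A" for v
 using gm(1)[OF that] A that finite_face[OF A(1)] by (auto simp: c_def)
have "mw_ext c A v = gm v" if "v : V" for v
proof (cases "v : A")
 case True
 have "0 = (SUM u:V. dl A v u * gm u)" using gm(2) dl(1)[OF A(1) True] by simp
 also have "... = (SUM u:V - A. dl A v u * gm u) + (SUM u:A. dl A v u * gm u)"
  by (rule sum.subset_diff) (use A finite_V in auto)
 also have "(SUM u:A. dl A v u * gm u) = gm v"
  using dl[OF A(1) True] True finite_face[OF A(1)] by (subst sum.remove[of A v]) auto
 finally show ?thesis using True gmc by (simp add: mw_ext_def neg_eq_iff_add_eq_0 add.commute)
qed (use that gmc in "simp add: mw_ext_def")
thus "(SUM v:V. l v * mw_ext c A v) = 0" using gm(2)[OF l] by simp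
qed (auto simp: c_def split: if_splits)
define D where "D = monfun (%m. mw_act c m {})"
have D: "linfun D" by (simp add: D_def linfun_monfun)
have D_single: "D (single m e) = e * mw_act c m {}" for m e by (simp add: D_def)
have gen: "D (r * g) = 0" if "g : chow_gens K L" for r g
proof (induction r rule: pm_induct)
case (add m e r)
have "D (single m e * g) = 0"
 using that unfolding chow_gens_def
proof (elim UnE imageE)
 fix l assume g: "g = lin_form K l" and l: "l : L"
 have "single m e * g = (SUM v:V. single (single v 1 + m) (e * l v))"
  by (simp add: g lin_form_def sum_distrib_left Cst_def Var_def mult_single add.commute)
 hence "D (single m e * g) = e * (SUM v:V. l v * mw_ext (mw_act c m) {} v)"
  by (simp add: lf_simps[OF D] D_single mw_act_add'[OF c] sum_distrib_left mult.assoc del: One_nat_def)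
 also have "... = 0" using mink_wt_act[OF c, of m] mw_ext_relation l by fastforce
 finally show ?thesis .
next
 assume "g : {xprod R |R. finite R & R ~: K}"
 then obtain R where g: "g = xprod R" and R: "finite R" "R ~: K" by blast
 have "single m e * g = single (m + (SUM v:R. single v 1)) e"
  by (simp add: g xprod_single mult_single)
 moreover have "mw_act c (m + (SUM v:R. single v 1)) {} = 0"
 proof (rule ccontr)
  assume "mw_act c (m + (SUM v:R. single v 1)) {} ~= 0"
  then obtain B where B: "B : K" "keys (m + (SUM v:R. single v 1)) <= B"
   using mw_act_support[OF c] by blast
  have "R <= keys (m + (SUM v:R. single v 1))"
  proof
   fix v assume "v : R"
   hence "lookup (SUM v:R. single v (1::nat)) v >= 1"
    using R(1) by (simp add: lookup_sum lookup_single when_def)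
   thus "v : keys (m + (SUM v:R. single v 1))" by (simp add: in_keys_iff lookup_add)
  qed
  with B R(2) down_closed show False by blast
 qed
 ultimately show ?thesis by (simp add: D_def)
qed
with add show ?case by (simp add: distrib_right lf_simps[OF D])
qed (simp add: lf_simps[OF D])
have "D p = 0" if "p : CI K L" for p
using that unfolding CI_def by (induction rule: pideal.induct) (auto simp: lf_simps[OF D] gen)
moreover have "D (xprod A) = w A" if "A : K" "card A = d" for A
using mw_act_face[OF c, of A "{}"] finite_face[OF that(1)] that by (simp add: D_def xprod_single c_def)
ultimately show ?thesis using D by (auto simp: is_deg_def)
qed

end

section \<open>Duality under stellar subdivision: powers of the exceptional variable over the
  original Chow ring\<close>

section \<open>Blow-ups\<close>

lemma subst_cong_mod:
assumes I: "is_ideal I" and fg: "!!v. f v - g v : I"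
shows "subst f p - subst g p : I"
proof -
have m: "mval f m - mval g m : I" for m
proof (induction m rule: mval_induct)
case (add v m)
have "mval f (single v 1 + m) - mval g (single v 1 + m)
  = f v * (mval f m - mval g m) + (f v - g v) * mval g m"
 by (simp add: mval_add algebra_simps)
thus ?case using is_idealD[OF I] add fg by auto
qed (simp add: is_idealD[OF I])
show ?thesis
proof (induction p rule: pm_induct)
case (add m c p)
have "subst f (single m c + p) - subst g (single m c + p)
  = Cst c * (mval f m - mval g m) + (subst f p - subst g p)"
 by (simp add: subst_def peval_add[OF ringhom_Cst] peval_single[OF ringhom_Cst] algebra_simps)
moreover have "Cst c * (mval f m - mval g m) + (subst f p - subst g p) : I"
 by (intro is_idealD[OF I] m add)
ultimately show ?case by (simp only:)
qed (simp add: is_idealD[OF I])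
qed

lemma xprod_split: "finite R ==> xprod R = xprod (R Int S) * xprod (R - S)"
unfolding xprod_def by (subst prod.union_disjoint[symmetric]) (auto intro: prod.cong)

lemma xprod_Un: "finite R ==> finite S ==> R Int S = {} ==> xprod (R Un S) = xprod R * xprod S"
unfolding xprod_def by (rule prod.union_disjoint)

lemma prod_add_const: "finite A ==> EX q. (PROD i:A. f i + t) = (PROD i:A. f i) + t * (q::'r::comm_ring_1)"
proof (induction A rule: finite_induct)
case empty
show ?case by (intro exI[of _ 0]) simp
next
case (insert i A)
then obtain q where q: "(PROD i:A. f i + t) = (PROD i:A. f i) + t * q" by blast
show ?case
by (rule exI[of _ "(PROD i:A. f i) + f i * q + t * q"]) (simp only: prod.insert[OF insert(1,2)] q, simp add: algebra_simps)
qed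

text \<open>The stellar subdivision of \<open>K\<close> at the face \<open>sg\<close> with new
  vertex \<open>e\<close>.\<close>

definition bcx :: "'v set set => 'v set => 'v => 'v set set" where
"bcx K sg e = {B : K. ~ sg <= B} Un {insert e B |B. ~ sg <= B & B Un sg : K}"

text \<open>Presents the Chow ring of the star of \<open>sg\<close> in the variables of
  \<open>K\<close>. The variables of \<open>sg\<close> are kept; they are eliminated by linear forms
  dual on \<open>sg\<close>.\<close>

definition star_ideal :: "'v set set => ('v => 'a::comm_ring_1) set => 'v set => ('v, 'a) mp set" where
"star_ideal K L sg = pideal (chow_gens K L Un {xprod R |R. finite R & R Int sg = {} & R Un sg ~: K})"

lemma is_ideal_star_ideal: "is_ideal (star_ideal K L sg)"
by (simp add: star_ideal_def is_ideal_pideal)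

text \<open>The product of the x_i - t as a polynomial in t. For \<open>S = sg\<close> and t the
  exceptional variable it expresses that the rays of \<open>sg\<close> no longer span a
  cone.\<close>

definition lin_prod :: "'v set => ('v, 'a::comm_ring_1) mp poly" where
"lin_prod S = (PROD i:S. [:Var i, -1:])"

lemma lin_prod:
assumes "finite S"
shows "degree (lin_prod S :: ('v,'a::comm_ring_1) mp poly) <= card S"
"coeff (lin_prod S) (card S) = ((-1) ^ card S :: ('v,'a::comm_ring_1) mp)"
"coeff (lin_prod S) 0 = (xprod S :: ('v,'a::comm_ring_1) mp)"
"i <= card S ==> homog (card S - i) (coeff (lin_prod S) i :: ('v,'a::comm_ring_1) mp)"
proof -
have "degree (lin_prod S :: ('v,'a::comm_ring_1) mp poly) <= card S &
coeff (lin_prod S) (card S) = ((-1) ^ card S :: ('v,'a::comm_ring_1) mp) &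
coeff (lin_prod S) 0 = (xprod S :: ('v,'a::comm_ring_1) mp) &
(ALL i<=card S. homog (card S - i) (coeff (lin_prod S) i :: ('v,'a::comm_ring_1) mp))"
using assms
proof (induction S rule: finite_induct)
case (insert v S)
let ?q = "lin_prod S :: ('v,'a::comm_ring_1) mp poly"
have q: "lin_prod (insert v S) = smult (Var v) ?q + pCons 0 (- ?q)"
 using insert by (simp add: lin_prod_def)
have c: "coeff (lin_prod (insert v S)) n = Var v * coeff ?q n - (if n = 0 then 0 else coeff ?q (n - 1))" for n
 unfolding q by (cases n) auto
have big: "coeff ?q n = 0" if "n > card S" for n
 using insert.IH that by (intro coeff_eq_0) auto
have "degree (lin_prod (insert v S) :: ('v,'a) mp poly) <= card (insert v S)"
 by (rule degree_le) (use insert(1,2) in "auto simp: c big")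
moreover have "homog (card (insert v S) - i) (coeff (lin_prod (insert v S)) i :: ('v,'a) mp)"
 if "i <= card (insert v S)" for i
proof -
 have i: "i <= Suc (card S)" using that insert by simp
 have "homog (Suc (card S) - i) (Var v * coeff ?q i)"
 proof (cases "i = Suc (card S)")
  case False
  hence "homog (Suc (card S - i)) (Var v * coeff ?q i)"
   using insert.IH i by (intro homog_mult_Suc) auto
  thus ?thesis using i False by (simp add: Suc_diff_le)
 qed (simp add: big)
 moreover have "homog (Suc (card S) - i) (if i = 0 then 0 else coeff ?q (i - 1))"
  using insert.IH i by (cases i) auto
 ultimately show ?thesis unfolding c using insert(1,2) by (simp add: homog_diff)
qed
ultimately show ?case
 using insert by (auto simp: c big xprod_def)
qed (auto simp: lin_prod_def xprod_def)
thus "degree (lin_prod S :: ('v,'a::comm_ring_1) mp poly) <= card S"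
"coeff (lin_prod S) (card S) = ((-1) ^ card S :: ('v,'a::comm_ring_1) mp)"
"coeff (lin_prod S) 0 = (xprod S :: ('v,'a::comm_ring_1) mp)"
"i <= card S ==> homog (card S - i) (coeff (lin_prod S) i :: ('v,'a::comm_ring_1) mp)"
by auto
qed

text \<open>\<open>L_e\<close> says that the new ray vector is the sum of those of
  \<open>sg\<close>; \<open>star_above_dim\<close> says that the Chow ring of the star vanishes
  above degree \<open>d - card sg\<close>.\<close>

locale blowup = ucx K L + B: ucx "bcx K sg e" L
for K :: "'v set set" and L :: "('v => 'a::idom) set" and sg :: "'v set" and e :: 'v +
fixes d :: nat and w :: "'v set => 'a"
assumes sg: "sg : K" and card_sg: "2 <= card sg" and e: "e ~: V"
and L_e: "l : L ==> l e = (SUM i:sg. l i)"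
and dim_le: "A : K ==> card A <= d"
and star_above_dim: "homog c p ==> d < c + card sg ==> p : star_ideal K L sg"
begin

abbreviation "K' == bcx K sg e"
abbreviation "k == card sg"
abbreviation "I == CI K L"
abbreviation "I' == CI K' L"
abbreviation "J == star_ideal K L sg"

lemma fin_sg: "finite sg" using sg finite_face by blast
lemma e_sg: "e ~: sg" using e sg by blast

lemma V': "\<Union>K' = insert e V"
proof -
have "v : \<Union>K'" if "v : V" for v
proof -
have "{v} : K" using that down_closed by blast
moreover have "~ sg <= {v}" using card_sg card_mono[of "{v}" sg] by auto
ultimately show ?thesis by (auto simp: bcx_def)
qed
moreover have "e : \<Union>K'"
proof -
have "~ sg <= {}" using card_sg by auto
hence "insert e {} : K'" using sg unfolding bcx_def by fastforce
thus ?thesis by blast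
qed
moreover have "\<Union>K' <= insert e V" by (auto simp: bcx_def)
ultimately show ?thesis by blast
qed

text \<open>The pull-back to the blow-up. The piecewise linear function of a ray of
  \<open>sg\<close> takes the value 1 at the new vector, the sum of the vectors of
  \<open>sg\<close>, so the exceptional variable is added; \<open>e\<close> itself is not a vertex
  of \<open>K\<close>.\<close>

definition Ps :: "('v,'a) mp => ('v,'a) mp" where
"Ps = subst (%v. if v : sg then Var v + Var e else if v = e then 0 else Var v)"

lemma ringhom_Ps: "ringhom Ps" by (simp add: Ps_def ringhom_subst)
lemmas Ps_simps [simp] = rh_simps[OF ringhom_Ps]
lemma Ps_Cst [simp]: "Ps (Cst c) = Cst c" by (simp add: Ps_def)
lemma Ps_Var: "Ps (Var v) = (if v : sg then Var v + Var e else if v = e then 0 else Var v)"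
by (simp add: Ps_def)
lemma Ps_homog: "homog n p ==> homog n (Ps p)"
unfolding Ps_def by (rule subst_homog) (use e_sg in "auto intro: homog_add[OF homog_Var homog_Var]")
lemma linfun_Ps: "linfun ph ==> linfun (%p. ph (Ps p * q))"
by (auto simp: linfun_def distrib_right mult.assoc)

lemma xprod_e_in_I':
assumes "finite R" "e ~: R" "R Int sg = {}" "R Un sg ~: K"
shows "Var e * xprod R : I'"
proof -
have "insert e R ~: K'"
proof
assume "insert e R : K'"
then consider "insert e R : K" | B where "insert e R = insert e B" "B Un sg : K"
 by (auto simp: bcx_def)
thus False
proof cases
 case 1 thus False using e by blast
next
 case 2
 hence "e ~: B" "R <= B" using e assms(2) by auto
 thus False using 2 down_closed[of "B Un sg" "R Un sg"] assms(4) by blast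
qed
qed
hence "xprod (insert e R) : I'" using assms(1) by (intro B.xprod_CI) auto
thus ?thesis using assms by (simp add: xprod_insert)
qed

lemma xprod_out_in_I':
assumes "finite R" "e ~: R" "R ~: K"
shows "xprod R : I'"
by (rule B.xprod_CI) (use assms in "auto simp: bcx_def")

lemma Ps_xprod: "finite R ==> e ~: R ==> EX q. Ps (xprod R) = xprod R + Var e * xprod (R - sg) * q"
proof -
assume R: "finite R" "e ~: R"
obtain q where q: "(PROD i:R Int sg. Var i + Var e) = (PROD i:R Int sg. Var i) + Var e * (q :: ('v,'a) mp)"
using prod_add_const[of "R Int sg"] R by blast
have "Ps (xprod R) = Ps (xprod (R Int sg)) * Ps (xprod (R - sg))"
by (subst xprod_split[OF R(1), of sg]) simp
also have "Ps (xprod (R Int sg)) = xprod (R Int sg) + Var e * q"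
using q by (simp add: xprod_def Ps_Var)
also have "Ps (xprod (R - sg)) = xprod (R - sg)"
using R by (auto simp: xprod_def Ps_Var intro!: prod.cong)
finally show ?thesis
by (intro exI[of _ q]) (simp only: xprod_split[OF R(1), of sg], simp add: algebra_simps)
qed

lemma lin_form_K': "l : L ==> Ps (lin_form K l) = lin_form K' l"
proof -
assume l: "l : L"
have "Ps (lin_form K l) = (SUM v:V. Cst (l v) * Var v + (if v : sg then Cst (l v) * Var e else 0))"
unfolding lin_form_def using e by (auto simp: Ps_Var algebra_simps intro!: sum.cong)
also have "... = (SUM v:V. Cst (l v) * Var v) + (SUM v:V Int sg. Cst (l v) * Var e)"
using finite_V by (simp add: sum.distrib sum.inter_restrict)
also have "V Int sg = sg" using sg by blast
also have "(SUM v:sg. Cst (l v) * Var e) = Cst (l e) * (Var e :: ('v,'a) mp)"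
by (simp add: L_e[OF l] Cst_sum sum_distrib_right)
finally show ?thesis unfolding lin_form_def V' using e finite_V by (simp add: add.commute)
qed

text \<open>When a non-face monomial is expanded, the terms divisible by the exceptional variable
  still contain all of \<open>R - sg\<close>, and this set together with \<open>sg\<close> is no
  face.\<close>

lemma Ps_I: "p : I ==> Ps p : I'"
unfolding CI_def[of K]
proof (erule pideal_image[OF _ ringhom_Ps B.is_ideal_CI])
fix g assume "g : chow_gens K L"
then consider l where "l : L" "g = lin_form K l" | R where "finite R" "R ~: K" "g = xprod R"
by (auto simp: chow_gens_def)
thus "Ps g : I'"
proof cases
case 1 thus ?thesis using B.lin_CI by (simp add: lin_form_K')
next
case 2
show ?thesis
proof (cases "e : R")
 case True
 hence "Ps g = 0" using 2 e_sg by (auto simp: xprod_def Ps_Var prod_zero_iff intro!: prod_zero bexI[of _ e])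
 thus ?thesis by (simp add: B.CI_closed)
next
 case False
 have "R - sg Un sg ~: K" using 2(2) down_closed[of "R - sg Un sg" R] by blast
 hence "Var e * xprod (R - sg) : I'" using False 2(1) by (intro xprod_e_in_I') auto
 moreover have "xprod R : I'" using 2 False by (intro xprod_out_in_I') auto
 ultimately show ?thesis using Ps_xprod[OF 2(1) False] 2(3) by (auto intro!: B.CI_closed)
qed
qed
qed

text \<open>Every face through \<open>e\<close> lies in the star of \<open>sg\<close>, so the
  exceptional variable annihilates the relations of the star.\<close>

lemma Var_e_J: "p : J ==> Ps p * Var e : I'"
unfolding star_ideal_def
proof (induction rule: pideal.induct)
case (gen g r)
have "Ps g * Var e : I'"
proof (cases "g : chow_gens K L")
case True
hence "g : I" by (auto simp: CI_def intro: pideal_gen)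
thus ?thesis by (intro B.CI_closed Ps_I)
next
case False
with gen obtain R where R: "finite R" "R Int sg = {}" "R Un sg ~: K" "g = xprod R" by auto
show ?thesis
proof (cases "e : R")
 case True
 hence "Ps g = 0" using R e_sg by (auto simp: xprod_def Ps_Var intro!: prod_zero bexI[of _ e])
 thus ?thesis by (simp add: B.CI_closed)
next
 case False
 have "Var e * xprod R : I'" by (rule xprod_e_in_I') (use R False in auto)
 moreover obtain q where "Ps (xprod R) = xprod R + Var e * xprod (R - sg) * q" using Ps_xprod[OF R(1) False] ..
 moreover have "R - sg = R" using R(2) by blast
 ultimately have "Ps g * Var e = Var e * xprod R * (1 + Var e * q)" using R(4) by (simp add: algebra_simps)
 with `Var e * xprod R : I'` show ?thesis by (auto intro: B.CI_closed)
qed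
qed
thus ?case using B.CI_closed(3)[of "Ps g * Var e" "Ps r"] by (simp add: mult.assoc)
qed (auto simp: distrib_right B.CI_closed)

lemma Var_e_J_power: "p : J ==> 0 < n ==> Ps p * Var e ^ n : I'"
using Var_e_J[of p] B.CI_closed(4)[of "Ps p * Var e" "Var e ^ (n - 1)"]
by (cases n) (auto simp: mult.assoc)

abbreviation "bp == lin_prod sg :: ('v,'a) mp poly"

text \<open>The push-forwards of the powers of the exceptional variable: 1, then zeros up to
  exponent \<open>k - 1\<close>, then the values forced by sending all multiples of
  \<open>bp\<close> to 0.\<close>

function gs :: "nat => ('v,'a) mp" where
"gs n = (if n = 0 then 1 else if n < k then 0 else - ((-1) ^ k) * (SUM i<k. coeff bp i * gs (n - k + i)))"
by auto
termination by (relation "Wellfounded.measure id") auto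

declare gs.simps [simp del]

lemma gs_0: "gs 0 = 1" by (simp add: gs.simps)
lemma gs_small: "0 < n ==> n < k ==> gs n = 0" by (simp add: gs.simps)
lemma gs_k: "gs k = - ((-1) ^ k) * xprod sg"
proof -
have "(SUM i<k. coeff bp i * gs i) = (SUM i<k. if i = 0 then xprod sg else 0)"
by (intro sum.cong) (auto simp: gs_0 gs_small lin_prod(3)[OF fin_sg])
thus ?thesis using card_sg by (subst gs.simps) (auto simp: sum.delta)
qed

lemma sign_sq: "(-1) ^ n * ((-1) ^ n * x) = (x::'r::comm_ring_1)"
by (simp add: mult.assoc[symmetric] power_mult_distrib[symmetric])

lemma gs_rec: "(SUM i<=k. coeff bp i * gs (i + j)) = 0"
proof -
have "gs (k + j) = - ((-1) ^ k) * (SUM i<k. coeff bp i * gs (i + j))"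
using card_sg by (subst gs.simps) (auto simp: add.commute)
thus ?thesis
by (simp add: lessThan_Suc_atMost[symmetric] lin_prod(2)[OF fin_sg] sign_sq mult.assoc)
qed

text \<open>In the recursion the only term without a factor \<open>gs\<close> of positive index
  carries the constant coefficient of \<open>bp\<close>, which is \<open>xprod sg\<close> itself.
  This divisibility is what makes t times a star relation push forward into
  \<open>I\<close>.\<close>

lemma gs_dvd: "0 < n ==> xprod sg dvd gs n"
proof (induction n rule: less_induct)
case (less n)
show ?case
proof (cases "n < k")
case True thus ?thesis using less gs_small by simp
next
case False
have "xprod sg dvd coeff bp i * gs (n - k + i)" if "i < k" for i
proof (cases "n - k + i = 0")
 case True
 thus ?thesis using lin_prod(3)[OF fin_sg, where ?'a = 'a] by simp
next
 case nz: False
 show ?thesis by (rule dvd_mult, rule less.IH) (use nz that False in auto)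
qed
hence "xprod sg dvd (SUM i<k. coeff bp i * gs (n - k + i))" by (intro dvd_sum) auto
moreover have "gs n = - ((-1) ^ k) * (SUM i<k. coeff bp i * gs (n - k + i))"
 using less(2) False by (subst gs.simps) simp
ultimately show ?thesis by (simp only: dvd_mult)
qed
qed

text \<open>The push-forward to the original Chow ring; its linearity over the coefficients
  (\<open>piS_smult\<close>) is the projection formula.\<close>

definition piS :: "('v,'a) mp poly => ('v,'a) mp" where
"piS q = (SUM n<=degree q. coeff q n * gs n)"

lemma piS_alt: "degree q <= N ==> piS q = (SUM n<=N. coeff q n * gs n)"
unfolding piS_def by (rule sum.mono_neutral_left) (auto simp: coeff_eq_0)

lemma piS_add: "piS (p + q) = piS p + piS q"
using degree_add_le_max[of p q]
by (simp add: piS_alt[of _ "max (degree p) (degree q)"] distrib_right sum.distrib)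

lemma piS_smult: "piS (smult a q) = a * piS q"
using degree_smult_le[of a q]
by (simp add: piS_alt[of _ "degree q"] sum_distrib_left mult.assoc)

lemma piS_const: "piS [:a:] = a" by (simp add: piS_def gs_0)
lemma piS_0 [simp]: "piS 0 = 0" by (simp add: piS_def)
lemma piS_sum: "piS (sum f A) = (SUM a:A. piS (f a))"
by (induction A rule: infinite_finite_induct) (auto simp: piS_add)

lemma piS_monom: "piS (monom a n) = a * gs n"
by (simp add: piS_alt[OF degree_monom_le] if_distrib[of "%x. x * _"] cong: if_cong)

lemma piS_bp_mult: "piS (bp * q) = 0"
proof -
have *: "piS (bp * monom a j) = 0" for a j
proof -
have "bp * monom a j = (SUM i<=k. monom (coeff bp i) i) * monom a j"
 by (subst poly_as_sum_of_monoms'[OF lin_prod(1)[OF fin_sg]]) simp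
also have "... = (SUM i<=k. monom (coeff bp i * a) (i + j))"
 by (simp add: sum_distrib_right mult_monom)
also have "piS ... = a * (SUM i<=k. coeff bp i * gs (i + j))"
 by (simp add: piS_sum piS_monom sum_distrib_left algebra_simps)
finally show ?thesis by (simp add: gs_rec)
qed
have "bp * q = (SUM j<=degree q. bp * monom (coeff q j) j)"
by (simp add: sum_distrib_left[symmetric] poly_as_sum_of_monoms)
thus ?thesis by (simp add: piS_sum *)
qed

lemma piS_t_mult: "piS (pCons 0 q) = (SUM n<=degree q. coeff q n * gs (Suc n))"
proof -
have "piS (pCons 0 q) = (SUM n<=Suc (degree q). coeff (pCons 0 q) n * gs n)"
by (rule piS_alt) (rule degree_pCons_le)
thus ?thesis by (simp add: sum.atMost_Suc_shift del: sum.atMost_Suc)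
qed

lemma piS_t_dvd: "xprod sg dvd piS (pCons 0 q)"
unfolding piS_t_mult by (intro dvd_sum dvd_mult gs_dvd) auto

lemma piS_low:
assumes "degree q < k" shows "piS q = coeff q 0"
proof -
have "(SUM n<=degree q. coeff q n * gs n) = (SUM n<=degree q. if n = 0 then coeff q 0 else 0)"
by (intro sum.cong) (use assms in "auto simp: gs_0 gs_small")
thus ?thesis by (simp add: piS_def)
qed

text \<open>Rewrites the blow-up in pulled-back variables: the variable of a ray of
  \<open>sg\<close> is its pull-back minus the exceptional variable, and the latter becomes the
  polynomial variable t.\<close>

definition Ph :: "('v,'a) mp => ('v,'a) mp poly" where
"Ph = peval (%c. [:Cst c:]) (%v. if v = e then [:0, 1:] else if v : sg then [:Var v, -1:] else [:Var v:])"

lemma ringhom_CC: "ringhom (%c. [:Cst c :: ('v,'a) mp:])"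
by (auto simp: ringhom_def Cst_add Cst_mult)
lemma ringhom_Ph: "ringhom Ph" unfolding Ph_def by (rule ringhom_peval[OF ringhom_CC])
lemmas Ph_simps [simp] = rh_simps[OF ringhom_Ph]
lemma Ph_Cst [simp]: "Ph (Cst c) = [:Cst c:]" by (simp add: Ph_def peval_Cst[OF ringhom_CC])
lemma Ph_Var: "Ph (Var v) = (if v = e then [:0, 1:] else if v : sg then [:Var v, -1:] else [:Var v:])"
by (simp add: Ph_def peval_Var[OF ringhom_CC])

definition ka :: "('v,'a) mp => ('v,'a) mp" where
"ka = subst (%v. if v = e then 0 else Var v)"

lemma ka_mod: "ka p - p : I"
proof -
have "subst (%v. if v = e then 0 else Var v) p - subst Var p : I"
by (rule subst_cong_mod[OF is_ideal_CI]) (use Var_in_CI[OF e] in "auto simp: CI_closed")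
thus ?thesis by (simp add: ka_def subst_Var_id)
qed

lemma PhPs: "Ph (Ps p) = [:ka p:]"
proof (rule ringhom_unique[OF ringhom_comp[OF ringhom_Ph ringhom_Ps]])
show "ringhom (%p. [:ka p:])" by (auto simp: ringhom_def ka_def)
qed (auto simp: Ph_Var Ps_Var ka_def e_sg)

lemma Ph_xprod:
assumes "finite R" "e ~: R"
shows "Ph (xprod R) = smult (xprod (R - sg)) (lin_prod (R Int sg))"
proof -
have "Ph (xprod R) = Ph (xprod (R Int sg)) * Ph (xprod (R - sg))"
by (subst xprod_split[OF assms(1), of sg]) simp
also have "Ph (xprod (R Int sg)) = lin_prod (R Int sg)"
using assms e_sg unfolding xprod_def lin_prod_def Ph_simps by (intro prod.cong) (auto simp: Ph_Var)
also have "Ph (xprod (R - sg)) = (PROD v:R - sg. [:Var v:])"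
using assms e_sg unfolding xprod_def Ph_simps by (intro prod.cong) (auto simp: Ph_Var)
also have "... = [:xprod (R - sg):]"
proof -
have "(PROD v:S. [:Var v:]) = [:xprod S :: ('v,'a) mp:]" for S
 by (induction S rule: infinite_finite_induct) (auto simp: one_pCons xprod_def)
thus ?thesis .
qed
finally show ?thesis by simp
qed

lemma t_mult_in_I:
assumes "finite R" "R Int sg = {}" "R Un sg ~: K" shows "xprod R * piS (pCons 0 q) : I"
proof -
obtain u where "piS (pCons 0 q) = xprod sg * u" using piS_t_dvd by (auto elim: dvdE)
hence "xprod R * piS (pCons 0 q) = xprod (R Un sg) * u"
using assms fin_sg by (simp add: xprod_Un mult.assoc)
moreover have "xprod (R Un sg) * u : I" using assms fin_sg by (intro CI_closed xprod_CI) auto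
ultimately show ?thesis by simp
qed

text \<open>If \<open>R\<close> contains \<open>sg\<close>, then \<open>bp\<close> splits off and
  the push-forward kills it. Otherwise \<open>R\<close> is no face of \<open>K\<close>: the constant
  term in t gives a multiple of \<open>xprod R\<close>, and the rest has a factor t, for which
  \<open>gs_dvd\<close> supplies the missing \<open>xprod sg\<close>.\<close>

lemma piS_Ph_xprod_out:
assumes R: "finite R" "e ~: R" "R ~: K'" shows "piS (Ph (xprod R) * q) : I"
proof (cases "sg <= R")
case True
hence "R Int sg = sg" by blast
thus ?thesis by (simp add: Ph_xprod[OF R(1,2)] piS_smult piS_bp_mult CI_closed)
next
case False
hence "R ~: K" using R(3) by (auto simp: bcx_def)
have nf: "R - sg Un sg ~: K" using `R ~: K` down_closed[of "R - sg Un sg" R] by blast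
define P :: "('v,'a) mp poly" where "P = lin_prod (R Int sg)"
obtain b r where P: "P = pCons b r" by (cases P)
have "coeff P 0 = xprod (R Int sg)" unfolding P_def by (rule lin_prod(3)) (use R(1) in auto)
hence b: "b = xprod (R Int sg)" by (simp add: P)
have "Ph (xprod R) * q = smult (xprod (R - sg)) (smult b q + pCons 0 (r * q))"
by (simp add: Ph_xprod[OF R(1,2)] P[unfolded P_def] smult_add_right)
hence "piS (Ph (xprod R) * q) = xprod R * piS q + xprod (R - sg) * piS (pCons 0 (r * q))"
by (subst xprod_split[OF R(1), of sg]) (simp only: piS_smult piS_add b distrib_left ac_simps)
moreover have "xprod R * piS q : I" using xprod_CI[OF R(1) `R ~: K`] by (rule CI_closed)
moreover have "xprod (R - sg) * piS (pCons 0 (r * q)) : I" by (rule t_mult_in_I) (use nf R in auto)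
ultimately show ?thesis using CI_closed(2) by simp
qed

lemma piS_Ph_xprod_in:
assumes R: "finite R" "e : R" "R ~: K'" shows "piS (Ph (xprod R) * q) : I"
proof -
define S where "S = R - {e}"
have S: "finite S" "e ~: S" "R = insert e S" using R by (auto simp: S_def)
have Ph: "Ph (xprod R) * q = smult (xprod (S - sg)) (pCons 0 (lin_prod (S Int sg) * q))"
using S by (simp add: xprod_insert Ph_Var Ph_xprod)
have "sg <= S | S Un sg ~: K" using R(3) S(3) by (auto simp: bcx_def)
thus ?thesis
proof
assume "sg <= S"
hence "S Int sg = sg" by blast
moreover have "pCons 0 (bp * q) = bp * pCons 0 q" by simp
ultimately show ?thesis unfolding Ph by (simp only: piS_smult piS_bp_mult) (simp add: CI_closed)
next
assume "S Un sg ~: K"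
moreover have "S - sg Un sg = S Un sg" by blast
ultimately show ?thesis unfolding Ph piS_smult using S by (intro t_mult_in_I) auto
qed
qed

lemma Ph_lin_form:
assumes l: "l : L" shows "Ph (lin_form K' l) = [:lin_form K l:]"
proof -
have "Ph (lin_form K' l) = Ph (Ps (lin_form K l))" by (simp add: lin_form_K'[OF l])
also have "... = [:ka (lin_form K l):]" by (rule PhPs)
also have "ka (lin_form K l) = lin_form K l"
using e unfolding ka_def lin_form_def by (auto intro!: sum.cong)
finally show ?thesis .
qed

lemma piS_Ph_I':
assumes "p : I'" shows "piS (Ph p) : I"
using assms unfolding CI_def[of K']
proof (induction rule: pideal.induct)
case (gen g r)
then consider l where "l : L" "g = lin_form K' l" | R where "finite R" "R ~: K'" "g = xprod R"
by (auto simp: chow_gens_def)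
thus ?case
proof cases
case 1
thus ?thesis using lin_CI by (simp add: Ph_lin_form piS_smult mult.commute[of "Ph r"] CI_closed)
next
case 2
thus ?thesis using piS_Ph_xprod_out[of R "Ph r"] piS_Ph_xprod_in[of R "Ph r"]
 by (cases "e : R") (auto simp: mult.commute[of "Ph r"])
qed
qed (auto simp: piS_add CI_closed)

text \<open>Push-forward is well defined on Chow rings (\<open>piS_Ph_I'\<close>), and after
  pull-back it is the identity modulo \<open>I\<close>.\<close>

lemma Ps_inj: "Ps p : I' ==> p : I"
proof -
assume "Ps p : I'"
hence "piS (Ph (Ps p)) : I" by (rule piS_Ph_I')
thus "p : I" using idiff_cancel[OF is_ideal_CI ka_mod] by (simp add: PhPs piS_const)
qed

lemma linfun_piS: "linfun ph ==> linfun (%p. ph (piS (Ph p)))"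
by (auto simp: linfun_def piS_add piS_smult)

lemma kill_piS: "(!!p. p : I ==> ph p = 0) ==> p : I' ==> ph (piS (Ph p)) = 0"
using piS_Ph_I' by blast

lemma piS_face_out:
assumes A: "A : K" "~ sg <= A" shows "piS (Ph (xprod A)) = xprod A"
proof -
have fin: "finite A" "finite (A Int sg)" using A finite_face by auto
have "degree (lin_prod (A Int sg) :: ('v,'a) mp poly) < k"
proof (rule le_less_trans[OF lin_prod(1)[OF fin(2)]])
show "card (A Int sg) < k" by (rule psubset_card_mono[OF fin_sg]) (use A in auto)
qed
hence "degree (Ph (xprod A)) < k"
using degree_smult_le[of "xprod (A - sg)" "lin_prod (A Int sg)"] e A(1)
by (subst Ph_xprod) (use fin in "auto intro: le_less_trans")
hence "piS (Ph (xprod A)) = coeff (Ph (xprod A)) 0" by (rule piS_low)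
also have "... = xprod A"
using e A(1) fin by (subst Ph_xprod) (auto simp: lin_prod(3) xprod_split[of A sg] mult.commute)
finally show ?thesis .
qed

text \<open>The rewritten monomial has degree \<open>k\<close> in t and no constant term, so only
  its t^k coefficient meets a nonzero \<open>gs\<close>; the signs of this coefficient and of
  \<open>gs k\<close> cancel.\<close>

lemma piS_face_in:
assumes B: "e ~: B" "B Un sg : K" "card (sg - B) = 1"
shows "piS (Ph (xprod (insert e B))) = xprod (B Un sg)"
proof -
have fin: "finite B" "finite (B Int sg)" using B(2) finite_face[of "B Un sg"] by auto
have c: "card (B Int sg) = k - 1"
using B(3) card_Diff_subset_Int[of sg B] fin by (simp add: Int_commute)
define P :: "('v,'a) mp poly" where "P = lin_prod (B Int sg)"
have degP: "degree P <= k - 1" using lin_prod(1)[OF fin(2)] c by (simp add: P_def)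
have "piS (pCons 0 P) = (SUM n<=k. coeff (pCons 0 P) n * gs n)"
by (rule piS_alt) (use degP degree_pCons_le[of 0 P] card_sg in linarith)
also have "... = coeff P (k - 1) * gs k"
by (subst sum.mono_neutral_right[of "{..k}" "{k}"])
  (use card_sg in "auto simp: gs_small coeff_pCons split: nat.splits")
also have "coeff P (k - 1) = (-1) ^ (k - 1)" using lin_prod(2)[OF fin(2), where ?'a = 'a] c by (simp add: P_def)
also have "(-1) ^ (k - 1) * gs k = (-1) ^ (k - 1) * ((-1) ^ (k - 1) * xprod sg)"
proof -
have "- ((-1) ^ k) = ((-1) ^ (k - 1) :: ('v,'a) mp)" using card_sg by (cases k) auto
thus ?thesis by (simp only: gs_k)
qed
also have "... = xprod sg" by (rule sign_sq)
finally have *: "piS (pCons 0 P) = xprod sg" .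
have "Ph (xprod (insert e B)) = smult (xprod (B - sg)) (pCons 0 P)"
using fin B by (simp add: xprod_insert Ph_Var Ph_xprod P_def)
hence "piS (Ph (xprod (insert e B))) = xprod (B - sg) * xprod sg"
by (simp only: piS_smult *)
also have "... = xprod (B - sg Un sg)" by (rule xprod_Un[symmetric]) (use fin fin_sg in auto)
also have "B - sg Un sg = B Un sg" by blast
finally show ?thesis .
qed

text \<open>The relation \<open>\<Prod>i\<in>\<sigma>. Var i = 0\<close> of the blow-up makes the exceptional variable integral over
the image of the Chow ring of the original fan.\<close>

lemma Var_e_power_k:
"Var e ^ k + (-1) ^ k * (SUM i<k. Ps (coeff bp i) * Var e ^ i) : I'"
proof -
have "sg ~: K'" using e_sg by (auto simp: bcx_def)
hence x: "xprod sg : I'" using fin_sg by (rule B.xprod_CI[rotated])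
have *: "(PROD i:S. Ps (Var i) - Var e) = (SUM i<=card S. Ps (coeff (lin_prod S) i) * Var e ^ i)"
if "finite S" for S
proof -
define ev where "ev q = (SUM i<=degree q. Ps (coeff q i) * Var e ^ i)" for q
have ev_alt: "ev q = (SUM i<=N. Ps (coeff q i) * Var e ^ i)" if "degree q <= N" for q N
 unfolding ev_def by (rule sum.mono_neutral_left) (use that in "auto simp: coeff_eq_0")
have ev: "ev q = poly (map_poly Ps q) (Var e)" for q
 unfolding poly_altdef ev_def
 by (rule sum.mono_neutral_cong_right)
   (auto simp: coeff_map_poly map_poly_degree_leq coeff_eq_0 intro: le_degree)
have hom: "map_poly Ps (p * q) = map_poly Ps p * map_poly Ps q" for p q
 by (rule poly_eqI) (simp add: coeff_map_poly coeff_mult)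
have "ev (lin_prod S) = (PROD i:S. Ps (Var i) - Var e)"
 using that
proof (induction S rule: finite_induct)
 case (insert v S)
 hence "ev (lin_prod (insert v S)) = ev [:Var v, -1:] * ev (lin_prod S)"
  unfolding ev by (simp add: lin_prod_def hom del: mult_pCons_left)
 moreover have "ev [:Var v, -1:] = Ps (Var v) - Var e" by (simp add: ev map_poly_pCons)
 ultimately show ?case using insert by simp
qed (simp add: lin_prod_def ev_def)
thus ?thesis using ev_alt[OF lin_prod(1)[OF that]] by simp
qed
have "(PROD i:sg. Ps (Var i) - Var e) = xprod sg"
unfolding xprod_def by (intro prod.cong) (auto simp: Ps_Var)
hence "xprod sg = (SUM i<k. Ps (coeff bp i) * Var e ^ i) + (-1) ^ k * Var e ^ k"
using *[OF fin_sg] by (simp add: lessThan_Suc_atMost[symmetric] lin_prod(2)[OF fin_sg])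
hence "(-1) ^ k * xprod sg = (-1) ^ k * (SUM i<k. Ps (coeff bp i) * Var e ^ i) + Var e ^ k"
by (simp add: distrib_left sign_sq)
thus ?thesis using B.CI_closed(3)[OF x, of "(-1) ^ k"] by (simp add: add.commute)
qed

text \<open>An expansion in powers of the exceptional variable below \<open>k\<close> with
  pulled-back coefficients. Requiring zero coefficients beyond index \<open>N\<close> keeps the
  truncated difference \<open>N - i\<close> harmless.\<close>

definition decomp :: "nat => ('v,'a) mp => (nat => ('v,'a) mp) => bool" where
"decomp N p s <-> (ALL i. if i <= N then homog (N - i) (s i) else s i = 0) &
 p - (SUM i<k. Ps (s i) * Var e ^ i) : I'"

lemma decomposedI:
assumes "!!i. i <= N ==> homog (N - i) (s i)" "!!i. N < i ==> s i = 0"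
"p - (SUM i<k. Ps (s i) * Var e ^ i) : I'"
shows "decomp N p s"
using assms by (auto simp: decomp_def)

lemma decomposedD:
assumes "decomp N p s"
shows "i <= N ==> homog (N - i) (s i)" "N < i ==> s i = 0"
"p - (SUM i<k. Ps (s i) * Var e ^ i) : I'"
proof -
have "if i <= N then homog (N - i) (s i) else s i = 0"
using assms unfolding decomp_def by blast
thus "i <= N ==> homog (N - i) (s i)" "N < i ==> s i = 0" by (auto split: if_splits)
show "p - (SUM i<k. Ps (s i) * Var e ^ i) : I'" using assms unfolding decomp_def by blast
qed

lemma decomposed_add:
"decomp N p s ==> decomp N q r ==> decomp N (p + q) (%i. s i + r i)"
proof -
assume a: "decomp N p s" "decomp N q r"
have "p + q - (SUM i<k. Ps (s i + r i) * Var e ^ i)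
 = (p - (SUM i<k. Ps (s i) * Var e ^ i)) + (q - (SUM i<k. Ps (r i) * Var e ^ i))"
by (simp add: algebra_simps sum.distrib)
moreover have "(p - (SUM i<k. Ps (s i) * Var e ^ i)) + (q - (SUM i<k. Ps (r i) * Var e ^ i)) : I'" by (rule B.CI_closed(2)[OF decomposedD(3)[OF a(1)] decomposedD(3)[OF a(2)]])
ultimately have "p + q - (SUM i<k. Ps (s i + r i) * Var e ^ i) : I'" by (simp only:)
thus ?thesis
by (rule decomposedI[rotated 2]) (simp_all add: homog_add decomposedD[OF a(1)] decomposedD[OF a(2)])
qed

lemma decomposed_cong: "decomp N p s ==> q - p : I' ==> decomp N q s"
unfolding decomp_def using B.CI_closed(2)[of "q - p"] by fastforce

lemma decomposed_Ps_mult: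
assumes "decomp N p s" "homog j r" shows "decomp (j + N) (Ps r * p) (%i. r * s i)"
proof -
have "Ps r * p - (SUM i<k. Ps (r * s i) * Var e ^ i) = Ps r * (p - (SUM i<k. Ps (s i) * Var e ^ i))"
by (simp add: right_diff_distrib sum_distrib_left mult.assoc)
moreover have "if i <= j + N then homog (j + N - i) (r * s i) else r * s i = 0" for i
using assms homog_mult[OF assms(2), of "N - i" "s i"] unfolding decomp_def
by (cases "i <= N") (auto dest: spec[of _ i])
ultimately show ?thesis using assms(1) B.CI_closed(3) unfolding decomp_def by auto
qed

lemma decomposed_power_k: "EX s. decomp k (Var e ^ k) s"
proof -
define s where "s i = (if i < k then - ((-1) ^ k) * coeff bp i else 0)" for i
have hs: "homog (k - i) (s i)" for i
proof -
have "(-1) ^ k = (Cst ((-1) ^ k) :: ('v,'a) mp)" by (simp add: rh_simps[OF ringhom_Cst])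
thus ?thesis unfolding s_def
 using lin_prod(4)[OF fin_sg, of i, where ?'a = 'a] by (auto intro!: homog_uminus homog_Cst_mult)
qed
have "Var e ^ k - (SUM i<k. Ps (s i) * Var e ^ i) = Var e ^ k + (-1) ^ k * (SUM i<k. Ps (coeff bp i) * Var e ^ i)"
by (simp add: s_def sum_distrib_left mult.assoc sum_negf)
with Var_e_power_k have "Var e ^ k - (SUM i<k. Ps (s i) * Var e ^ i) : I'" by (simp only:)
moreover have "s i = 0" if "~ i <= k" for i using that by (simp add: s_def)
ultimately have "decomp k (Var e ^ k) s" unfolding decomp_def using hs by simp
thus ?thesis by blast
qed

text \<open>All coefficients move up by one; the one that reaches exponent \<open>k\<close> is
  expanded again by the integral equation.\<close>

lemma decomposed_e_mult:
assumes s: "decomp N p s" shows "EX r. decomp (Suc N) (Var e * p) r"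
proof -
define s' where "s' i = (if i = 0 | k <= i then 0 else s (i - 1))" for i
define a where "a = s (k - 1)"
have k: "Suc (k - 1) = k" using card_sg by simp
have "decomp (Suc N) (SUM i<k. Ps (s' i) * Var e ^ i) s'"
proof (rule decomposedI)
show "homog (Suc N - i) (s' i)" if "i <= Suc N" for i
 using that decomposedD(1)[OF s, of "i - 1"] by (cases i) (auto simp: s'_def)
show "s' i = 0" if "Suc N < i" for i
 using that decomposedD(2)[OF s, of "i - 1"] by (cases i) (auto simp: s'_def)
qed (simp add: B.CI_closed(1))
moreover have "EX r. decomp (Suc N) (Ps a * Var e ^ k) r"
proof (cases "k - 1 <= N")
case True
hence "homog (N - (k - 1)) a" using s unfolding decomp_def a_def by metis
moreover obtain t where "decomp k (Var e ^ k) t" using decomposed_power_k ..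
ultimately have "decomp (N - (k - 1) + k) (Ps a * Var e ^ k) (%i. a * t i)" by (rule decomposed_Ps_mult[rotated])
moreover have "N - (k - 1) + k = Suc N" using True k by linarith
ultimately show ?thesis by auto
next
case False
hence "a = 0" using s unfolding decomp_def a_def by metis
thus ?thesis by (intro exI[of _ "%_. 0"]) (auto simp: decomp_def B.CI_closed)
qed
then obtain r where "decomp (Suc N) (Ps a * Var e ^ k) r" ..
ultimately have dec: "decomp (Suc N) ((SUM i<k. Ps (s' i) * Var e ^ i) + Ps a * Var e ^ k) (%i. s' i + r i)"
by (rule decomposed_add)
have eq: "(SUM i<k. Ps (s' i) * Var e ^ i) + Ps a * Var e ^ k = Var e * (SUM i<k. Ps (s i) * Var e ^ i)"
proof -
have "(SUM i<k. Ps (s' i) * Var e ^ i) = (SUM i<k - 1. Ps (s i) * Var e ^ Suc i)"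
 by (subst k[symmetric], subst sum.lessThan_Suc_shift) (auto simp: s'_def intro!: sum.cong)
hence "(SUM i<k. Ps (s' i) * Var e ^ i) + Ps a * Var e ^ k
  = (SUM i<k - 1. Ps (s i) * Var e ^ Suc i) + Ps (s (k - 1)) * Var e ^ Suc (k - 1)"
 by (simp only: a_def k)
also have "... = (SUM i<Suc (k - 1). Ps (s i) * Var e ^ Suc i)" by (rule sum.lessThan_Suc[symmetric])
finally show ?thesis unfolding k by (simp add: sum_distrib_left mult.left_commute)
qed
have "Var e * (p - (SUM i<k. Ps (s i) * Var e ^ i)) : I'" by (rule B.CI_closed(3)[OF decomposedD(3)[OF s]])
hence "Var e * p - Var e * (SUM i<k. Ps (s i) * Var e ^ i) : I'" by (simp only: right_diff_distrib)
from decomposed_cong[OF dec[unfolded eq] this] show ?thesis by blast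
qed

lemma decomposed_Var_mult:
assumes s: "decomp N p s" shows "EX r. decomp (Suc N) (Var v * p) r"
proof -
have *: "decomp (Suc N) (Ps (Var v) * p) (%i. Var v * s i)"
using decomposed_Ps_mult[OF s, of 1 "Var v"] by simp
obtain r where r: "decomp (Suc N) (Var e * p) r" using decomposed_e_mult[OF s] by blast
consider "v = e" | "v : sg" "v ~= e" | "v ~: sg" "v ~= e" by blast
thus ?thesis
proof cases
case 1 thus ?thesis using r by blast
next
case 2
have "decomp (0 + Suc N) (Ps (Cst (-1)) * (Var e * p)) (%i. Cst (-1) * r i)"
 by (rule decomposed_Ps_mult[OF r]) simp
hence "decomp (Suc N) (Ps (Var v) * p + - (Var e * p)) (%i. Var v * s i + Cst (-1) * r i)"
 by (intro decomposed_add[OF *]) (simp add: Cst_uminus)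
moreover have "Ps (Var v) * p + - (Var e * p) = Var v * p"
 using 2 by (simp add: Ps_Var algebra_simps)
ultimately show ?thesis by metis
next
case 3 thus ?thesis using * by (auto simp: Ps_Var)
qed
qed

text \<open>The generating half of the description of the blow-up as the Chow ring of the fan plus
  \<open>k - 1\<close> copies of that of the star; the other half is replaced by computing
  degrees.\<close>

lemma decomposition:
assumes "homog N p" obtains s where "decomp N p s"
proof -
have one: "EX s. decomp (mdeg m) (single m 1) s" for m
proof (induction m rule: mval_induct)
case zero
have "decomp 0 1 (%i. if i = 0 then 1 else 0)"
 unfolding decomp_def using card_sg
 by (auto simp: if_distrib[of Ps] if_distrib[of "%x. x * _"] B.CI_closed cong: if_cong)
thus ?case by auto
next
case (add v m)
then obtain s where "decomp (mdeg m) (single m 1) s" by blast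
from decomposed_Var_mult[OF this, of v] show ?case
 by (simp add: Var_def mult_single mdeg_add)
qed
have "EX s. decomp N p s"
using assms
proof (induction rule: homog_induct)
case zero
show ?case by (intro exI[of _ "%_. 0"]) (auto simp: decomp_def B.CI_closed)
next
case (add m c p)
obtain s where s: "decomp N (single m 1) s" using one[of m] add(2) by auto
obtain r where r: "decomp N p r" using add(1) by blast
have "decomp (0 + N) (Ps (Cst c) * single m 1) (%i. Cst c * s i)"
 by (rule decomposed_Ps_mult[OF s]) simp
hence "decomp N (single m c) (%i. Cst c * s i)" by (simp add: Cst_mult_single)
from decomposed_add[OF this r] show ?case by blast
qed
thus ?thesis using that by blast
qed

text \<open>The degree map of the blow-up is the degree map of the fan after projecting to the summand of
exponent zero.\<close>

declare Ph_simps [simp del] Ps_simps [simp del]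

context
fixes D assumes D: "is_deg K L d w D"
begin

abbreviation "D' p == D (piS (Ph p))"

lemma linD: "linfun D" and killD: "p : I ==> D p = 0"
using D by (auto simp: is_deg_def)

lemma linD': "linfun D'" by (rule linfun_piS[OF linD])
lemma killD': "p : I' ==> D' p = 0" using kill_piS[of D] killD by blast

lemma is_deg_blowup:
assumes w1: "!!A. A : K ==> ~ sg <= A ==> card A = d ==> w' A = w A"
and w2: "!!B. ~ sg <= B ==> B Un sg : K ==> Suc (card B) = d ==> w' (insert e B) = w (B Un sg)"
shows "is_deg K' L d w' D'"
unfolding is_deg_def
proof (intro conjI ballI impI)
fix A assume A: "A : K'" "card A = d"
from A(1) consider "A : K" "~ sg <= A" | B where "A = insert e B" "~ sg <= B" "B Un sg : K"
unfolding bcx_def by blast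
thus "D' (xprod A) = w' A"
proof cases
case 1
thus ?thesis using D A(2) w1 by (simp add: piS_face_out is_deg_def)
next
case 2
have eB: "e ~: B" using e 2(3) by blast
have finB: "finite B" using finite_face[OF 2(3)] by simp
have cB: "Suc (card B) = d" using A(2) 2(1) eB finB by simp
have "card (B Un sg) = card B + card (sg - B)"
 using finB fin_sg by (subst card_Un_disjoint[symmetric]) (auto intro: arg_cong[of _ _ card])
moreover have "card (B Un sg) <= d" using dim_le 2(3) by blast
moreover have "card (sg - B) ~= 0" using 2(2) fin_sg by auto
\<comment> \<open>\<open>B\<close> has \<open>d - 1\<close> elements and \<open>B Un sg\<close> at
  most \<open>d\<close>, so exactly one vertex of \<open>sg\<close> is missing from
  \<open>B\<close>.\<close>
ultimately have c: "card (sg - B) = 1" "card (B Un sg) = d" using cB by linarith+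
show ?thesis using piS_face_in[OF eB 2(3) c(1)] D 2(3) c(2) w2[OF 2(2,3) cB]
 by (simp add: is_deg_def 2(1))
qed
qed (use linD' killD' in auto)

text \<open>The projection formula. Its cases of exponent 0, strictly between 0 and
  \<open>k\<close>, and equal to \<open>k\<close> are the entries that make the pairing block
  triangular.\<close>

lemma D'_Ps_power: "D' (Ps s * Var e ^ i) = D (s * gs i)"
proof -
have "Ph (Ps s * Var e ^ i) = smult (ka s) (monom 1 i)"
by (simp add: PhPs Ph_Var monom_altdef Ph_simps)
hence "D' (Ps s * Var e ^ i) = D (ka s * gs i)" by (simp add: piS_smult piS_monom)
also have "... = D (s * gs i)"
by (rule lf_eq_mod[OF linD killD]) (auto simp: left_diff_distrib[symmetric] CI_closed ka_mod)
finally show ?thesis .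
qed

lemma D'_0: "D' (Ps s) = D s"
using D'_Ps_power[of s 0] by (simp add: gs_0)
lemma D'_small: "0 < i ==> i < k ==> D' (Ps s * Var e ^ i) = 0"
by (simp add: D'_Ps_power gs_small lf_simps[OF linD])
lemma D'_k: "D' (Ps s * Var e ^ k) = - ((-1) ^ k) * D (xprod sg * s)"
proof -
have "s * gs k = Cst (- ((-1) ^ k)) * (xprod sg * s)"
by (simp add: gs_k rh_simps[OF ringhom_Cst] mult.commute mult.left_commute)
thus ?thesis by (simp add: D'_Ps_power lf_simps[OF linD])
qed

lemma D'_J: "s : J ==> 0 < i ==> D' (Ps s * p * Var e ^ i) = 0"
proof -
assume "s : J" "0 < i"
hence "Ps s * Var e ^ i * p : I'" by (intro B.CI_closed(4) Var_e_J_power)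
hence "Ps s * p * Var e ^ i : I'" by (simp add: ac_simps)
thus ?thesis by (rule killD')
qed

lemma linfun_decomposed:
assumes "linfun ph" "!!p. p : I' ==> ph p = 0" "decomp N p s"
shows "ph (p * q) = (SUM i<k. ph (Ps (s i) * Var e ^ i * q))"
proof -
have "ph (p * q) = ph ((SUM i<k. Ps (s i) * Var e ^ i) * q)"
proof (rule lf_eq_mod[OF assms(1,2)])
show "p * q - (SUM i<k. Ps (s i) * Var e ^ i) * q : I'"
 using B.CI_closed(4)[OF decomposedD(3)[OF assms(3)], of q] by (simp only: left_diff_distrib)
qed
thus ?thesis by (simp add: sum_distrib_right lf_simps[OF assms(1)])
qed

context
assumes star: "PD_on J (%p. D (xprod sg * p)) (d - k)"
begin

text \<open>Pairing with pull-backs isolates the coefficient of exponent 0. The others are shown to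
  lie in \<open>J\<close> from the top exponent down: against a pull-back times the power
  \<open>k - i\<close>, lower coefficients contribute total exponents between 0 and
  \<open>k\<close>, higher ones are already in \<open>J\<close>, and what remains is the pairing of
  the star.\<close>

lemma PD_blowup_inj:
assumes PD: "PD_on I D d" and ab: "a + b = d" and p: "homog a p"
and z: "!!q. homog b q ==> D' (p * q) = 0"
shows "p : I'"
proof -
obtain s where s: "decomp a p s" by (rule decomposition[OF p])
have pq: "D' (p * q) = (SUM i<k. D' (Ps (s i) * Var e ^ i * q))" for q
by (rule linfun_decomposed[OF linD' killD' s])
have "s 0 : I"
proof (rule PD_on_inj[OF PD ab])
show "homog a (s 0)" using decomposedD(1)[OF s, of 0] by simp
fix q :: "('v,'a) mp" assume q: "homog b q"
have "D' (Ps (s i) * Var e ^ i * Ps q) = (if i = 0 then D (s 0 * q) else 0)" if "i < k" for i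
proof -
 have "Ps (s i) * Var e ^ i * Ps q = Ps (s i * q) * Var e ^ i" by (simp add: ac_simps Ps_simps)
 thus ?thesis using D'_small[of i "s i * q"] D'_0[of "s i * q"] that by (cases "i = 0") auto
qed
hence "D' (p * Ps q) = D (s 0 * q)" using card_sg by (simp add: pq sum.delta)
thus "D (s 0 * q) = 0" using z Ps_homog[OF q] by simp
qed
hence s0: "Ps (s 0) : I'" by (rule Ps_I)
have sJ: "s i : J" if "0 < i" "i < k" for i
using that
proof (induction "k - i" arbitrary: i rule: less_induct)
case less
have IH: "s l : J" if "i < l" "l < k" for l using less that by simp
define j where "j = k - i"
have j: "0 < j" "j < k" "i + j = k" using less.prems by (auto simp: j_def)
show ?case
proof (cases "i <= a")
 case False
 thus ?thesis using decomposedD(2)[OF s, of i] is_idealD(1)[OF is_ideal_star_ideal] by simp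
next
 case True
 note hs = decomposedD(1)[OF s True]
 show ?thesis
 proof (cases "j <= b")
  case False
  \<comment> \<open>There is no complementary power to pair with, but then the degree of
    \<open>s i\<close> exceeds the dimension of the star.\<close>
  thus ?thesis using star_above_dim[OF hs] ab j True by linarith
 next
  case jb: True
  have "(a - i) + (b - j) = d - k" using ab j True jb by linarith
  thus ?thesis
  proof (rule PD_on_inj[OF star _ hs])
   fix q :: "('v,'a) mp" assume q: "homog (b - j) q"
   have "D' (Ps (s l) * Var e ^ l * (Ps q * Var e ^ j)) = (if l = i then - ((-1) ^ k) * D (xprod sg * (s i * q)) else 0)"
    if "l < k" for l
   proof -
    have eq: "Ps (s l) * Var e ^ l * (Ps q * Var e ^ j) = Ps (s l * q) * Var e ^ (l + j)"
     by (simp add: power_add ac_simps Ps_simps)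
    consider "l < i" | "l = i" | "i < l" by linarith
    thus ?thesis
    proof cases
     case 1
     thus ?thesis unfolding eq using D'_small[of "l + j" "s l * q"] j by simp
    next
     case 2
     thus ?thesis unfolding eq using j(3) D'_k[of "s i * q"] by simp
    next
     case 3
     thus ?thesis unfolding eq using D'_J[OF IH[OF 3 that], of "l + j" "Ps q"] j by (simp add: Ps_simps)
    qed
   qed
   hence "D' (p * (Ps q * Var e ^ j)) = - ((-1) ^ k) * D (xprod sg * (s i * q))"
    unfolding pq using less.prems by (simp add: sum.delta)
   moreover have "homog b (Ps q * Var e ^ j)"
    using homog_mult[OF Ps_homog[OF q] homog_power[OF homog_Var, of j e]] jb by simp
   ultimately show "D (xprod sg * (s i * q)) = 0" using z by simp
  qed
 qed
qed
qed
have "Ps (s i) * Var e ^ i : I'" if "i < k" for i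
proof (cases "i = 0")
case True
show ?thesis unfolding True using s0 by simp
next
case False
thus ?thesis by (intro Var_e_J_power sJ that) simp_all
qed
hence "(SUM i<k. Ps (s i) * Var e ^ i) : I'" by (intro B.CI_closed(7)) (simp only: lessThan_iff)
thus ?thesis by (rule iffD2[OF idiff_cancel[OF B.is_ideal_CI decomposedD(3)[OF s]]])
qed

text \<open>The functional is matched on one power of the exceptional variable after another. A
  pull-back times the power \<open>k - j\<close> corrects the value on the power \<open>j\<close> by
  duality of the star, and leaves smaller powers alone because the total exponents stay strictly
  between 0 and \<open>k\<close>.\<close>

lemma PD_blowup_surj:
assumes PD: "PD_on I D d" and ab: "a + b = d" and ph: "linfun ph" "!!p. p : I' ==> ph p = 0"
shows "EX p. homog a p & (ALL q. homog b q --> ph q = D' (p * q))"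
proof -
have "EX p. homog a p & (ALL j<=n. j <= b --> (ALL q. homog (b - j) q --> ph (Ps q * Var e ^ j) = D' (p * (Ps q * Var e ^ j))))"
if "n < k" for n
using that
proof (induction n)
case 0
have "linfun (%p. ph (Ps p))" using linfun_Ps[OF ph(1), of 1] by simp
then obtain p where p: "homog a p" "!!q. homog b q ==> ph (Ps q) = D (p * q)"
 using PD_on_surj[OF PD ab, of "%p. ph (Ps p)"] ph(2) Ps_I by metis
have "ph (Ps q) = D' (Ps p * Ps q)" if "homog b q" for q
 using p(2)[OF that] D'_0[of "p * q"] by (simp add: Ps_simps)
thus ?case using p(1) Ps_homog by (intro exI[of _ "Ps p"]) auto
next
case (Suc n)
then obtain p where p: "homog a p"
 "!!j q. j <= n ==> j <= b ==> homog (b - j) q ==> ph (Ps q * Var e ^ j) = D' (p * (Ps q * Var e ^ j))"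
 by fastforce
define j where "j = Suc n"
define i where "i = k - j"
have ij: "0 < j" "j < k" "0 < i" "i < k" "i + j = k" using Suc.prems by (auto simp: i_def j_def)
\<comment> \<open>The error on the \<open>j\<close>-th power. It vanishes on \<open>J\<close>, so
  duality of the star can represent it.\<close>
define de where "de q = ph (Ps q * Var e ^ j) - D' (Ps q * (p * Var e ^ j))" for q
have linde: "linfun (%q. - ((-1) ^ k) * de q)"
proof (rule linfunI)
 show "- ((-1) ^ k) * de (x + y) = - ((-1) ^ k) * de x + - ((-1) ^ k) * de y" for x y
  unfolding de_def lf_simps(1)[OF linfun_Ps[OF ph(1)]] lf_simps(1)[OF linfun_Ps[OF linD']]
  by (simp only: algebra_simps)
 show "- ((-1) ^ k) * de (Cst c * x) = c * (- ((-1) ^ k) * de x)" for c x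
  unfolding de_def lf_simps(2)[OF linfun_Ps[OF ph(1)]] lf_simps(2)[OF linfun_Ps[OF linD']]
  by (simp only: algebra_simps)
qed
have deJ: "de q = 0" if "q : J" for q
 using ph(2)[OF Var_e_J_power[OF that ij(1)]] D'_J[OF that ij(1), of p] by (simp add: de_def mult.assoc)
have "EX s. homog a (Ps s * Var e ^ i) & (j <= b --> (ALL q. homog (b - j) q --> de q = D' (Ps s * Var e ^ i * (Ps q * Var e ^ j))))"
proof (cases "j <= b & i <= a")
 case True
 hence "(a - i) + (b - j) = d - k" using ab ij by linarith
 then obtain s where s: "homog (a - i) s"
  "!!q. homog (b - j) q ==> - ((-1) ^ k) * de q = D (xprod sg * (s * q))"
  using PD_on_surj[OF star _ linde] deJ by (metis mult_zero_right)
 have "de q = D' (Ps s * Var e ^ i * (Ps q * Var e ^ j))" if "homog (b - j) q" for q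
 proof -
  have "Ps s * Var e ^ i * (Ps q * Var e ^ j) = Ps (s * q) * Var e ^ k"
   unfolding ij(5)[symmetric] by (simp add: power_add ac_simps Ps_simps)
  hence "D' (Ps s * Var e ^ i * (Ps q * Var e ^ j)) = - ((-1) ^ k) * (- ((-1) ^ k) * de q)"
   by (simp only: D'_k s(2)[OF that])
  also have "... = de q" by (simp add: sign_sq)
  finally show ?thesis by simp
 qed
 moreover have "homog a (Ps s * Var e ^ i)"
  using homog_mult[OF Ps_homog[OF s(1)] homog_power[OF homog_Var, of i e]] True by simp
 ultimately show ?thesis by blast
next
 case False
 have "de q = 0" if "j <= b" "homog (b - j) q" for q
  by (rule deJ, rule star_above_dim[OF that(2)]) (use False that ab ij in linarith)
 thus ?thesis by (intro exI[of _ 0]) (auto simp: lf_simps[OF linD] Ps_simps Ph_simps)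
qed
then obtain s where s: "homog a (Ps s * Var e ^ i)"
 "!!q. j <= b ==> homog (b - j) q ==> de q = D' (Ps s * Var e ^ i * (Ps q * Var e ^ j))" by blast
have "ph (Ps q * Var e ^ j') = D' ((p + Ps s * Var e ^ i) * (Ps q * Var e ^ j'))"
 if "j' <= Suc n" "j' <= b" "homog (b - j') q" for j' q
proof (cases "j' = j")
 case True
 have "D' (p * (Ps q * Var e ^ j)) = D' (Ps q * (p * Var e ^ j))" by (simp add: ac_simps)
 thus ?thesis using s(2)[of q] that True
  by (simp add: de_def distrib_right lf_simps(1)[OF linD'] algebra_simps)
next
 case False
 hence "j' <= n" using that(1) j_def by simp
 moreover have "Ps s * Var e ^ i * (Ps q * Var e ^ j') = Ps (s * q) * Var e ^ (i + j')"
  by (simp add: power_add ac_simps Ps_simps)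
 moreover have "i + j' < k" using `j' <= n` ij j_def by linarith
 ultimately show ?thesis using p(2)[of j' q] that D'_small[of "i + j'" "s * q"] ij(3)
  by (simp add: distrib_right lf_simps(1)[OF linD'])
qed
thus ?case using homog_add[OF p(1) s(1)] by blast
qed
moreover have "k - 1 < k" using card_sg by linarith
ultimately obtain p where p: "homog a p" and p': "ALL j<=k - 1. j <= b -->
 (ALL q. homog (b - j) q --> ph (Ps q * Var e ^ j) = D' (p * (Ps q * Var e ^ j)))"
by blast
have "ph q = D' (p * q)" if q: "homog b q" for q
proof -
obtain s where s: "decomp b q s" by (rule decomposition[OF q])
have "ph (Ps (s j) * Var e ^ j) = D' (p * (Ps (s j) * Var e ^ j))" if "j < k" for j
proof (cases "j <= b")
 case True
 moreover have "j <= k - 1" using that by linarith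
 ultimately show ?thesis using p' decomposedD(1)[OF s True] by blast
next
 case False
 thus ?thesis using decomposedD(2)[OF s, of j]
  by (simp add: lf_simps[OF ph(1)] lf_simps[OF linD'] Ps_simps)
qed
thus ?thesis
 using linfun_decomposed[OF ph s, of 1] linfun_decomposed[OF linD' killD' s, of p]
 by (simp add: mult.commute[of p])
qed
with p show ?thesis by blast
qed

text \<open>Against an expansion, the pulled-back class meets degree zero at the exponents between 0
  and \<open>k\<close>, and the original pairing at exponent 0; so duality upstairs kills it and
  \<open>Ps_inj\<close> applies.\<close>

lemma PD_blowdown_inj:
assumes PD: "PD_on I' D' d" and ab: "a + b = d" and p: "homog a p"
and z: "!!q. homog b q ==> D (p * q) = 0"
shows "p : I"
proof (rule Ps_inj, rule PD_on_inj[OF PD ab Ps_homog[OF p]])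
fix q :: "('v,'a) mp" assume q: "homog b q"
obtain s where s: "decomp b q s" by (rule decomposition[OF q])
have "D' (Ps (s i) * Var e ^ i * Ps p) = 0" if "i < k" for i
proof -
have "Ps (s i) * Var e ^ i * Ps p = Ps (p * s i) * Var e ^ i" by (simp add: ac_simps Ps_simps)
thus ?thesis using D'_small[of i "p * s i"] D'_0[of "p * s i"] z[of "s 0"] decomposedD(1)[OF s, of 0] that
 by (cases "i = 0") auto
qed
thus "D' (Ps p * q) = 0"
using linfun_decomposed[OF linD' killD' s, of "Ps p"] by (simp add: mult.commute[of _ q])
qed

text \<open>Compose the functional with the push-forward, represent it on the blow-up, and keep the
  coefficient of exponent 0.\<close>

lemma PD_blowdown_surj:
assumes PD: "PD_on I' D' d" and ab: "a + b = d" and ph: "linfun ph" "!!p. p : I ==> ph p = 0"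
shows "EX p. homog a p & (ALL q. homog b q --> ph q = D (p * q))"
proof -
have *: "ph (piS (Ph p)) = 0" if "p : I'" for p using that ph(2) piS_Ph_I' by blast
obtain p where p: "homog a p" "!!q. homog b q ==> ph (piS (Ph q)) = D' (p * q)"
using PD_on_surj[OF PD ab linfun_piS[OF ph(1)] *] by blast
obtain s where s: "decomp a p s" by (rule decomposition[OF p(1)])
have "ph q = D (s 0 * q)" if q: "homog b q" for q
proof -
have "ph q = ph (ka q)" by (rule sym, rule lf_eq_mod[OF ph ka_mod])
also have "... = D' (p * Ps q)" using p(2)[OF Ps_homog[OF q]] by (simp add: PhPs piS_const)
also have "... = (SUM i<k. D' (Ps (s i) * Var e ^ i * Ps q))" by (rule linfun_decomposed[OF linD' killD' s])
also have "... = (SUM i<k. if i = 0 then D (s 0 * q) else 0)"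
proof (intro sum.cong refl)
 fix i assume "i : {..<k}"
 moreover have "Ps (s i) * Var e ^ i * Ps q = Ps (s i * q) * Var e ^ i" by (simp add: ac_simps Ps_simps)
 ultimately show "D' (Ps (s i) * Var e ^ i * Ps q) = (if i = 0 then D (s 0 * q) else 0)"
  using D'_small[of i "s i * q"] D'_0[of "s i * q"] by (cases "i = 0") auto
qed
finally show ?thesis using card_sg by (simp add: sum.delta)
qed
with decomposedD(1)[OF s, of 0] show ?thesis by auto
qed

lemma PD_blowup_iff: "PD_on I D d <-> PD_on I' D' d"
proof
show "PD_on I' D' d" if "PD_on I D d"
by (rule PD_onI) (use PD_blowup_inj[OF that] PD_blowup_surj[OF that] in blast)+
show "PD_on I D d" if "PD_on I' D' d"
by (rule PD_onI) (use PD_blowdown_inj[OF that] PD_blowdown_surj[OF that] in blast)+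
qed

end

end

end

section \<open>Transport of duality: relabelling, the star as a quotient, adding a graph
  coordinate\<close>

section \<open>Renaming, star fans and tropical modifications\<close>

text \<open>Variables outside \<open>W\<close> go to zero; with \<open>W\<close> the vertex set this
  is consistent with the ideal, which contains them.\<close>

definition ren :: "('v => 'u) => 'v set => ('v, 'a::comm_ring_1) mp => ('u, 'a) mp" where
"ren g W = subst (%v. if v : W then Var (g v) else 0)"

lemma ringhom_ren: "ringhom (ren g W)" by (simp add: ren_def ringhom_subst)
lemma ren_Cst [simp]: "ren g W (Cst c) = Cst c" by (simp add: ren_def)
lemma ren_Var: "ren g W (Var v) = (if v : W then Var (g v) else 0)" by (simp add: ren_def)
lemma ren_homog: "homog n p ==> homog n (ren g W p)" unfolding ren_def by (rule subst_homog) auto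
lemmas ren_simps = rh_simps[OF ringhom_ren]

lemma ren_xprod:
assumes "finite R" "inj_on g W"
shows "ren g W (xprod R) = (if R <= W then xprod (g ` R) else 0)"
proof (cases "R <= W")
case True
hence "inj_on g R" using assms(2) inj_on_subset by blast
hence "xprod (g ` R) = (PROD v:R. Var (g v) :: ('b,'c) mp)" by (simp add: xprod_def prod.reindex)
also have "... = ren g W (xprod R)"
unfolding xprod_def ren_simps by (intro prod.cong) (use True in "auto simp: ren_Var")
finally show ?thesis using True by simp
next
case False
then obtain v where "v : R" "v ~: W" by blast
hence "(PROD v:R. ren g W (Var v :: ('a,'c) mp)) = 0"
using assms(1) by (intro prod_zero bexI[of _ v]) (auto simp: ren_Var)
thus ?thesis using False by (simp add: xprod_def ren_simps)
qed

lemma ren_subst_mod: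
assumes I: "is_ideal I" and "!!u. Var u - ren g W (f u) : I"
shows "p - ren g W (subst f p) : I"
proof -
have "subst Var p - subst (%u. ren g W (f u)) p : I" by (rule subst_cong_mod[OF I]) (rule assms(2))
thus ?thesis by (simp add: ren_def subst_Var_id subst_subst)
qed

lemma ren_CI:
fixes L :: "('v => 'a::idom) set" and L' :: "('u => 'a) set"
assumes K: "ucx K L" and inj: "inj_on g (\<Union>K)" and I': "is_ideal I'"
and nf: "!!A. A <= \<Union>K ==> finite A ==> A ~: K ==> xprod (g ` A) : I'"
and lf: "!!l. l : L ==> (SUM v:\<Union>K. Cst (l v) * Var (g v)) : I'"
and p: "p : CI K L"
shows "ren g (\<Union>K) p : I'"
using p[unfolded CI_def]
proof (rule pideal_image[OF _ ringhom_ren I'])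
fix q :: "('v, 'a) mp" assume "q : chow_gens K L"
then consider R where "finite R" "R ~: K" "q = xprod R" | l where "l : L" "q = lin_form K l"
by (auto simp: chow_gens_def)
thus "ren g (\<Union>K) q : I'"
proof cases
case 1
thus ?thesis using nf is_idealD(1)[OF I'] by (auto simp: ren_xprod[OF _ inj])
next
case 2
have "ren g (\<Union>K) q = (SUM v:\<Union>K. Cst (l v) * Var (g v))"
 unfolding 2 lin_form_def ren_simps ren_Cst by (intro sum.cong refl) (auto simp: ren_Var)
thus ?thesis using lf[OF 2(1)] by simp
qed
qed

lemma ren_CI_rename:
fixes L :: "('v => 'a::idom) set" and L' :: "('u => 'a) set"
assumes K: "ucx K L" "ucx ((`) g ` K) L'" and inj: "inj_on g (\<Union>K)"
and L: "!!l. l : L ==> EX l':L'. ALL v:\<Union>K. l' (g v) = l v"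
and p: "p : CI K L"
shows "ren g (\<Union>K) p : CI ((`) g ` K) L'"
proof (rule ren_CI[OF K(1) inj ucx.is_ideal_CI[OF K(2)] _ _ p])
fix A assume A: "A <= \<Union>K" "finite A" "A ~: K"
have "g ` A ~: (`) g ` K"
proof
assume "g ` A : (`) g ` K"
then obtain B where B: "B : K" "g ` A = g ` B" by blast
hence "A = B" using inj A(1) inj_on_image_eq_iff[of g "\<Union>K" A B] by blast
with A(3) B(1) show False by simp
qed
thus "xprod (g ` A) : CI ((`) g ` K) L'" using A(2) by (intro ucx.xprod_CI[OF K(2)]) auto
next
fix l assume "l : L"
from L[OF `l : L`] obtain l' where "l' : L'" "ALL v:\<Union>K. l' (g v) = l v" by (elim bexE conjE)
note l' = this(1) bspec[OF this(2)]
have "lin_form ((`) g ` K) l' = (SUM v:\<Union>K. Cst (l v) * Var (g v))"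
unfolding lin_form_def using inj l'(2) by (simp add: image_Union[symmetric] sum.reindex)
thus "(SUM v:\<Union>K. Cst (l v) * Var (g v)) : CI ((`) g ` K) L'"
using ucx.lin_CI[OF K(2) l'(1)] by simp
qed

text \<open>Chow ring and degree depend only on the complex, the facet weights and the restrictions
  of the forms to the vertices. This serves both the passage from primitive vectors to rays and
  isomorphisms of fans.\<close>

theorem PDc_rename:
fixes L :: "('v => 'a::idom) set" and L' :: "('u => 'a) set"
assumes K: "ucx K L" "ucx ((`) g ` K) L'" and inj: "inj_on g (\<Union>K)"
and L: "!!l. l : L ==> EX l':L'. ALL v:\<Union>K. l' (g v) = l v"
and L': "!!l'. l' : L' ==> EX l:L. ALL v:\<Union>K. l' (g v) = l v"
and w: "!!A. A : K ==> card A = d ==> w' (g ` A) = w A"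
and PD: "PDc K L d w"
shows "PDc ((`) g ` K) L' d w'"
proof -
interpret A: ucx K L by fact
interpret B: ucx "(`) g ` K" L' by fact
obtain D where D: "is_deg K L d w D" "PD_on (CI K L) D d" using PD by (auto simp: PDc_def)
define h where "h = inv_into (\<Union>K) g"
have hg: "v : \<Union>K ==> h (g v) = v" for v using inj by (simp add: h_def)
have V': "\<Union>((`) g ` K) = g ` \<Union>K" by blast
have K': "(`) h ` (`) g ` K = K"
proof -
have "h ` g ` X = X" if "X : K" for X using that hg by (force simp: image_image)
thus ?thesis by (force simp: image_image)
qed
have injh: "inj_on h (\<Union>((`) g ` K))" unfolding V' by (rule inj_on_inverseI[of _ g]) (metis hg imageE)
define th :: "('v, 'a) mp => ('u, 'a) mp" where "th = ren g (\<Union>K)"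
define io :: "('u, 'a) mp => ('v, 'a) mp" where "io = ren h (\<Union>((`) g ` K))"
have thI: "th p : CI ((`) g ` K) L'" if "p : CI K L" for p
unfolding th_def by (rule ren_CI_rename[OF K inj L that])
have ioI: "io p : CI K L" if "p : CI ((`) g ` K) L'" for p
unfolding io_def
proof (rule ren_CI_rename[OF K(2), of h L, unfolded K', OF K(1) injh _ that])
show "EX l:L. ALL u:\<Union>((`) g ` K). l (h u) = l' u" if "l' : L'" for l'
proof -
 from L'[OF that] obtain l where l: "l : L" "ALL v:\<Union>K. l' (g v) = l v" by (elim bexE)
 note l(1) bspec[OF l(2)]
 thus ?thesis unfolding V' by (intro bexI[of _ l]) (auto simp: hg)
qed
qed
have thio: "p - th (io p) : CI ((`) g ` K) L'" for p
unfolding th_def io_def ren_def[of h]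
proof (rule ren_subst_mod[OF B.is_ideal_CI])
show "Var u - ren g (\<Union>K) (if u : \<Union>((`) g ` K) then Var (h u) else 0) : CI ((`) g ` K) L'" for u
proof (cases "u : \<Union>((`) g ` K)")
 case True
 then obtain v where "v : \<Union>K" "u = g v" by blast
 thus ?thesis using True by (auto simp: ren_Var hg B.CI_closed)
qed (use B.Var_in_CI[of u] in "auto simp: ren_simps")
qed
have ioth: "p - io (th p) : CI K L" for p
unfolding th_def io_def ren_def[of g]
proof (rule ren_subst_mod[OF A.is_ideal_CI])
show "Var v - ren h (\<Union>((`) g ` K)) (if v : \<Union>K then Var (g v) else 0) : CI K L" for v
proof (cases "v : \<Union>K")
 case True
 thus ?thesis unfolding V' by (auto simp: ren_Var hg A.CI_closed)
qed (use A.Var_in_CI[of v] in "auto simp: ren_simps")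
qed
have linD: "linfun D" and killD: "!!p. p : CI K L ==> D p = 0" using D(1) by (auto simp: is_deg_def)
have linD': "linfun (%p. D (io p))" unfolding io_def ren_def by (rule linfun_comp_subst[OF linD])
have deg: "is_deg ((`) g ` K) L' d w' (%p. D (io p))"
unfolding is_deg_def
proof (intro conjI ballI impI)
fix B assume B: "B : (`) g ` K" "card B = d"
then obtain A where A: "A : K" "B = g ` A" by blast
have "inj_on g A" using inj A(1) by (auto intro: inj_on_subset)
hence "card A = d" using B(2) A(2) by (simp add: card_image)
have "(%x. h (g x)) ` A = (%x. x) ` A"
 by (rule image_cong[OF refl]) (rule hg[OF UnionI[OF A(1)]])
hence "h ` B = A" unfolding A(2) image_image by simp
hence "io (xprod B) = xprod A"
 unfolding io_def using B.finite_face[OF B(1)] B(1) injh by (subst ren_xprod) auto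
thus "D (io (xprod B)) = w' B" using D(1) A `card A = d` w by (simp add: is_deg_def)
qed (rule linD', rule killD[OF ioI])
have "PD_on (CI ((`) g ` K) L') (%p. D (io p)) d"
proof (rule PD_on_transfer[OF D(2) _ _ _ thI _ thio B.is_ideal_CI linD'])
show "ringhom th" unfolding th_def by (rule ringhom_ren)
show "th (Cst c) = Cst c" for c unfolding th_def by (rule ren_Cst)
show "homog n (th p)" if "homog n p" for n p unfolding th_def by (rule ren_homog[OF that])
show "homog n (io p)" if "homog n p" for n p unfolding io_def by (rule ren_homog[OF that])
show "D (io p) = 0" if "p : CI ((`) g ` K) L'" for p by (rule killD[OF ioI[OF that]])
show "D p = D (io (th p))" for p by (rule lf_eq_mod[OF linD killD ioth])
qed
with deg show ?thesis by (auto simp: PDc_def)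
qed

text \<open>The degrees of \<open>Var v * xprod A\<close> also satisfy all linear forms, and a
  relation is determined by its coefficients outside \<open>A\<close> through the dual
  forms.\<close>

lemma (in ucx) deg_relation:
assumes D: "is_deg K L d w D" and A: "A : K" "Suc (card A) = d"
and gm: "!!v. v : V - A ==> gm v = (if insert v A : K then w (insert v A) else 0)"
 "!!l. l : L ==> (SUM v:V. l v * gm v) = 0"
and v: "v : V"
shows "D (Var v * xprod A) = gm v"
proof -
have linD: "linfun D" and killD: "!!p. p : CI K L ==> D p = 0" using D by (auto simp: is_deg_def)
have finA: "finite A" using finite_face A(1) .
have out: "D (Var v * xprod A) = gm v" if "v : V - A" for v
proof (cases "insert v A : K")
case True
hence "D (xprod (insert v A)) = w (insert v A)" using D A(2) that finA by (auto simp: is_deg_def)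
thus ?thesis using that finA gm(1)[OF that] True by (simp add: xprod_insert)
next
case False
hence "D (xprod (insert v A)) = 0" using finA by (intro killD xprod_CI) auto
thus ?thesis using that finA gm(1)[OF that] False by (simp add: xprod_insert)
qed
have rel: "(SUM v:V. l v * D (Var v * xprod A)) = 0" if "l : L" for l
proof -
have "(SUM v:V. l v * D (Var v * xprod A)) = D (SUM v:V. Cst (l v) * (Var v * xprod A))"
 by (simp add: lf_simps[OF linD])
also have "(SUM v:V. Cst (l v) * (Var v * xprod A)) = lin_form K l * xprod A"
 by (simp add: lin_form_def sum_distrib_right mult.assoc)
also have "D ... = 0" using that by (intro killD CI_closed lin_CI)
finally show ?thesis .
qed
show ?thesis
proof (cases "v : A")
case True
have single: "(SUM u:V. dl A v u * h u) = (SUM u:V - A. dl A v u * h u) + h v" for h :: "'v => 'a"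
proof -
 have "(SUM u:V. dl A v u * h u) = (SUM u:V - A. dl A v u * h u) + (SUM u:A. dl A v u * h u)"
  by (rule sum.subset_diff) (use A finite_V in auto)
 also have "(SUM u:A. dl A v u * h u) = h v"
  using dl[OF A(1) True] True finA by (subst sum.remove[of A v]) auto
 finally show ?thesis .
qed
have "(SUM u:V - A. dl A v u * D (Var u * xprod A)) = (SUM u:V - A. dl A v u * gm u)"
 by (intro sum.cong refl) (simp add: out)
hence "(SUM u:V - A. dl A v u * gm u) + D (Var v * xprod A) = (SUM u:V - A. dl A v u * gm u) + gm v"
 using single[of "%u. D (Var u * xprod A)"] single[of gm] rel[OF dl(1)[OF A(1) True]] gm(2)[OF dl(1)[OF A(1) True]]
 by simp
thus ?thesis by (rule add_left_imp_eq)
qed (use out v in simp)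
qed

text \<open>The relation coming from the new coordinate eliminates the new variable, so the Chow ring of a
modification is a quotient of the Chow ring of the fan; Poincare duality of the fan makes the
kernel vanish.\<close>

theorem PDc_modification:
fixes L :: "('v => 'a::idom) set" and L' :: "('u => 'a) set" and g :: "'v => 'u"
assumes K: "ucx K L" and inj: "inj_on g (\<Union>K)" and u: "u ~: g ` \<Union>K"
and De: "De <= K" "!!A B. A : De ==> B <= A ==> B : De"
and K': "K' = (`) g ` K Un (%B. insert u (g ` B)) ` De"
and L'_L: "!!l'. l' : L' ==> EX l:L. ALL v:\<Union>K. l' (g v) = l v + l' u * f v"
and L_L': "!!l. l : L ==> EX l':L'. l' u = 0 & (ALL v:\<Union>K. l' (g v) = l v)"
and L'_u: "EX l':L'. l' u = 1 & (ALL v:\<Union>K. l' (g v) = f v)"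
and dim: "!!A. A : K ==> card A <= d"
and D: "is_deg K L d w D" and PD: "PD_on (CI K L) D d"
and ord: "!!A. A : K ==> Suc (card A) = d ==> D ((SUM v:\<Union>K. Cst (f v) * Var v) * xprod A) = - ord A"
and ord0: "!!A. A : K ==> Suc (card A) = d ==> A ~: De ==> ord A = 0"
and w1: "!!A. A : K ==> card A = d ==> w' (g ` A) = w A"
and w2: "!!A. A : De ==> Suc (card A) = d ==> w' (insert u (g ` A)) = ord A"
shows "PDc K' L' d w'"
proof -
interpret ucx K L by fact
have linD: "linfun D" and killD: "!!p. p : CI K L ==> D p = 0" using D by (auto simp: is_deg_def)
define F where "F = (SUM v:V. Cst (f v) * Var v)"
have homF: "homog (Suc 0) F" unfolding F_def by (intro homog_sum homog_Cst_mult homog_Var)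
\<comment> \<open>Here duality enters: all codimension one faces above \<open>A\<close> are outside
  the divisor, so this class has degree zero against everything (\<open>functional_moving\<close>)
  and is therefore zero.\<close>
have FA: "F * xprod A : CI K L" if A: "A : K" "A ~: De" for A
proof (cases "card A < d")
case False
thus ?thesis
 using above_dim[OF dim homog_mult[OF homF homog_xprod[OF finite_face[OF A(1)]]]] by simp
next
case True
hence "Suc (card A) + (d - Suc (card A)) = d" by simp
thus ?thesis
proof (rule PD_on_inj[OF PD])
 show "homog (Suc (card A)) (F * xprod A)"
  using homog_mult[OF homF homog_xprod[OF finite_face[OF A(1)]]] by simp
 fix q :: "('v, 'a) mp" assume q: "homog (d - Suc (card A)) q"
 have "D (F * (xprod A * q)) = 0"
 proof (rule functional_moving[OF linfun_mult[OF linD] _ _ A(1) q])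
  show "D (F * p) = 0" if "p : CI K L" for p using that by (intro killD CI_closed)
  fix B assume B: "B : K" "A <= B" "card B = card A + (d - Suc (card A))"
  hence c: "Suc (card B) = d" using True by simp
  have "B ~: De" using A(2) B(2) De(2) by blast
  thus "D (F * xprod B) = 0" using ord[OF B(1) c] ord0[OF B(1) c] by (simp add: F_def)
 qed
 thus "D (F * xprod A * q) = 0" by (simp add: mult.assoc)
qed
qed
define h where "h = inv_into V g"
have hg: "v : V ==> h (g v) = v" for v using inj by (simp add: h_def)
\<comment> \<open>The form with value 1 on the new ray expresses the new variable as
  \<open>- F\<close>.\<close>
define th :: "('u, 'a) mp => ('v, 'a) mp" where
"th = subst (%x. if x = u then - F else if x : g ` V then Var (h x) else 0)"
have th: "ringhom th" "!!c. th (Cst c) = Cst c" "th (Var u) = - F" "!!v. v : V ==> th (Var (g v)) = Var v"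
"!!x. x ~= u ==> x ~: g ` V ==> th (Var x) = 0"
using u hg by (auto simp: th_def ringhom_subst)
define io :: "('v, 'a) mp => ('u, 'a) mp" where "io = ren g V"
have V': "\<Union>K' = g ` V Un (if De = {} then {} else {u})"
proof (cases "De = {}")
case False
hence "{} : De" using De(2) by blast
hence "u : \<Union>K'" by (auto simp: K')
moreover have "g v : \<Union>K'" if "v : V" for v using that by (auto simp: K')
moreover have "\<Union>K' <= insert u (g ` V)" using De(1) by (auto simp: K')
ultimately show ?thesis using False by auto
qed (auto simp: K')
have sumV': "(SUM x:\<Union>K'. h' x) = (SUM v:V. h' (g v)) + (if De = {} then 0 else h' u)"
for h' :: "'u => ('b, 'a) mp"
unfolding V' using u finite_V by (auto simp: sum.reindex[OF inj] add.commute)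
have I': "is_ideal (CI K' L')" by (simp add: CI_def is_ideal_pideal)
have lf': "lin_form K' l' : CI K' L'" if "l' : L'" for l'
using that by (auto simp: CI_def chow_gens_def intro!: pideal_gen)
have nf': "xprod R : CI K' L'" if "finite R" "R ~: K'" for R
using that by (auto simp: CI_def chow_gens_def intro!: pideal_gen)
have ioI: "io p : CI K' L'" if p: "p : CI K L" for p
unfolding io_def
proof (rule ren_CI[OF K inj I' _ _ p])
fix A assume A: "A <= V" "finite A" "A ~: K"
have "g ` A ~: K'"
proof
 assume "g ` A : K'"
 moreover have "u ~: g ` A" using u A(1) by blast
 ultimately obtain B where B: "B : K" "g ` A = g ` B" unfolding K' by blast
 hence "A = B" using inj A(1) inj_on_image_eq_iff[of g V A B] by blast
 with A(3) B(1) show False by simp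
qed
thus "xprod (g ` A) : CI K' L'" using A(2) by (intro nf') auto
next
fix l assume "l : L"
from L_L'[OF `l : L`] obtain l' where "l' : L'" "l' u = 0" "ALL v:V. l' (g v) = l v" by (elim bexE conjE)
note l' = this(1) this(2) bspec[OF this(3)]
have "lin_form K' l' = (SUM v:V. Cst (l v) * Var (g v))"
 unfolding lin_form_def sumV' using l'(2,3) by simp
thus "(SUM v:V. Cst (l v) * Var (g v)) : CI K' L'" using lf'[OF l'(1)] by simp
qed
have thI: "th p : CI K L" if "p : CI K' L'" for p
using that[unfolded CI_def[of K']]
proof (rule pideal_image[OF _ th(1) is_ideal_CI])
fix q :: "('u, 'a) mp" assume "q : chow_gens K' L'"
then consider R where "finite R" "R ~: K'" "q = xprod R" | l' where "l' : L'" "q = lin_form K' l'"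
 by (auto simp: chow_gens_def)
thus "th q : CI K L"
proof cases
 case 1
 have thq: "th q = (PROD x:R. th (Var x))" by (simp add: 1 xprod_def rh_simps[OF th(1)])
 show ?thesis
 proof (cases "R <= insert u (g ` V)")
  case False
  then obtain x where "x : R" "x ~= u" "x ~: g ` V" by blast
  hence "th q = 0" unfolding thq using 1(1) th(5) by (intro prod_zero bexI[of _ x]) auto
  thus ?thesis by (simp add: CI_closed)
 next
  case True
  then obtain A where A: "A <= V" "R - {u} = g ` A"
   by (metis Diff_subset_conv insert_is_Un subset_imageE)
  have injA: "inj_on g A" using inj A(1) inj_on_subset by blast
  have finA: "finite A" using 1(1) A(2) injA by (metis finite_Diff finite_imageD)
  have *: "(PROD x:R - {u}. th (Var x)) = xprod A"
   unfolding A(2) xprod_def prod.reindex[OF injA] using A(1) th(4) by (intro prod.cong) auto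
  show ?thesis
  proof (cases "u : R")
   case False
   hence "R = g ` A" using A(2) by blast
   hence "A ~: K" using 1(2) by (auto simp: K')
   thus ?thesis using * finA xprod_CI False by (simp add: thq)
  next
   case u: True
   hence "R = insert u (g ` A)" using A(2) by blast
   hence "A ~: De" using 1(2) by (auto simp: K')
   hence "F * xprod A : CI K L"
    using FA xprod_CI[OF finA] by (cases "A : K") (auto intro: CI_closed)
   moreover have "th q = - (F * xprod A)"
    unfolding thq using u 1(1) * th(3) by (subst prod.remove[of R u]) auto
   ultimately show ?thesis by (simp add: CI_closed)
  qed
 qed
next
 case 2
 from L'_L[OF 2(1)] obtain l where "l : L" "ALL v:V. l' (g v) = l v + l' u * f v" by (elim bexE conjE)
 note l = this(1) bspec[OF this(2)]
 have "th q = (SUM v:V. Cst (l' (g v)) * Var v) + (if De = {} then 0 else - (Cst (l' u) * F))"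
 proof -
  have "(SUM v:V. Cst (l' (g v)) * th (Var (g v))) = (SUM v:V. Cst (l' (g v)) * Var v)"
   by (intro sum.cong refl) (simp only: th(4))
  thus ?thesis
   unfolding 2 lin_form_def sumV' by (simp add: rh_simps[OF th(1)] th(2,3))
 qed
 also have "(SUM v:V. Cst (l' (g v)) * Var v) = lin_form K l + Cst (l' u) * F"
  by (simp add: l(2) lin_form_def F_def Cst_add Cst_mult algebra_simps sum.distrib sum_distrib_left)
 finally have q: "th q = lin_form K l + (if De = {} then Cst (l' u) * F else 0)" by simp
 \<comment> \<open>For a trivial divisor the new ray is not a vertex and its variable is absent from
   the form; the empty face in \<open>FA\<close> shows that \<open>F\<close> is already
   zero.\<close>
 have "F : CI K L" if "De = {}" using FA[of "{}"] that empty_face by simp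
 thus ?thesis unfolding q using lin_CI[OF l(1)] by (auto intro: CI_closed)
qed
qed
have ioth: "p - io (th p) : CI K' L'" for p
unfolding io_def th_def
proof (rule ren_subst_mod[OF I'])
fix x
consider v where "v : V" "x = g v" | "x = u" | "x ~= u" "x ~: g ` V" by blast
thus "Var x - ren g V (if x = u then - F else if x : g ` V then Var (h x) else 0) : CI K' L'"
proof cases
 case 1
 thus ?thesis using u by (auto simp: hg ren_Var is_idealD[OF I'])
next
 case 2
 from L'_u obtain l' where "l' : L'" "l' u = 1" "ALL v:V. l' (g v) = f v" by (elim bexE conjE)
 note l' = this(1) this(2) bspec[OF this(3)]
 have rF: "ren g V F = (SUM v:V. Cst (f v) * Var (g v))"
  unfolding F_def ren_simps ren_Cst by (intro sum.cong refl) (auto simp: ren_Var)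
 have lf: "lin_form K' l' = ren g V F + (if De = {} then 0 else Var u)"
  unfolding lin_form_def sumV' rF using l'(2,3) by simp
 have "Var u + ren g V F : CI K' L'"
 proof (cases "De = {}")
  case True
  have "{u} ~= g ` A" if "A : K" for A using u that by blast
  hence "{u} ~: K'" using True unfolding K' by blast
  hence "Var u : CI K' L'" using nf'[of "{u}"] by (simp add: xprod_def)
  thus ?thesis using lf'[OF l'(1)] lf True is_idealD[OF I'] by auto
 qed (use lf lf'[OF l'(1)] in "simp add: add.commute")
 thus ?thesis using 2 by (simp add: ren_simps)
next
 case 3
 have "x ~: \<Union>K'" using 3 unfolding V' by simp
 hence "{x} ~: K'" by blast
 thus ?thesis using nf'[of "{x}"] 3 by (simp add: xprod_def ren_simps)
qed
qed
have thio: "p - th (io p) : CI K L" for p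
proof -
have "subst Var p - subst (%v. th (if v : V then Var (g v) else 0)) p : CI K L"
proof (rule subst_cong_mod[OF is_ideal_CI])
 show "Var v - th (if v : V then Var (g v) else 0) : CI K L" for v
  using Var_in_CI[of v] th(4) by (cases "v : V") (auto simp: rh_simps[OF th(1)] CI_closed)
qed
thus ?thesis by (simp add: subst_Var_id io_def ren_def th_def subst_subst)
qed
have linD': "linfun (%p. D (th p))" unfolding th_def by (rule linfun_comp_subst[OF linD])
have deg: "is_deg K' L' d w' (%p. D (th p))"
unfolding is_deg_def
proof (intro conjI ballI impI)
fix B assume B: "B : K'" "card B = d"
have img: "th (xprod (g ` A)) = xprod A" if "A : K" for A
proof -
 have "inj_on g A" using inj that by (auto intro: inj_on_subset)
 thus ?thesis using that th(4)
  by (auto simp: xprod_def prod.reindex rh_simps[OF th(1)] intro!: prod.cong)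
qed
have cimg: "card (g ` A) = card A" if "A : K" for A
 using inj that by (intro card_image) (auto intro: inj_on_subset)
from B(1) consider A where "A : K" "B = g ` A" | A where "A : De" "B = insert u (g ` A)"
 by (auto simp: K')
thus "D (th (xprod B)) = w' B"
proof cases
 case 1
 thus ?thesis using D w1 B(2) by (simp add: img cimg is_deg_def)
next
 case 2
 hence A: "A : K" "u ~: g ` A" "finite A" using De(1) u finite_face by auto
 have c: "Suc (card A) = d" using B(2) 2(2) A by (simp add: cimg)
 have "th (xprod B) = - (F * xprod A)"
  using A img[OF A(1)] by (simp add: 2 xprod_def rh_simps[OF th(1)] th(3))
 thus ?thesis using ord[OF A(1) c] w2[OF 2(1) c] by (simp add: 2 F_def lf_simps[OF linD])
qed
qed (rule linD', rule killD[OF thI])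
have "PD_on (CI K' L') (%p. D (th p)) d"
proof (rule PD_on_transfer[OF PD _ _ _ ioI _ ioth I' linD'])
show "ringhom io" unfolding io_def by (rule ringhom_ren)
show "io (Cst c) = Cst c" for c unfolding io_def by (rule ren_Cst)
show "homog n (io p)" if "homog n p" for n p unfolding io_def by (rule ren_homog[OF that])
show "D (th p) = 0" if "p : CI K' L'" for p by (rule killD[OF thI[OF that]])
show "D p = D (th (io p))" for p by (rule lf_eq_mod[OF linD killD thio])
show "homog n (th p)" if "homog n p" for n p
 unfolding th_def by (rule subst_homog[OF _ that]) (auto intro: homF homog_uminus)
qed
with deg show ?thesis by (auto simp: PDc_def)
qed

text \<open>The map \<open>r\<close> goes to the star by eliminating the variables of
  \<open>sg\<close> with their dual forms, \<open>th\<close> names the variables of the star in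
  \<open>K\<close>, and \<open>th\<close> after \<open>r\<close> is the identity modulo the star
  ideal. The degree on the star corresponds to multiplication by \<open>xprod sg\<close> followed by
  \<open>D\<close>.\<close>

theorem star_transfer:
fixes L :: "('v => 'a::idom) set" and L' :: "('u => 'a) set" and g :: "'v => 'u"
assumes K: "ucx K L" and sg: "sg : K"
and W: "W = {v. v ~: sg & insert v sg : K}" and inj: "inj_on g W"
and K': "K' = {g ` (B - sg) |B. B : K & sg <= B}" and uK': "ucx K' L'"
and L'_L: "!!l'. l' : L' ==> EX l:L. (ALL i:sg. l i = 0) & (ALL v:W. l' (g v) = l v)"
and dim: "!!A. A : K ==> card A <= d" and D: "is_deg K L d w D"
and w: "!!B. B : K ==> sg <= B ==> card B = d ==> w' (g ` (B - sg)) = w B"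
shows "homog c p ==> d < c + card sg ==> p : star_ideal K L sg"
and "PDc K' L' (d - card sg) w' ==> PD_on (star_ideal K L sg) (%p. D (xprod sg * p)) (d - card sg)"
proof -
interpret ucx K L by fact
interpret B: ucx K' L' by fact
let ?J = "star_ideal K L sg"
have linD: "linfun D" and killD: "!!p. p : CI K L ==> D p = 0" using D by (auto simp: is_deg_def)
have finW: "finite W" using finite_V by (rule finite_subset[rotated]) (auto simp: W)
have finsg: "finite sg" using sg finite_face by blast
have J: "is_ideal ?J" by (rule is_ideal_star_ideal)
have IJ: "CI K L <= ?J"
unfolding CI_def star_ideal_def by (rule pideal_minimal[OF is_ideal_pideal]) (auto intro: pideal_gen)
have xJ: "xprod R : ?J" if "finite R" "R Int sg = {}" "R Un sg ~: K" for R
using that by (auto simp: star_ideal_def intro!: pideal_gen)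
have VJ: "Var v : ?J" if "v ~: W" "v ~: sg" for v
using xJ[of "{v}"] that by (auto simp: xprod_def W)
define h where "h = inv_into W g"
have hg: "v : W ==> h (g v) = v" for v using inj by (simp add: h_def)
have V': "\<Union>K' = g ` W"
proof (intro equalityI subsetI)
fix x assume "x : \<Union>K'"
then obtain B v where v: "B : K" "sg <= B" "v : B - sg" "x = g v" by (auto simp: K')
hence "insert v sg : K" using down_closed[of B "insert v sg"] by blast
with v show "x : g ` W" by (auto simp: W)
next
fix x assume "x : g ` W"
then obtain v where v: "v ~: sg" "insert v sg : K" "x = g v" by (auto simp: W)
hence "g ` (insert v sg - sg) : K'" by (auto simp: K')
with v show "x : \<Union>K'" by blast
qed
have injh: "inj_on h (\<Union>K')" unfolding V' by (rule inj_on_inverseI[of _ g]) (metis hg imageE)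
define th :: "('u, 'a) mp => ('v, 'a) mp" where "th = ren h (\<Union>K')"
have th: "ringhom th" "!!c. th (Cst c) = Cst c" by (auto simp: th_def ringhom_ren)
define r :: "('v, 'a) mp => ('u, 'a) mp" where
"r = subst (%v. if v : W then Var (g v) else if v : sg then - (SUM j:W. Cst (dl sg v j) * Var (g j)) else 0)"
have lin_rest: "(SUM v:W. Cst (l v) * Var v) + (SUM i:sg. Cst (l i) * Var i) : ?J" if "l : L" for l
proof -
have "W Un sg <= V" "W Int sg = {}" using sg by (auto simp: W)
hence "lin_form K l = (SUM v:V - (W Un sg). Cst (l v) * Var v) + (SUM v:W Un sg. Cst (l v) * Var v)"
 unfolding lin_form_def by (intro sum.subset_diff) (use finite_V in auto)
also have "(SUM v:W Un sg. Cst (l v) * Var v) = (SUM v:W. Cst (l v) * Var v) + (SUM i:sg. Cst (l i) * Var i)"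
 using finW finsg `W Int sg = {}` by (rule sum.union_disjoint)
finally have "(SUM v:W. Cst (l v) * Var v) + (SUM i:sg. Cst (l i) * Var i)
 = lin_form K l - (SUM v:V - (W Un sg). Cst (l v) * Var v)" by simp
moreover have "lin_form K l : ?J" using lin_CI[OF that] IJ by blast
moreover have "(SUM v:V - (W Un sg). Cst (l v) * Var v) : ?J"
 by (intro is_idealD(7)[OF J] is_idealD(3)[OF J] VJ) auto
ultimately show ?thesis using is_idealD(6)[OF J] by simp
qed
have thI: "th p : ?J" if p: "p : CI K' L'" for p
unfolding th_def
proof (rule ren_CI[OF uK' injh J _ _ p])
fix A assume A: "A <= \<Union>K'" "finite A" "A ~: K'"
then obtain R where R: "R <= W" "A = g ` R" unfolding V' by (meson subset_imageE)
have "h ` A = R" using R hg by (force simp: image_image)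
have "R Un sg ~: K"
proof
 assume "R Un sg : K"
 moreover have "(R Un sg) - sg = R" using R(1) by (auto simp: W)
 ultimately have "R Un sg : K & sg <= R Un sg & g ` R = g ` (R Un sg - sg)" by simp
 hence "g ` R : K'" unfolding K' by blast
 with A(3) R(2) show False by simp
qed
thus "xprod (h ` A) : ?J" unfolding \<open>h ` A = R\<close>
 using R(1) finite_subset[OF R(1) finW] by (intro xJ) (auto simp: W)
next
fix l' assume "l' : L'"
from L'_L[OF `l' : L'`] obtain l where "l : L" "ALL i:sg. l i = 0" "ALL v:W. l' (g v) = l v" by (elim bexE conjE)
note l = this(1) bspec[OF this(2)] bspec[OF this(3)]
have "(SUM x:\<Union>K'. Cst (l' x) * Var (h x)) = (SUM v:W. Cst (l v) * Var v)"
 unfolding V' sum.reindex[OF inj] by (intro sum.cong refl) (simp add: l(3) hg)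
moreover have "(SUM i:sg. Cst (l i) * Var i) = 0" using l(2) by simp
ultimately show "(SUM x:\<Union>K'. Cst (l' x) * Var (h x)) : ?J" using lin_rest[OF l(1)] by simp
qed
have thg: "th (Var (g j)) = Var j" if "j : W" for j using that by (simp add: th_def ren_Var V' hg)
have thr: "p - th (r p) : ?J" for p
unfolding th_def r_def
proof (rule ren_subst_mod[OF J], fold th_def)
fix v
consider "v : W" | "v ~: W" "v : sg" | "v ~: W" "v ~: sg" by blast
thus "Var v - th (if v : W then Var (g v) else if v : sg then - (SUM j:W. Cst (dl sg v j) * Var (g j)) else 0) : ?J"
proof cases
 case 1 thus ?thesis by (simp add: thg is_idealD[OF J])
next
 case 2
 have "(SUM i:sg. Cst (dl sg v i) * Var i) = Var v"
  using dl[OF sg 2(2)] 2 finsg by (subst sum.remove[of sg v]) auto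
 moreover have "th (- (SUM j:W. Cst (dl sg v j) * Var (g j))) = - (SUM j:W. Cst (dl sg v j) * Var j)"
  by (simp add: rh_simps[OF th(1)] th(2) thg)
 ultimately show ?thesis using lin_rest[OF dl(1)[OF sg 2(2)]] 2 by (simp add: add.commute)
next
 case 3 thus ?thesis using VJ by (simp add: rh_simps[OF th(1)])
qed
qed
have rh: "homog n (r p)" if "homog n p" for n p
unfolding r_def
by (rule subst_homog[OF _ that]) (auto intro!: homog_uminus homog_sum homog_Cst_mult)
have dim': "card A <= d - card sg" if "A : K'" for A
proof -
from that have "A : {g ` (B - sg) |B. B : K & sg <= B}" by (simp only: K')
then obtain B where B: "B : K" "sg <= B" "A = g ` (B - sg)" by (elim CollectE exE conjE)
have "card A <= card (B - sg)" unfolding B(3) using finite_face[OF B(1)] by (intro card_image_le) auto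
also have "... = card B - card sg" using B(2) finsg by (rule card_Diff_subset[rotated])
also have "... <= d - card sg" using dim[OF B(1)] by simp
finally show ?thesis .
qed
show "p : ?J" if "homog c p" "d < c + card sg" for c p
proof -
have "r p : CI K' L'" by (rule B.above_dim[OF dim' rh[OF that(1)]]) (use that(2) dim[OF sg] in auto)
hence "th (r p) : ?J" by (rule thI)
thus ?thesis by (rule iffD2[OF idiff_cancel[OF J thr]])
qed
assume "PDc K' L' (d - card sg) w'"
then obtain D' where D': "is_deg K' L' (d - card sg) w' D'" "PD_on (CI K' L') D' (d - card sg)"
by (auto simp: PDc_def)
have linsg: "linfun (%p. D (xprod sg * p))" by (rule linfun_mult[OF linD])
have killsg: "D (xprod sg * p) = 0" if "p : ?J" for p
proof -
have "xprod sg * p : CI K L"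
 using that unfolding star_ideal_def
proof (induction rule: pideal.induct)
 case (gen q s)
 have "xprod sg * q : CI K L"
 proof (cases "q : chow_gens K L")
  case True
  hence "q : CI K L" by (auto simp: CI_def intro: pideal_gen)
  thus ?thesis by (rule CI_closed)
 next
  case False
  with gen obtain R where R: "finite R" "R Int sg = {}" "R Un sg ~: K" "q = xprod R" by blast
  hence "xprod sg * q = xprod (R Un sg)" using finsg by (simp add: xprod_Un mult.commute)
  thus ?thesis using R finsg xprod_CI by simp
 qed
 hence "s * (xprod sg * q) : CI K L" by (rule CI_closed)
 thus ?case by (simp add: mult.left_commute)
qed (auto simp: distrib_left CI_closed)
thus ?thesis by (rule killD)
qed
show "PD_on ?J (%p. D (xprod sg * p)) (d - card sg)"
proof (rule PD_on_transfer[OF D'(2) th _ thI rh thr J linsg killsg])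
show "homog n (th p)" if "homog n p" for n p unfolding th_def by (rule ren_homog[OF that])
show "D' p = D (xprod sg * th p)" if "homog (d - card sg) p" for p
proof (rule B.deg_unique[OF _ _ _ _ _ that])
 show "linfun D'" "!!p. p : CI K' L' ==> D' p = 0" using D'(1) by (auto simp: is_deg_def)
 show "linfun (%p. D (xprod sg * th p))" unfolding th_def ren_def by (rule linfun_comp_subst[OF linsg])
 show "D (xprod sg * th p) = 0" if "p : CI K' L'" for p using killsg thI that by blast
 fix A assume A: "A : K'" "card A = d - card sg"
 from A(1) have "A : {g ` (B - sg) |B. B : K & sg <= B}" by (simp only: K')
 then obtain B where B: "B : K" "sg <= B" "A = g ` (B - sg)" by (elim CollectE exE conjE)
 have BW: "B - sg <= W"
 proof
  fix v assume "v : B - sg"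
  thus "v : W" using B down_closed[of B "insert v sg"] by (auto simp: W)
 qed
 have finB: "finite B" using finite_face[OF B(1)] .
 have "card A = card (B - sg)" unfolding B(3) using inj BW by (intro card_image) (rule inj_on_subset)
 also have "... = card B - card sg" using B(2) finsg by (rule card_Diff_subset[rotated])
 finally have "card B = d" using A(2) card_mono[OF finB B(2)] dim[OF sg] by simp
 have "h ` A = B - sg" unfolding B(3) using BW hg by (force simp: image_image)
 hence "th (xprod A) = xprod (B - sg)"
  unfolding th_def using A(1) B.finite_face[OF A(1)] by (subst ren_xprod[OF _ injh]) auto
 moreover have "xprod (sg Un (B - sg)) = xprod sg * (xprod (B - sg) :: ('v, 'a) mp)"
  by (rule xprod_Un) (use finsg finB in auto)
 moreover have "sg Un (B - sg) = B" using B(2) by blast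
 ultimately have "xprod sg * th (xprod A) = xprod B" by (simp only:)
 thus "D' (xprod A) = D (xprod sg * th (xprod A))"
  using D D'(1) A B(1) `card B = d` w[OF B(1,2) `card B = d`] B(3) by (simp add: is_deg_def)
qed
qed
qed

section \<open>Dual systems of generators and the Kuenneth argument for products\<close>

section \<open>Dual bases and products\<close>

text \<open>The Euclidean size shifted to make zero strictly smallest; its sum over a relation is
  the induction measure.\<close>

definition size0 :: "'a::euclidean_ring => nat" where
"size0 x = (if x = 0 then 0 else Suc (euclidean_size x))"

lemma size0_mod: "y ~= 0 ==> size0 (x mod y) < size0 y"
by (auto simp: size0_def mod_size_less)

definition gsys ::
"('v, 'a::comm_ring_1) mp set => nat => 's set => ('s => ('v, 'a) mp) => bool" where
"gsys I j S b <-> finite S & (ALL s:S. homog j (b s)) &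
 (ALL y. homog j y --> (EX c. y - (SUM s:S. Cst (c s) * b s) : I))"

definition independent_mod :: "('v, 'a::comm_ring_1) mp set => 's set => ('s => ('v, 'a) mp) => bool" where
"independent_mod I S b <-> (ALL c. (SUM s:S. Cst (c s) * b s) : I --> (ALL s:S. c s = 0))"

text \<open>A finitely generated torsion-free module over a Euclidean ring is free: in a minimal system of
generators, a relation of minimal size involves only one generator.\<close>

lemma free_generators:
fixes I :: "('v, 'a::euclidean_ring) mp set"
assumes I: "is_ideal I"
and tf: "!!c p. homog j p ==> c ~= 0 ==> Cst c * p : I ==> p : I"
and fg: "gsys I j (S :: 's set) b"
shows "EX (S :: nat set) b. gsys I j S b & independent_mod I S b"
proof -
let ?gen = "gsys I j :: nat set => (nat => ('v, 'a) mp) => bool"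
have "EX n S b. ?gen S b & card S = n"
proof -
note fg' = fg[unfolded gsys_def]
note S = conjunct1[OF fg'] conjunct1[OF conjunct2[OF fg']] conjunct2[OF conjunct2[OF fg']]
obtain f where f: "bij_betw f {..<card S} S"
 using ex_bij_betw_nat_finite[OF S(1)] by (auto simp: lessThan_atLeast0)
have "?gen {..<card S} (b \<circ> f)"
 unfolding gsys_def
proof (intro conjI allI impI ballI)
 fix s assume "s : {..<card S}"
 hence "f s : S" using f by (auto dest: bij_betwE)
 thus "homog j ((b \<circ> f) s)" unfolding comp_def by (rule bspec[OF S(2)])
next
 fix y :: "('v, 'a) mp" assume "homog j y"
 hence "EX c. y - (SUM s:S. Cst (c s) * b s) : I" by (rule mp[OF spec[OF S(3)]])
 then obtain c where "y - (SUM s:S. Cst (c s) * b s) : I" by blast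
 moreover have "(SUM s:{..<card S}. Cst ((c \<circ> f) s) * (b \<circ> f) s) = (SUM s:S. Cst (c s) * b s)"
  unfolding comp_def using f by (rule sum.reindex_bij_betw)
 ultimately have "y - (SUM s:{..<card S}. Cst ((c \<circ> f) s) * (b \<circ> f) s) : I" by (simp only:)
 thus "EX c. y - (SUM s:{..<card S}. Cst (c s) * (b \<circ> f) s) : I" by (rule exI[where x = "c \<circ> f"])
qed auto
thus ?thesis by blast
qed
define n where "n = (LEAST n. EX S b. ?gen S b & card S = n)"
have n: "EX S b. ?gen S b & card S = n"
unfolding n_def by (rule LeastI_ex) fact
have min: "~ (EX S b. ?gen S b & card S = m)" if "m < n" for m
using that unfolding n_def by (rule not_less_Least)
define bad where "bad S b c <-> ?gen S b & card S = n & (SUM s:S. Cst (c s) * b s) : I & (EX s:S. c s ~= 0)"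
for S b c
have no_bad: "~ bad S b c" for S b and c :: "nat => 'a"
proof (induction "SUM s:S. size0 (c s)" arbitrary: b c rule: less_induct)
case less
show ?case
proof
 assume B: "bad S b c"
 hence g: "?gen S b" "card S = n" and rel: "(SUM s:S. Cst (c s) * b s) : I" and finS: "finite S"
  by (auto simp: bad_def gsys_def)
 obtain p where p: "p : S" "c p ~= 0" using B by (auto simp: bad_def)
 show False
 proof (cases "EX q:S. q ~= p & c q ~= 0")
  case True
  \<comment> \<open>Divide the larger coefficient by the smaller one and absorb the quotient into
    the generator \<open>b q\<close>. The relation survives with the remainder in place of
    \<open>c q'\<close>, and the generators still generate.\<close>
  obtain q q' where q: "q : S" "q' : S" "q ~= q'" "c q ~= 0" "c q' ~= 0" "size0 (c q) <= size0 (c q')"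
   using True p by (metis linorder_linear)
  define u where "u = c q' div c q"
  define b' where "b' = b(q := b q + Cst u * b q')"
  define c' where "c' = c(q' := c q' mod c q)"
  have sum2: "(SUM s:S. Cst (x s) * y s) = Cst (x q) * y q + Cst (x q') * y q' + (SUM s:S - {q, q'}. Cst (x s) * y s)"
   for x :: "nat => 'a" and y :: "nat => ('v, 'a) mp"
  proof -
   have "S - {q, q'} = (S - {q}) - {q'}" by blast
   thus ?thesis using q finS by (simp add: sum.remove[of S q] sum.remove[of "S - {q}" q'] add.assoc)
  qed
  have out: "(SUM s:S - {q, q'}. Cst (x s) * b' s) = (SUM s:S - {q, q'}. Cst (x s) * b s)" for x :: "nat => 'a"
   by (intro sum.cong) (auto simp: b'_def)
  have out': "(SUM s:S - {q, q'}. Cst (c' s) * y s) = (SUM s:S - {q, q'}. Cst (c s) * y s)" for y :: "nat => ('v, 'a) mp"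
   by (intro sum.cong) (auto simp: c'_def)
  have cq': "c q' = u * c q + c q' mod c q" by (simp add: u_def)
  have "(SUM s:S. Cst (c' s) * b' s) = (SUM s:S. Cst (c s) * b s)"
  proof -
   have "Cst (c q') = Cst u * Cst (c q) + (Cst (c q' mod c q) :: ('v, 'a) mp)"
    by (subst cq') (simp only: Cst_add Cst_mult)
   thus ?thesis unfolding sum2[of c'] sum2[of c] out out' using q(3)
    by (simp add: b'_def c'_def algebra_simps)
  qed
  hence rel': "(SUM s:S. Cst (c' s) * b' s) : I" using rel by simp
  have "?gen S b'"
   unfolding gsys_def
  proof (intro conjI ballI allI impI)
   show "finite S" by fact
   show "homog j (b' s)" if "s : S" for s
    using that g(1) q unfolding gsys_def b'_def by (auto intro!: homog_add homog_Cst_mult)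
   fix y :: "('v, 'a) mp" assume "homog j y"
   then obtain x where x: "y - (SUM s:S. Cst (x s) * b s) : I" using g(1) by (auto simp: gsys_def)
   define x' where "x' = x(q' := x q' - u * x q)"
   have "(SUM s:S. Cst (x' s) * b' s) = (SUM s:S. Cst (x s) * b s)"
   proof -
    have "(SUM s:S - {q, q'}. Cst (x' s) * b s) = (SUM s:S - {q, q'}. Cst (x s) * b s)"
     by (intro sum.cong) (auto simp: x'_def)
    moreover have *: "Cst (x q' - u * x q) = Cst (x q') - Cst u * (Cst (x q) :: ('v, 'a) mp)"
     by (simp add: rh_simps[OF ringhom_Cst])
    ultimately show ?thesis unfolding sum2[of x'] sum2[of x] out using q(3)
     by (simp add: b'_def x'_def *) (simp add: algebra_simps)
   qed
   with x show "EX c. y - (SUM s:S. Cst (c s) * b' s) : I" by metis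
  qed
  moreover have "c' q ~= 0" using q by (simp add: c'_def)
  ultimately have "bad S b' c'" using g(2) rel' q(1) by (auto simp: bad_def)
  moreover have "(SUM s:S. size0 (c' s)) < (SUM s:S. size0 (c s))"
  proof (rule sum_strict_mono_ex1[OF finS])
   show "ALL x:S. size0 (c' x) <= size0 (c x)"
    using size0_mod[OF q(4), of "c q'"] q(6) by (auto simp: c'_def)
   show "EX a:S. size0 (c' a) < size0 (c a)"
    using size0_mod[OF q(4), of "c q'"] q(2,6) by (auto simp: c'_def intro!: bexI[of _ q'])
  qed
  ultimately show False using less by blast
 next
  case False
  hence "(SUM s:S. Cst (c s) * b s) = Cst (c p) * b p"
   using p(1) finS by (subst sum.remove[of S p]) (auto intro!: sum.neutral)
  hence bp: "b p : I" using rel p g(1) tf[of "b p" "c p"] by (auto simp: gsys_def)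
  have "?gen (S - {p}) b"
   unfolding gsys_def
  proof (intro conjI ballI allI impI)
   fix y :: "('v, 'a) mp" assume "homog j y"
   then obtain x where x: "y - (SUM s:S. Cst (x s) * b s) : I" using g(1) by (auto simp: gsys_def)
   have "y - (SUM s:S - {p}. Cst (x s) * b s) = (y - (SUM s:S. Cst (x s) * b s)) + Cst (x p) * b p"
    using p(1) finS by (subst sum.remove[of S p]) auto
   also have "... : I" by (intro is_idealD(2,3)[OF I] x bp)
   finally show "EX c. y - (SUM s:S - {p}. Cst (c s) * b s) : I" by blast
  qed (use g(1) in "auto simp: gsys_def")
  moreover have "card (S - {p}) < n" using p(1) finS g(2) by (metis card_Diff1_less)
  ultimately show False using min by blast
 qed
qed
qed
obtain S b where "?gen S b" "card S = n" using n by blast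
moreover have "independent_mod I S b"
unfolding independent_mod_def using no_bad[of S b] calculation by (auto simp: bad_def)
ultimately show ?thesis by blast
qed

text \<open>Two systems that recover every class of degree \<open>k\<close> and of degree
  \<open>j\<close> from its pairings, as dual bases do. In this form the property multiplies under
  products of fans.\<close>

definition dsys ::
"('v, 'a::comm_ring_1) mp set => (('v, 'a) mp => 'a) => nat => nat => nat set => (nat => ('v, 'a) mp) => (nat => ('v, 'a) mp) => bool" where
"dsys I D k j S a b <-> finite S & (ALL s:S. homog k (a s) & homog j (b s)) &
 (ALL x. homog k x --> x - (SUM s:S. Cst (D (x * b s)) * a s) : I) &
 (ALL y. homog j y --> y - (SUM s:S. Cst (D (y * a s)) * b s) : I)"

context ucx begin

text \<open>The ideal is homogeneous because its generators are.\<close>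

lemma hcomp_CI: "p : CI K L ==> hcomp n p : CI K L"
unfolding CI_def
proof (induction rule: pideal.induct)
case (gen g r)
hence "EX i. homog i g"
proof -
from gen consider R where "finite R" "g = xprod R" | l where "g = lin_form K l" by (auto simp: chow_gens_def)
thus ?thesis
proof cases
 case 1 thus ?thesis using homog_xprod by blast
next
 case 2
 have "homog (Suc 0) g" unfolding 2 lin_form_def by (intro homog_sum homog_Cst_mult homog_Var)
 thus ?thesis by blast
qed
qed
then obtain i where "homog i g" by blast
thus ?case using gen by (auto simp: hcomp_mult_homog intro: pideal.intros)
qed (auto simp: hcomp_add intro: pideal.intros)

lemma generators:
"gsys (CI K L) j {B : K. card B = j} xprod"
proof -
let ?S = "{B : K. card B = j}"
have fin: "finite ?S" using finite_K by simp
define T where "T = {y. EX c. y - (SUM s:?S. Cst (c s) * xprod s) : CI K L}"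
have "xprod {} * y : T" if "homog j y" for y
proof (rule moving[where a = j])
show "p + q : T" if pq: "p : T" "q : T" for p q
proof -
 obtain c c' where "p - (SUM s:?S. Cst (c s) * xprod s) : CI K L" "q - (SUM s:?S. Cst (c' s) * xprod s) : CI K L"
  using pq by (auto simp: T_def)
 from CI_closed(2)[OF this] have "p + q - (SUM s:?S. Cst (c s + c' s) * xprod s) : CI K L"
  by (simp add: Cst_add distrib_right sum.distrib add_diff_add)
 thus ?thesis unfolding T_def by (intro CollectI exI[of _ "%s. c s + c' s"])
qed
show "Cst x * p : T" if p: "p : T" for x p
proof -
 obtain c where "p - (SUM s:?S. Cst (c s) * xprod s) : CI K L" using p by (auto simp: T_def)
 from CI_closed(3)[OF this, of "Cst x"] have "Cst x * p - (SUM s:?S. Cst (x * c s) * xprod s) : CI K L"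
  by (simp add: Cst_mult right_diff_distrib sum_distrib_left mult.assoc)
 thus ?thesis unfolding T_def by (intro CollectI exI[of _ "%s. x * c s"])
qed
show "CI K L <= T"
proof
 fix p assume "p : CI K L"
 hence "p - (SUM s:?S. Cst 0 * xprod s) : CI K L" by simp
 thus "p : T" unfolding T_def by (intro CollectI exI[of _ "%s. 0"])
qed
show "xprod B : T" if "B : K" "card B = card {} + j" for B
proof -
 have "(SUM s:?S. Cst (if s = B then 1 else 0) * xprod s) = (SUM s:?S. if s = B then xprod B else 0 :: ('v,'a) mp)"
  by (intro sum.cong) auto
 also have "... = xprod B" using that fin by (simp add: sum.delta)
 finally have "xprod B - (SUM s:?S. Cst (if s = B then 1 else 0) * xprod s) : CI K L"
  using CI_closed(1) by simp
 thus ?thesis unfolding T_def by (intro CollectI exI[of _ "%s. if s = B then 1 else 0"])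
qed
qed (use empty_face that in auto)
hence "EX c. y - (SUM s:?S. Cst (c s) * xprod s) : CI K L" if "homog j y" for y
using that by (simp add: T_def)
moreover have "homog j (xprod s :: ('v,'a) mp)" if "s : ?S" for s
using homog_xprod[of s] finite_face that by auto
ultimately show ?thesis using fin by (simp add: gsys_def)
qed

end

text \<open>By duality a class with a nonzero multiple in the ideal pairs to zero with everything,
  so the graded piece is torsion-free. Being generated by finitely many square-free monomials it is
  free, and duality represents its coordinate functionals by classes \<open>a s\<close>.\<close>

lemma ex_dual_system:
fixes L :: "('v => 'a::euclidean_ring) set"
assumes "ucx K L" and D: "is_deg K L d w D" and PD: "PD_on (CI K L) D d" and kj: "k + j = d"
shows "EX S a b. dsys (CI K L) D k j S a b"
proof -
interpret ucx K L by fact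
have linD: "linfun D" and killD: "!!p. p : CI K L ==> D p = 0" using D by (auto simp: is_deg_def)
have jk: "j + k = d" using kj by simp
have tf: "p : CI K L" if p: "homog j p" "c ~= 0" "Cst c * p : CI K L" for c p
proof (rule PD_on_inj[OF PD jk p(1)])
fix q :: "('v, 'a) mp"
have "D (Cst c * (p * q)) = 0" using p(3) by (intro killD) (simp add: CI_closed(4) flip: mult.assoc)
thus "D (p * q) = 0" using p(2) by (simp add: lf_simps[OF linD])
qed
obtain S :: "nat set" and b where Sb: "gsys (CI K L) j S b" "independent_mod (CI K L) S b"
using free_generators[OF is_ideal_CI _ generators[of j]] tf by blast
have S: "finite S" and b: "!!s. s : S ==> homog j (b s)"
and gen: "!!y. homog j y ==> EX c. y - (SUM s:S. Cst (c s) * b s) : CI K L"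
using Sb(1) by (auto simp: gsys_def)
have ind: "c s = 0" if "(SUM s:S. Cst (c s) * b s) : CI K L" "s : S" for c s
using Sb(2) that by (auto simp: independent_mod_def)
define co where "co y = (SOME c. hcomp j y - (SUM s:S. Cst (c s) * b s) : CI K L)" for y
have co: "hcomp j y - (SUM s:S. Cst (co y s) * b s) : CI K L" for y
unfolding co_def by (rule someI_ex[OF gen]) simp
have uniq: "c s = c' s" if "y - (SUM s:S. Cst (c s) * b s) : CI K L" "y - (SUM s:S. Cst (c' s) * b s) : CI K L" "s : S"
for c c' y s
proof -
have "(SUM s:S. Cst (c s - c' s) * b s) = (y - (SUM s:S. Cst (c' s) * b s)) - (y - (SUM s:S. Cst (c s) * b s))"
 by (simp add: rh_simps[OF ringhom_Cst] left_diff_distrib sum_subtractf)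
also have "... : CI K L" by (intro CI_closed that)
finally show ?thesis using ind[of "%s. c s - c' s", OF _ that(3)] by simp
qed
have lin_co: "linfun (%y. co y s)" if s: "s : S" for s
proof (rule linfunI)
fix p q c
from CI_closed(2)[OF co[of p] co[of q]]
have "hcomp j (p + q) - (SUM s:S. Cst (co p s + co q s) * b s) : CI K L"
 by (simp add: hcomp_add Cst_add distrib_right sum.distrib add_diff_add)
thus "co (p + q) s = co p s + co q s" by (rule uniq[OF co _ s])
from CI_closed(3)[OF co[of p], of "Cst c"]
have "hcomp j (Cst c * p) - (SUM s:S. Cst (c * co p s) * b s) : CI K L"
 by (simp add: hcomp_Cst_mult Cst_mult right_diff_distrib sum_distrib_left mult.assoc)
thus "co (Cst c * p) s = c * co p s" by (rule uniq[OF co _ s])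
qed
have co_kill: "co y s = 0" if "y : CI K L" "s : S" for y s
proof (rule uniq[OF co _ that(2)])
show "hcomp j y - (SUM s:S. Cst 0 * b s) : CI K L" using hcomp_CI[OF that(1)] by simp
qed
have "EX a. homog k a & (ALL q. homog j q --> co q s = D (a * q))" if "s : S" for s
using PD_on_surj[OF PD kj lin_co[OF that]] co_kill that by metis
then obtain a where a: "!!s. s : S ==> homog k (a s)" "!!s q. s : S ==> homog j q ==> co q s = D (a s * q)"
by metis
have y: "y - (SUM s:S. Cst (D (y * a s)) * b s) : CI K L" if y: "homog j y" for y
proof -
have "(SUM s:S. Cst (D (y * a s)) * b s) = (SUM s:S. Cst (co y s) * b s)"
 by (intro sum.cong refl) (simp add: a(2)[OF _ y] mult.commute)
thus ?thesis using co[of y] hcomp_homog[OF y, of j] by simp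
qed
have x: "x - (SUM s:S. Cst (D (x * b s)) * a s) : CI K L" if x: "homog k x" for x
proof (rule PD_on_inj[OF PD kj])
show "homog k (x - (SUM s:S. Cst (D (x * b s)) * a s))"
 by (intro homog_diff x homog_sum homog_Cst_mult a)
fix q :: "('v, 'a) mp" assume q: "homog j q"
have "D (x * q) = D (x * (SUM s:S. Cst (D (q * a s)) * b s))"
 by (rule lf_eq_mod[OF linD killD]) (use CI_closed(3)[OF y[OF q], of x] in "simp_all add: right_diff_distrib")
also have "... = (SUM s:S. D (q * a s) * D (x * b s))"
 by (simp add: sum_distrib_left mult.left_commute[of x] lf_simps[OF linD])
also have "... = (SUM s:S. D (x * b s) * D (a s * q))" by (simp only: mult.commute)
also have "... = D ((SUM s:S. Cst (D (x * b s)) * a s) * q)"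
 by (simp add: sum_distrib_right mult.assoc lf_simps[OF linD])
finally show "D ((x - (SUM s:S. Cst (D (x * b s)) * a s)) * q) = 0"
 by (simp add: left_diff_distrib lf_simps[OF linD])
qed
have "dsys (CI K L) D k j S a b"
unfolding dsys_def using S a(1) b x y by blast
thus ?thesis by blast
qed

locale product_complex =
A: ucx K1 L1 + B: ucx K2 L2 + C: ucx K12 L12
for K1 :: "'v set set" and L1 :: "('v => 'a::euclidean_ring) set"
and K2 :: "'u set set" and L2 :: "('u => 'a) set"
and K12 :: "'x set set" and L12 :: "('x => 'a) set" +
fixes g1 :: "'v => 'x" and g2 :: "'u => 'x" and d1 d2 w1 w2 w12 D1 D2 D12
assumes inj1: "inj_on g1 (\<Union>K1)" and inj2: "inj_on g2 (\<Union>K2)"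
and disj: "g1 ` \<Union>K1 Int g2 ` \<Union>K2 = {}"
and K12: "K12 = {g1 ` A Un g2 ` B |A B. A : K1 & B : K2}"
and ext1: "!!l. l : L1 ==> EX l':L12. (ALL v:\<Union>K1. l' (g1 v) = l v) & (ALL v:\<Union>K2. l' (g2 v) = 0)"
and ext2: "!!l. l : L2 ==> EX l':L12. (ALL v:\<Union>K1. l' (g1 v) = 0) & (ALL v:\<Union>K2. l' (g2 v) = l v)"
and dim1: "!!A. A : K1 ==> card A <= d1" and dim2: "!!A. A : K2 ==> card A <= d2"
and w12: "!!A B. A : K1 ==> B : K2 ==> card A = d1 ==> card B = d2 ==> w12 (g1 ` A Un g2 ` B) = w1 A * w2 B"
and D1: "is_deg K1 L1 d1 w1 D1" and D2: "is_deg K2 L2 d2 w2 D2"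
and D12: "is_deg K12 L12 (d1 + d2) w12 D12"
and PD1: "PD_on (CI K1 L1) D1 d1" and PD2: "PD_on (CI K2 L2) D2 d2"
begin

abbreviation "I1 == CI K1 L1"
abbreviation "I2 == CI K2 L2"
abbreviation "I12 == CI K12 L12"

lemma lin: "linfun D1" "linfun D2" "linfun D12" using D1 D2 D12 by (auto simp: is_deg_def)
lemma kill: "p : I1 ==> D1 p = 0" "q : I2 ==> D2 q = 0" "r : I12 ==> D12 r = 0"
using D1 D2 D12 by (auto simp: is_deg_def)

lemma K12I: "A : K1 ==> B : K2 ==> g1 ` A Un g2 ` B : K12"
unfolding K12 by blast

lemma K12E:
assumes "X : K12" obtains A B where "A : K1" "B : K2" "X = g1 ` A Un g2 ` B"
proof -
from assms have "EX A B. X = g1 ` A Un g2 ` B & A : K1 & B : K2" by (simp add: K12)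
thus ?thesis using that by blast
qed

lemma V12: "\<Union>K12 = g1 ` \<Union>K1 Un g2 ` \<Union>K2"
proof -
have "g1 ` \<Union>K1 <= \<Union>K12" using K12I[OF _ B.empty_face] by blast
moreover have "g2 ` \<Union>K2 <= \<Union>K12" using K12I[OF A.empty_face] by blast
moreover have "\<Union>K12 <= g1 ` \<Union>K1 Un g2 ` \<Union>K2"
proof
fix x assume "x : \<Union>K12"
then obtain X where "X : K12" "x : X" by blast
thus "x : g1 ` \<Union>K1 Un g2 ` \<Union>K2" by (elim K12E) blast
qed
ultimately show ?thesis by (simp only: set_eq_subset Un_least)
qed

lemma sum_V12: "(SUM x:\<Union>K12. h x) = (SUM v:\<Union>K1. h (g1 v)) + (SUM v:\<Union>K2. h (g2 v))"
unfolding V12 using A.finite_V B.finite_V disj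
by (subst sum.union_disjoint) (simp_all add: sum.reindex inj1 inj2)

definition ep1 :: "('v, 'a) mp => ('x, 'a) mp" where "ep1 = ren g1 (\<Union>K1)"
definition ep2 :: "('u, 'a) mp => ('x, 'a) mp" where "ep2 = ren g2 (\<Union>K2)"

lemma ringhom_ep: "ringhom ep1" "ringhom ep2" by (simp_all add: ep1_def ep2_def ringhom_ren)
lemmas ep_simps = rh_simps[OF ringhom_ep(1)] rh_simps[OF ringhom_ep(2)]
lemma ep_Cst: "ep1 (Cst c) = Cst c" "ep2 (Cst c) = Cst c" by (simp_all add: ep1_def ep2_def)
lemma ep_homog: "homog n p ==> homog n (ep1 p)" "homog n q ==> homog n (ep2 q)"
by (simp_all add: ep1_def ep2_def ren_homog)

lemma face1: "A <= \<Union>K1 ==> g1 ` A : K12 ==> A : K1"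
proof -
assume A: "A <= \<Union>K1" "g1 ` A : K12"
obtain A' B where AB: "A' : K1" "B : K2" "g1 ` A = g1 ` A' Un g2 ` B" using A(2) by (rule K12E)
have "g2 ` B <= g1 ` \<Union>K1" using AB(3) A(1) by blast
moreover have "g2 ` B <= g2 ` \<Union>K2" using AB(2) by blast
ultimately have "g2 ` B <= g1 ` \<Union>K1 Int g2 ` \<Union>K2" by (rule Int_greatest)
hence "g1 ` A = g1 ` A'" using AB(3) unfolding disj by simp
hence "A = A'" by (rule iffD1[OF inj_on_image_eq_iff[OF inj1 A(1) Union_upper[OF AB(1)]]])
thus ?thesis using AB(1) by simp
qed

lemma face2: "A <= \<Union>K2 ==> g2 ` A : K12 ==> A : K2"
proof -
assume A: "A <= \<Union>K2" "g2 ` A : K12"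
obtain A' B where AB: "A' : K1" "B : K2" "g2 ` A = g1 ` A' Un g2 ` B" using A(2) by (rule K12E)
have "g1 ` A' <= g2 ` \<Union>K2" using AB(3) A(1) by blast
moreover have "g1 ` A' <= g1 ` \<Union>K1" using AB(1) by blast
ultimately have "g1 ` A' <= g1 ` \<Union>K1 Int g2 ` \<Union>K2" by (intro Int_greatest)
hence "g2 ` A = g2 ` B" using AB(3) unfolding disj by simp
hence "A = B" by (rule iffD1[OF inj_on_image_eq_iff[OF inj2 A(1) Union_upper[OF AB(2)]]])
thus ?thesis using AB(2) by simp
qed

lemma ep1_I: "p : I1 ==> ep1 p : I12"
unfolding ep1_def
proof (rule ren_CI[OF A.ucx_axioms inj1 C.is_ideal_CI])
show "xprod (g1 ` A) : I12" if "A <= \<Union>K1" "finite A" "A ~: K1" for A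
using that face1 by (intro C.xprod_CI) auto
fix l assume "l : L1"
from ext1[OF `l : L1`] obtain l' where "l' : L12" "ALL v:\<Union>K1. l' (g1 v) = l v" "ALL v:\<Union>K2. l' (g2 v) = 0" by (elim bexE conjE)
note l' = this(1) bspec[OF this(2)] bspec[OF this(3)]
have "lin_form K12 l' = (SUM v:\<Union>K1. Cst (l v) * Var (g1 v))"
unfolding lin_form_def sum_V12 using l'(2,3) by simp
thus "(SUM v:\<Union>K1. Cst (l v) * Var (g1 v)) : I12" using C.lin_CI[OF l'(1)] by simp
qed

lemma ep2_I: "p : I2 ==> ep2 p : I12"
unfolding ep2_def
proof (rule ren_CI[OF B.ucx_axioms inj2 C.is_ideal_CI])
show "xprod (g2 ` A) : I12" if "A <= \<Union>K2" "finite A" "A ~: K2" for A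
using that face2 by (intro C.xprod_CI) auto
fix l assume "l : L2"
from ext2[OF `l : L2`] obtain l' where "l' : L12" "ALL v:\<Union>K1. l' (g1 v) = 0" "ALL v:\<Union>K2. l' (g2 v) = l v" by (elim bexE conjE)
note l' = this(1) bspec[OF this(2)] bspec[OF this(3)]
have "lin_form K12 l' = (SUM v:\<Union>K2. Cst (l v) * Var (g2 v))"
unfolding lin_form_def sum_V12 using l'(2,3) by simp
thus "(SUM v:\<Union>K2. Cst (l v) * Var (g2 v)) : I12" using C.lin_CI[OF l'(1)] by simp
qed

lemma lin_ep1: "linfun (%p. D12 (ep1 p * r))"
by (rule linfunI) (simp_all add: ep_simps ep_Cst distrib_right mult.assoc lf_simps[OF lin(3)])
lemma lin_ep2: "linfun (%q. D12 (r * ep2 q))"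
by (rule linfunI) (simp_all add: ep_simps ep_Cst distrib_left mult.left_commute[of r] lf_simps[OF lin(3)])

text \<open>With one factor fixed, both sides are functionals in the other factor that vanish on its
  ideal, so comparing facets suffices, twice.\<close>

lemma D12_top:
assumes "homog d1 p" "homog d2 q" shows "D12 (ep1 p * ep2 q) = D1 p * D2 q"
proof (rule A.deg_unique[OF lin_ep1 _ _ _ _ assms(1)])
show "D12 (ep1 p * ep2 q) = 0" if "p : I1" for p by (intro kill C.CI_closed ep1_I that)
show "linfun (%p. D1 p * D2 q)" by (rule linfunI) (simp_all add: lf_simps[OF lin(1)] distrib_right mult.assoc)
show "D1 p * D2 q = 0" if "p : I1" for p using kill(1)[OF that] by simp
fix A assume A: "A : K1" "card A = d1"
show "D12 (ep1 (xprod A) * ep2 q) = D1 (xprod A) * D2 q"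
proof (rule B.deg_unique[OF lin_ep2 _ _ _ _ assms(2)])
show "D12 (ep1 (xprod A) * ep2 q) = 0" if "q : I2" for q by (intro kill C.CI_closed ep2_I that)
show "linfun (%q. D1 (xprod A) * D2 q)"
 by (rule linfunI) (simp_all add: lf_simps[OF lin(2)] distrib_left mult.left_commute)
show "D1 (xprod A) * D2 q = 0" if "q : I2" for q using kill(2)[OF that] by simp
fix B assume B: "B : K2" "card B = d2"
have fin: "finite A" "finite B" using A B A.finite_face B.finite_face by auto
have AV: "A <= \<Union>K1" "B <= \<Union>K2" using A B by auto
have i: "inj_on g1 A" "inj_on g2 B" using inj1 inj2 AV inj_on_subset by blast+
have dis: "g1 ` A Int g2 ` B = {}" using disj AV by blast
have "card (g1 ` A Un g2 ` B) = d1 + d2"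
 using fin dis i A B by (simp add: card_Un_disjoint card_image)
moreover have "ep1 (xprod A) * ep2 (xprod B) = xprod (g1 ` A Un g2 ` B)"
 using AV fin dis by (simp add: ep1_def ep2_def ren_xprod inj1 inj2 xprod_Un)
moreover have "g1 ` A Un g2 ` B : K12" using A(1) B(1) by (rule K12I)
ultimately show "D12 (ep1 (xprod A) * ep2 (xprod B)) = D1 (xprod A) * D2 (xprod B)"
 using D1 D2 D12 A B w12 by (simp add: is_deg_def)
qed
qed

text \<open>If the degrees are distributed differently from \<open>d1\<close> and \<open>d2\<close>,
  one factor lies above its dimension and is zero.\<close>

lemma D12_prod:
assumes "homog i p" "homog j q" "i + j = d1 + d2"
shows "D12 (ep1 p * ep2 q) = (if i = d1 then D1 p * D2 q else 0)"
proof -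
consider "i = d1" "j = d2" | "i > d1" | "i < d1" "j > d2" using assms(3) by linarith
thus ?thesis
proof cases
case 1 thus ?thesis using D12_top assms by simp
next
case 2
hence "ep1 p : I12" by (intro ep1_I A.above_dim[OF dim1 assms(1)])
thus ?thesis using 2 by (simp add: kill(3) C.CI_closed(4))
next
case 3
hence "ep2 q : I12" by (intro ep2_I B.above_dim[OF dim2 assms(2)])
thus ?thesis using 3 by (simp add: kill(3) C.CI_closed(3))
qed
qed

lemma ex_systems:
"EX S a b. ALL i<=d1. dsys I1 D1 i (d1 - i) (S i) (a i) (b i)"
"EX S a b. ALL i<=d2. dsys I2 D2 i (d2 - i) (S i) (a i) (b i)"
proof -
have 1: "EX S a b. dsys I1 D1 i (d1 - i) S a b" if "i <= d1" for i
by (rule ex_dual_system[OF A.ucx_axioms D1 PD1]) (use that in simp)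
have 2: "EX S a b. dsys I2 D2 i (d2 - i) S a b" if "i <= d2" for i
by (rule ex_dual_system[OF B.ucx_axioms D2 PD2]) (use that in simp)
show "EX S a b. ALL i<=d1. dsys I1 D1 i (d1 - i) (S i) (a i) (b i)" using 1 by metis
show "EX S a b. ALL i<=d2. dsys I2 D2 i (d2 - i) (S i) (a i) (b i)" using 2 by metis
qed

lemma mod_mult:
assumes "p - p' : I1" "q - q' : I2" shows "ep1 p * ep2 q - ep1 p' * ep2 q' : I12"
proof -
have "ep1 p * ep2 q - ep1 p' * ep2 q' = ep1 (p - p') * ep2 q + ep1 p' * ep2 (q - q')"
by (simp add: ep_simps algebra_simps)
thus ?thesis using ep1_I[OF assms(1)] ep2_I[OF assms(2)] C.CI_closed by auto
qed

text \<open>Every polynomial is, modulo the ideal, a combination of products of homogeneous elements of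
the factors.\<close>

lemma product_induct [consumes 1, case_names add ideal prod]:
assumes x: "homog k x"
and add: "!!x y. P x ==> P y ==> P (x + y)"
and ideal: "!!x. homog k x ==> x : I12 ==> P x"
and prod: "!!i j p q. i + j = k ==> homog i p ==> homog j q ==> P (ep1 p * ep2 q)"
shows "P x"
proof -
define splits where "splits m <->
(EX i j p q. i + j = mdeg m & homog i p & homog j q & single m 1 = ep1 p * ep2 q)" for m
have mono: "splits m | single m 1 : I12" for m
proof (induction m rule: mval_induct)
case zero
have "single 0 1 = ep1 1 * ep2 1" by (simp add: ep_simps)
hence "splits 0" unfolding splits_def
 by (intro exI[of _ 0] exI[of _ 1] conjI) simp_all
thus ?case ..
next
case (add v m)
have s: "single (single v 1 + m) 1 = Var v * single m (1::'a)" by (simp add: Var_def mult_single)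
show ?case
proof (cases "single m (1::'a) : I12 | v ~: \<Union>K12")
 case True
 hence "Var v * single m 1 : I12"
  by (elim disjE) (rule C.CI_closed(3), assumption, rule C.CI_closed(4)[OF C.Var_in_CI])
 thus ?thesis unfolding s by (rule disjI2)
next
 case False
 hence nf: "single m (1::'a) ~: I12" "v : g1 ` \<Union>K1 Un g2 ` \<Union>K2" by (simp_all only: de_Morgan_disj not_not V12 simp_thms)
 from add nf(1) have "splits m" by simp
 then obtain i j p q where pq: "i + j = mdeg m" "homog i p" "homog j q" "single m 1 = ep1 p * ep2 q"
  unfolding splits_def by blast
 from nf(2) consider u where "u : \<Union>K1" "v = g1 u" | u where "u : \<Union>K2" "v = g2 u"
  by (elim UnE imageE)
 thus ?thesis
 proof cases
  case 1
  hence "single (single v 1 + m) 1 = ep1 (Var u * p) * ep2 q"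
   unfolding s pq(4) by (simp add: ep_simps) (simp add: ep1_def ren_Var mult.assoc)
  moreover have "homog (Suc i) (Var u * p)" using pq(2) by (intro homog_mult_Suc) auto
  moreover have "Suc i + j = mdeg (single v 1 + m)" using pq(1) by (simp add: mdeg_add)
  ultimately show ?thesis using pq(3) unfolding splits_def
   by (intro disjI1 exI[of _ "Suc i"] exI[of _ j] exI[of _ "Var u * p"] exI[of _ q] conjI)
 next
  case 2
  hence "single (single v 1 + m) 1 = ep1 p * ep2 (Var u * q)"
   unfolding s pq(4) by (simp add: ep_simps) (simp add: ep2_def ren_Var mult.left_commute)
  moreover have "homog (Suc j) (Var u * q)" using pq(3) by (intro homog_mult_Suc) auto
  moreover have "i + Suc j = mdeg (single v 1 + m)" using pq(1) by (simp add: mdeg_add)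
  ultimately show ?thesis using pq(2) unfolding splits_def
   by (intro disjI1 exI[of _ i] exI[of _ "Suc j"] exI[of _ p] exI[of _ "Var u * q"] conjI)
 qed
qed
qed
from x show ?thesis
proof (induction rule: homog_induct)
case zero
show ?case by (rule ideal) (simp_all add: C.CI_closed(1))
next
case (add m c p)
have "P (single m c)"
proof (cases "single m (1::'a) : I12")
 case True
 hence "single m c : I12" by (subst single_Cst) (rule C.CI_closed(3))
 thus ?thesis by (intro ideal homog_single add)
next
 case False
 hence "splits m" using mono by blast
 then obtain i j p q where pq: "i + j = mdeg m" "homog i p" "homog j q" "single m 1 = ep1 p * ep2 q"
  unfolding splits_def by blast
 have "single m c = ep1 (Cst c * p) * ep2 q"
  by (subst single_Cst) (simp add: pq(4) ep_simps ep_Cst mult.assoc)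
 thus ?thesis using prod[OF pq(1)[unfolded add(2)] homog_Cst_mult[OF pq(2)] pq(3)] by simp
qed
thus ?case using add(1) by (rule assms(2))
qed
qed

text \<open>The products \<open>al\<close> and \<open>be\<close> of dual systems of the factors
  satisfy the two expansions \<open>X\<close> and \<open>Y\<close>, checked on products of classes.
  Duality is then read off: zero pairings give a zero expansion, and a functional is represented by
  the \<open>al\<close> with its values on the \<open>be\<close> as coefficients.\<close>

theorem PD_product: "PD_on I12 D12 (d1 + d2)"
proof -
obtain S1 a1 b1 where ds1: "!!i. i <= d1 ==> dsys I1 D1 i (d1 - i) (S1 i) (a1 i) (b1 i)"
using ex_systems(1) by metis
obtain S2 a2 b2 where ds2: "!!i. i <= d2 ==> dsys I2 D2 i (d2 - i) (S2 i) (a2 i) (b2 i)"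
using ex_systems(2) by metis
define ix where "ix k = (SIGMA i:{i. i <= k & i <= d1 & k - i <= d2}. S1 i \<times> S2 (k - i))" for k
define al where "al k z = (case z of (i, s, t) => ep1 (a1 i s) * ep2 (a2 (k - i) t))" for k z
define be where "be k z = (case z of (i, s, t) => ep1 (b1 i s) * ep2 (b2 (k - i) t))" for k z
have fin1: "finite (S1 i)" if "i <= d1" for i using ds1[OF that] by (simp add: dsys_def)
have fin2: "finite (S2 i)" if "i <= d2" for i using ds2[OF that] by (simp add: dsys_def)
have fin_ix: "finite (ix k)" for k unfolding ix_def by (intro finite_SigmaI finite_cartesian_product) (auto intro: fin1 fin2)
have hom1: "homog i (a1 i s)" "homog (d1 - i) (b1 i s)" if "i <= d1" "s : S1 i" for i s
using ds1[OF that(1)] that(2) by (simp_all add: dsys_def)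
have hom2: "homog i (a2 i s)" "homog (d2 - i) (b2 i s)" if "i <= d2" "s : S2 i" for i s
using ds2[OF that(1)] that(2) by (simp_all add: dsys_def)
have hal: "homog k (al k z)" if "z : ix k" for k z
proof -
obtain i s t where z: "z = (i, s, t)" "i <= k" "i <= d1" "k - i <= d2" "s : S1 i" "t : S2 (k - i)"
 using `z : ix k` by (auto simp: ix_def)
have "homog (i + (k - i)) (al k z)" unfolding al_def z(1) prod.case
 by (intro homog_mult ep_homog hom1 hom2 z)
thus ?thesis using z(2) by simp
qed
have hbe: "homog j (be k z)" if "z : ix k" "k + j = d1 + d2" for k j z
proof -
obtain i s t where z: "z = (i, s, t)" "i <= k" "i <= d1" "k - i <= d2" "s : S1 i" "t : S2 (k - i)"
 using `z : ix k` by (auto simp: ix_def)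
have "homog ((d1 - i) + (d2 - (k - i))) (be k z)" unfolding be_def z(1) prod.case
 by (intro homog_mult ep_homog hom1 hom2 z)
moreover have "(d1 - i) + (d2 - (k - i)) = j" using z that by linarith
ultimately show ?thesis by simp
qed
have sum_ix: "(SUM z:ix k. h z) = (SUM i | i <= k & i <= d1 & k - i <= d2. SUM s:S1 i. SUM t:S2 (k - i). h (i, s, t))"
for k and h :: "_ => ('x, 'a) mp"
proof -
let ?A = "{i. i <= k & i <= d1 & k - i <= d2}"
have "(SUM i:?A. SUM y:S1 i \<times> S2 (k - i). h (i, y)) = (SUM (i, y):ix k. h (i, y))"
 unfolding ix_def by (rule sum.Sigma) (auto intro: fin1 fin2)
moreover have "(SUM s:S1 i. SUM t:S2 (k - i). h (i, s, t)) = (SUM y:S1 i \<times> S2 (k - i). h (i, y))" for i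
 by (simp add: sum.cartesian_product split_def)
ultimately show ?thesis by (simp add: split_def)
qed
have dsum: "(SUM s:S. SUM t:T. Cst (x s * y t) * (ep1 (u s) * ep2 (v t))) =
 ep1 (SUM s:S. Cst (x s) * u s) * ep2 (SUM t:T. Cst (y t) * v t)"
for S T :: "nat set" and x y u v
by (simp add: ep_simps ep_Cst sum_product Cst_mult algebra_simps)
have X: "x - (SUM z:ix k. Cst (D12 (x * be k z)) * al k z) : I12"
if x: "homog k x" and kj: "k + j = d1 + d2" for x k j
using x
proof (induction rule: product_induct)
case (add x y)
from C.CI_closed(2)[OF add] show ?case
 by (simp add: distrib_right lf_simps[OF lin(3)] Cst_add sum.distrib add_diff_add)
next
case (ideal x)
hence "D12 (x * be k z) = 0" for z by (intro kill C.CI_closed)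
thus ?case using ideal by simp
next
case (prod i' j' p q)
have val: "Cst (D12 (ep1 p * ep2 q * be k (i, s, t))) * al k (i, s, t)
  = (if i = i' then Cst (D1 (p * b1 i s) * D2 (q * b2 (k - i) t)) * al k (i, s, t) else 0)"
 if i: "i <= k" "i <= d1" "k - i <= d2" and st: "s : S1 i" "t : S2 (k - i)" for i s t
proof -
 have "ep1 p * ep2 q * be k (i, s, t) = ep1 (p * b1 i s) * ep2 (q * b2 (k - i) t)"
  by (simp add: be_def ep_simps ac_simps)
 moreover have "D12 ... = (if i' + (d1 - i) = d1 then D1 (p * b1 i s) * D2 (q * b2 (k - i) t) else 0)"
  by (rule D12_prod[OF homog_mult[OF prod(2) hom1(2)[OF i(2) st(1)]] homog_mult[OF prod(3) hom2(2)[OF i(3) st(2)]]])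
    (use i kj prod(1) in linarith)
 moreover have "i' + (d1 - i) = d1 <-> i = i'" using i by linarith
 ultimately show ?thesis by simp
qed
have "(SUM z:ix k. Cst (D12 (ep1 p * ep2 q * be k z)) * al k z) =
 (SUM i | i <= k & i <= d1 & k - i <= d2. if i = i' then
   (SUM s:S1 i'. SUM t:S2 j'. Cst (D1 (p * b1 i' s) * D2 (q * b2 j' t)) * (ep1 (a1 i' s) * ep2 (a2 j' t))) else 0)"
 unfolding sum_ix
proof (intro sum.cong refl)
 fix i assume "i : {i. i <= k & i <= d1 & k - i <= d2}"
 hence i: "i <= k" "i <= d1" "k - i <= d2" by auto
 have "(SUM s:S1 i. SUM t:S2 (k - i). Cst (D12 (ep1 p * ep2 q * be k (i, s, t))) * al k (i, s, t)) =
  (SUM s:S1 i. SUM t:S2 (k - i). if i = i' then Cst (D1 (p * b1 i s) * D2 (q * b2 (k - i) t)) * al k (i, s, t) else 0)"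
  by (intro sum.cong refl val i)
 moreover have "k - i' = j'" using prod(1) by simp
 ultimately show "(SUM s:S1 i. SUM t:S2 (k - i). Cst (D12 (ep1 p * ep2 q * be k (i, s, t))) * al k (i, s, t)) =
  (if i = i' then (SUM s:S1 i'. SUM t:S2 j'. Cst (D1 (p * b1 i' s) * D2 (q * b2 j' t)) * (ep1 (a1 i' s) * ep2 (a2 j' t))) else 0)"
  by (auto simp: al_def)
qed
also have "... = (if i' <= d1 & j' <= d2 then
   ep1 (SUM s:S1 i'. Cst (D1 (p * b1 i' s)) * a1 i' s) * ep2 (SUM t:S2 j'. Cst (D2 (q * b2 j' t)) * a2 j' t) else 0)"
proof -
 have "k - i' = j'" "i' <= k" using prod(1) by auto
 thus ?thesis by (simp add: sum.delta dsum)
qed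
finally have T: "(SUM z:ix k. Cst (D12 (ep1 p * ep2 q * be k z)) * al k z) = ..." .
show ?case
proof (cases "i' <= d1 & j' <= d2")
 case True
 hence "p - (SUM s:S1 i'. Cst (D1 (p * b1 i' s)) * a1 i' s) : I1" "q - (SUM t:S2 j'. Cst (D2 (q * b2 j' t)) * a2 j' t) : I2"
  using ds1[of i'] ds2[of j'] prod by (auto simp: dsys_def)
 from mod_mult[OF this] show ?thesis using T True by simp
next
 case False
 hence "ep1 p * ep2 q : I12"
  using ep1_I[OF A.above_dim[OF dim1 prod(2)]] ep2_I[OF B.above_dim[OF dim2 prod(3)]] C.CI_closed(3,4)
  by (meson not_le)
 thus ?thesis using T False by simp
qed
qed
have Y: "y - (SUM z:ix k. Cst (D12 (y * al k z)) * be k z) : I12"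
if y: "homog j y" and kj: "k + j = d1 + d2" for y k j
using y
proof (induction rule: product_induct)
case (add x y)
from C.CI_closed(2)[OF add] show ?case
 by (simp add: distrib_right lf_simps[OF lin(3)] Cst_add sum.distrib add_diff_add)
next
case (ideal x)
hence "D12 (x * al k z) = 0" for z by (intro kill C.CI_closed)
thus ?case using ideal by simp
next
case (prod i' j' p q)
\<comment> \<open>Only generators of the complementary degree in the first factor can pair
  nontrivially with \<open>p\<close>.\<close>
define i0 where "i0 = d1 - i'"
have val: "Cst (D12 (ep1 p * ep2 q * al k (i, s, t))) * be k (i, s, t)
  = (if i = i0 & i' <= d1 then Cst (D1 (p * a1 i s) * D2 (q * a2 (k - i) t)) * be k (i, s, t) else 0)"
 if i: "i <= k" "i <= d1" "k - i <= d2" and st: "s : S1 i" "t : S2 (k - i)" for i s t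
proof -
 have "ep1 p * ep2 q * al k (i, s, t) = ep1 (p * a1 i s) * ep2 (q * a2 (k - i) t)"
  by (simp add: al_def ep_simps ac_simps)
 moreover have "D12 ... = (if i' + i = d1 then D1 (p * a1 i s) * D2 (q * a2 (k - i) t) else 0)"
  by (rule D12_prod[OF homog_mult[OF prod(2) hom1(1)[OF i(2) st(1)]] homog_mult[OF prod(3) hom2(1)[OF i(3) st(2)]]])
    (use i kj prod(1) in linarith)
 moreover have "i' + i = d1 <-> i = i0 & i' <= d1" using i by (auto simp: i0_def)
 ultimately show ?thesis by simp
qed
have T: "(SUM z:ix k. Cst (D12 (ep1 p * ep2 q * al k z)) * be k z) =
 (SUM i | i <= k & i <= d1 & k - i <= d2. if i = i0 then (if i' <= d1 then
   (SUM s:S1 i0. SUM t:S2 (k - i0). Cst (D1 (p * a1 i0 s) * D2 (q * a2 (k - i0) t)) * (ep1 (b1 i0 s) * ep2 (b2 (k - i0) t))) else 0) else 0)"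
 unfolding sum_ix
proof (intro sum.cong refl)
 fix i assume "i : {i. i <= k & i <= d1 & k - i <= d2}"
 hence i: "i <= k" "i <= d1" "k - i <= d2" by auto
 have "(SUM s:S1 i. SUM t:S2 (k - i). Cst (D12 (ep1 p * ep2 q * al k (i, s, t))) * be k (i, s, t)) =
  (SUM s:S1 i. SUM t:S2 (k - i). if i = i0 & i' <= d1 then Cst (D1 (p * a1 i s) * D2 (q * a2 (k - i) t)) * be k (i, s, t) else 0)"
  by (intro sum.cong refl val i)
 thus "(SUM s:S1 i. SUM t:S2 (k - i). Cst (D12 (ep1 p * ep2 q * al k (i, s, t))) * be k (i, s, t)) =
  (if i = i0 then (if i' <= d1 then
   (SUM s:S1 i0. SUM t:S2 (k - i0). Cst (D1 (p * a1 i0 s) * D2 (q * a2 (k - i0) t)) * (ep1 (b1 i0 s) * ep2 (b2 (k - i0) t))) else 0) else 0)"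
  by (auto simp: be_def)
qed
show ?case
proof (cases "i' <= d1 & j' <= d2")
 case True
 hence i0: "i0 <= k" "i0 <= d1" "k - i0 <= d2" "d1 - i0 = i'" "d2 - (k - i0) = j'"
  using prod(1) kj by (auto simp: i0_def)
 have "p - (SUM s:S1 i0. Cst (D1 (p * a1 i0 s)) * b1 i0 s) : I1"
  using ds1[OF i0(2)] prod(2) i0(4) by (auto simp: dsys_def)
 moreover have "q - (SUM t:S2 (k - i0). Cst (D2 (q * a2 (k - i0) t)) * b2 (k - i0) t) : I2"
  using ds2[OF i0(3)] prod(3) i0(5) by (auto simp: dsys_def)
 ultimately have "ep1 p * ep2 q - ep1 (SUM s:S1 i0. Cst (D1 (p * a1 i0 s)) * b1 i0 s) *
  ep2 (SUM t:S2 (k - i0). Cst (D2 (q * a2 (k - i0) t)) * b2 (k - i0) t) : I12" by (rule mod_mult)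
 thus ?thesis unfolding T using True i0 by (simp add: sum.delta dsum)
next
 case False
 hence "ep1 p * ep2 q : I12"
  using ep1_I[OF A.above_dim[OF dim1 prod(2)]] ep2_I[OF B.above_dim[OF dim2 prod(3)]] C.CI_closed(3,4)
  by (meson not_le)
 hence "D12 (ep1 p * ep2 q * al k z) = 0" for z by (rule kill(3)[OF C.CI_closed(4)])
 thus ?thesis using `ep1 p * ep2 q : I12` by simp
qed
qed
show ?thesis
proof (rule PD_onI)
fix k j and p :: "('x, 'a) mp" assume kj: "k + j = d1 + d2" and p: "homog k p" and z: "!!q. homog j q ==> D12 (p * q) = 0"
have "(SUM z:ix k. Cst (D12 (p * be k z)) * al k z) = 0"
 by (intro sum.neutral ballI) (simp add: z[OF hbe[OF _ kj]])
thus "p : I12" using X[OF p kj] by simp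
next
fix k j ph assume kj: "k + j = d1 + d2" and ph: "linfun ph" and z: "!!p. p : I12 ==> ph p = 0"
define p where "p = (SUM z:ix k. Cst (ph (be k z)) * al k z)"
have "homog k p" unfolding p_def by (intro homog_sum homog_Cst_mult hal)
moreover have "ph q = D12 (p * q)" if q: "homog j q" for q
proof -
 have "ph q = ph (SUM z:ix k. Cst (D12 (q * al k z)) * be k z)"
  by (rule lf_eq_mod[OF ph z Y[OF q kj]])
 also have "... = (SUM z:ix k. D12 (q * al k z) * ph (be k z))" by (simp add: lf_simps[OF ph])
 also have "... = (SUM z:ix k. ph (be k z) * D12 (al k z * q))" by (simp only: mult.commute)
 also have "... = D12 (p * q)"
  by (simp add: p_def sum_distrib_right mult.assoc lf_simps[OF lin(3)])
 finally show ?thesis .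
qed
ultimately show "EX p. homog k p & (ALL q. homog j q --> ph q = D12 (p * q))" by blast
qed
qed

end

section \<open>Simplicial cones on lattice bases: coordinates, faces, primitive vectors\<close>

section \<open>Unimodular cones\<close>

abbreviation cn :: "vec set => vec set" where "cn B == convex_cone hull B"

lemma lookup_scaleR: "lookup (r *\<^sub>R (x :: vec)) i = r * lookup x i"
proof -
have "finite {i. r * lookup x i ~= 0}"
by (rule finite_subset[OF _ finite_lookup[of x]]) auto
thus ?thesis by (simp add: scaleR_poly_mapping_def)
qed

lemma mem_Zlat: "v : Zlat n <-> (ALL i. lookup v i : \<int>) & (ALL i>=n. lookup v i = 0)"
by (simp add: Zlat_def)

lemma Zlat_add: "x : Zlat n ==> y : Zlat n ==> x + y : Zlat n"
by (simp add: mem_Zlat lookup_add)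
lemma Zlat_diff: "x : Zlat n ==> y : Zlat n ==> x - y : Zlat n"
by (simp add: mem_Zlat lookup_minus)
lemma Zlat_0 [simp]: "0 : Zlat n" by (simp add: mem_Zlat)
lemma Zlat_scale: "x : Zlat n ==> of_int c *\<^sub>R x : Zlat n"
by (simp add: mem_Zlat lookup_scaleR)
lemma Zlat_sum: "(!!a. a : A ==> f a : Zlat n) ==> sum f A : Zlat n"
by (induction A rule: infinite_finite_induct) (auto simp: Zlat_add)
lemma Zlat_Rspace: "Zlat n <= Rspace n" by (auto simp: Zlat_def Rspace_def)
lemma sub_Rspace: "subspace (Rspace n)"
by (auto simp: subspace_def Rspace_def lookup_add lookup_scaleR)

text \<open>The coordinate function of \<open>b\<close>, extended linearly to the whole space by
  choice; outside \<open>span B\<close> its values carry no information.\<close>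

definition co :: "vec set => vec => vec => real" where
"co B b = (SOME g. linear g & (ALL x:B. g x = (if x = b then 1 else 0)))"

lemma co:
assumes "independent B"
shows "linear (co B b)" "x : B ==> co B b x = (if x = b then 1 else 0)"
proof -
have "EX g :: vec => real. linear g & (ALL x:B. g x = (if x = b then 1 else 0))"
by (rule linear_independent_extend[OF assms])
hence "linear (co B b) & (ALL x:B. co B b x = (if x = b then 1 else 0))"
unfolding co_def by (rule someI_ex)
thus "linear (co B b)" "x : B ==> co B b x = (if x = b then 1 else 0)" by auto
qed

lemma co_sum:
assumes "independent B" "finite B" "b : B" shows "co B b (SUM x:B. c x *\<^sub>R x) = c b"
proof -
have "co B b (SUM x:B. c x *\<^sub>R x) = (SUM x:B. c x * co B b x)"
by (simp add: linear_sum[OF co(1)[OF assms(1)]] linear_scale[OF co(1)[OF assms(1)]])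
also have "... = (SUM x:B. if x = b then c b else 0)"
by (intro sum.cong) (auto simp: co(2)[OF assms(1)])
finally show ?thesis using assms by simp
qed

lemma co_span:
assumes "independent B" "finite B" "x : span B" shows "(SUM b:B. co B b x *\<^sub>R b) = x"
proof -
obtain c where "x = (SUM b:B. c b *\<^sub>R b)" using assms(3) by (auto simp: span_finite[OF assms(2)])
thus ?thesis using co_sum[OF assms(1,2)] by simp
qed

lemma co_zero:
assumes "independent B" "C <= B" "b ~: C" "x : span C" shows "co B b x = 0"
using linear_eq_0_on_span[OF co(1)[OF assms(1)] _ assms(4)] co(2)[OF assms(1)] assms(2,3)
by (metis subsetD)

lemma span_sub_iff:
assumes "independent B" "finite B" "C <= B" "x : span B"
shows "x : span C <-> (ALL b:B - C. co B b x = 0)"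
proof
assume z: "ALL b:B - C. co B b x = 0"
have "x = (SUM b:B. co B b x *\<^sub>R b)" using co_span[OF assms(1,2,4)] by simp
also have "... = (SUM b:C. co B b x *\<^sub>R b)"
by (rule sum.mono_neutral_right) (use assms z in auto)
also have "... : span C" by (intro span_sum span_scale span_base)
finally show "x : span C" .
qed (use co_zero[OF assms(1,3)] in auto)

lemma span_cone_of [simp]: "span (cn B) = span B"
proof
have "convex_cone (span B)" by (simp add: convex_cone_iff span_zero span_add span_scale)
hence "cn B <= span B" by (intro hull_minimal) (auto simp: span_base)
thus "span (cn B) <= span B" by (rule span_minimal) (rule subspace_span)
qed (intro span_mono hull_subset)

lemma mem_cone_of:
assumes B: "independent B" "finite B"
shows "x : cn B <-> x : span B & (ALL b:B. 0 <= co B b x)"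
proof -
let ?C = "{x : span B. ALL b:B. 0 <= co B b x}"
have "convex_cone ?C"
by (auto simp: convex_cone_iff span_zero span_add span_scale linear_add[OF co(1)[OF B(1)]]
  linear_scale[OF co(1)[OF B(1)]] linear_0[OF co(1)[OF B(1)]])
hence "cn B <= ?C" using B by (intro hull_minimal) (auto simp: span_base co)
moreover have "x : cn B" if "x : ?C" for x
proof -
have "(SUM b:A. co B b x *\<^sub>R b) : cn B" if "A <= B" "finite A" for A
 using that(2,1) `x : ?C`
 by (induction A rule: finite_induct)
   (auto simp: convex_cone_hull_contains_0 hull_inc intro!: convex_cone_hull_add convex_cone_hull_mul)
from this[of B] show ?thesis using co_span[OF B] that B(2) by simp
qed
ultimately show ?thesis by blast
qed

lemma cone_of_sub_iff:
assumes B: "independent B" "finite B" and C: "C <= B"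
shows "x : cn C <-> x : cn B & (ALL b:B - C. co B b x = 0)"
proof -
have iC: "independent C" "finite C" using B C independent_mono finite_subset by blast+
have eq: "co C b x = co B b x" if "x : span C" "b : C" for b
proof -
have "(SUM b:B. (if b : C then co C b x else 0) *\<^sub>R b) = (SUM b:C. co C b x *\<^sub>R b)"
 by (rule sum.mono_neutral_cong_right) (use B C in auto)
hence "x = (SUM b:B. (if b : C then co C b x else 0) *\<^sub>R b)"
 using co_span[OF iC that(1)] by simp
thus ?thesis using co_sum[OF B, of b "%b. if b : C then co C b x else 0"] that C by auto
qed
show ?thesis
proof
assume "x : cn C"
hence "x : span C" "ALL b:C. 0 <= co C b x" using mem_cone_of[OF iC] by auto
moreover have "x : span B" using span_mono[OF C] calculation(1) by blast
moreover have z: "ALL b:B - C. co B b x = 0" using co_zero[OF B(1) C] calculation(1) by auto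
moreover have "0 <= co B b x" if "b : B" for b
 using that eq[OF calculation(1), of b] calculation(2) z by (cases "b : C") auto
ultimately show "x : cn B & (ALL b:B - C. co B b x = 0)" using mem_cone_of[OF B] by auto
next
assume x: "x : cn B & (ALL b:B - C. co B b x = 0)"
hence "x : span B" "ALL b:B. 0 <= co B b x" using mem_cone_of[OF B] by auto
moreover have "x : span C" using span_sub_iff[OF B C calculation(1)] x by auto
ultimately show "x : cn C" using mem_cone_of[OF iC] eq C by auto
qed
qed

lemma cone_face_sub:
assumes B: "independent B" "finite B" and C: "C <= B"
shows "cone_face (cn C) (cn B)"
unfolding cone_face_def face_of_def
proof (intro conjI ballI impI)
show "cn C <= cn B" by (rule hull_mono[OF C])
show "convex (cn C)" by (rule convex_convex_cone_hull)
show "cn C ~= {}" by (rule convex_cone_hull_nonempty)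
fix a b x assume a: "a : cn B" and b: "b : cn B" and x: "x : cn C" "x : open_segment a b"
obtain u where u: "0 < u" "u < 1" "x = (1 - u) *\<^sub>R a + u *\<^sub>R b" using x(2) by (auto simp: in_segment)
have z: "co B y a = 0 & co B y b = 0" if "y : B - C" for y
proof -
have "0 = (1 - u) * co B y a + u * co B y b"
 using x(1) that cone_of_sub_iff[OF B C, of x]
 by (simp add: u(3) linear_add[OF co(1)[OF B(1)]] linear_scale[OF co(1)[OF B(1)]])
moreover have "0 <= co B y a" "0 <= co B y b" using a b that mem_cone_of[OF B] by auto
ultimately show ?thesis using u
 by (smt (verit, ccfv_SIG) mult_nonneg_nonneg mult_pos_pos zero_less_mult_iff)
qed
show "a : cn C" "b : cn C" using z a b cone_of_sub_iff[OF B C] by auto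
qed

text \<open>If a point of the face has a positive coordinate at \<open>b\<close>, it is the midpoint
  between twice its \<open>b\<close>-part and twice the rest, so the face contains \<open>b\<close>.
  Hence the generators inside the face generate it.\<close>

lemma cone_face_imp:
assumes B: "independent B" "finite B" and ta: "cone_face ta (cn B)"
shows "EX C<=B. ta = cn C"
proof (intro exI[of _ "B Int ta"] conjI)
have f: "ta face_of cn B" "ta ~= {}" using ta by (auto simp: cone_face_def)
have sub: "ta <= cn B" using f(1) by (rule face_of_imp_subset)
have cc: "conic ta" using face_of_conic[OF conic_convex_cone_hull f(1)] .
have "convex_cone ta" using f(2) face_of_imp_convex[OF f(1)] cc by (auto simp: convex_cone_def)
hence "cn (B Int ta) <= ta" by (intro hull_minimal) auto
moreover have "ta <= cn (B Int ta)"
proof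
fix x assume x: "x : ta"
hence xB: "x : cn B" using sub by blast
have "co B b x = 0" if b: "b : B - B Int ta" for b
proof (rule ccontr)
 assume nz: "co B b x ~= 0"
 hence pos: "0 < co B b x" using xB b mem_cone_of[OF B, of x] by fastforce
 define c where "c = co B b x"
 define y where "y = x - c *\<^sub>R b"
 have bB: "b : cn B" using b by (simp add: hull_inc)
 have yB: "y : cn B"
  unfolding mem_cone_of[OF B]
 proof (intro conjI ballI)
  show "y : span B" unfolding y_def using xB mem_cone_of[OF B, of x] b
   by (intro span_diff span_scale) (auto intro: span_base)
  show "0 <= co B a y" if "a : B" for a
   using that xB b mem_cone_of[OF B, of x]
   by (auto simp: y_def c_def linear_diff[OF co(1)[OF B(1)]] linear_scale[OF co(1)[OF B(1)]] co(2)[OF B(1)])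
 qed
 have "2 *\<^sub>R (c *\<^sub>R b) : ta"
 proof (cases "2 *\<^sub>R (c *\<^sub>R b) = 2 *\<^sub>R y")
  case True
  hence "x = 2 *\<^sub>R (c *\<^sub>R b)" by (simp add: y_def scaleR_2 algebra_simps)
  thus ?thesis using x by simp
 next
  case False
  have "x = (1 - 1/2) *\<^sub>R (2 *\<^sub>R (c *\<^sub>R b)) + (1/2) *\<^sub>R (2 *\<^sub>R y)" by (simp add: y_def)
  hence "x : open_segment (2 *\<^sub>R (c *\<^sub>R b)) (2 *\<^sub>R y)"
   unfolding in_segment using False by (intro conjI exI[of _ "1/2"]) auto
  moreover have "2 *\<^sub>R (c *\<^sub>R b) : cn B" "2 *\<^sub>R y : cn B"
   using bB yB pos by (auto simp: c_def intro!: convex_cone_hull_mul)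
  ultimately show ?thesis using f(1) x by (auto simp: face_of_def)
 qed
 hence "(1 / (2 * c)) *\<^sub>R (2 *\<^sub>R (c *\<^sub>R b)) : ta"
  by (rule conicD[OF cc]) (use pos in "simp add: c_def")
 moreover have "(1 / (2 * c)) *\<^sub>R (2 *\<^sub>R (c *\<^sub>R b)) = b" using pos by (simp add: c_def)
 ultimately have "b : ta" by metis
 thus False using b by blast
qed
thus "x : cn (B Int ta)" using cone_of_sub_iff[OF B, of "B Int ta" x] xB by auto
qed
ultimately show "ta = cn (B Int ta)" by blast
qed auto

text \<open>\<open>B\<close> is a basis of the saturated sublattice on its span; equivalently, the
  cone on \<open>B\<close> is unimodular with generators \<open>B\<close>.\<close>

definition ubasis :: "nat => vec set => bool" where
"ubasis n B <-> lattice_basis B (Zlat n Int span B)"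

lemma ubasis_iff:
"ubasis n B <-> finite B & independent B & B <= Zlat n & (ALL x:Zlat n Int span B. ALL b:B. co B b x : \<int>)"
proof
assume u: "ubasis n B"
hence f: "finite B" "independent B"
and L: "Zlat n Int span B = {SUM b:B. of_int (c b) *\<^sub>R b |c. True}"
by (auto simp: ubasis_def lattice_basis_def)
have "B <= Zlat n"
proof
fix b assume b: "b : B"
have "(SUM x:B. of_int (if x = b then 1 else 0) *\<^sub>R x) = (SUM x:B. if x = b then b else 0)"
 by (intro sum.cong) auto
also have "... = b" using f b by simp
finally have "b : {SUM b:B. of_int (c b) *\<^sub>R b |c. True}"
 by (intro CollectI exI[of _ "%x. if x = b then 1 else 0"]) simp
thus "b : Zlat n" unfolding L[symmetric] by blast
qed
moreover have "co B b x : \<int>" if x: "x : Zlat n Int span B" and b: "b : B" for x b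
proof -
obtain c where c: "x = (SUM b:B. of_int (c b) *\<^sub>R b)" using x unfolding L by blast
show ?thesis unfolding c co_sum[OF f(2,1) b] by simp
qed
ultimately show "finite B & independent B & B <= Zlat n & (ALL x:Zlat n Int span B. ALL b:B. co B b x : \<int>)"
using f by blast
next
assume u: "finite B & independent B & B <= Zlat n & (ALL x:Zlat n Int span B. ALL b:B. co B b x : \<int>)"
hence f: "finite B" "independent B" by auto
have "Zlat n Int span B = {SUM b:B. of_int (c b) *\<^sub>R b |c. True}"
proof (intro equalityI subsetI)
fix x assume x: "x : Zlat n Int span B"
have "(SUM b:B. of_int \<lfloor>co B b x\<rfloor> *\<^sub>R b) = (SUM b:B. co B b x *\<^sub>R b)"
 using x u by (intro sum.cong refl) (simp add: of_int_floor)
hence "x = (SUM b:B. of_int \<lfloor>co B b x\<rfloor> *\<^sub>R b)"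
 using co_span[OF f(2,1), of x] x by simp
thus "x : {SUM b:B. of_int (c b) *\<^sub>R b |c. True}"
 by (intro CollectI exI[of _ "%b. \<lfloor>co B b x\<rfloor>"]) simp
next
fix x assume "x : {SUM b:B. of_int (c b) *\<^sub>R b |c. True}"
then obtain c where c: "x = (SUM b:B. of_int (c b) *\<^sub>R b)" by blast
show "x : Zlat n Int span B" unfolding c using u
 by (intro IntI Zlat_sum Zlat_scale span_sum span_scale span_base) auto
qed
thus "ubasis n B" using f by (auto simp: ubasis_def lattice_basis_def)
qed

lemma ubasisD:
assumes "ubasis n B"
shows "finite B" "independent B" "B <= Zlat n" "x : Zlat n ==> x : span B ==> b : B ==> co B b x : \<int>"
using assms by (auto simp: ubasis_iff)

lemma ubasisI:
assumes "finite B" "independent B" "B <= Zlat n"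
"!!x. x : Zlat n ==> x : span B ==> EX c. x = (SUM b:B. of_int (c b) *\<^sub>R b)"
shows "ubasis n B"
unfolding ubasis_iff
proof (intro conjI ballI assms(1-3))
fix x b assume "x : Zlat n Int span B" "b : B"
then obtain c where "x = (SUM b:B. of_int (c b) *\<^sub>R b)" using assms(4)[of x] by blast
thus "co B b x : \<int>" using co_sum[OF assms(2,1) `b : B`, of "%b. of_int (c b)"] by simp
qed

lemma ub_coords:
assumes "ubasis n B" "x : Zlat n" "x : span B"
shows "x = (SUM b:B. of_int \<lfloor>co B b x\<rfloor> *\<^sub>R b)"
proof -
have "(SUM b:B. of_int \<lfloor>co B b x\<rfloor> *\<^sub>R b) = (SUM b:B. co B b x *\<^sub>R b)"
using ubasisD(4)[OF assms] by (intro sum.cong refl) (simp add: of_int_floor)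
thus ?thesis using co_span[OF ubasisD(2,1)[OF assms(1)] assms(3)] by simp
qed

lemma ubasis_mono: "ubasis n B ==> C <= B ==> ubasis n C"
proof (rule ubasisI)
assume u: "ubasis n B" and C: "C <= B"
note B = ubasisD[OF u]
show "finite C" "independent C" "C <= Zlat n" using B C finite_subset independent_mono by blast+
fix x assume x: "x : Zlat n" "x : span C"
hence "x : span B" using span_mono[OF C] by blast
have "x = (SUM b:B. of_int \<lfloor>co B b x\<rfloor> *\<^sub>R b)" by (rule ub_coords[OF u x(1)]) fact
also have "... = (SUM b:C. of_int \<lfloor>co B b x\<rfloor> *\<^sub>R b)"
by (rule sum.mono_neutral_right) (use B C x co_zero[OF B(2) C] in auto)
finally show "EX c. x = (SUM b:C. of_int (c b) *\<^sub>R b)" by (rule exI[where x = "%b. \<lfloor>co B b x\<rfloor>"])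
qed

lemma ubasis_empty: "ubasis n {}" by (rule ubasisI) (auto simp: dependent_def)

lemma dim_cone_of: "ubasis n B ==> dim (cn B) = card B"
using dim_span[of "cn B"] by (metis span_cone_of dim_span dim_eq_card_independent ubasisD(2))

text \<open>The ray of \<open>b\<close> is a face of the second cone, hence carries one of its
  generators, c = r b with r > 0. Both bases are integral on it, so r and 1 / r are integers and r =
  1.\<close>

lemma cone_of_subset_imp:
assumes B: "ubasis n B" and C: "ubasis n C" and eq: "cn B = cn C"
shows "B <= C"
proof
fix b assume b: "b : B"
note Bs = ubasisD[OF B] and Cs = ubasisD[OF C]
have "cone_face (cn {b}) (cn C)"
unfolding eq[symmetric] by (rule cone_face_sub) (use Bs b in auto)
then obtain C' where C': "C' <= C" "cn {b} = cn C'" using cone_face_imp[OF Cs(2,1)] by blast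
have b0: "b ~= 0" using Bs(2) b dependent_zero by blast
have i: "independent {b}" using Bs(2) b independent_mono by blast
have "C' ~= {}"
proof
assume "C' = {}"
hence "b : {0}" using C'(2) hull_inc[of b "{b}"] by auto
thus False using b0 by simp
qed
then obtain c where c: "c : C'" by blast
hence cC: "c : C" using C' by blast
have c0: "c ~= 0" using Cs(2) cC dependent_zero by blast
have "c : cn {b}" unfolding C'(2) using c by (rule hull_inc)
hence cs: "c : span {b}" "0 <= co {b} b c" using mem_cone_of[OF i, of c] by auto
define r where "r = co {b} b c"
have cr: "c = r *\<^sub>R b" using co_span[OF i _ cs(1)] by (simp add: r_def)
have "r ~= 0" using c0 cr by auto
moreover have "0 <= r" unfolding r_def by (rule cs(2))
ultimately have r: "r > 0" by simp
have "co B b c = r" unfolding cr using b by (simp add: linear_scale[OF co(1)[OF Bs(2)]] co(2)[OF Bs(2)])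
hence r1: "r : \<int>" using Bs(4)[of c b] cr b Cs(3) cC by (auto simp: span_scale span_base)
have br: "b = (1 / r) *\<^sub>R c" using r by (simp add: cr)
have "co C c b = 1 / r" unfolding br using cC by (simp add: linear_scale[OF co(1)[OF Cs(2)]] co(2)[OF Cs(2)])
moreover have "b : span C" unfolding br using cC by (intro span_scale span_base)
ultimately have r2: "1 / r : \<int>" using Cs(4)[of b c] b cC Bs(3) by auto
obtain k l where kl: "r = of_int k" "1 / r = of_int l" using r1 r2 by (auto elim!: Ints_cases)
have "of_int (k * l) = r * (1 / r)" by (metis kl of_int_mult)
hence "of_int (k * l) = (1::real)" using r by simp
hence "k * l = 1" by linarith
moreover have "k > 0" using r kl by simp
ultimately have "k = 1" by (metis pos_zmult_eq_1_iff)
thus "b : C" using kl cr cC by simp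
qed

lemma cone_of_inj: "ubasis n B ==> ubasis n C ==> cn B = cn C ==> B = C"
using cone_of_subset_imp by blast

lemma prim_vec_cone_of:
assumes u: "ubasis n {b}" shows "prim_vec n (cn {b}) = b"
proof -
note B = ubasisD[OF u]
have b0: "b ~= 0" using B(2) by auto
have r: "cn {b} Int Zlat n = range (%k::nat. of_nat k *\<^sub>R b)"
proof (intro equalityI subsetI)
fix x assume x: "x : cn {b} Int Zlat n"
hence s: "x : span {b}" "0 <= co {b} b x" using mem_cone_of[OF B(2,1), of x] by auto
have "co {b} b x : \<int>" using B(4)[of x b] s x by auto
then obtain k where k: "co {b} b x = of_int k" by (auto elim: Ints_cases)
hence "x = of_nat (nat k) *\<^sub>R b" using co_span[OF B(2,1) s(1)] s(2) by simp
thus "x : range (%k::nat. of_nat k *\<^sub>R b)" by blast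
next
fix x assume "x : range (%k::nat. of_nat k *\<^sub>R b)"
then obtain k :: nat where x: "x = of_nat k *\<^sub>R b" by blast
have "x : cn {b}" unfolding x by (intro convex_cone_hull_mul hull_inc) auto
moreover have "x : Zlat n" using Zlat_scale[of b n "int k"] B(3) by (simp add: x)
ultimately show "x : cn {b} Int Zlat n" by blast
qed
show ?thesis
unfolding prim_vec_def
proof (rule the_equality)
show "b ~= 0 & cn {b} Int Zlat n = range (%k::nat. of_nat k *\<^sub>R b)" using b0 r by blast
fix e assume e: "e ~= 0 & cn {b} Int Zlat n = range (%k::nat. of_nat k *\<^sub>R e)"
hence eq: "range (%k::nat. of_nat k *\<^sub>R e) = range (%k::nat. of_nat k *\<^sub>R b)" using r by simp
have "b : range (%k::nat. of_nat k *\<^sub>R e)" unfolding eq by (rule range_eqI[of _ _ 1]) simp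
then obtain k :: nat where k: "b = of_nat k *\<^sub>R e" by blast
have "e : range (%k::nat. of_nat k *\<^sub>R b)" unfolding eq[symmetric] by (rule range_eqI[of _ _ 1]) simp
then obtain l :: nat where l: "e = of_nat l *\<^sub>R b" by blast
have "(real k * real l) *\<^sub>R b = b" using k l by (metis scaleR_scaleR)
hence "(1 - real k * real l) *\<^sub>R b = 0" by (simp add: scaleR_diff_left)
hence "real (k * l) = 1" using b0 by simp
hence "k * l = 1" by (simp only: of_nat_eq_1_iff)
thus "e = b" using l by simp
qed
qed

section \<open>Saturated sublattices are direct summands\<close>

subsection \<open>Extension of lattice bases\<close>

text \<open>A homogeneous integral linear system with fewer equations than unknowns.\<close>

lemma abs_lookup_le_norm: "\<bar>lookup (x :: vec) i\<bar> <= norm x"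
proof (cases "i : keys x")
case True
hence "\<bar>lookup x i\<bar> <= (SUM j:keys x. \<bar>lookup x j\<bar>)" by (intro member_le_sum) auto
thus ?thesis by (simp add: norm_poly_mapping_def dist_poly_mapping_def)
qed (simp add: in_keys_iff)

definition trunc :: "nat => vec => vec" where "trunc n v = (SUM i<n. single i (lookup v i))"

lemma lookup_trunc: "lookup (trunc n v) j = (if j < n then lookup v j else 0)"
proof -
have "lookup (trunc n v) j = (SUM i<n. if i = j then lookup v j else 0)"
unfolding trunc_def lookup_sum by (intro sum.cong) (auto simp: lookup_single when_def)
thus ?thesis by simp
qed

lemma trunc_Rspace: "x : Rspace n ==> trunc n x = x"
by (rule poly_mapping_eqI) (simp add: lookup_trunc Rspace_def)

lemma single_scale: "(single i r :: vec) = r *\<^sub>R single i 1"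
by (rule poly_mapping_eqI) (simp add: lookup_scaleR lookup_single when_def)

lemma finite_bounded_Zlat: "finite {x : Zlat n. norm x <= M}"
proof (rule finite_subset)
let ?F = "PiE {..<n} (%_. {- \<lceil>M\<rceil>..\<lceil>M\<rceil>})"
show "finite ((%f. SUM i<n. single i (real_of_int (f i))) ` ?F)" by (intro finite_imageI finite_PiE) auto
show "{x : Zlat n. norm x <= M} <= (%f. SUM i<n. single i (real_of_int (f i))) ` ?F"
proof
fix x assume x: "x : {x : Zlat n. norm x <= M}"
let ?f = "\<lambda>i\<in>{..<n}. \<lfloor>lookup x i\<rfloor>"
have "\<lfloor>lookup x i\<rfloor> : {- \<lceil>M\<rceil>..\<lceil>M\<rceil>}" for i
 using abs_lookup_le_norm[of x i] x by simp linarith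
hence "?f : ?F" by (auto simp only: restrict_PiE_iff)
moreover have "x = (SUM i<n. single i (real_of_int (?f i)))"
 using x trunc_Rspace[of x n] subsetD[OF Zlat_Rspace, of x n] by (simp add: trunc_def mem_Zlat of_int_floor)
ultimately show "x : (%f. SUM i<n. single i (real_of_int (f i))) ` ?F" by - (rule image_eqI)
qed
qed

text \<open>Extension by one vector: among the finitely many lattice points with \<open>B\<close>-coordinates in
\<open>[0,1]\<close> and last coordinate in \<open>(0,1]\<close>, choose one with the least last coordinate.\<close>

lemma ubasis_insert_ex:
assumes B: "ubasis n B" and v: "v : Zlat n" "v ~: span B"
obtains c where "c ~: B" "ubasis n (insert c B)" "span (insert c B) = span (insert v B)"
proof -
note Bs = ubasisD[OF B]
let ?I = "insert v B"
have I: "independent ?I" "finite ?I" and vB: "v ~: B"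
using Bs(1,2) v(2) contra_subsetD[OF span_superset v(2)] by (simp_all add: independent_insert)
note co1 = co(1)[OF I(1)]
have coB: "co ?I v x = 0 <-> x : span B" if "x : span ?I" for x
using span_sub_iff[OF I, of B x] that vB by (auto simp: insert_Diff_if)
define T where "T = {x : Zlat n Int span ?I. 0 < co ?I v x & (ALL b:?I. 0 <= co ?I b x & co ?I b x <= 1)}"
have "norm x <= (SUM b:?I. norm b)" if "x : T" for x
proof -
have "norm x = norm (SUM b:?I. co ?I b x *\<^sub>R b)" using co_span[OF I, of x] that by (simp add: T_def)
also have "... <= (SUM b:?I. norm (co ?I b x *\<^sub>R b))" by (rule norm_sum)
also have "... <= (SUM b:?I. norm b)" using that by (intro sum_mono) (auto simp: T_def mult_left_le_one_le)
finally show ?thesis .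
qed
hence "finite T" by (intro finite_subset[OF _ finite_bounded_Zlat[of n "SUM b:?I. norm b"]]) (auto simp: T_def)
moreover have "v : T" using v(1) co(2)[OF I(1)] by (auto simp: T_def intro: span_base)
hence "T ~= {}" by blast
ultimately obtain c where c: "c : T" "!!x. x : T ==> co ?I v c <= co ?I v x"
using arg_min_if_finite(1)[of T "co ?I v"] arg_min_least[of T _ "co ?I v"] by blast
hence cs: "c : Zlat n" "c : span ?I" "0 < co ?I v c" by (auto simp: T_def)
have cB: "c ~: span B" using coB[OF cs(2)] cs(3) by auto
have cnB: "c ~: B" using cB span_base by blast
have sub: "span (insert c B) <= span ?I" by (rule span_minimal) (use cs(2) in "auto intro: span_base")
have "ubasis n (insert c B)"
proof (rule ubasisI)
show "independent (insert c B)" using Bs(2) cB by (simp add: independent_insert)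
fix x assume x: "x : Zlat n" "x : span (insert c B)"
\<comment> \<open>Division by \<open>c\<close> in the last coordinate. After the
  \<open>B\<close>-coordinates are reduced to their fractional parts, a nonzero remainder would give
  a point of \<open>T\<close> below the minimum.\<close>
define q where "q = \<lfloor>co ?I v x / co ?I v c\<rfloor>"
define y where "y = x - of_int q *\<^sub>R c"
define z where "z = y - (SUM b:B. of_int \<lfloor>co ?I b y\<rfloor> *\<^sub>R b)"
have y: "y : Zlat n" "y : span ?I" using x sub cs unfolding y_def by (auto intro: Zlat_diff Zlat_scale span_diff span_scale)
have z: "z : Zlat n" "z : span ?I"
 using y Bs(3) unfolding z_def by (auto intro!: Zlat_diff Zlat_sum Zlat_scale span_diff span_sum span_scale intro: span_base)
have "of_int q * co ?I v c <= co ?I v x" "co ?I v x < (of_int q + 1) * co ?I v c"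
 using cs(3) by (simp_all add: q_def pos_le_divide_eq[symmetric] pos_divide_less_eq[symmetric])
hence ty: "0 <= co ?I v y" "co ?I v y < co ?I v c"
 by (simp_all add: y_def linear_diff[OF co1] linear_scale[OF co1] algebra_simps)
have cz: "co ?I a z = co ?I a y - (SUM b:B. of_int \<lfloor>co ?I b y\<rfloor> * (if b = a then 1 else 0))" for a
 using co(2)[OF I(1)] by (simp add: z_def linear_diff[OF co1] linear_sum[OF co1] linear_scale[OF co1])
have czB: "co ?I b z = co ?I b y - of_int \<lfloor>co ?I b y\<rfloor>" if "b : B" for b
 unfolding cz using that Bs(1) by (simp add: if_distrib cong: if_cong)
have czv: "co ?I v z = co ?I v y" unfolding cz using vB by (auto intro!: sum.neutral)
have "co ?I v y = 0"
proof (rule ccontr)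
 assume "co ?I v y ~= 0"
 moreover have "co ?I v c <= 1" using c(1) by (simp add: T_def)
 ultimately have "z : T" using z ty czv czB by (auto simp: T_def) linarith+
 thus False using c(2) ty(2) czv by fastforce
qed
hence "y : span B" using coB y(2) by blast
hence yB: "y = (SUM b:B. of_int \<lfloor>co B b y\<rfloor> *\<^sub>R b)" by (rule ub_coords[OF B y(1)])
have "(SUM b:insert c B. of_int (if b = c then q else \<lfloor>co B b y\<rfloor>) *\<^sub>R b) = of_int q *\<^sub>R c + (SUM b:B. of_int \<lfloor>co B b y\<rfloor> *\<^sub>R b)"
 using cnB Bs(1) by (auto intro!: sum.cong)
also have "... = x" unfolding yB[symmetric] by (simp add: y_def)
finally have "x = (SUM b:insert c B. of_int (if b = c then q else \<lfloor>co B b y\<rfloor>) *\<^sub>R b)" by (rule sym)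
thus "EX c'. x = (SUM b:insert c B. of_int (c' b) *\<^sub>R b)"
 by (rule exI[where x = "%b. if b = c then q else \<lfloor>co B b y\<rfloor>"])
qed (use Bs cs in auto)
moreover have "span (insert c B) = span ?I"
using in_span_insert[OF cs(2) cB] sub by (intro antisym span_minimal) (auto intro: span_base)
ultimately show ?thesis using that cnB by blast
qed

abbreviation "units n == (%i. single i 1 :: vec) ` {..<n}"

lemma Rspace_units: "Rspace n <= span (units n)"
proof
fix v assume "v : Rspace n"
hence "v = (SUM i<n. lookup v i *\<^sub>R single i 1)" using trunc_Rspace[of v n] by (simp add: trunc_def flip: single_scale)
also have "... : span (units n)" by (intro span_sum span_scale span_base) auto
finally show "v : span (units n)" .
qed

lemma ubasis_card_le:
assumes "ubasis n B" shows "card B <= n"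
proof -
have "card B <= card (units n)"
using ubasisD(2,3)[OF assms] Zlat_Rspace Rspace_units[of n] by (intro independent_span_bound[THEN conjunct2]) auto
also have "... <= n" using card_image_le[of "{..<n}" "%i. single i (1::real)"] by simp
finally show ?thesis .
qed

lemma independent_units: "independent (units n)"
proof (rule independent_if_scalars_zero)
fix f and x :: vec assume s: "(SUM x:units n. f x *\<^sub>R x) = 0" and "x : units n"
then obtain j where j: "j < n" "x = single j 1" by blast
have inj: "inj_on (%i. single i (1::real)) {..<n}" by (rule inj_onI) (metis lookup_single_eq lookup_single_not_eq zero_neq_one)
have "lookup (SUM x:units n. f x *\<^sub>R x) j = (SUM i<n. if i = j then f x else 0)"
unfolding sum.reindex[OF inj] lookup_sum by (intro sum.cong) (auto simp: j lookup_scaleR lookup_single when_def)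
thus "f x = 0" using j(1) unfolding s by simp
qed simp

lemma units_card: "card (units n) = n"
by (subst card_image) (auto intro!: inj_onI, metis lookup_single_eq lookup_single_not_eq zero_neq_one)

lemma ubasis_extend:
assumes "ubasis n B" obtains C where "B <= C" "ubasis n C" "card C = n"
proof -
have "EX C. B <= C & ubasis n C & card C = n" using assms
proof (induction "n - card B" arbitrary: B)
case 0
thus ?case using ubasis_card_le by (metis diff_is_0_eq le_antisym order_refl)
next
case (Suc k)
note Bs = ubasisD[OF Suc.prems]
have "card B < n" using Suc(2) by simp
hence "~ units n <= span B"
 using independent_span_bound[OF Bs(1) independent_units, of n] unfolding units_card by linarith
then obtain i where i: "i < n" "single i 1 ~: span B" by blast
have "single i 1 : Zlat n" using i(1) by (auto simp: mem_Zlat lookup_single when_def)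
from ubasis_insert_ex[OF Suc.prems this i(2)]
obtain c where c: "c ~: B" "ubasis n (insert c B)" .
have "k = n - card (insert c B)" using Suc(2) c(1) Bs(1) by simp
from Suc(1)[OF this c(2)] show ?case by blast
qed
thus ?thesis using that by blast
qed

lemma ubasis_full_span:
assumes C: "ubasis n C" "card C = n" shows "span C = Rspace n"
proof
note Cs = ubasisD[OF C(1)]
show "span C <= Rspace n" by (rule span_minimal) (use Cs(3) Zlat_Rspace sub_Rspace in auto)
have "units n <= span C"
proof (rule ccontr)
assume "~ ?thesis"
then obtain i where i: "i < n" "single i 1 ~: span C" by blast
have "single i 1 : Zlat n" using i(1) by (auto simp: mem_Zlat lookup_single when_def)
from ubasis_insert_ex[OF C(1) this i(2)]
obtain c where c: "c ~: C" "ubasis n (insert c C)" .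
thus False using ubasis_card_le[OF c(2)] C(2) Cs(1) by simp
qed
thus "Rspace n <= span C" using Rspace_units[of n] span_minimal[OF _ subspace_span, of "units n" C] by blast
qed

text \<open>The dual lattice; values outside the lattice are unconstrained.\<close>

definition Zdual :: "nat => (vec => int) set" where
"Zdual n = {m. ALL x:Zlat n. ALL y:Zlat n. m (x + y) = m x + m y}"

lemma Zdual_D:
assumes "m : Zdual n"
shows "x : Zlat n ==> y : Zlat n ==> m (x + y) = m x + m y" "m 0 = 0"
"x : Zlat n ==> y : Zlat n ==> m (x - y) = m x - m y"
"x : Zlat n ==> m (of_int c *\<^sub>R x) = c * m x"
"(!!a. a : A ==> f a : Zlat n) ==> m (sum f A) = (SUM a:A. m (f a))"
proof -
show a: "!!x y. x : Zlat n ==> y : Zlat n ==> m (x + y) = m x + m y" using assms by (auto simp: Zdual_def)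
show z: "m 0 = 0" using a[of 0 0] by simp
show d: "!!x y. x : Zlat n ==> y : Zlat n ==> m (x - y) = m x - m y"
using a[of "_ - _" _] Zlat_diff by (metis add_diff_cancel_right' diff_add_cancel)
have nat: "m (of_nat k *\<^sub>R x) = int k * m x" if x: "x : Zlat n" for x and k :: nat
proof (induction k)
case (Suc k)
have "of_nat (Suc k) *\<^sub>R x = x + of_nat k *\<^sub>R x" by (simp add: scaleR_add_left)
moreover have "of_nat k *\<^sub>R x : Zlat n" using Zlat_scale[OF x, of "int k"] by simp
ultimately show ?case using a[OF x] Suc by (simp add: distrib_right)
qed (simp add: z)
show "m (of_int c *\<^sub>R x) = c * m x" if x: "x : Zlat n" for x c
proof (cases "c >= 0")
case True
thus ?thesis using nat[OF x, of "nat c"] by simp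
next
case False
have y: "of_nat (nat (- c)) *\<^sub>R x : Zlat n" using Zlat_scale[OF x, of "- c"] False by simp
have "of_int c *\<^sub>R x = 0 - of_nat (nat (- c)) *\<^sub>R x" using False by simp
thus ?thesis using d[OF Zlat_0 y] nat[OF x, of "nat (- c)"] False z by simp
qed
show "(!!a. a : A ==> f a : Zlat n) ==> m (sum f A) = (SUM a:A. m (f a))"
by (induction A rule: infinite_finite_induct) (auto simp: z a Zlat_sum)
qed

lemma Zdual_linear:
assumes "linear h" "!!x. x : Zlat n ==> h x : \<int>" shows "(%x. \<lfloor>h x\<rfloor>) : Zdual n"
unfolding Zdual_def
proof (intro CollectI ballI)
fix x y assume "x : Zlat n" "y : Zlat n"
then obtain k l where "h x = of_int k" "h y = of_int l" using assms(2) by (meson Ints_cases)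
thus "\<lfloor>h (x + y)\<rfloor> = \<lfloor>h x\<rfloor> + \<lfloor>h y\<rfloor>" by (simp add: linear_add[OF assms(1)])
qed

text \<open>A coordinate function of an extension of \<open>B\<close> to a basis of the whole
  lattice is integral. This is where the forms required by \<open>ucx\<close> come from.\<close>

lemma ubasis_dual:
assumes B: "ubasis n B" and b: "b : B"
shows "EX m:Zdual n. m b = 1 & (ALL x:B - {b}. m x = 0)"
proof -
obtain C where C: "B <= C" "ubasis n C" "card C = n" using ubasis_extend[OF B] .
note Cs = ubasisD[OF C(2)]
have "Zlat n <= span C" using Zlat_Rspace ubasis_full_span[OF C(2,3)] by simp
hence "(%x. \<lfloor>co C b x\<rfloor>) : Zdual n"
using Cs(4) b C(1) by (intro Zdual_linear co(1)[OF Cs(2)]) auto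
moreover have "\<lfloor>co C b b\<rfloor> = 1" using b C(1) by (auto simp: co(2)[OF Cs(2)])
moreover have "\<lfloor>co C b x\<rfloor> = 0" if "x : B - {b}" for x using that C(1) by (auto simp: co(2)[OF Cs(2)])
ultimately show ?thesis by (intro bexI[of _ "%x. \<lfloor>co C b x\<rfloor>"]) auto
qed

lemma ubasis_span_ex:
assumes "finite S" "S <= Zlat n" obtains B where "ubasis n B" "span B = span S"
proof -
have "EX B. ubasis n B & span B = span S" using assms
proof (induction S rule: finite_induct)
case empty
show ?case by (intro exI[of _ "{}"]) (simp add: ubasis_empty)
next
case (insert s S)
then obtain B where B: "ubasis n B" "span B = span S" by auto
show ?case
proof (cases "s : span B")
 case True
 hence "span (insert s S) = span B" using B(2) by (simp add: span_redundant)
 thus ?thesis using B(1) by blast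
next
 case False
 have sZ: "s : Zlat n" using insert.prems by blast
 obtain c' where "c' ~: B" "ubasis n (insert c' B)" "span (insert c' B) = span (insert s B)"
  by (rule ubasis_insert_ex[OF B(1) sZ False])
 moreover have "span (insert s B) = span (insert s S)"
  by (simp only: span_insert B(2))
 ultimately show ?thesis by metis
qed
qed
thus ?thesis using that by blast
qed

text \<open>The lattice points of a subspace spanned by lattice vectors have a complement, and
  \<open>m\<close> is composed with the projection along it.\<close>

lemma Zdual_extend:
assumes S: "finite S" "S <= Zlat n"
and m: "!!x y. x : Zlat n Int span S ==> y : Zlat n Int span S ==> m (x + y) = m x + (m y :: int)"
shows "EX m':Zdual n. ALL x:Zlat n Int span S. m' x = m x"
proof -
obtain B where B: "ubasis n B" "span B = span S" using ubasis_span_ex[OF S] .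
obtain C where C: "B <= C" "ubasis n C" "card C = n" using ubasis_extend[OF B(1)] .
note Cs = ubasisD[OF C(2)] and Bs = ubasisD[OF B(1)]
have ZC: "Zlat n <= span C" using Zlat_Rspace ubasis_full_span[OF C(2,3)] by simp
define pr where "pr x = (SUM b:B. of_int \<lfloor>co C b x\<rfloor> *\<^sub>R b)" for x
have prZ: "pr x : Zlat n Int span S" for x
unfolding pr_def B(2)[symmetric] using Bs(3)
by (intro IntI Zlat_sum Zlat_scale span_sum span_scale span_base) auto
have dual: "(%x. m (pr x)) : Zdual n"
unfolding Zdual_def
proof (intro CollectI ballI)
fix x y assume xy: "x : Zlat n" "y : Zlat n"
have "\<lfloor>co C b (x + y)\<rfloor> = \<lfloor>co C b x\<rfloor> + \<lfloor>co C b y\<rfloor>" if "b : B" for b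
proof -
 have "(%x. \<lfloor>co C b x\<rfloor>) : Zdual n"
  using Cs(4) that C(1) ZC by (intro Zdual_linear co(1)[OF Cs(2)]) auto
 thus ?thesis using Zdual_D(1) xy by blast
qed
hence "pr (x + y) = pr x + pr y"
 by (simp add: pr_def scaleR_add_left sum.distrib[symmetric] cong: sum.cong)
thus "m (pr (x + y)) = m (pr x) + m (pr y)" using m[OF prZ prZ] by simp
qed
have eq: "m (pr x) = m x" if "x : Zlat n Int span S" for x
proof -
have xB: "x : span B" using that B(2) by simp
have "x = (SUM b:C. of_int \<lfloor>co C b x\<rfloor> *\<^sub>R b)" by (rule ub_coords[OF C(2)]) (use that ZC in auto)
also have "... = pr x" unfolding pr_def
 by (rule sum.mono_neutral_right) (use Cs C(1) co_zero[OF Cs(2) C(1) _ xB] in auto)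
finally have "pr x = x" by (rule sym)
thus ?thesis by (rule arg_cong)
qed
show ?thesis by (rule bexI[OF _ dual]) (rule ballI, rule eq)
qed

section \<open>From unimodular fans to complexes, with balancing and orders of vanishing\<close>

section \<open>Unimodular fans and their complexes of primitive vectors\<close>

text \<open>The fan as a simplicial complex on primitive vectors; by \<open>cone_of_inj\<close> each
  unimodular cone contributes exactly one \<open>B\<close>.\<close>

definition fcx :: "tfan => vec set set" where
"fcx Sg = {B. ubasis (lat_rank Sg) B & cn B : cones Sg}"

lemma fan_complex_eqI:
assumes "cones T = cn ` KK" "!!B. B : KK ==> ubasis (lat_rank T) B"
shows "fcx T = KK"
proof (intro equalityI subsetI)
fix B assume "B : fcx T"
hence B: "ubasis (lat_rank T) B" "cn B : cn ` KK" using assms(1) by (auto simp: fcx_def)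
then obtain C where "C : KK" "cn B = cn C" by blast
thus "B : KK" using cone_of_inj[OF B(1) assms(2)] by simp
qed (use assms in "auto simp: fcx_def")

definition dforms :: "nat => (vec => 'a::ring_1) set" where
"dforms n = (%m v. of_int (m v)) ` Zdual n"

definition link :: "'v set set => 'v set => 'v set" where
"link K A = {b. b ~: A & insert b A : K}"

text \<open>The combinatorial content of the fan axioms. It is separated out so that star fans, too,
  can be shown to have it, directly from their complexes.\<close>

locale cone_complex =
fixes T :: tfan
assumes fincx: "finite (fcx T)"
and cones_eq: "cones T = cn ` fcx T"
and empty_complex: "{} : fcx T"
and dcx: "B : fcx T ==> C <= B ==> C : fcx T"
and cone_subset: "B : fcx T ==> C : fcx T ==> cn B <= cn C ==> B <= C"
begin

abbreviation "K == fcx T"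
abbreviation "n == lat_rank T"
abbreviation "d == fan_dim T"

lemma face_ub: "B : K ==> ubasis n B" by (simp add: fcx_def)

lemma fin_face: "B : K ==> finite B" using face_ub ubasisD(1) by blast

lemma cone_in: "B : K ==> cn B : cones T" by (simp add: fcx_def)

lemma cone_subset_iff: "B : K ==> C : K ==> cn B <= cn C <-> B <= C"
using cone_subset hull_mono by blast

lemma inj_cone_of: "inj_on cn K"
using cone_of_inj face_ub by (auto intro!: inj_onI)

lemma dim_face: "B : K ==> dim (cn B) = card B" using dim_cone_of face_ub by blast

lemma cones_dim_eq: "cones_dim T k = cn ` {B : K. card B = k}"
using dim_face by (force simp: cones_dim_def cones_eq)

lemma ucx: "ucx K (dforms n :: (vec => 'a::{idom, ring_char_0}) set)"
proof
fix A v assume "A : K" "v : A"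
then obtain m where m: "m : Zdual n" "m v = 1" "ALL x:A - {v}. m x = 0" using ubasis_dual[OF face_ub] by blast
thus "EX l:dforms n :: (vec => 'a) set. l v = 1 & (ALL u:A - {v}. l u = 0)"
unfolding dforms_def by (intro bexI[of _ "%v. of_int (m v)"]) auto
qed (use fincx empty_complex dcx fin_face in auto)

lemma vertex_Zlat: "v : \<Union>K ==> v : Zlat n" using face_ub ubasisD(3) by blast

lemma vertex_face: "v : \<Union>K ==> {v} : K" using dcx by blast

lemma fan_dim_eq: "fan_dim T = Max (card ` K)"
proof -
have "dim ` cones T = card ` K" using dim_face by (force simp: cones_eq image_image)
thus ?thesis by (simp add: fan_dim_def)
qed

lemma card_le: "B : K ==> card B <= d"
unfolding fan_dim_eq using fincx by (intro Max_ge) auto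

lemma star_sum:
assumes A: "A : K" "Suc (card A) = k"
shows "(SUM sg | sg : cones_dim T k & cn A <= sg. F sg) = (SUM b:link K A. F (cn (insert b A)))"
proof (rule sum.reindex_bij_betw[symmetric])
have finA: "finite A" using fin_face A(1) .
show "bij_betw (%b. cn (insert b A)) (link K A) {sg. sg : cones_dim T k & cn A <= sg}"
proof (rule bij_betw_imageI)
show "inj_on (%b. cn (insert b A)) (link K A)"
proof (rule inj_onI)
 fix b c assume bc: "b : link K A" "c : link K A" "cn (insert b A) = cn (insert c A)"
 hence "insert b A = insert c A" using inj_onD[OF inj_cone_of bc(3)] by (auto simp: link_def)
 thus "b = c" using bc by (auto simp: link_def)
qed
show "(%b. cn (insert b A)) ` link K A = {sg. sg : cones_dim T k & cn A <= sg}"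
proof (intro equalityI subsetI)
 fix sg assume "sg : (%b. cn (insert b A)) ` link K A"
 then obtain b where b: "b ~: A" "insert b A : K" "sg = cn (insert b A)" by (auto simp: link_def)
 thus "sg : {sg. sg : cones_dim T k & cn A <= sg}"
  using finA A(2) by (auto simp: cones_dim_eq intro: subsetD[OF hull_mono[of A "insert b A"]])
next
 fix sg assume "sg : {sg. sg : cones_dim T k & cn A <= sg}"
 then obtain B where B: "B : K" "card B = k" "sg = cn B" "cn A <= cn B" by (auto simp: cones_dim_eq)
 hence AB: "A <= B" using cone_subset A(1) by blast
 have "card (B - A) = 1" using AB finA B(2) A(2) by (simp add: card_Diff_subset)
 then obtain b where "B - A = {b}" by (auto simp: card_1_singleton_iff)
 hence "b ~: A" "B = insert b A" using AB by auto
 thus "sg : (%b. cn (insert b A)) ` link K A" using B by (auto simp: link_def)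
qed
qed
qed

end

subsection \<open>Normal vectors and orders of vanishing\<close>

lemma Nsub_cone_of: "Nsub n (cn B) = Zlat n Int span B" by (simp add: Nsub_def)

lemma is_normal_vec_basis:
assumes u: "ubasis n (insert b A)" and b: "b ~: A"
shows "is_normal_vec n (cn (insert b A)) (cn A) b"
proof -
note B = ubasisD[OF u]
have A: "ubasis n A" by (rule ubasis_mono[OF u]) blast
have bn: "b ~: span A" using B(2) b by (simp add: independent_insert)
have bZ: "b : Zlat n" using B(3) by blast
show ?thesis
unfolding is_normal_vec_def Nsub_cone_of
proof (intro conjI)
show "b : Zlat n Int span (insert b A)" using bZ by (auto intro: span_base)
have "b : mink_sum (cn (insert b A)) (span A)"
 unfolding mink_sum_def by (intro CollectI exI[of _ b] exI[of _ 0]) (auto simp: span_zero hull_inc)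
thus "b : mink_sum (cn (insert b A)) (span (cn A)) - span (cn A)" using bn by simp
show "Zlat n Int span (insert b A) = {u + of_int k *\<^sub>R b |u k. u : Zlat n Int span A}"
proof (intro equalityI subsetI)
 fix x assume x: "x : Zlat n Int span (insert b A)"
 have "x = (SUM c:insert b A. of_int \<lfloor>co (insert b A) c x\<rfloor> *\<^sub>R c)" by (rule ub_coords[OF u]) (use x in auto)
 also have "... = (SUM c:A. of_int \<lfloor>co (insert b A) c x\<rfloor> *\<^sub>R c) + of_int \<lfloor>co (insert b A) b x\<rfloor> *\<^sub>R b"
  using B(1) b by (simp add: add.commute)
 finally show "x : {u + of_int k *\<^sub>R b |u k. u : Zlat n Int span A}"
  using B(3)
  by (intro CollectI exI[of _ "SUM c:A. of_int \<lfloor>co (insert b A) c x\<rfloor> *\<^sub>R c"] exI[of _ "\<lfloor>co (insert b A) b x\<rfloor>"] conjI IntI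
    Zlat_sum Zlat_scale span_sum span_scale span_base) auto
next
 fix x assume "x : {u + of_int k *\<^sub>R b |u k. u : Zlat n Int span A}"
 then obtain u k where x: "x = u + of_int k *\<^sub>R b" "u : Zlat n" "u : span A" by blast
 have "u : span (insert b A)" using span_mono[of A "insert b A"] x(3) by blast
 thus "x : Zlat n Int span (insert b A)" unfolding x(1)
  using x(2) bZ by (auto intro!: Zlat_add Zlat_scale span_add span_scale intro: span_base)
qed
qed
qed

text \<open>Modulo the span of \<open>A\<close> the lattice is infinite cyclic with generators
  \<open>b\<close> and \<open>v\<close>, which therefore agree up to sign; lying on the side of the
  cone excludes the minus sign.\<close>

lemma is_normal_vec_diff:
assumes u: "ubasis n (insert b A)" and b: "b ~: A"
and v: "is_normal_vec n (cn (insert b A)) (cn A) v"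
shows "v : Zlat n" "v - b : span A"
proof -
note B = ubasisD[OF u]
define f where "f = co (insert b A) b"
have f: "linear f" "f b = 1" unfolding f_def using co[OF B(2)] by auto
have fA: "f x = 0" if "x : span A" for x unfolding f_def by (rule co_zero[OF B(2) _ b that]) blast
have vs: "v : Zlat n" "v : span (insert b A)" "v : mink_sum (cn (insert b A)) (span A)"
and gen: "Zlat n Int span (insert b A) = {u + of_int k *\<^sub>R v |u k. u : Zlat n Int span A}"
using v unfolding is_normal_vec_def Nsub_cone_of by auto
show "v : Zlat n" by fact
obtain x y where xy: "v = x + y" "x : cn (insert b A)" "y : span A" using vs(3) by (auto simp: mink_sum_def)
have "0 <= f x" using xy(2) mem_cone_of[OF B(2,1)] by (auto simp: f_def)
hence fv: "0 <= f v" using fA[OF xy(3)] xy(1) by (simp add: linear_add[OF f(1)])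
obtain l where l: "f v = of_int l" using B(4)[OF vs(1,2), of b] by (auto simp: f_def elim: Ints_cases)
have "b : Zlat n Int span (insert b A)" using B(3) by (auto intro: span_base)
then obtain u k where uk: "b = u + of_int k *\<^sub>R v" "u : span A" unfolding gen by blast
have "f b = f u + of_int k * f v" by (subst uk(1)) (simp add: linear_add[OF f(1)] linear_scale[OF f(1)])
hence "(1::real) = of_int (k * l)" using fA[OF uk(2)] f(2) l by simp
hence "k * l = 1" by linarith
moreover have "l >= 0" using fv l by simp
ultimately have "l = 1" by (metis mult.commute pos_zmult_eq_1_iff less_le mult_zero_right zero_neq_one)
hence "f (v - b) = 0" using l f by (simp add: linear_diff[OF f(1)])
moreover have "v - b : span (insert b A)" using vs(2) by (auto intro!: span_diff intro: span_base)
moreover have "insert b A - A = {b}" using b by blast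
ultimately show "v - b : span A" using span_sub_iff[OF B(2,1), of A "v - b"] by (auto simp: f_def)
qed

lemma normal_vec_diff:
assumes "ubasis n (insert b A)" "b ~: A"
shows "normal_vec n (cn (insert b A)) (cn A) : Zlat n"
"normal_vec n (cn (insert b A)) (cn A) - b : span A"
proof -
have "is_normal_vec n (cn (insert b A)) (cn A) (normal_vec n (cn (insert b A)) (cn A))"
unfolding normal_vec_def by (rule someI) (rule is_normal_vec_basis[OF assms])
thus "normal_vec n (cn (insert b A)) (cn A) : Zlat n"
"normal_vec n (cn (insert b A)) (cn A) - b : span A"
using is_normal_vec_diff[OF assms] by blast+
qed

context cone_complex
begin

text \<open>Balancing with primitive vectors in place of the chosen normal vectors; by
  \<open>normal_sum\<close> the two sums differ by an element of the span of
  \<open>A\<close>.\<close>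

definition balanced_at :: "vec set => bool" where
"balanced_at A <-> (SUM b:link K A. of_int (wt T (cn (insert b A))) *\<^sub>R b) : span A"

lemma finite_link: "finite (link K A)"
by (rule finite_subset[of _ "\<Union>K"]) (use fincx fin_face in "auto simp: link_def")

lemma link_ubasis: "b : link K A ==> ubasis n (insert b A) & b ~: A"
using face_ub by (auto simp: link_def)

lemma normal_sum:
"(SUM b:link K A. of_int (wt T (cn (insert b A))) *\<^sub>R normal_vec n (cn (insert b A)) (cn A))
- (SUM b:link K A. of_int (wt T (cn (insert b A))) *\<^sub>R b) : span A"
proof -
have "normal_vec n (cn (insert b A)) (cn A) - b : span A" if "b : link K A" for b
using normal_vec_diff(2) link_ubasis[OF that] by blast
hence "(SUM b:link K A. of_int (wt T (cn (insert b A))) *\<^sub>R (normal_vec n (cn (insert b A)) (cn A) - b)) : span A"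
by (intro span_sum span_scale)
thus ?thesis by (simp add: scaleR_diff_right sum_subtractf)
qed

lemma balanced_if_minkowski:
assumes "minkowski_weight T d (wt T)" "A : K" "Suc (card A) = d"
shows "balanced_at A"
proof -
have "dim (cn A) + 1 = d" using assms(2,3) dim_face by simp
hence "(SUM sg | sg : cones_dim T d & cn A <= sg. of_int (wt T sg) *\<^sub>R normal_vec n sg (cn A)) : Nsub n (cn A)"
using assms(1) cone_in[OF assms(2)] unfolding minkowski_weight_def by blast
hence "(SUM b:link K A. of_int (wt T (cn (insert b A))) *\<^sub>R normal_vec n (cn (insert b A)) (cn A)) : span A"
unfolding star_sum[OF assms(2,3)] Nsub_cone_of by blast
from span_diff[OF this normal_sum] show ?thesis unfolding balanced_at_def by simp
qed

lemma balanced_coeffs: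
assumes "balanced_at A" "A : K"
shows "EX mu. (SUM b:link K A. of_int (wt T (cn (insert b A))) *\<^sub>R b) = (SUM a:A. of_int (mu a :: int) *\<^sub>R a)"
proof -
have "(SUM b:link K A. of_int (wt T (cn (insert b A))) *\<^sub>R b) : Zlat n"
by (intro Zlat_sum Zlat_scale) (auto simp: link_def intro: vertex_Zlat)
from ub_coords[OF face_ub[OF assms(2)] this assms(1)[unfolded balanced_at_def]]
show ?thesis by (rule exI[where x = "%a. \<lfloor>co A a (SUM b:link K A. of_int (wt T (cn (insert b A))) *\<^sub>R b)\<rfloor>"])
qed

text \<open>Balancing as a relation between all primitive vectors with the weights as coefficients
  outside \<open>A\<close>, which is the input of \<open>ex_deg\<close>.\<close>

lemma balanced_relation:
assumes "balanced_at A" "A : K"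
obtains gm :: "vec => int" where
"ALL v. v ~: A --> gm v = (if insert v A : K then wt T (cn (insert v A)) else 0)"
"ALL m:Zdual n. (SUM v:\<Union>K. m v * gm v) = 0"
"(SUM b:link K A. of_int (wt T (cn (insert b A))) *\<^sub>R b) = (SUM a:A. of_int (- gm a) *\<^sub>R a)"
proof -
obtain mu :: "vec => int" where l: "(SUM b:link K A. of_int (wt T (cn (insert b A))) *\<^sub>R b) = (SUM a:A. of_int (mu a) *\<^sub>R a)"
using balanced_coeffs[OF assms] by blast
define gm where "gm v = (if v : A then - mu v else if insert v A : K then wt T (cn (insert v A)) else 0)" for v
have finV: "finite (\<Union>K)" using fincx fin_face by blast
have "(SUM v:\<Union>K. m v * gm v) = 0" if m: "m : Zdual n" for m
proof -
have AV: "A Un link K A <= \<Union>K" "A Int link K A = {}" using assms(2) by (auto simp: link_def)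
have AZ: "v : Zlat n" if "v : A Un link K A" for v using AV(1) that vertex_Zlat by blast
have "(SUM v:\<Union>K. m v * gm v) = (SUM v:A Un link K A. m v * gm v)"
 by (rule sum.mono_neutral_right) (use finV AV in "auto simp: gm_def link_def")
also have "... = (SUM v:A. m v * gm v) + (SUM v:link K A. m v * gm v)"
 by (rule sum.union_disjoint) (use AV finite_link fin_face assms(2) in auto)
also have "(SUM v:A. m v * gm v) = - (SUM v:A. mu v * m v)" by (simp add: gm_def sum_negf mult.commute)
also have "(SUM v:A. mu v * m v) = m (SUM a:A. of_int (mu a) *\<^sub>R a)"
 using AZ by (subst Zdual_D(5)[OF m]) (auto simp: Zdual_D(4)[OF m] intro!: Zlat_scale sum.cong)
also have "(SUM v:link K A. m v * gm v) = (SUM v:link K A. wt T (cn (insert v A)) * m v)"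
 by (intro sum.cong) (auto simp: gm_def link_def)
also have "... = m (SUM b:link K A. of_int (wt T (cn (insert b A))) *\<^sub>R b)"
 using AZ by (subst Zdual_D(5)[OF m]) (auto simp: Zdual_D(4)[OF m] intro!: Zlat_scale sum.cong)
finally show ?thesis using l by simp
qed
moreover have "(SUM a:A. of_int (mu a) *\<^sub>R a) = (SUM a:A. of_int (- gm a) *\<^sub>R a)"
by (intro sum.cong) (auto simp: gm_def)
ultimately show ?thesis using l by (intro that[of gm]) (auto simp: gm_def)
qed

lemma local_form_ex:
assumes "meromorphic_fun T f" "B : K" shows "is_local_form T f (cn B) (local_form T f (cn B))"
using assms cone_in unfolding meromorphic_fun_def local_form_def by (metis someI_ex)

lemma local_formD:
assumes "meromorphic_fun T f" "B : K"
defines "l == local_form T f (cn B)"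
shows "linear l" "!!x. x : cn B ==> l x = f x" "!!v. v : Zlat n ==> v : span B ==> l v : \<int>"
using local_form_ex[OF assms(1,2)] by (auto simp: is_local_form_def l_def Nsub_cone_of)

lemma meromorphic_vertex_Ints: "meromorphic_fun T f ==> v : \<Union>K ==> f v : \<int>"
using local_formD(2,3)[of f "{v}" v] vertex_face[of v] vertex_Zlat[of v]
by (auto simp: hull_inc span_base)

lemma local_form_span:
assumes f: "meromorphic_fun T f" and B: "B : K" and A: "A <= B" and x: "x : span A"
shows "local_form T f (cn B) x = local_form T f (cn A) x"
proof -
have AK: "A : K" using dcx B A by blast
show ?thesis
proof (rule linear_eq_on_span[OF local_formD(1)[OF f B] local_formD(1)[OF f AK] _ x])
fix a assume "a : A"
thus "local_form T f (cn B) a = local_form T f (cn A) a"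
 using A local_formD(2)[OF f B, of a] local_formD(2)[OF f AK, of a] by (auto simp: hull_inc)
qed
qed

text \<open>Changing a normal vector by an element of the span of \<open>A\<close> changes both sums
  in the order equally. The order can thus be computed with primitive vectors and depends only on
  the values of \<open>f\<close> there.\<close>

lemma ord_formula:
assumes f: "meromorphic_fun T f" and A: "A : K" "Suc (card A) = d"
and l: "(SUM b:link K A. of_int (wt T (cn (insert b A))) *\<^sub>R b) = (SUM a:A. of_int (mu a :: int) *\<^sub>R a)"
shows "of_int (ord_at T f (cn A)) =
- (SUM b:link K A. of_int (wt T (cn (insert b A))) * f b) + (SUM a:A. of_int (mu a) * f a)"
proof -
let ?w = "%b. real_of_int (wt T (cn (insert b A)))"
let ?nv = "%b. normal_vec n (cn (insert b A)) (cn A)"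
let ?l = "local_form T f"
let ?lA = "local_form T f (cn A)"
note lA = local_formD[OF f A(1)]
have sum1: "(SUM sg:{sg : cones_dim T d. cn A <= sg}. F sg) = (SUM b:link K A. F (cn (insert b A)))" for F :: "vec set => real"
by (rule star_sum[OF A])
have sum2: "(SUM sg:{sg : cones_dim T d. cn A <= sg}. F sg) = (SUM b:link K A. F (cn (insert b A)))" for F :: "vec set => vec"
by (rule star_sum[OF A])
have loc: "?l (cn (insert b A)) (?nv b) = f b + ?lA (?nv b - b)" if b: "b : link K A" for b
proof -
have bK: "insert b A : K" using b by (simp add: link_def)
have "?l (cn (insert b A)) (?nv b) = ?l (cn (insert b A)) b + ?l (cn (insert b A)) (?nv b - b)"
 by (simp add: linear_diff[OF local_formD(1)[OF f bK]])
also have "?l (cn (insert b A)) b = f b" by (rule local_formD(2)[OF f bK]) (simp add: hull_inc)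
also have "?l (cn (insert b A)) (?nv b - b) = ?lA (?nv b - b)"
 using link_ubasis[OF b] by (intro local_form_span[OF f bK]) (auto intro: normal_vec_diff(2))
finally show ?thesis .
qed
have vert: "?lA a = f a" if "a : A" for a using that by (intro lA(2) hull_inc)
have "- (SUM b:link K A. ?w b * ?l (cn (insert b A)) (?nv b)) + ?lA (SUM b:link K A. ?w b *\<^sub>R ?nv b)
 = - (SUM b:link K A. ?w b * f b) + ?lA ((SUM b:link K A. ?w b *\<^sub>R ?nv b) - (SUM b:link K A. ?w b *\<^sub>R (?nv b - b)))"
by (simp add: loc distrib_left sum.distrib linear_diff[OF lA(1)] linear_sum[OF lA(1)] linear_scale[OF lA(1)] cong: sum.cong)
also have "(SUM b:link K A. ?w b *\<^sub>R ?nv b) - (SUM b:link K A. ?w b *\<^sub>R (?nv b - b)) = (SUM b:link K A. ?w b *\<^sub>R b)"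
by (simp add: scaleR_diff_right sum_subtractf)
also have "... = (SUM a:A. of_int (mu a) *\<^sub>R a)" by (rule l)
also have "?lA ... = (SUM a:A. of_int (mu a) * f a)"
by (simp add: linear_sum[OF lA(1)] linear_scale[OF lA(1)] vert)
finally have eq: "- (SUM b:link K A. ?w b * ?l (cn (insert b A)) (?nv b)) + ?lA (SUM b:link K A. ?w b *\<^sub>R ?nv b)
= - (SUM b:link K A. ?w b * f b) + (SUM a:A. of_int (mu a) * f a)" .
have int: "- (SUM b:link K A. ?w b * f b) + (SUM a:A. of_int (mu a) * f a) : \<int>"
using A(1) by (intro Ints_add Ints_minus Ints_sum Ints_mult) (auto simp: link_def intro: meromorphic_vertex_Ints[OF f])
have "ord_at T f (cn A) = \<lfloor>- (SUM b:link K A. ?w b * f b) + (SUM a:A. of_int (mu a) * f a)\<rfloor>"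
unfolding ord_at_def Let_def sum1 sum2 eq by (rule refl)
thus ?thesis using int by simp
qed

end

locale ufan =
fixes Sg :: tfan
assumes rational: "rational_fan Sg" and unimodular: "unimodular Sg"
begin

lemma cone_basis:
assumes "sg : cones Sg" obtains B where "B : fcx Sg" "sg = cn B"
proof -
obtain B where B: "lattice_basis B (Nsub (lat_rank Sg) sg)" "sg = cn B"
using unimodular assms by (auto simp: unimodular_def)
hence "ubasis (lat_rank Sg) B" by (simp add: ubasis_def Nsub_cone_of)
thus ?thesis using B assms that by (auto simp: fcx_def)
qed

text \<open>As a face of both cones, the intersection is generated by a subset of \<open>B\<close>
  and by a subset of \<open>C\<close>; lattice generators of a cone are unique, so the subsets
  coincide.\<close>

lemma inter_complex:
assumes B: "B : fcx Sg" and C: "C : fcx Sg"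
shows "cn B Int cn C = cn (B Int C)"
proof -
have u: "ubasis (lat_rank Sg) B" "ubasis (lat_rank Sg) C" using B C by (auto simp: fcx_def)
have "cone_face (cn B Int cn C) (cn B)" "cone_face (cn B Int cn C) (cn C)"
using rational B C by (auto simp: rational_fan_def fcx_def)
then obtain B' C' where B': "B' <= B" "cn B Int cn C = cn B'"
and C': "C' <= C" "cn B Int cn C = cn C'"
using cone_face_imp ubasisD(1,2)[OF u(1)] ubasisD(1,2)[OF u(2)] by metis
have "B' = C'" using cone_of_inj[OF ubasis_mono[OF u(1) B'(1)] ubasis_mono[OF u(2) C'(1)]] B' C' by simp
hence "cn B' <= cn (B Int C)" using B' C' by (intro hull_mono) blast
moreover have "cn (B Int C) <= cn B Int cn C" by (intro Int_greatest hull_mono) auto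
ultimately show ?thesis using B'(2) by blast
qed

sublocale cone_complex Sg
proof
show eq: "cones Sg = cn ` fcx Sg"
using cone_basis by (auto simp: fcx_def)
have inj: "inj_on cn (fcx Sg)"
by (rule inj_onI) (rule cone_of_inj[of "lat_rank Sg"], simp_all add: fcx_def)
show "finite (fcx Sg)"
using rational eq finite_imageD[OF _ inj] by (simp add: rational_fan_def)
show down: "C : fcx Sg" if B: "B : fcx Sg" and C: "C <= B" for B C
proof -
have u: "ubasis (lat_rank Sg) B" "cn B : cones Sg" using B by (auto simp: fcx_def)
have "cone_face (cn C) (cn B)" using cone_face_sub ubasisD(1,2)[OF u(1)] C by blast
hence "cn C : cones Sg" using rational u(2) by (auto simp: rational_fan_def)
thus ?thesis using ubasis_mono[OF u(1) C] by (simp add: fcx_def)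
qed
obtain sg where "sg : cones Sg" using rational by (auto simp: rational_fan_def)
then obtain B where "B : fcx Sg" using cone_basis by blast
thus "{} : fcx Sg" by (rule down) blast
show "B <= C" if B: "B : fcx Sg" and C: "C : fcx Sg" and s: "cn B <= cn C" for B C
proof -
have "cn B = cn (B Int C)" using inter_complex[OF B C] s by blast
hence "B = B Int C" using inj_onD[OF inj _ B down[OF B]] by blast
thus ?thesis by blast
qed
qed

end

locale utrop = ufan +
assumes tropical: "tropical_fan Sg"
begin

lemma balanced: "A : K ==> Suc (card A) = d ==> balanced_at A"
using tropical by (intro balanced_if_minkowski) (auto simp: tropical_fan_def)

lemma facet_ex:
assumes "B : K" obtains C where "C : K" "B <= C" "card C = d"
proof -
have "finite {C : K. B <= C}" "B : {C : K. B <= C}" using fincx assms by auto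
then obtain C where C: "C : K" "B <= C" "!!D. D : K ==> B <= D ==> C <= D ==> D = C"
using finite_has_maximal[of "{C : K. B <= C}"] by (metis (no_types, lifting) empty_iff mem_Collect_eq)
have "ALL et:cones Sg. cn C <= et --> et = cn C"
proof (intro ballI impI)
fix et assume "et : cones Sg" and s: "cn C <= et"
then obtain D where D: "D : K" "et = cn D" using cone_basis by blast
hence "C <= D" using cone_subset C(1) s by blast
thus "et = cn C" using C D by blast
qed
hence "dim (cn C) = d"
using tropical cone_in[OF C(1)] by (auto simp: tropical_fan_def pure_dim_def)
thus ?thesis using that C dim_face by simp
qed

abbreviation wK :: "vec set => 'a::ring_1" where "wK B == of_int (wt Sg (cn B))"

lemma ex_degree:
"EX D. is_deg K (dforms n) d wK (D :: (vec, 'a::{idom, ring_char_0}) mp => 'a)"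
proof -
interpret ucx K "dforms n :: (vec => 'a) set" by (rule ucx)
show ?thesis
proof (rule ex_deg)
fix A assume A: "A : K" "Suc (card A) = d"
obtain gm where gm: "ALL v. v ~: A --> gm v = (if insert v A : K then wt Sg (cn (insert v A)) else 0)"
 "ALL m:Zdual n. (SUM v:\<Union>K. m v * gm v) = 0"
 "(SUM b:link K A. of_int (wt Sg (cn (insert b A))) *\<^sub>R b) = (SUM a:A. of_int (- gm a) *\<^sub>R a)"
 by (rule balanced_relation[OF balanced[OF A] A(1)])
have "(SUM v:\<Union>K. of_int (m v) * of_int (gm v)) = (0::'a)" if "m : Zdual n" for m
proof -
 have "(SUM v:\<Union>K. of_int (m v) * of_int (gm v)) = (of_int (SUM v:\<Union>K. m v * gm v) :: 'a)" by (simp only: of_int_sum of_int_mult)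
 thus ?thesis using gm(2) that by simp
qed
hence "ALL l:dforms n. (SUM v:\<Union>K. l v * of_int (gm v)) = (0::'a)"
 unfolding dforms_def by (intro ballI) (erule imageE, simp)
moreover have "ALL v:\<Union>K - A. of_int (gm v) = (if insert v A : K then wK (insert v A) else (0::'a))"
 using gm(1) by (intro ballI) simp
ultimately show "EX gm. (ALL v:\<Union>K - A. gm v = (if insert v A : K then wK (insert v A) else (0::'a))) &
   (ALL l:dforms n. (SUM v:\<Union>K. l v * gm v) = 0)" by (intro exI[of _ "%v. of_int (gm v)"] conjI) assumption+
qed
qed

end

text \<open>Duality with coefficients in the ring named by the type argument, on the complex of
  primitive vectors.\<close>

definition PD_over :: "'a::{idom, ring_char_0} itself => tfan => bool" where
"PD_over _ Sg <-> PDc (fcx Sg) (dforms (lat_rank Sg) :: (vec => 'a) set) (fan_dim Sg)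
 (%B. of_int (wt Sg (cn B)))"

section \<open>The star fan as a quotient complex\<close>

subsection \<open>Star fans\<close>

text \<open>Extend \<open>S\<close> to a basis of the lattice and keep the coordinates outside
  \<open>S\<close>.\<close>

lemma quot_map_ex:
assumes S: "ubasis (lat_rank Sg) S"
shows "is_quot_map Sg (cn S) (quot_map Sg (cn S))"
proof -
define n where "n = lat_rank Sg"
obtain C where C: "S <= C" "ubasis n C" "card C = n" using ubasis_extend[OF S] n_def by blast
note Cs = ubasisD[OF C(2)]
have span: "span C = Rspace n" by (rule ubasis_full_span[OF C(2,3)])
have finS: "finite S" using S ubasisD(1) by blast
define k where "k = n - card S"
have "card (C - S) = k" using C finS by (simp add: card_Diff_subset k_def)
then obtain e where e: "bij_betw e (C - S) {..<k}"
using ex_bij_betw_finite_nat[of "C - S"] Cs(1) by (auto simp: lessThan_atLeast0)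
define pp :: "vec => vec" where "pp v = (SUM c:C - S. co C c v *\<^sub>R single (e c) 1)" for v
have lin: "linear pp"
by (rule linearI) (simp_all add: pp_def linear_add[OF co(1)[OF Cs(2)]] linear_scale[OF co(1)[OF Cs(2)]]
  scaleR_add_left sum.distrib scaleR_sum_right)
have look: "lookup (SUM c:C - S. a c *\<^sub>R single (e c) (1::real)) (e c) = a c" if c: "c : C - S" for a c
proof -
have "lookup (SUM c:C - S. a c *\<^sub>R single (e c) (1::real)) (e c) = (SUM x:C - S. if x = c then a c else 0)"
 unfolding lookup_sum
 using e c by (intro sum.cong) (auto simp: lookup_scaleR lookup_single when_def bij_betw_def inj_on_def)
thus ?thesis using c Cs(1) by simp
qed
have e_lt: "e c < k" if "c : C - S" for c using bij_betwE[OF e] that by auto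
have eZ: "single (e c) 1 : Zlat k" if "c : C - S" for c
using e_lt[OF that] by (auto simp: mem_Zlat lookup_single when_def)
have ker: "{v : Rspace n. pp v = 0} = span (cn S)"
proof (intro equalityI subsetI)
fix v assume v: "v : {v : Rspace n. pp v = 0}"
hence "co C c v = 0" if "c : C - S" for c
 using look[OF that, of "%c. co C c v"] by (simp add: pp_def)
thus "v : span (cn S)" using span_sub_iff[OF Cs(2,1) C(1), of v] v span by auto
next
fix v assume "v : span (cn S)"
hence vS: "v : span S" by simp
hence "v : span C" using span_mono[OF C(1)] by blast
moreover have "co C c v = 0" if "c : C - S" for c using co_zero[OF Cs(2) C(1) _ vS] that by blast
ultimately show "v : {v : Rspace n. pp v = 0}" using span by (simp add: pp_def)
qed
have ZC: "Zlat n <= span C" using span Zlat_Rspace by simp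
have img: "pp ` Zlat n = Zlat k"
proof (intro equalityI subsetI)
fix y assume "y : pp ` Zlat n"
then obtain x where x: "x : Zlat n" "y = pp x" by blast
have "co C c x *\<^sub>R single (e c) 1 : Zlat k" if c: "c : C - S" for c
proof -
 obtain z where "co C c x = of_int z" using Cs(4)[of x c] x(1) ZC c by (auto elim: Ints_cases)
 thus ?thesis using Zlat_scale[OF eZ[OF c]] by simp
qed
thus "y : Zlat k" unfolding x(2) pp_def by (intro Zlat_sum)
next
fix y assume y: "y : Zlat k"
define x where "x = (SUM c:C. (if c : C - S then lookup y (e c) else 0) *\<^sub>R c)"
have cx: "co C c x = lookup y (e c)" if "c : C - S" for c
 unfolding x_def using that by (subst co_sum[OF Cs(2,1)]) auto
have "x : Zlat n"
 unfolding x_def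
proof (rule Zlat_sum)
 fix c assume c: "c : C"
 obtain z where "(if c : C - S then lookup y (e c) else 0) = of_int z"
  using y Ints_cases[of "lookup y (e c)"] by (cases "c : C - S") (auto simp: mem_Zlat intro: that[of 0])
 thus "(if c : C - S then lookup y (e c) else 0) *\<^sub>R c : Zlat n" using Zlat_scale[of c n z] Cs(3) c by auto
qed
moreover have "pp x = y"
proof (rule poly_mapping_eqI)
 fix i
 show "lookup (pp x) i = lookup y i"
 proof (cases "i < k")
  case True
  hence "i : e ` (C - S)" using e by (simp add: bij_betw_def)
  then obtain c where "c : C - S" "e c = i" by blast
  thus ?thesis using look[of c "%c. co C c x"] cx by (auto simp: pp_def)
 next
  case False
  have "pp x = (SUM c:C - S. lookup y (e c) *\<^sub>R single (e c) 1)" by (simp add: pp_def cx)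
  also have "lookup ... i = 0"
   unfolding lookup_sum by (intro sum.neutral) (use e_lt False in "auto simp: lookup_scaleR lookup_single when_def")
  finally show ?thesis using y False by (simp add: mem_Zlat)
 qed
qed
ultimately show "y : pp ` Zlat n" by blast
qed
have "dim (cn S) = card S" by (rule dim_cone_of[OF S])
hence "is_quot_map Sg (cn S) pp"
using lin img ker by (simp add: is_quot_map_def n_def k_def)
thus ?thesis unfolding quot_map_def by (rule someI[of "is_quot_map Sg (cn S)"])
qed

locale ustar = utrop +
fixes S assumes S: "S : K"
begin

abbreviation "pp == quot_map Sg (cn S)"
abbreviation "T == star_fan Sg (cn S)"
abbreviation "k == card S"
abbreviation "KS == {pp ` (B - S) |B. B : K & S <= B}"

lemma quot: "linear pp" "pp ` Zlat n = Zlat (n - k)" "x : Rspace n ==> pp x = 0 <-> x : span S"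
proof -
have q: "is_quot_map Sg (cn S) pp" by (rule quot_map_ex[OF face_ub[OF S]])
thus "linear pp" "pp ` Zlat n = Zlat (n - k)" by (auto simp: is_quot_map_def dim_face[OF S])
assume "x : Rspace n"
moreover have "{v : Rspace n. pp v = 0} = span S" using q by (simp add: is_quot_map_def)
ultimately show "pp x = 0 <-> x : span S" by blast
qed

lemma rank_T: "lat_rank T = n - k" by (simp add: star_fan_def dim_face[OF S])

lemma span_Rspace: "B : K ==> span B <= Rspace n"
using face_ub ubasisD(3) Zlat_Rspace sub_Rspace by (intro span_minimal) blast+

lemma pp_S: "x : span S ==> pp x = 0" using quot(3) span_Rspace[OF S] by blast

text \<open>A positive multiple of a vertex outside the centre, moved along the centre, stays in the
relative interior of the corresponding cone; hence the projection separates cones.\<close>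

lemma separate:
assumes A: "A : K" "S <= A" and B: "B : K" "S <= B" and a: "a : A - S" and x: "x : cn B" "pp a = pp x"
shows "a : B"
proof -
note As = ubasisD[OF face_ub[OF A(1)]] and Bs = ubasisD[OF face_ub[OF B(1)]]
note Ss = ubasisD[OF face_ub[OF S]]
have xR: "x : Rspace n" using x(1) mem_cone_of[OF Bs(2,1)] span_Rspace[OF B(1)] by blast
have aR: "a : Rspace n" using a A(1) span_Rspace[OF A(1)] span_base by blast
have "x - a : Rspace n" by (rule subspace_diff[OF sub_Rspace xR aR])
moreover have "pp (x - a) = 0" using x(2) by (simp add: linear_diff[OF quot(1)])
ultimately have s: "x - a : span S" using quot(3) by blast
define p where "p = (SUM i:S. max 0 (co S i (x - a)) *\<^sub>R i)"
define q where "q = (SUM i:S. max 0 (- co S i (x - a)) *\<^sub>R i)"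
have "p - q = (SUM i:S. co S i (x - a) *\<^sub>R i)"
unfolding p_def q_def sum_subtractf[symmetric] scaleR_diff_left[symmetric] by (intro sum.cong refl) (auto simp: max_def)
hence pq: "x + q = a + p" using co_span[OF Ss(2,1) s] by (simp add: algebra_simps)
have S_cone: "(SUM i:S'. c i *\<^sub>R i) : cn S" if "!!i. i : S' ==> 0 <= c i" "S' <= S" for c :: "vec => real" and S'
using that by (induction S' rule: infinite_finite_induct)
 (auto simp: convex_cone_hull_contains_0 hull_inc intro!: convex_cone_hull_add convex_cone_hull_mul)
have pS: "p : cn S" "q : cn S" unfolding p_def q_def by (auto intro!: S_cone)
have "x + q : cn B" using x(1) pS(2) hull_mono[OF B(2)] by (blast intro: convex_cone_hull_add)
moreover have "a + p : cn A" using a pS(1) hull_mono[OF A(2), of convex_cone]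
by (blast intro: convex_cone_hull_add hull_inc)
ultimately have "a + p : cn (A Int B)" using pq inter_complex[OF A(1) B(1)] by auto
hence in_AB: "ALL b:A - A Int B. co A b (a + p) = 0" using cone_of_sub_iff[OF As(2,1), of "A Int B"] by blast
have "p : span S" using pS(1) mem_cone_of[OF Ss(2,1)] by blast
hence "co A a (a + p) = 1"
using a co_zero[OF As(2) A(2), of a p] by (auto simp: linear_add[OF co(1)[OF As(2)]] co(2)[OF As(2)])
thus "a : B" using in_AB a by force
qed

lemma inj_pp: "inj_on pp (link K S)"
proof (rule inj_onI)
fix a b assume ab: "a : link K S" "b : link K S" "pp a = pp b"
have "a : insert b S" by (rule separate[of "insert a S" _ _ b]) (use ab in "auto simp: link_def hull_inc")
thus "a = b" using ab by (auto simp: link_def)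
qed

lemma sub_link: "B : K ==> S <= B ==> B - S <= link K S"
using dcx by (fastforce simp: link_def)

lemma pp_cone: "S <= B ==> pp ` cn B = cn (pp ` (B - S))"
proof -
assume SB: "S <= B"
have z: "pp s = 0" if "s : S" for s using that by (intro pp_S span_base)
have "pp ` cn B = cn (pp ` B)" by (rule convex_cone_hull_linear_image[symmetric]) (rule quot(1))
also have "... = cn (pp ` (B - S))"
proof (rule hull_unique[symmetric])
show "pp ` (B - S) <= cn (pp ` B)" by (meson Diff_subset hull_subset image_mono order_trans)
show "convex_cone (cn (pp ` B))" by (rule convex_cone_convex_cone_hull)
fix t assume t: "pp ` (B - S) <= t" "convex_cone t"
have "pp ` B <= t" using t z convex_cone_contains_0[OF t(2)] by fastforce
thus "cn (pp ` B) <= t" using t(2) by (rule hull_minimal)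
qed
finally show ?thesis .
qed

text \<open>A lattice point in the span of the image is lifted to the lattice and to the span of
  \<open>B - S\<close>. The lifts differ by an element of the span of \<open>S\<close>, so the
  lattice lift has integral coordinates in \<open>B\<close>, and the projection discards those of
  \<open>S\<close>.\<close>

lemma ubasis_pp:
assumes B: "B : K" "S <= B" shows "ubasis (n - k) (pp ` (B - S))"
proof (rule ubasisI)
note Bs = ubasisD[OF face_ub[OF B(1)]]
show "finite (pp ` (B - S))" using Bs(1) by simp
show "pp ` (B - S) <= Zlat (n - k)" using Bs(3) quot(2) by blast
have inj: "inj_on pp (B - S)" using inj_pp sub_link[OF B] by (rule inj_on_subset)
have inj_span: "inj_on pp (span (B - S))"
proof (rule inj_onI)
fix x y assume xy: "x : span (B - S)" "y : span (B - S)" "pp x = pp y"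
have d: "x - y : span (B - S)" using xy by (intro span_diff)
have dB: "x - y : span B" using d span_mono[of "B - S" B] by blast
hence dS: "x - y : span S" using quot(3)[of "x - y"] span_Rspace[OF B(1)] xy(3)
 by (auto simp: linear_diff[OF quot(1)])
have "co B b (x - y) = 0" if "b : B" for b
proof (cases "b : S")
 case True thus ?thesis using co_zero[OF Bs(2) Diff_subset _ d] by blast
next
 case False thus ?thesis using co_zero[OF Bs(2) B(2) _ dS] by blast
qed
hence "x - y = 0" using co_span[OF Bs(2,1) dB] by simp
thus "x = y" by simp
qed
have "independent (B - S)" using Bs(2) independent_mono by blast
thus "independent (pp ` (B - S))" by (rule linear_independent_injective_image[OF quot(1) _ inj_span])
fix y assume y: "y : Zlat (n - k)" "y : span (pp ` (B - S))"
obtain z where z: "z : Zlat n" "y = pp z" using y(1) quot(2) by blast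
obtain x where x: "x : span (B - S)" "y = pp x" using y(2) by (auto simp: linear_span_image[OF quot(1)])
have xB: "x : span B" using x(1) span_mono[of "B - S" B] by blast
have "z - x : Rspace n" by (rule subspace_diff[OF sub_Rspace]) (use z(1) Zlat_Rspace xB span_Rspace[OF B(1)] in auto)
moreover have "pp (z - x) = 0" using z(2) x(2) by (simp add: linear_diff[OF quot(1)])
ultimately have "z - x : span S" using quot(3) by blast
hence "z - x : span B" using span_mono[OF B(2)] by blast
hence "z : span B" using span_add[of "z - x" B x] xB by simp
from ub_coords[OF face_ub[OF B(1)] z(1) this]
have zc: "z = (SUM b:B. of_int \<lfloor>co B b z\<rfloor> *\<^sub>R b)" .
have "y = (SUM b:B. of_int \<lfloor>co B b z\<rfloor> *\<^sub>R pp b)"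
unfolding z(2) by (subst zc) (simp add: linear_sum[OF quot(1)] linear_scale[OF quot(1)])
also have "... = (SUM b:B - S. of_int \<lfloor>co B b z\<rfloor> *\<^sub>R pp b)"
by (rule sum.mono_neutral_right) (use Bs(1) pp_S in "auto intro: span_base")
also have "... = (SUM c:pp ` (B - S). of_int \<lfloor>co B (inv_into (B - S) pp c) z\<rfloor> *\<^sub>R c)"
by (subst sum.reindex[OF inj]) (auto simp: inv_into_f_f[OF inj])
finally show "EX c. y = (SUM b:pp ` (B - S). of_int (c b) *\<^sub>R b)" by (rule exI[where x = "%c. \<lfloor>co B (inv_into (B - S) pp c) z\<rfloor>"])
qed

lemma cones_T: "cones T = cn ` KS"
proof -
have "cones T = {pp ` cn B |B. B : K & S <= B}"
unfolding star_fan_def cones_eq using cone_subset_iff[OF S] by auto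
also have "... = cn ` KS" using pp_cone by (auto simp: image_iff)
finally show ?thesis .
qed

lemma complex_T: "fcx T = KS"
by (rule fan_complex_eqI[OF cones_T]) (use ubasis_pp in "auto simp: rank_T")

lemma image_inj:
assumes "A : K" "S <= A" "B : K" "S <= B" "pp ` (A - S) = pp ` (B - S)" shows "A = B"
proof -
have "A - S = B - S" using inj_on_image_eq_iff[OF inj_pp sub_link[OF assms(1,2)] sub_link[OF assms(3,4)]] assms(5) by blast
thus ?thesis using assms by blast
qed

lemma card_T: "B : K ==> S <= B ==> card (pp ` (B - S)) = card B - k"
using inj_on_subset[OF inj_pp sub_link] fin_face by (simp add: card_image card_Diff_subset fin_face[OF S])

sublocale star: cone_complex T
proof
show "finite (fcx T)" unfolding complex_T using fincx by simp
show "cones T = cn ` fcx T" unfolding complex_T by (rule cones_T)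
show "{} : fcx T" unfolding complex_T using S by blast
show "C : fcx T" if B: "B : fcx T" and C: "C <= B" for B C
proof -
obtain A where A: "A : K" "S <= A" "B = pp ` (A - S)" using B unfolding complex_T by blast
then obtain D where D: "D <= A - S" "C = pp ` D" using C by (meson subset_imageE)
have "D Un S : K" using A D dcx[OF A(1), of "D Un S"] by blast
moreover have "(D Un S) - S = D" using D(1) by blast
ultimately have "D Un S : K & S <= D Un S & C = pp ` ((D Un S) - S)" using D(2) by simp
thus ?thesis unfolding complex_T by blast
qed
fix B C assume "B : fcx T" "C : fcx T" and s: "cn B <= cn C"
then obtain A D where A: "A : K" "S <= A" "B = pp ` (A - S)" and D: "D : K" "S <= D" "C = pp ` (D - S)"
by (auto simp: complex_T)
have "a : D" if a: "a : A - S" for a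
proof -
have "pp a : cn B" using a A(3) by (auto intro: hull_inc)
hence "pp a : pp ` cn D" using s pp_cone[OF D(2)] D(3) by auto
then obtain x where "x : cn D" "pp a = pp x" by blast
thus ?thesis using separate[OF A(1,2) D(1,2) a] by blast
qed
thus "B <= C" using A(3) D(3) by blast
qed

lemma wt_T: "B : K ==> S <= B ==> wt T (cn (pp ` (B - S))) = wt Sg (cn B)"
proof -
assume B: "B : K" "S <= B"
have "(THE w. EX et:cones Sg. cn S <= et & pp ` cn B = pp ` et & w = wt Sg et) = wt Sg (cn B)"
proof (rule the_equality)
show "EX et:cones Sg. cn S <= et & pp ` cn B = pp ` et & wt Sg (cn B) = wt Sg et"
 using cone_in[OF B(1)] hull_mono[OF B(2)] by blast
fix w assume "EX et:cones Sg. cn S <= et & pp ` cn B = pp ` et & w = wt Sg et"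
then obtain et where et: "et : cones Sg" "cn S <= et" "pp ` cn B = pp ` et" "w = wt Sg et" by blast
obtain C where C: "C : K" "et = cn C" using cone_basis[OF et(1)] by blast
have SC: "S <= C" using cone_subset[OF S C(1)] et(2) C(2) by blast
have "cn (pp ` (B - S)) = cn (pp ` (C - S))" using et(3) C(2) pp_cone[OF B(2)] pp_cone[OF SC] by simp
hence "pp ` (B - S) = pp ` (C - S)" by (rule cone_of_inj[OF ubasis_pp[OF B] ubasis_pp[OF C(1) SC]])
hence "B = C" by (rule image_inj[OF B C(1) SC])
thus "w = wt Sg (cn B)" using et(4) C(2) by simp
qed
thus ?thesis unfolding pp_cone[OF B(2)] by (simp add: star_fan_def pp_cone[OF B(2)])
qed

lemma dim_T: "fan_dim T = d - k"
proof -
obtain C where C: "C : K" "S <= C" "card C = d" using facet_ex[OF S] .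
have "fan_dim T = Max (card ` KS)" unfolding star.fan_dim_eq complex_T ..
also have "... = d - k"
proof (rule Max_eqI)
show "finite (card ` KS)" using fincx by simp
show "y <= d - k" if "y : card ` KS" for y
proof -
 obtain B where B: "B : K" "S <= B" "y = card (pp ` (B - S))" using \<open>y : card ` KS\<close> by blast
 thus ?thesis using card_T[OF B(1,2)] card_le[OF B(1)] by simp
qed
show "d - k : card ` KS" using C card_T[OF C(1,2)] by (intro image_eqI[of _ _ "pp ` (C - S)"]) auto
qed
finally show ?thesis .
qed

lemma link_T:
assumes B: "B : K" "S <= B" shows "link (fcx T) (pp ` (B - S)) = pp ` link K B"
proof (intro equalityI subsetI)
fix c assume "c : link (fcx T) (pp ` (B - S))"
hence c: "c ~: pp ` (B - S)" "insert c (pp ` (B - S)) : KS" by (auto simp: link_def complex_T)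
from c(2) obtain A where A: "A : K" "S <= A" "insert c (pp ` (B - S)) = pp ` (A - S)" by blast
then obtain a where a: "a : A - S" "c = pp a" by blast
have "pp ` (B - S) <= pp ` (A - S)" using A(3) by blast
hence "B - S <= A - S" using inj_on_image_subset_iff[OF inj_pp sub_link[OF B] sub_link[OF A(1,2)]] by blast
hence "insert a B <= A" using a(1) A(2) by blast
hence "insert a B : K" using A(1) dcx by blast
moreover have "a ~: B" using c(1) a by blast
ultimately show "c : pp ` link K B" using a(2) by (auto simp: link_def)
next
fix c assume "c : pp ` link K B"
then obtain a where a: "a ~: B" "insert a B : K" "c = pp a" by (auto simp: link_def)
have aS: "a : insert a B - S" using a(1) B(2) by blast
have "pp a ~: pp ` (B - S)"
proof
assume "pp a : pp ` (B - S)"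
then obtain b where b: "b : B - S" "pp a = pp b" by blast
have "a = b" by (rule inj_onD[OF inj_pp b(2)]) (use sub_link[OF B] sub_link[OF a(2)] b(1) aS B(2) in auto)
thus False using a(1) b(1) by blast
qed
moreover have "insert a B : K & S <= insert a B & insert (pp a) (pp ` (B - S)) = pp ` (insert a B - S)"
using a B(2) aS by auto
hence "insert (pp a) (pp ` (B - S)) : KS" by blast
ultimately show "c : link (fcx T) (pp ` (B - S))" unfolding a(3) link_def complex_T by blast
qed

lemma inj_link: "B : K ==> S <= B ==> inj_on pp (link K B)"
proof (rule inj_on_subset[OF inj_pp])
assume B: "B : K" "S <= B"
show "link K B <= link K S"
proof
fix b assume "b : link K B"
thus "b : link K S" using B dcx[of "insert b B" "insert b S"] by (auto simp: link_def)
qed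
qed

lemma insert_pp: "S <= B ==> b : link K B ==> insert (pp b) (pp ` (B - S)) = pp ` (insert b B - S)"
by (auto simp: link_def)

lemma star_balanced_sum:
assumes B: "B : K" "S <= B"
shows "(SUM c:link (fcx T) (pp ` (B - S)). of_int (wt T (cn (insert c (pp ` (B - S))))) *\<^sub>R c)
= pp (SUM b:link K B. of_int (wt Sg (cn (insert b B))) *\<^sub>R b)"
proof -
have "wt T (cn (insert (pp b) (pp ` (B - S)))) = wt Sg (cn (insert b B))" if b: "b : link K B" for b
unfolding insert_pp[OF B(2) b] using b B(2) by (intro wt_T) (auto simp: link_def)
thus ?thesis
unfolding link_T[OF B] sum.reindex[OF inj_link[OF B]]
by (simp add: linear_sum[OF quot(1)] linear_scale[OF quot(1)])
qed

text \<open>The projection carries the balancing sum at \<open>B\<close> to that of the star; orders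
  on star fans are computed from it.\<close>

lemma star_balanced:
assumes "A : fcx T" "Suc (card A) = fan_dim T" shows "star.balanced_at A"
proof -
obtain B where B: "B : K" "S <= B" "A = pp ` (B - S)" using assms(1) by (auto simp: complex_T)
have "k <= card B" using card_mono[OF fin_face[OF B(1)] B(2)] .
hence "Suc (card B) = d" using assms(2) card_T[OF B(1,2)] dim_T B(3) by simp
from balanced[OF B(1) this]
have "pp (SUM b:link K B. of_int (wt Sg (cn (insert b B))) *\<^sub>R b) : pp ` span B" unfolding balanced_at_def by blast
also have "pp ` span B = span (pp ` (cn B))" by (simp add: linear_span_image[OF quot(1)])
also have "... = span A" unfolding pp_cone[OF B(2)] B(3) by simp
finally show ?thesis unfolding star.balanced_at_def B(3) star_balanced_sum[OF B(1,2)] .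
qed

end

section \<open>Perfect pairings of abelian groups, integrally and after tensoring with the
  rationals\<close>

section \<open>Perfect pairings of abelian groups\<close>

definition addit :: "'a monoid => ('a => 'c::ab_group_add) => bool" where
"addit A f <-> (ALL x:carrier A. ALL y:carrier A. f (x \<otimes>\<^bsub>A\<^esub> y) = f x + f y)"

lemma additive_onD: "addit A f ==> x : carrier A ==> y : carrier A ==> f (x \<otimes>\<^bsub>A\<^esub> y) = f x + f y"
by (simp add: addit_def)

lemma additive_on_simps:
assumes A: "group A" and f: "addit A f"
shows "f \<one>\<^bsub>A\<^esub> = 0" "x : carrier A ==> f (inv\<^bsub>A\<^esub> x) = - f x"
"x : carrier A ==> y : carrier A ==> f (x \<otimes>\<^bsub>A\<^esub> inv\<^bsub>A\<^esub> y) = f x - f y"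
proof -
interpret group A by fact
show one: "f \<one>\<^bsub>A\<^esub> = 0" using additive_onD[OF f, of "\<one>\<^bsub>A\<^esub>" "\<one>\<^bsub>A\<^esub>"] by simp
show i: "f (inv\<^bsub>A\<^esub> x) = - f x" if "x : carrier A" for x
using additive_onD[OF f, of x "inv\<^bsub>A\<^esub> x"] that one by (simp add: eq_neg_iff_add_eq_0 add.commute)
show "x : carrier A ==> y : carrier A ==> f (x \<otimes>\<^bsub>A\<^esub> inv\<^bsub>A\<^esub> y) = f x - f y"
using additive_onD[OF f, of x "inv\<^bsub>A\<^esub> y"] i by simp
qed

lemma additive_on_pow:
fixes f :: "'a => 'c::ring_1"
assumes A: "group A" and f: "addit A f" and x: "x : carrier A"
shows "f (x [^]\<^bsub>A\<^esub> (n::nat)) = of_nat n * f x"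
proof -
interpret group A by fact
show ?thesis by (induction n) (simp_all add: additive_on_simps(1)[OF A f] additive_onD[OF f] x algebra_simps)
qed

text \<open>One half of perfectness with denominators from \<open>N\<close>: for
  \<open>N = {1}\<close> it is integral perfectness, for all positive integers it is perfectness
  after tensoring with the rationals.\<close>

definition nondeg ::
"'c::ring_1 itself => nat set => 'a monoid => 'b monoid => ('a => 'b => int) => bool" where
"nondeg _ N A B b <->
 (ALL x:carrier A. (ALL y:carrier B. b x y = 0) --> (EX n:N. x [^]\<^bsub>A\<^esub> n = \<one>\<^bsub>A\<^esub>)) &
 (ALL ph::'b => 'c. addit B ph -->
  (EX x:carrier A. EX n:N. ALL y:carrier B. of_int (b x y) = of_nat n * ph y))"

lemma bij_betw_hom_iff:
fixes b :: "'a => 'b => 'c::ab_group_add"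
assumes A: "group A" and B: "group B" and H: "carrier H = UNIV" "monoid.mult H = (+)"
and b: "!!x. x : carrier A ==> addit B (b x)" "!!y. y : carrier B ==> addit A (%x. b x y)"
shows "bij_betw (%x. \<lambda>y\<in>carrier B. b x y) (carrier A) (hom B H Int extensional (carrier B)) <->
(ALL x:carrier A. (ALL y:carrier B. b x y = 0) --> x = \<one>\<^bsub>A\<^esub>) &
(ALL ph. addit B ph --> (EX x:carrier A. ALL y:carrier B. b x y = ph y))" (is "?L <-> ?I & ?S")
proof -
interpret A: group A by fact
interpret B: group B by fact
let ?b = "%x. \<lambda>y\<in>carrier B. b x y"
have hom: "ph : hom B H <-> addit B ph" for ph by (auto simp: hom_def addit_def H)
have eq: "?b x = ?b x' <-> (ALL y:carrier B. b x y = b x' y)" for x x' by (auto simp: restrict_def fun_eq_iff)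
have "inj_on ?b (carrier A) <-> ?I"
proof
assume inj: "inj_on ?b (carrier A)"
show ?I
proof (intro ballI impI)
 fix x assume x: "x : carrier A" "ALL y:carrier B. b x y = 0"
 hence "?b x = ?b \<one>\<^bsub>A\<^esub>" unfolding eq using additive_on_simps(1)[OF A b(2)] by simp
 thus "x = \<one>\<^bsub>A\<^esub>" using inj_onD[OF inj] x(1) by blast
qed
next
assume I: ?I
show "inj_on ?b (carrier A)"
proof (rule inj_onI)
 fix x x' assume x: "x : carrier A" "x' : carrier A" "?b x = ?b x'"
 hence "ALL y:carrier B. b (x \<otimes>\<^bsub>A\<^esub> inv\<^bsub>A\<^esub> x') y = 0"
  using additive_on_simps(3)[OF A b(2)] unfolding eq by simp
 hence "x \<otimes>\<^bsub>A\<^esub> inv\<^bsub>A\<^esub> x' = \<one>\<^bsub>A\<^esub>" using I x by simp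
 thus "x = x'" using x by (metis A.inv_closed A.inv_equality A.inv_inv)
qed
qed
moreover have "?b ` carrier A = hom B H Int extensional (carrier B) <-> ?S"
proof
assume im: "?b ` carrier A = hom B H Int extensional (carrier B)"
show ?S
proof (intro allI impI)
 fix ph :: "'b => 'c" assume "addit B ph"
 hence "restrict ph (carrier B) : hom B H Int extensional (carrier B)" by (auto simp: hom addit_def)
 then obtain x where "x : carrier A" "restrict ph (carrier B) = ?b x" unfolding im[symmetric] by blast
 thus "EX x:carrier A. ALL y:carrier B. b x y = ph y" by (metis restrict_apply')
qed
next
assume S: ?S
show "?b ` carrier A = hom B H Int extensional (carrier B)"
proof (intro equalityI subsetI)
 fix ph assume "ph : ?b ` carrier A"
 thus "ph : hom B H Int extensional (carrier B)" using b(1) by (auto simp: hom addit_def)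
next
 fix ph assume ph: "ph : hom B H Int extensional (carrier B)"
 then obtain x where x: "x : carrier A" "ALL y:carrier B. b x y = ph y" using S hom by blast
 have "ph = ?b x" using x(2) ph by (intro extensionalityI[of _ "carrier B"]) auto
 thus "ph : ?b ` carrier A" using x(1) by blast
qed
qed
ultimately show ?thesis by (simp add: bij_betw_def)
qed

lemma perfect_pairing_iff:
fixes b :: "'a => 'b => 'c::ab_group_add"
assumes A: "group A" and B: "group B" and H: "carrier H = UNIV" "monoid.mult H = (+)"
and b: "!!x. x : carrier A ==> addit B (b x)" "!!y. y : carrier B ==> addit A (%x. b x y)"
shows "perfect_pairing A B H b <->
(ALL x:carrier A. (ALL y:carrier B. b x y = 0) --> x = \<one>\<^bsub>A\<^esub>) &
(ALL ph. addit B ph --> (EX x:carrier A. ALL y:carrier B. b x y = ph y)) &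
(ALL y:carrier B. (ALL x:carrier A. b x y = 0) --> y = \<one>\<^bsub>B\<^esub>) &
(ALL ph. addit A ph --> (EX y:carrier B. ALL x:carrier A. b x y = ph x))"
proof -
have "b x : hom B H" if "x : carrier A" for x using b(1)[OF that] by (auto simp: hom_def addit_def H)
moreover have "(%x. b x y) : hom A H" if "y : carrier B" for y using b(2)[OF that] by (auto simp: hom_def addit_def H)
moreover have "bij_betw (%x. \<lambda>y\<in>carrier B. b x y) (carrier A) (hom B H Int extensional (carrier B)) <->
(ALL x:carrier A. (ALL y:carrier B. b x y = 0) --> x = \<one>\<^bsub>A\<^esub>) &
(ALL ph. addit B ph --> (EX x:carrier A. ALL y:carrier B. b x y = ph y))"
using A B H b by (rule bij_betw_hom_iff)
moreover have "bij_betw (%y. \<lambda>x\<in>carrier A. b x y) (carrier B) (hom A H Int extensional (carrier A)) <->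
(ALL y:carrier B. (ALL x:carrier A. b x y = 0) --> y = \<one>\<^bsub>B\<^esub>) &
(ALL ph. addit A ph --> (EX y:carrier B. ALL x:carrier A. b x y = ph x))"
using B A H b(2,1) by (rule bij_betw_hom_iff)
ultimately show ?thesis unfolding perfect_pairing_def by simp
qed

lemma perfect_pairing_int_iff:
assumes A: "group A" and B: "group B"
and b: "!!x. x : carrier A ==> addit B (b x)" "!!y. y : carrier B ==> addit A (%x. b x y)"
shows "perfect_pairing A B integer_group b <->
nondeg TYPE(int) {1} A B b & nondeg TYPE(int) {1} B A (%y x. b x y)"
proof -
interpret A: group A by fact
interpret B: group B by fact
have "carrier integer_group = UNIV" "monoid.mult integer_group = (+)" by (auto simp: integer_group_def)
from perfect_pairing_iff[OF A B this b] show ?thesis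
by (simp add: nondeg_def conj_assoc cong: ball_cong)
qed

subsection \<open>Tensoring with the rationals\<close>

definition frag_sum :: "('x => 'r) => ('x \<Rightarrow>\<^sub>0 int) => 'r::comm_ring_1" where
"frag_sum g c = (SUM x:keys c. of_int (lookup c x) * g x)"

lemma frag_sum_alt: "finite S ==> keys c <= S ==> frag_sum g c = (SUM x:S. of_int (lookup c x) * g x)"
unfolding frag_sum_def by (rule sum.mono_neutral_left) (auto simp: in_keys_iff)

lemma frag_sum_add: "frag_sum g (c + c') = frag_sum g c + frag_sum g c'"
proof -
have "finite (keys c Un keys c')" "keys (c + c') <= keys c Un keys c'" using keys_add[of c c'] by auto
thus ?thesis
by (simp add: frag_sum_alt[of "keys c Un keys c'"] lookup_add algebra_simps sum.distrib)
qed

lemma frag_sum_0 [simp]: "frag_sum g 0 = 0" by (simp add: frag_sum_def)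

lemma frag_sum_uminus: "frag_sum g (- c) = - frag_sum g c"
using frag_sum_add[of g c "- c"] by (simp add: eq_neg_iff_add_eq_0 add.commute)

lemma frag_sum_diff: "frag_sum g (c - c') = frag_sum g c - frag_sum g c'"
using frag_sum_add[of g c "- c'"] by (simp add: frag_sum_uminus)

lemma frag_sum_frag_of [simp]: "frag_sum g (frag_of x) = g x"
by (simp add: frag_sum_def)

lemma frag_sum_cong: "(!!x. x : keys c ==> g x = g' x) ==> frag_sum g c = frag_sum g' c"
by (simp add: frag_sum_def)

lemma frag_sum_plus: "frag_sum (%x. g x + g' x) c = frag_sum g c + frag_sum g' c"
by (simp add: frag_sum_def algebra_simps sum.distrib)

locale rat_tensor = comm_group A for A :: "'a monoid" (structure)
begin

abbreviation "F == free_Abelian_group (carrier A \<times> carrier rat_group)"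
abbreviation "R == tensor_kernel A rat_group"
abbreviation "TA == tensor_Q A"
abbreviation "pt a q == pure_tensor A rat_group a q"

lemma rat_group_simps [simp]: "carrier rat_group = UNIV" "x \<otimes>\<^bsub>rat_group\<^esub> y = x + y" "\<one>\<^bsub>rat_group\<^esub> = 0"
by (auto simp: rat_group_def)

lemma rels_closed: "tensor_rels A rat_group <= carrier F"
unfolding tensor_rels_def carrier_free_Abelian_group_iff
by (auto dest!: subsetD[OF keys_diff] split: if_splits)

lemma subgroup_R: "subgroup R F"
unfolding tensor_kernel_def using rels_closed by (intro group.generate_is_subgroup) auto

sublocale FF: comm_group F by (rule abelian_free_Abelian_group)

lemma normal_R: "R \<lhd> F" by (rule FF.subgroup_imp_normal[OF subgroup_R])

sublocale TT: comm_group TA unfolding tensor_def by (rule FF.abelian_FactGroup[OF subgroup_R])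

lemma R_closed:
"c : R ==> keys c <= carrier A \<times> carrier rat_group" "0 : R" "c : R ==> c' : R ==> c + c' : R" "c : R ==> - c : R"
using subgroup.mem_carrier[OF subgroup_R, of c] subgroup.one_closed[OF subgroup_R]
subgroup.m_closed[OF subgroup_R, of c c'] subgroup.m_inv_closed[OF subgroup_R, of c]
by auto

definition co_set :: "('a \<times> rat \<Rightarrow>\<^sub>0 int) => ('a \<times> rat \<Rightarrow>\<^sub>0 int) set" where
"co_set c = R #>\<^bsub>F\<^esub> c"

lemma co_set_alt: "co_set c = {h + c |h. h : R}" by (auto simp: co_set_def r_coset_def)

lemma co_set_eq: "c - c' : R ==> co_set c = co_set c'"
proof -
have sub: "co_set c <= co_set c'" if "c - c' : R" for c c'
proof
fix x assume "x : co_set c"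
then obtain h where h: "h : R" "x = h + c" by (auto simp: co_set_alt)
hence "x = (h + (c - c')) + c'" "h + (c - c') : R" using that R_closed(3) by auto
thus "x : co_set c'" unfolding co_set_alt by blast
qed
assume "c - c' : R"
moreover have "c' - c : R" using R_closed(4)[OF calculation] by simp
ultimately show ?thesis using sub by blast
qed

lemma pt_co_set: "pt a q = co_set (frag_of (a, q))" by (simp add: pure_tensor_def co_set_def)

lemma carrier_TA: "carrier TA = co_set ` carrier F"
by (auto simp: tensor_def FactGroup_def RCOSETS_def co_set_def)

lemma co_set_mult: "keys c <= carrier A \<times> carrier rat_group ==> keys c' <= carrier A \<times> carrier rat_group ==>
co_set c \<otimes>\<^bsub>TA\<^esub> co_set c' = co_set (c + c')"
using normal.rcos_sum[OF normal_R, of c c'] by (simp add: tensor_def FactGroup_def co_set_def)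

lemma one_TA: "\<one>\<^bsub>TA\<^esub> = co_set 0"
by (auto simp: tensor_def FactGroup_def co_set_alt)

lemma pt_closed: "a : carrier A ==> pt a q : carrier TA"
by (simp add: pt_co_set carrier_TA)

lemma R_rel:
"a : carrier A ==> a' : carrier A ==> frag_of (a \<otimes> a', q) - frag_of (a, q) - frag_of (a', q) : R"
"a : carrier A ==> frag_of (a, q + q') - frag_of (a, q) - frag_of (a, q') : R"
unfolding tensor_kernel_def
by (rule generate.incl, force simp: tensor_rels_def)+

lemma pt_mult:
"a : carrier A ==> a' : carrier A ==> pt (a \<otimes> a') q = pt a q \<otimes>\<^bsub>TA\<^esub> pt a' q"
"a : carrier A ==> pt a (q + q') = pt a q \<otimes>\<^bsub>TA\<^esub> pt a q'"
using R_rel(1)[of a a' q] R_rel(2)[of a q q'] unfolding pt_co_set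
by (simp_all add: co_set_mult diff_diff_eq co_set_eq)

lemma pt_one: "pt \<one> q = \<one>\<^bsub>TA\<^esub>"
proof -
have "pt \<one> q \<otimes>\<^bsub>TA\<^esub> pt \<one> q = pt \<one> q" using pt_mult(1)[of \<one> \<one> q] by simp
thus ?thesis using pt_closed[of \<one> q] by (simp add: TT.r_cancel_one')
qed

lemma pt_pow: "a : carrier A ==> pt (a [^] (n::nat)) q = pt a q [^]\<^bsub>TA\<^esub> n"
by (induction n) (simp_all add: pt_one pt_mult(1))

lemma pt_zero: "a : carrier A ==> pt a 0 = \<one>\<^bsub>TA\<^esub>"
proof -
assume a: "a : carrier A"
have "pt a 0 \<otimes>\<^bsub>TA\<^esub> pt a 0 = pt a 0" using pt_mult(2)[OF a, of 0 0] by simp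
thus ?thesis using pt_closed[OF a] by (simp add: TT.r_cancel_one')
qed

lemma pt_mult_nat: "a : carrier A ==> pt a (of_nat n * q) = pt a q [^]\<^bsub>TA\<^esub> n"
by (induction n) (simp_all add: pt_zero pt_mult(2) distrib_right TT.m_comm pt_closed TT.nat_pow_closed)

lemma pt_shift: "a : carrier A ==> pt (a [^] n) q = pt a (of_nat n * q)"
by (simp add: pt_pow pt_mult_nat)

lemma pt_inv: "a : carrier A ==> pt (inv a) q = inv\<^bsub>TA\<^esub> pt a q" "a : carrier A ==> pt a (- q) = inv\<^bsub>TA\<^esub> pt a q"
proof -
assume a: "a : carrier A"
show "pt (inv a) q = inv\<^bsub>TA\<^esub> pt a q" using pt_mult(1)[of "inv a" a q] a
by (intro TT.inv_equality[symmetric]) (simp_all add: pt_one pt_closed)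
show "pt a (- q) = inv\<^bsub>TA\<^esub> pt a q" using pt_mult(2)[of a "- q" q] a
by (intro TT.inv_equality[symmetric]) (simp_all add: pt_zero pt_closed)
qed

lemma pt_unit_fraction:
assumes a: "a : carrier A" shows "EX a':carrier A. EX n>0. pt a q = pt a' (1 / of_nat n)"
proof -
obtain p r where q: "q = of_int p / of_int r" "r > 0" using quotient_of_div[OF surjective_pairing] quotient_of_denom_pos' by blast
define n where "n = nat r"
have n: "n > 0" "q = of_int p / of_nat n" using q by (auto simp: n_def)
show ?thesis
proof (cases "p >= 0")
case True
hence "q = of_nat (nat p) * (1 / of_nat n)" using n by simp
hence "pt a q = pt (a [^] nat p) (1 / of_nat n)" using pt_shift[OF a] by metis
thus ?thesis using n(1) a by blast
next
case False
hence "q = of_nat (nat (- p)) * (- (1 / of_nat n))" using n by simp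
hence "pt a q = pt (a [^] nat (- p)) (- (1 / of_nat n))" using pt_shift[OF a] by metis
also have "... = pt (inv (a [^] nat (- p))) (1 / of_nat n)" using a by (simp add: pt_inv)
finally show ?thesis using n(1) a by blast
qed
qed

text \<open>Two pure tensors merge into one over a common denominator.\<close>

lemma TA_pure:
assumes "X : carrier TA" obtains a n where "a : carrier A" "n > 0" "X = pt a (1 / of_nat n)"
proof -
obtain c where c: "keys c <= carrier A \<times> carrier rat_group" "X = co_set c" using assms by (auto simp: carrier_TA)
have "EX a:carrier A. EX n>0. co_set c = pt a (1 / of_nat n)"
proof (rule free_Abelian_group_induct[OF c(1)])
have "co_set 0 = pt \<one> (1 / of_nat 1)" by (simp add: pt_one one_TA)
thus "EX a:carrier A. EX n>0. co_set 0 = pt a (1 / of_nat n)" by (intro bexI[of _ \<one>] exI[of _ 1]) auto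
next
fix x assume "x : carrier A \<times> carrier rat_group"
thus "EX a:carrier A. EX n>0. co_set (frag_of x) = pt a (1 / of_nat n)"
 using pt_unit_fraction[of "fst x" "snd x"] by (auto simp: pt_co_set)
next
fix c c' assume c: "keys c <= carrier A \<times> carrier rat_group" "keys c' <= carrier A \<times> carrier rat_group"
 and "EX a:carrier A. EX n>0. co_set c = pt a (1 / of_nat n)" "EX a:carrier A. EX n>0. co_set c' = pt a (1 / of_nat n)"
then obtain a n a' n' where a: "a : carrier A" "n > 0" "co_set c = pt a (1 / of_nat n)"
 "a' : carrier A" "n' > 0" "co_set c' = pt a' (1 / of_nat n')" by blast
have k: "keys (c - c') <= carrier A \<times> carrier rat_group" using c keys_diff[of c c'] by blast
have "co_set (c - c') \<otimes>\<^bsub>TA\<^esub> co_set c' = co_set c" using co_set_mult[OF k c(2)] by simp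
moreover have cc: "co_set c : carrier TA" "co_set c' : carrier TA" "co_set (c - c') : carrier TA"
 using c k by (auto simp: carrier_TA)
ultimately have "co_set (c - c') = co_set c \<otimes>\<^bsub>TA\<^esub> inv\<^bsub>TA\<^esub> co_set c'"
 by (metis TT.inv_solve_right)
also have "... = pt a (of_nat n' * (1 / of_nat (n * n'))) \<otimes>\<^bsub>TA\<^esub> pt (inv a') (of_nat n * (1 / of_nat (n * n')))"
 using a by (simp add: pt_inv)
also have "... = pt (a [^] n' \<otimes> (inv a') [^] n) (1 / of_nat (n * n'))"
 using a by (simp only: pt_shift[symmetric] inv_closed) (simp add: pt_mult(1))
finally show "EX a:carrier A. EX n>0. co_set (c - c') = pt a (1 / of_nat n)"
 using a by (intro bexI[of _ "a [^] n' \<otimes> (inv a') [^] n"] exI[of _ "n * n'"]) auto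
qed
thus ?thesis using that c(2) by blast
qed

text \<open>The factorisation of biadditive maps through the tensor product. Biadditivity is
  required only modulo \<open>I\<close>, so that maps into a quotient can be used without forming
  it.\<close>

lemma frag_sum_R:
fixes g :: "'a \<times> rat => 'r::comm_ring_1"
assumes I: "is_ideal I"
and g: "!!a a' q. a : carrier A ==> a' : carrier A ==> g (a \<otimes> a', q) - g (a, q) - g (a', q) : I"
 "!!a q q'. a : carrier A ==> g (a, q + q') - g (a, q) - g (a, q') : I"
and c: "c : R"
shows "frag_sum g c : I"
using c unfolding tensor_kernel_def
proof (induction rule: generate.induct)
case one
thus ?case by (simp add: is_idealD[OF I])
next
case (incl h)
thus ?case using g by (auto simp: tensor_rels_def frag_sum_diff)
next
case (inv h)
hence "keys h <= carrier A \<times> carrier rat_group" using subsetD[OF rels_closed, of h] by simp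
moreover have "frag_sum g h : I" using inv g by (auto simp: tensor_rels_def frag_sum_diff)
ultimately show ?case by (simp add: frag_sum_uminus is_idealD[OF I] del: rat_group_simps)
next
case (eng h h')
thus ?case by (simp add: frag_sum_add is_idealD[OF I])
qed

text \<open>The rational extension of an additive map, evaluated on a chosen representative of the
  class.\<close>

definition ext :: "('a => rat) => ('a \<times> rat \<Rightarrow>\<^sub>0 int) set => rat" where
"ext h X = frag_sum (%(a, q). q * h a) (SOME c. c : X & keys c <= carrier A \<times> carrier rat_group)"

lemma ext_co_set:
assumes h: "addit A h" and c: "keys c <= carrier A \<times> carrier rat_group"
shows "ext h (co_set c) = frag_sum (%(a, q). q * h a) c"
proof -
define c' where "c' = (SOME c'. c' : co_set c & keys c' <= carrier A \<times> carrier rat_group)"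
have "c : co_set c" using R_closed(2) unfolding co_set_alt by force
hence "c' : co_set c" unfolding c'_def using c by (metis (mono_tags, lifting) someI_ex)
then obtain r where r: "r : R" "c' = r + c" by (auto simp: co_set_alt)
have "frag_sum (%(a, q). q * h a) r : {0}"
by (rule frag_sum_R[OF _ _ _ r(1)]) (auto simp: is_ideal_def additive_onD[OF h] algebra_simps)
thus ?thesis unfolding ext_def c'_def[symmetric] r(2) by (simp add: frag_sum_add)
qed

lemma ext_pt: "addit A h ==> a : carrier A ==> ext h (pt a q) = q * h a"
by (simp add: pt_co_set ext_co_set)

lemma additive_ext: assumes h: "addit A h" shows "addit TA (ext h)"
unfolding addit_def
proof (intro ballI)
fix X Y assume "X : carrier TA" "Y : carrier TA"
then obtain c c' where c: "keys c <= carrier A \<times> carrier rat_group" "keys c' <= carrier A \<times> carrier rat_group"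
and X: "X = co_set c" "Y = co_set c'"
by (auto simp: carrier_TA)
have "keys (c + c') <= carrier A \<times> carrier rat_group" using c keys_add[of c c'] by blast
thus "ext h (X \<otimes>\<^bsub>TA\<^esub> Y) = ext h X + ext h Y"
unfolding X co_set_mult[OF c] using c h by (simp only: ext_co_set frag_sum_add)
qed

lemma ext_plus:
assumes "!!a. a : carrier A ==> h a = h1 a + h2 a" "X : carrier TA"
shows "ext h X = ext h1 X + ext h2 X"
proof -
define c where "c = (SOME c. c : X & keys c <= carrier A \<times> carrier rat_group)"
obtain e where e: "keys e <= carrier A \<times> carrier rat_group" "X = co_set e" using assms(2) by (auto simp: carrier_TA)
have "e : X" using R_closed(2) unfolding e(2) co_set_alt by force
hence c: "keys c <= carrier A \<times> carrier rat_group"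
unfolding c_def using e(1) by (metis (mono_tags, lifting) someI_ex)
have "frag_sum (%(a, q). q * h a) c = frag_sum (%x. (case x of (a, q) => q * h1 a) + (case x of (a, q) => q * h2 a)) c"
by (rule frag_sum_cong) (use c assms(1) in "auto simp: algebra_simps")
thus ?thesis unfolding ext_def c_def[symmetric] frag_sum_plus .
qed

lemma additive_pt:
assumes ph: "addit TA ph" and a: "a : carrier A"
shows "ph (pt a (1 / of_nat n)) = (1 / of_nat n :: rat) * ph (pt a 1)"
proof (cases "n = 0")
case True
thus ?thesis by (simp add: pt_zero[OF a] additive_on_simps(1)[OF TT.group_axioms ph])
next
case False
hence "pt a 1 = pt a (1 / of_nat n) [^]\<^bsub>TA\<^esub> n" using pt_mult_nat[OF a, of n "1 / of_nat n"] by simp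
hence "ph (pt a 1) = of_nat n * ph (pt a (1 / of_nat n))"
using additive_on_pow[OF TT.group_axioms ph pt_closed[OF a]] by metis
thus ?thesis using False by simp
qed

lemma additive_pt1: assumes "addit TA ph" shows "addit A (%a. ph (pt a 1))"
unfolding addit_def using pt_mult(1) additive_onD[OF assms] pt_closed by simp

end

text \<open>Torsion is detected by a map to a module over the rationals. This spares a description of the
kernel of \<open>A \<rightarrow> A \<otimes> \<rat>\<close>.\<close>

definition tors_det :: "'a monoid => ('a => 'r::comm_ring_1) => (rat => 'r) => 'r set => bool" where
"tors_det A ta s I <-> is_ideal I & ringhom s &
 (ALL x:carrier A. ALL y:carrier A. ta (x \<otimes>\<^bsub>A\<^esub> y) - ta x - ta y : I) &
 (ALL x:carrier A. ta x : I --> (EX n>0. x [^]\<^bsub>A\<^esub> (n::nat) = \<one>\<^bsub>A\<^esub>))"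

lemma (in rat_tensor) pt_torsion:
assumes t: "tors_det A ta s I" and a: "a : carrier A" "pt a 1 = \<one>\<^bsub>TA\<^esub>"
shows "EX n>0. a [^] (n::nat) = \<one>"
proof -
note I = is_idealD[OF conjunct1[OF t[unfolded tors_det_def]]]
have s: "ringhom s" and ta: "!!x y. x : carrier A ==> y : carrier A ==> ta (x \<otimes> y) - ta x - ta y : I"
using t by (auto simp: tors_det_def)
have "frag_of (a, 1) : co_set (frag_of (a, 1))" using R_closed(2) unfolding co_set_alt by force
hence "frag_of (a, 1) : R" using a(2) unfolding pt_co_set one_TA by (auto simp: co_set_alt)
have "frag_sum (%(a, q). s q * ta a) (frag_of (a, 1)) : I"
proof (rule frag_sum_R[OF conjunct1[OF t[unfolded tors_det_def]] _ _ `frag_of (a, 1) : R`])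
show "(case (x \<otimes> y, q) of (a, q) => s q * ta a) - (case (x, q) of (a, q) => s q * ta a) - (case (y, q) of (a, q) => s q * ta a) : I"
 if "x : carrier A" "y : carrier A" for x y q
 using I(3)[OF ta[OF that], of "s q"] by (simp add: algebra_simps)
show "(case (x, q + q') of (a, q) => s q * ta a) - (case (x, q) of (a, q) => s q * ta a) - (case (x, q') of (a, q) => s q * ta a) : I"
 for x q q' using I(1) by (simp add: rh_simps[OF s] algebra_simps)
qed
hence "ta a : I" by (simp add: rh_simps[OF s])
thus ?thesis using t a(1) by (simp add: tors_det_def)
qed

lemma hom_rat: "ph : hom C rat_group <-> addit C ph"
by (auto simp: hom_def addit_def rat_group_def)

text \<open>Elements of both tensor products have the form a tensor 1 / n, so each condition can be
  tested on \<open>A\<close> and \<open>B\<close> after multiplying by denominators;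
  \<open>tors_det\<close> turns a vanishing tensor into a torsion element.\<close>

lemma nondegenerate_tensor_iff:
assumes A: "comm_group A" and B: "comm_group B" and t: "tors_det A ta s I"
and h: "!!X. X : carrier (tensor_Q A) ==> addit (tensor_Q B) (h X)"
and val: "!!a c q r. a : carrier A ==> c : carrier B ==>
 h (pure_tensor A rat_group a q) (pure_tensor B rat_group c r) = q * r * rat_of_int (b a c)"
shows "(ALL x:carrier (tensor_Q A). (ALL y:carrier (tensor_Q B). h x y = 0) --> x = \<one>\<^bsub>tensor_Q A\<^esub>) &
 (ALL ph. addit (tensor_Q B) ph -->
  (EX x:carrier (tensor_Q A). ALL y:carrier (tensor_Q B). h x y = ph y)) <->
 nondeg TYPE(rat) {n. n > 0} A B b"
proof -
interpret A: rat_tensor A using A by (simp add: rat_tensor_def)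
interpret B: rat_tensor B using B by (simp add: rat_tensor_def)
have "(ALL x:carrier A.TA. (ALL y:carrier B.TA. h x y = 0) --> x = \<one>\<^bsub>A.TA\<^esub>) <->
(ALL x:carrier A. (ALL y:carrier B. b x y = 0) --> (EX n:{n::nat. n > 0}. x [^]\<^bsub>A\<^esub> n = \<one>\<^bsub>A\<^esub>))" (is "?L1 <-> ?R1")
proof
assume L: ?L1
show ?R1
proof (intro ballI impI)
 fix x assume x: "x : carrier A" "ALL y:carrier B. b x y = 0"
 have "h (A.pt x 1) Y = 0" if "Y : carrier B.TA" for Y
  using that by (rule B.TA_pure) (simp add: val x)
 hence "A.pt x 1 = \<one>\<^bsub>A.TA\<^esub>" using L A.pt_closed[OF x(1)] by blast
 thus "EX n:{n::nat. n > 0}. x [^]\<^bsub>A\<^esub> n = \<one>\<^bsub>A\<^esub>" using A.pt_torsion[OF t x(1)] by auto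
qed
next
assume R: ?R1
show ?L1
proof (intro ballI impI)
 fix X assume X: "X : carrier A.TA" "ALL Y:carrier B.TA. h X Y = 0"
 obtain a n where a: "a : carrier A" "n > 0" "X = A.pt a (1 / of_nat n)" using X(1) by (rule A.TA_pure)
 have "b a c = 0" if c: "c : carrier B" for c
  using X(2) B.pt_closed[OF c, of 1] val[OF a(1) c, of "1 / of_nat n" 1] a by auto
 then obtain m :: nat where m: "m > 0" "a [^]\<^bsub>A\<^esub> m = \<one>\<^bsub>A\<^esub>" using R a(1) by blast
 have "X = A.pt a (of_nat m * (1 / of_nat (m * n)))" using a m by simp
 thus "X = \<one>\<^bsub>A.TA\<^esub>" by (simp only: A.pt_shift[OF a(1), symmetric] m(2) A.pt_one)
qed
qed
moreover have "(ALL ph. addit B.TA ph --> (EX x:carrier A.TA. ALL y:carrier B.TA. h x y = ph y)) <->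
(ALL ph::_ => rat. addit B ph -->
  (EX x:carrier A. EX n:{n::nat. n > 0}. ALL y:carrier B. of_int (b x y) = of_nat n * ph y))" (is "?L2 <-> ?R2")
proof
assume L: ?L2
show ?R2
proof (intro allI impI)
 fix ph :: "_ => rat" assume ph: "addit B ph"
 obtain X where X: "X : carrier A.TA" "ALL Y:carrier B.TA. h X Y = B.ext ph Y" using L B.additive_ext[OF ph] by blast
 obtain a n where a: "a : carrier A" "n > 0" "X = A.pt a (1 / of_nat n)" using X(1) by (rule A.TA_pure)
 have "of_int (b a c) = of_nat n * ph c" if c: "c : carrier B" for c
  using X(2) B.pt_closed[OF c, of 1] val[OF a(1) c, of "1 / of_nat n" 1] a B.ext_pt[OF ph c, of 1]
  by (auto simp: field_simps)
 thus "EX x:carrier A. EX n:{n. n > 0}. ALL y:carrier B. of_int (b x y) = of_nat n * ph y"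
  using a by blast
qed
next
assume R: ?R2
show ?L2
proof (intro allI impI)
 fix ph :: "_ => rat" assume ph: "addit B.TA ph"
 obtain a and n :: nat where a: "a : carrier A" "n > 0" "ALL c:carrier B. of_int (b a c) = of_nat n * ph (B.pt c 1)"
  using R B.additive_pt1[OF ph] by blast
 have "h (A.pt a (1 / of_nat n)) Y = ph Y" if Y: "Y : carrier B.TA" for Y
 proof -
  obtain c m where c: "c : carrier B" "m > 0" "Y = B.pt c (1 / of_nat m)" using Y by (rule B.TA_pure)
  show ?thesis unfolding c(3) val[OF a(1) c(1)] using a c(1) by (simp add: B.additive_pt[OF ph c(1)])
 qed
 thus "EX x:carrier A.TA. ALL y:carrier B.TA. h x y = ph y" using A.pt_closed[OF a(1)] by blast
qed
qed
ultimately show ?thesis unfolding nondeg_def by simp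
qed

lemma perfect_pairing_rat_iff:
assumes A: "comm_group A" and B: "comm_group B"
and b: "!!x. x : carrier A ==> addit B (b x)" "!!y. y : carrier B ==> addit A (%x. b x y)"
and t: "tors_det A ta s I" "tors_det B ta' s' I'"
shows "perfect_pairing (tensor_Q A) (tensor_Q B) rat_group (rat_pairing A B b) <->
nondeg TYPE(rat) {n. n > 0} A B b & nondeg TYPE(rat) {n. n > 0} B A (%y x. b x y)"
proof -
interpret A: rat_tensor A using A by (simp add: rat_tensor_def)
interpret B: rat_tensor B using B by (simp add: rat_tensor_def)
have grp: "group A" "group B" by (rule A.group_axioms, rule B.group_axioms)
let ?bq = "%x y. rat_of_int (b x y)"
have bq: "addit B (?bq x)" if "x : carrier A" for x using b(1)[OF that] by (simp add: addit_def)
have bq': "addit A (%x. ?bq x y)" if "y : carrier B" for y using b(2)[OF that] by (simp add: addit_def)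
\<comment> \<open>Extending in each variable in turn shows that the induced pairing exists, so the
  choice in \<open>rat_pairing\<close> has the property it is chosen for.\<close>
define g0 where "g0 X Y = A.ext (%a. B.ext (?bq a) Y) X" for X Y
have add1: "addit A (%a. B.ext (?bq a) Y)" if "Y : carrier B.TA" for Y
unfolding addit_def using that b(2)
by (intro ballI B.ext_plus) (auto simp: addit_def)
define P where "P g <-> (ALL x:carrier A.TA. g x : hom B.TA rat_group) &
 (ALL y:carrier B.TA. (%x. g x y) : hom A.TA rat_group) &
 (ALL a:carrier A. ALL c:carrier B. ALL q r. g (A.pt a q) (B.pt c r) = q * r * of_int (b a c))" for g
have "P g0"
unfolding P_def
proof (intro conjI ballI allI)
fix X assume X: "X : carrier A.TA"
show "g0 X : hom B.TA rat_group"
 unfolding hom_rat addit_def g0_def using bq B.additive_ext X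
 by (intro ballI A.ext_plus) (auto simp: addit_def)
next
fix Y assume "Y : carrier B.TA"
thus "(%X. g0 X Y) : hom A.TA rat_group"
 unfolding hom_rat g0_def by (intro A.additive_ext add1)
next
fix a c q r assume a: "a : carrier A" "c : carrier B"
thus "g0 (A.pt a q) (B.pt c r) = q * r * of_int (b a c)"
 unfolding g0_def A.ext_pt[OF add1[OF B.pt_closed[OF a(2)]] a(1)] by (simp add: B.ext_pt bq)
qed
moreover define g where "g = rat_pairing A B b"
moreover have "g = (SOME g. P g)" unfolding g_def rat_pairing_def P_def ..
ultimately have "P g" by (metis someI)
hence g: "!!X. X : carrier A.TA ==> addit B.TA (g X)" "!!Y. Y : carrier B.TA ==> addit A.TA (%X. g X Y)"
"!!a c q r. a : carrier A ==> c : carrier B ==> g (A.pt a q) (B.pt c r) = q * r * of_int (b a c)"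
unfolding P_def hom_rat by auto
have hh: "carrier rat_group = UNIV" "monoid.mult rat_group = (+)" by (auto simp: rat_group_def)
have 1: "(ALL x:carrier A.TA. (ALL y:carrier B.TA. g x y = 0) --> x = \<one>\<^bsub>A.TA\<^esub>) &
 (ALL ph. addit B.TA ph --> (EX x:carrier A.TA. ALL y:carrier B.TA. g x y = ph y)) <->
 nondeg TYPE(rat) {n. n > 0} A B b"
by (rule nondegenerate_tensor_iff[OF A B t(1) g(1) g(3)])
have 2: "(ALL y:carrier B.TA. (ALL x:carrier A.TA. g x y = 0) --> y = \<one>\<^bsub>B.TA\<^esub>) &
 (ALL ph. addit A.TA ph --> (EX y:carrier B.TA. ALL x:carrier A.TA. g x y = ph x)) <->
 nondeg TYPE(rat) {n. n > 0} B A (%y x. b x y)"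
by (rule nondegenerate_tensor_iff[OF B A t(2) g(2)]) (simp_all add: g(3))
show ?thesis
unfolding g_def[symmetric] 1[symmetric] 2[symmetric] conj_assoc
by (rule perfect_pairing_iff[OF A.TT.group_axioms B.TT.group_axioms hh]) (fact g(1), fact g(2))
qed

section \<open>Comparison of the defined Chow ring and its pairing with the polynomial model\<close>

section \<open>Chow rings\<close>

lemma of_int_eq_Cst: "of_int c = (Cst c :: ('v, int) mp)"
by (metis Cst_def of_int_eq_id id_apply single_of_int)

lemma pvar_eq_Var: "pvar ze = Var ze" by (simp add: pvar_def Var_def)

lemma homogeneous_eq_homog: "homogeneous k p = homog k p" by (simp add: homogeneous_def homog_def mdeg_def)

definition mp_int :: "('v, int) mp => ('v, 'a::comm_ring_1) mp" where
"mp_int = peval (%c. Cst (of_int c)) Var"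

lemma ringhom_Cst_of_int: "ringhom (%c. Cst (of_int c) :: ('v, 'a::comm_ring_1) mp)"
by (simp add: ringhom_def Cst_add Cst_mult)

lemma ringhom_mp_int: "ringhom mp_int" unfolding mp_int_def by (rule ringhom_peval[OF ringhom_Cst_of_int])

lemmas mpi_simps = rh_simps[OF ringhom_mp_int]

lemma mp_int_Cst [simp]: "mp_int (Cst c) = Cst (of_int c)" by (simp add: mp_int_def ringhom_Cst_of_int)
lemma mp_int_Var [simp]: "mp_int (Var v) = Var v" by (simp add: mp_int_def ringhom_Cst_of_int)
lemma mp_int_xprod [simp]: "mp_int (xprod A) = xprod A" by (simp add: xprod_def mpi_simps)

lemma mp_int_single: "mp_int (single m c) = single m (of_int c)"
unfolding mp_int_def peval_single[OF ringhom_Cst_of_int] single_eq_mval[symmetric] by (metis single_Cst)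

lemma lookup_mp_int: "lookup (mp_int p) m = of_int (lookup p m)"
proof (induction p rule: pm_induct)
case (add m' c p)
thus ?case by (simp add: mpi_simps mp_int_single lookup_add lookup_single when_def)
qed (simp add: mpi_simps)

lemma mp_int_inj: "mp_int p = (mp_int q :: ('v, 'a::{comm_ring_1, ring_char_0}) mp) ==> p = q"
by (rule poly_mapping_eqI) (metis lookup_mp_int of_int_eq_iff)

lemma homog_mp_int: "homog k (mp_int p :: ('v, 'a::{comm_ring_1, ring_char_0}) mp) <-> homog k p"
proof -
have "keys (mp_int p :: ('v, 'a) mp) = keys p" by (auto simp: in_keys_iff lookup_mp_int)
thus ?thesis by (simp add: homog_def)
qed

text \<open>The admissible denominators are \<open>{1}\<close> for the integers and all positive integers for the rationals.\<close>

definition denominators :: "'a::{idom, ring_char_0} itself => nat set => bool" where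
"denominators _ N <-> 0 ~: N & 1 : N & (ALL i:N. ALL j:N. i * j : N) & (ALL i:N. EX c::'a. of_nat i * c = 1) &
 (ALL a::'a. EX i:N. EX z. of_nat i * a = of_int z)"

lemma denominators_int: "denominators TYPE(int) {1}"
by (auto simp: denominators_def)

lemma denominators_rat: "denominators TYPE(rat) {n. n > 0}"
proof -
have "EX i:{n. n > 0}. EX z. of_nat i * a = of_int z" for a :: rat
proof -
obtain p r where q: "a = of_int p / of_int r" "r > 0" using quotient_of_div[OF surjective_pairing] quotient_of_denom_pos' by blast
hence "of_nat (nat r) * a = of_int p" "nat r > 0" by auto
thus ?thesis by blast
qed
moreover have "EX c::rat. of_nat i * c = 1" if "i > 0" for i using that by (intro exI[of _ "1 / of_nat i"]) simp
ultimately show ?thesis unfolding denominators_def by auto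
qed

context
fixes N :: "nat set"
assumes N: "denominators TYPE('a::{idom, ring_char_0}) N"
begin

lemma denominatorsD:
"i : N ==> (of_nat i :: 'a) ~= 0" "i : N ==> j : N ==> i * j : N" "i : N ==> EX c::'a. of_nat i * c = 1"
"1 : N"
using N by (auto simp: denominators_def intro: ccontr)

lemma clear_denominators:
fixes p :: "('v, 'a) mp" obtains i p' where "i : N" "Cst (of_nat i) * p = mp_int p'"
proof -
have "EX i:N. EX p'. Cst (of_nat i) * p = mp_int p'"
proof (induction p rule: pm_induct)
case zero
thus ?case using denominatorsD(4) by (metis mpi_simps(4) mult_zero_right)
next
case (add m c p)
then obtain i p' where i: "i : N" "Cst (of_nat i) * p = mp_int p'" by blast
obtain j z where j: "j : N" "of_nat j * c = of_int z" using N unfolding denominators_def by blast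
have "Cst (of_nat (i * j)) * (single m c + p)
  = Cst (of_nat i) * (Cst (of_nat j) * single m c) + Cst (of_nat j) * (Cst (of_nat i) * p)"
 by (simp add: Cst_mult algebra_simps)
also have "... = mp_int (Cst (int i) * single m z + Cst (int j) * p')"
 by (simp add: mpi_simps mp_int_single i Cst_mult_single j)
finally show ?case using denominatorsD(2)[OF i(1) j(1)] by blast
qed
thus ?thesis using that by blast
qed

lemma clear_homog:
fixes p :: "('v, 'a) mp" assumes "homog k p"
obtains i p' where "i : N" "Cst (of_nat i) * p = mp_int p'" "homog k p'"
proof -
obtain i p' where i: "i : N" "Cst (of_nat i) * p = mp_int p'" by (rule clear_denominators)
moreover have "homog k p'" using homog_Cst_mult[OF assms, of "of_nat i"] unfolding i(2) homog_mp_int .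
ultimately show ?thesis by (rule that)
qed

lemma clear_CI:
fixes M :: "('v => int) set" and p :: "('v, 'a) mp"
assumes "p : CI K ((%m v. of_int (m v)) ` M)"
obtains i p' where "i : N" "Cst (of_nat i) * p = mp_int p'" "p' : CI K M"
proof -
have I: "is_ideal (CI K M)" unfolding CI_def by (rule is_ideal_pideal)
have "EX i:N. EX p':CI K M. Cst (of_nat i) * p = mp_int p'"
using assms unfolding CI_def[of K "_ ` _"]
proof (induction rule: pideal.induct)
case zero
thus ?case using denominatorsD(4) is_idealD(1)[OF I] by (metis mpi_simps(4) mult_zero_right)
next
case (add p q)
then obtain i p' j q' where *: "i : N" "p' : CI K M" "Cst (of_nat i) * p = mp_int p'"
 "j : N" "q' : CI K M" "Cst (of_nat j) * q = mp_int q'" by blast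
have "Cst (of_nat (i * j)) * (p + q) = Cst (of_nat j) * (Cst (of_nat i) * p) + Cst (of_nat i) * (Cst (of_nat j) * q)"
 by (simp add: Cst_mult algebra_simps)
also have "... = mp_int (Cst (int j) * p' + Cst (int i) * q')" using * by (simp add: mpi_simps)
finally show ?case using denominatorsD(2)[OF *(1,4)] * is_idealD[OF I] by blast
next
case (gen g r)
obtain i r' where i: "i : N" "Cst (of_nat i) * r = mp_int r'" by (rule clear_denominators)
have "EX g':CI K M. g = mp_int g'"
proof -
 from gen consider R where "finite R" "R ~: K" "g = xprod R" | m where "m : M" "g = lin_form K (%v. of_int (m v))"
  by (auto simp: chow_gens_def)
 thus ?thesis
 proof cases
  case 1
  hence "xprod R : CI K M" unfolding CI_def by (intro pideal_gen) (auto simp: chow_gens_def)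
  thus ?thesis using 1 by (metis mp_int_xprod)
 next
  case 2
  hence "lin_form K m : CI K M" unfolding CI_def by (intro pideal_gen) (auto simp: chow_gens_def)
  moreover have "g = mp_int (lin_form K m)" using 2 by (simp add: lin_form_def mpi_simps)
  ultimately show ?thesis by blast
 qed
qed
then obtain g' where g': "g' : CI K M" "g = mp_int g'" by blast
have "Cst (of_nat i) * (r * g) = mp_int (r' * g')" using i g' by (simp add: mpi_simps mult.assoc[symmetric])
thus ?case using i(1) is_idealD(3)[OF I g'(1)] by blast
qed
thus ?thesis using that by blast
qed

end

lemma mp_int_CI: "p : CI K M ==> mp_int p : (CI K ((%m v. of_int (m v)) ` M) :: ('v, 'a::comm_ring_1) mp set)"
unfolding CI_def[of K M]
proof (rule pideal_image[OF _ ringhom_mp_int])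
show "is_ideal (CI K ((%m v. of_int (m v)) ` M) :: ('v, 'a) mp set)" unfolding CI_def by (rule is_ideal_pideal)
fix g assume "g : chow_gens K M"
then consider R where "finite R" "R ~: K" "g = xprod R" | m where "m : M" "g = lin_form K m"
by (auto simp: chow_gens_def)
hence "mp_int g : (chow_gens K ((%m v. of_int (m v)) ` M) :: ('v, 'a) mp set)"
by cases (auto simp: chow_gens_def lin_form_def mpi_simps)
thus "mp_int g : (CI K ((%m v. of_int (m v)) ` M) :: ('v, 'a) mp set)" unfolding CI_def by (rule pideal_gen)
qed

subsection \<open>The complex of rays\<close>

context cone_complex
begin

abbreviation "ray v == cn {v :: vec}"
abbreviation "prim == prim_vec n"
text \<open>The Chow ring takes rays, as cones, for its variables; \<open>KC\<close> is the complex
  with each primitive vector replaced by its ray.\<close>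

abbreviation "KC == (`) ray ` K"
abbreviation "MC == (%m ze. m (prim ze)) ` Zdual n"
abbreviation "LC == (%m ze. of_int (m ze)) ` MC"
abbreviation "Z1 == cones_dim T 1"

lemma prim_ray: "v : \<Union>K ==> prim (ray v) = v"
by (rule prim_vec_cone_of) (rule face_ub[OF vertex_face])

lemma prim_rays: "A : K ==> prim ` ray ` A = A"
proof -
assume "A : K"
hence "prim (ray v) = v" if "v : A" for v using that prim_ray by blast
thus ?thesis by (simp add: image_image)
qed

lemma Z1_eq: "Z1 = ray ` \<Union>K"
proof -
have "{B : K. card B = 1} = {{v} |v. v : \<Union>K}" using vertex_face by (auto simp: card_1_singleton_iff)
thus ?thesis unfolding cones_dim_eq by auto
qed

lemma Union_KC: "\<Union>KC = Z1" unfolding Z1_eq by blast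

lemma finite_Z1: "finite Z1" unfolding Z1_eq using fincx fin_face by blast

lemma inj_ray: "inj_on ray (\<Union>K)" by (rule inj_on_inverseI[of _ prim]) (rule prim_ray)

lemma inj_prim: "inj_on prim Z1" unfolding Z1_eq by (rule inj_on_inverseI[of _ ray], elim imageE, simp only: prim_ray)

lemma ucomplex_KC: "ucx KC (LC :: (vec set => 'a::{idom, ring_char_0}) set)"
proof
show "finite KC" using fincx by blast
show "{} : KC" using empty_complex by blast
fix A assume A: "A : KC"
then obtain B where B: "B : K" "A = ray ` B" by blast
show "finite A" using B fin_face by blast
show "C : KC" if C: "C <= A" for C
proof -
obtain B' where "B' <= B" "C = ray ` B'" using C B(2) by (meson subset_imageE)
thus ?thesis using dcx[OF B(1)] by blast
qed
fix v assume "v : A"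
then obtain b where b: "b : B" "v = ray b" using B by blast
obtain m where m: "m : Zdual n" "m b = 1" "ALL x:B - {b}. m x = 0" using ubasis_dual[OF face_ub[OF B(1)] b(1)] by blast
have p: "prim (ray x) = x" if "x : B" for x using prim_ray B(1) that by blast
have "m (prim u) = 0" if "u : A - {v}" for u
using that p m(3) b by (auto simp: B(2))
moreover have "(%ze. of_int (m (prim ze))) : LC" unfolding image_image by (rule imageI[OF m(1)])
ultimately show "EX l:LC. l v = (1::'a) & (ALL u:A - {v}. l u = 0)"
using m(2) p[OF b(1)] b(2) by (intro bexI[of _ "%ze. of_int (m (prim ze))"]) auto
qed

lemma face_KC_iff: "R <= Z1 ==> (EX sg:cones T. ALL ro:R. ro <= sg) <-> R : KC"
proof
assume R: "R <= Z1" and "EX sg:cones T. ALL ro:R. ro <= sg"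
then obtain B where B: "B : K" "ALL ro:R. ro <= cn B" by (auto simp: cones_eq)
obtain A where A: "A <= \<Union>K" "R = ray ` A" using R unfolding Z1_eq by (meson subset_imageE)
have "A <= B"
proof
fix a assume a: "a : A"
hence "{a} : K" using A(1) vertex_face by blast
hence "{a} <= B" by (rule cone_subset[OF _ B(1)]) (use B(2) A(2) a in blast)
thus "a : B" by blast
qed
thus "R : KC" using dcx[OF B(1)] A(2) by blast
next
assume "R : KC"
then obtain B where B: "B : K" "R = ray ` B" by blast
have "ray b <= cn B" if "b : B" for b using that by (intro hull_mono) auto
thus "EX sg:cones T. ALL ro:R. ro <= sg" using cone_in[OF B(1)] B(2) by blast
qed

end

context utrop
begin

definition wC :: "vec set set => 'a::ring_1" where "wC A = of_int (wt Sg (cn (prim ` A)))"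

lemma PDc_KC:
"PDc K (dforms n) d (wK :: vec set => 'a::{idom, ring_char_0}) <-> PDc KC LC d (wC :: _ => 'a)"
proof
assume PD: "PDc K (dforms n) d (wK :: vec set => 'a)"
show "PDc KC LC d (wC :: _ => 'a)"
proof (rule PDc_rename[OF ucx ucomplex_KC inj_ray _ _ _ PD])
show "EX l':LC. ALL v:\<Union>K. l' (ray v) = l v" if l: "l : dforms n" for l :: "vec => 'a"
proof -
 obtain m where m: "m : Zdual n" "l = (%v. of_int (m v))" using l by (auto simp: dforms_def)
 show ?thesis using m prim_ray by (intro bexI[of _ "%ze. of_int (m (prim ze))"]) auto
qed
show "EX l:dforms n. ALL v:\<Union>K. l' (ray v) = l v" if l: "l' : LC" for l' :: "vec set => 'a"
proof -
 obtain m where m: "m : Zdual n" "l' = (%ze. of_int (m (prim ze)))" using l by blast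
 show ?thesis using m prim_ray by (intro bexI[of _ "%v. of_int (m v)"]) (auto simp: dforms_def)
qed
qed (simp add: wC_def prim_rays)
next
assume PD: "PDc KC LC d (wC :: _ => 'a)"
have "prim ` A = B" if "B : K" "A = ray ` B" for A B using prim_rays that by simp
hence K: "(`) prim ` KC = K" by (auto simp: image_iff prim_rays)
have "PDc ((`) prim ` KC) (dforms n) d (wK :: vec set => 'a)"
proof (rule PDc_rename[OF ucomplex_KC _ _ _ _ _ PD])
show "ucx ((`) prim ` KC) (dforms n :: (vec => 'a) set)" unfolding K by (rule ucx)
show "inj_on prim (\<Union>KC)" unfolding Union_KC by (rule inj_prim)
show "EX l':dforms n. ALL v:\<Union>KC. l' (prim v) = l v" if "l : LC" for l :: "vec set => 'a"
 using that by (auto simp: dforms_def)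
show "EX l:LC. ALL v:\<Union>KC. l' (prim v) = l v" if l: "l' : dforms n" for l' :: "vec => 'a"
proof -
 obtain m where m: "m : Zdual n" "l' = (%v. of_int (m v))" using l by (auto simp: dforms_def)
 show ?thesis using m by (intro bexI[of _ "%ze. of_int (m (prim ze))"]) auto
qed
qed (simp add: wC_def)
thus "PDc K (dforms n) d (wK :: vec set => 'a)" unfolding K .
qed

lemma ex_degree_KC: "EX D. is_deg KC (LC :: (vec set => 'a::{idom, ring_char_0}) set) d wC D"
proof -
interpret C: ucx KC "LC :: (vec set => 'a) set" by (rule ucomplex_KC)
show ?thesis
proof (rule C.ex_deg)
fix A' assume A': "A' : KC" "Suc (card A') = d"
then obtain A where A: "A : K" "A' = ray ` A" by blast
have "inj_on ray A" by (rule inj_on_subset[OF inj_ray]) (use A(1) in blast)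
hence cA: "Suc (card A) = d" using A' A by (simp add: card_image)
obtain gm where gm: "ALL v. v ~: A --> gm v = (if insert v A : K then wt Sg (cn (insert v A)) else 0)"
 "ALL m:Zdual n. (SUM v:\<Union>K. m v * gm v) = 0"
 "(SUM b:link K A. of_int (wt Sg (cn (insert b A))) *\<^sub>R b) = (SUM a:A. of_int (- gm a) *\<^sub>R a)"
 by (rule balanced_relation[OF balanced[OF A(1) cA] A(1)])
define gm' where "gm' ze = (of_int (gm (prim ze)) :: 'a)" for ze
have 1: "gm' v = (if insert v A' : KC then wC (insert v A') else 0)" if v: "v : \<Union>KC - A'" for v
proof -
 have "v : ray ` \<Union>K" using v unfolding Union_KC Z1_eq by blast
 then obtain b where b: "b : \<Union>K" "v = ray b" by blast
 have bA: "b ~: A" using v b A by blast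
 have p: "prim v = b" using prim_ray[OF b(1)] b(2) by simp
 have pi: "prim ` insert v A' = insert b A" using p prim_rays[OF A(1)] A(2) by simp
 have "insert v A' : KC <-> insert b A : K"
 proof
  assume "insert v A' : KC"
  then obtain B where B: "B : K" "insert v A' = ray ` B" by blast
  hence "insert b A = B" using pi prim_rays by metis
  thus "insert b A : K" using B by simp
 next
  assume "insert b A : K"
  moreover have "insert v A' = ray ` insert b A" using b A by simp
  ultimately show "insert v A' : KC" by blast
 qed
 thus ?thesis using gm(1) bA by (simp add: gm'_def p wC_def pi[simplified] A(2) prim_rays[OF A(1)])
qed
have 2: "(SUM v:\<Union>KC. l v * gm' v) = 0" if l: "l : LC" for l :: "vec set => 'a"
proof -
 obtain m where m: "m : Zdual n" "l = (%ze. of_int (m (prim ze)))" using l by blast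
 have "(SUM v:\<Union>KC. l v * gm' v) = (SUM v:\<Union>K. l (ray v) * gm' (ray v))"
  unfolding Union_KC Z1_eq by (rule sum.reindex[OF inj_ray, unfolded comp_def])
 also have "... = of_int (SUM v:\<Union>K. m v * gm v)"
  unfolding of_int_sum m(2) gm'_def by (intro sum.cong refl) (simp add: prim_ray)
 finally show ?thesis using gm(2) m(1) by simp
qed
show "EX gm. (ALL v:\<Union>KC - A'. gm v = (if insert v A' : KC then wC (insert v A') else (0::'a))) &
   (ALL l:LC. (SUM v:\<Union>KC. l v * gm v) = 0)"
 using 1 2 by (intro exI[of _ gm'] conjI ballI) assumption+
qed
qed

end

subsection \<open>The Chow ring as a quotient of the full polynomial ring\<close>

context utrop
begin

abbreviation "PR == chow_poly_ring Sg"
abbreviation "CZ == CI KC MC"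
abbreviation "cls == chow_class Sg"
abbreviation "AG k == chow_group Sg k"
text \<open>\<open>CZ\<close> lives in polynomials over all sets of vectors as variables, the Chow
  ring only in those over rays. Setting the other variables to zero mediates, since they lie in
  \<open>CZ\<close>.\<close>

definition proj :: "cone_poly => cone_poly" where "proj = subst (%ze. if ze : Z1 then Var ze else 0)"

lemma PR_simps [simp]:
"p \<otimes>\<^bsub>PR\<^esub> q = p * q" "p \<oplus>\<^bsub>PR\<^esub> q = p + q" "\<one>\<^bsub>PR\<^esub> = 1" "\<zero>\<^bsub>PR\<^esub> = 0"
by (simp_all add: chow_poly_ring_def poly_ring_def)

lemma carrier_PR: "p : carrier PR <-> (ALL m:keys p. keys m <= Z1)"
by (simp add: chow_poly_ring_def poly_ring_def)

lemma carrier_PR_add: "p : carrier PR ==> q : carrier PR ==> p + q : carrier PR"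
unfolding carrier_PR using keys_add[of p q] by blast

lemma PR_mult: "p : carrier PR ==> q : carrier PR ==> p * q : carrier PR"
proof -
assume pq: "p : carrier PR" "q : carrier PR"
have "keys m <= Z1" if m: "m : keys (p * q)" for m
proof -
obtain a b where ab: "a : keys p" "b : keys q" "m = a + b" using keys_mult[of p q] m by blast
hence "keys a <= Z1" "keys b <= Z1" using pq unfolding carrier_PR by blast+
thus ?thesis using keys_add[of a b] ab(3) by blast
qed
thus ?thesis unfolding carrier_PR by blast
qed

lemma PR_uminus: "p : carrier PR ==> - p : carrier PR" unfolding carrier_PR by (simp add: keys_def)
lemma carrier_PR_diff: "p : carrier PR ==> q : carrier PR ==> p - q : carrier PR"
using carrier_PR_add[of p "- q"] PR_uminus by simp
lemma carrier_PR_0: "0 : carrier PR" unfolding carrier_PR by simp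
lemma carrier_PR_Cst: "Cst c : carrier PR" unfolding carrier_PR Cst_def by (simp split: if_splits)
lemma carrier_PR_1: "1 : carrier PR" using carrier_PR_Cst[of 1] by simp
lemma carrier_PR_Var: "ze : Z1 ==> Var ze : carrier PR" unfolding carrier_PR Var_def by simp
lemma carrier_PR_sum: "(!!a. a : A ==> f a : carrier PR) ==> sum f A : carrier PR"
by (induction A rule: infinite_finite_induct) (auto intro: carrier_PR_0 carrier_PR_add)
lemma carrier_PR_prod: "(!!a. a : A ==> f a : carrier PR) ==> prod f A : carrier PR"
by (induction A rule: infinite_finite_induct) (auto intro: carrier_PR_1 PR_mult)
lemma carrier_PR_xprod: "A <= Z1 ==> xprod A : carrier PR"
unfolding xprod_def by (intro carrier_PR_prod carrier_PR_Var) blast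
lemma carrier_PR_power: "p : carrier PR ==> p ^ k : carrier PR"
by (induction k) (auto intro: carrier_PR_1 PR_mult)

lemma cring_PR: "cring PR"
proof (rule cringI)
show "abelian_group PR"
proof (rule abelian_groupI)
show "EX y:carrier PR. y \<oplus>\<^bsub>PR\<^esub> x = \<zero>\<^bsub>PR\<^esub>" if "x : carrier PR" for x
 using PR_uminus[OF that] by (intro bexI[of _ "- x"]) auto
qed (auto simp: carrier_PR_0 carrier_PR_add add.assoc add.commute)
show "comm_monoid PR"
by (rule comm_monoidI) (auto simp: carrier_PR_1 PR_mult mult.assoc mult.commute)
qed (simp add: distrib_right)

sublocale PR: cring PR by (rule cring_PR)

lemma carrier_proj: "proj p : carrier PR"
unfolding proj_def subst_def peval_def mval_def
by (intro carrier_PR_sum PR_mult carrier_PR_Cst carrier_PR_prod carrier_PR_power) (auto intro: carrier_PR_0 carrier_PR_Var)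

lemma proj_id: "p : carrier PR ==> proj p = p"
proof -
assume p: "p : carrier PR"
have "proj p = (SUM m:keys p. Cst (lookup p m) * mval Var m)"
unfolding proj_def subst_def peval_def mval_def
using p by (intro sum.cong prod.cong arg_cong2[of _ _ _ _ "(*)"] refl) (auto simp: carrier_PR)
also have "... = p"
unfolding single_eq_mval[symmetric] by (subst (3) poly_mapping_sum_single[of p]) (simp add: single_Cst[symmetric])
finally show ?thesis .
qed

lemma ringhom_proj: "ringhom proj" unfolding proj_def by (rule ringhom_subst)
lemmas proj_simps = rh_simps[OF ringhom_proj]
lemma proj_Cst [simp]: "proj (Cst c) = Cst c" by (simp add: proj_def)

sublocale UC: ucx KC "MC :: (vec set => int) set"
using ucomplex_KC[where 'a = int] by (simp add: image_image)

lemma proj_mod: "p - proj p : CZ"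
proof (induction p rule: pm_induct)
case zero
thus ?case by (simp add: proj_simps UC.CI_closed)
next
case (add m c p)
let ?g = "%ze. if ze : Z1 then Var ze else (0 :: cone_poly)"
have V: "Var ze - ?g ze : CZ" for ze using UC.Var_in_CI[of ze] unfolding Union_KC by (simp add: UC.CI_closed)
have "mval Var m - mval ?g m : CZ"
proof (induction m rule: mval_induct)
case zero
thus ?case by (simp add: UC.CI_closed)
next
case (add v m)
have "mval Var (single v 1 + m) - mval ?g (single v 1 + m) = Var v * (mval Var m - mval ?g m) + (Var v - ?g v) * mval ?g m"
 unfolding mval_add mval_single by (simp only: power_one_right) (simp add: algebra_simps)
thus ?case using add V UC.CI_closed(2,3,4) by simp
qed
hence "Cst c * (mval Var m - mval ?g m) : CZ" by (rule UC.CI_closed(3))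
moreover have "single m c - proj (single m c) = Cst c * (mval Var m - mval ?g m)"
unfolding proj_def subst_def peval_single[OF ringhom_Cst]
by (subst single_Cst) (simp add: single_eq_mval algebra_simps)
ultimately have "single m c - proj (single m c) : CZ" by simp
from UC.CI_closed(2)[OF this add] show ?case by (simp add: proj_simps algebra_simps)
qed

lemma proj_CI_iff: "proj p : CZ <-> p : CZ"
using idiff_cancel[OF UC.is_ideal_CI proj_mod] by blast

lemma homog_proj: "homog k p ==> homog k (proj p)"
unfolding homog_def
proof
assume p: "ALL m:keys p. mdeg m = k"
have eq: "lookup (proj p) m = (if keys m <= Z1 then lookup p m else 0)" for m
proof (induction p rule: pm_induct)
case zero
thus ?case by (simp add: proj_simps)
next
case (add m' c p)
have "proj (single m' c) = (if keys m' <= Z1 then single m' c else 0)"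
proof (cases "keys m' <= Z1")
 case True
 hence "single m' c : carrier PR" unfolding carrier_PR by auto
 thus ?thesis using True proj_id by simp
next
 case False
 then obtain v where v: "v : keys m'" "v ~: Z1" by blast
 hence "mval (%ze. if ze : Z1 then Var ze else (0 :: cone_poly)) m' = 0"
  unfolding mval_def by (intro prod_zero bexI[of _ v]) (auto simp: in_keys_iff zero_power)
 thus ?thesis using False unfolding proj_def subst_def peval_single[OF ringhom_Cst] by simp
qed
thus ?case using add by (simp add: proj_simps lookup_add lookup_single when_def)
qed
fix m assume "m : keys (proj p)"
hence "m : keys p" unfolding in_keys_iff eq by (auto split: if_splits)
thus "mdeg m = k" using p by blast
qed

lemma proj_xprod: "finite R ==> proj (xprod R) = (if R <= Z1 then xprod R else 0)"
unfolding proj_def subst_xprod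
by (auto simp: xprod_def intro!: prod.cong prod_zero)

lemma lin_form_KC: "lin_form KC (%ze. m (prim ze)) = (SUM ze:Z1. of_int (m (prim ze)) * pvar ze)"
unfolding lin_form_def Union_KC of_int_eq_Cst pvar_eq_Var ..

lemma gens_J_eq: "gens_J Sg = lin_form KC ` MC"
proof -
have hom: "m : hom (lat_group (Zlat n)) integer_group <-> m : Zdual n" for m
by (auto simp: hom_def lat_group_def integer_group_def Zdual_def)
have "gens_J Sg = {lin_form KC (%ze. m (prim ze)) |m. m : Zdual n}"
unfolding gens_J_def lin_form_KC hom ..
thus ?thesis unfolding image_image by (simp only: setcompr_eq_image Collect_mem_eq)
qed

lemma gens_I_eq: "gens_I Sg = {xprod R |R. R <= Z1 & R ~: KC}"
unfolding gens_I_def xprod_def pvar_eq_Var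
by (intro Collect_cong ex_cong1 conj_cong refl) (simp only: face_KC_iff)

lemma gens_carrier: "gens_I Sg <= carrier PR" "gens_J Sg <= carrier PR"
proof -
show "gens_I Sg <= carrier PR" unfolding gens_I_eq using carrier_PR_xprod by blast
have "lin_form KC l : carrier PR" for l
unfolding lin_form_def Union_KC by (intro carrier_PR_sum PR_mult carrier_PR_Cst carrier_PR_Var)
thus "gens_J Sg <= carrier PR" unfolding gens_J_eq by blast
qed

lemma ideal_chow: "ideal (chow_ideal Sg) PR"
unfolding chow_ideal_def by (intro PR.add_ideals PR.genideal_ideal gens_carrier)

lemma idealD:
assumes "ideal I PR"
shows "0 : I" "p : I ==> q : I ==> p + q : I" "p : I ==> r : carrier PR ==> r * p : I" "I <= carrier PR"
proof -
interpret I: ideal I PR by fact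
show "0 : I" using I.zero_closed by simp
show "p : I ==> q : I ==> p + q : I" using I.a_closed[of p q] by simp
show "p : I ==> r : carrier PR ==> r * p : I" using I.I_l_closed[of p r] by simp
show "I <= carrier PR" by (rule I.a_subset)
qed

text \<open>One inclusion holds because the intersection is an ideal containing the generators. For
  the other, the polynomials whose projection lies in \<open>chow_ideal Sg\<close> form an ideal of
  the full ring that contains the generators of \<open>CZ\<close>.\<close>

lemma chow_ideal_eq: "chow_ideal Sg = carrier PR Int CZ"
proof (intro equalityI subsetI)
have id: "ideal (carrier PR Int CZ) PR"
proof (rule idealI)
show "subgroup (carrier PR Int CZ) (add_monoid PR)"
proof (rule PR.add.subgroupI)
 show "carrier PR Int CZ ~= {}" using carrier_PR_0 UC.CI_closed(1) by blast
 fix a assume a: "a : carrier PR Int CZ"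
 have "\<ominus>\<^bsub>PR\<^esub> a = - a"
  using a PR_uminus by (intro PR.minus_equality) auto
 thus "\<ominus>\<^bsub>PR\<^esub> a : carrier PR Int CZ" using a PR_uminus UC.CI_closed(5) by simp
 fix b assume "b : carrier PR Int CZ"
 thus "a \<oplus>\<^bsub>PR\<^esub> b : carrier PR Int CZ" using a carrier_PR_add UC.CI_closed(2) by simp
qed blast
qed (auto simp: PR.ring_axioms PR_mult UC.CI_closed(3,4))
have gI: "gens_I Sg <= carrier PR Int CZ"
using gens_carrier(1) UC.xprod_CI finite_subset[OF _ finite_Z1] unfolding gens_I_eq by blast
have gJ: "gens_J Sg <= carrier PR Int CZ"
using gens_carrier(2) UC.lin_CI unfolding gens_J_eq by blast
fix p assume "p : chow_ideal Sg"
then obtain a b where "p = a + b" "a : Idl\<^bsub>PR\<^esub> gens_I Sg" "b : Idl\<^bsub>PR\<^esub> gens_J Sg"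
unfolding chow_ideal_def set_add_def' by auto
thus "p : carrier PR Int CZ"
using PR.genideal_minimal[OF id gI] PR.genideal_minimal[OF id gJ] idealD(2)[OF id] by blast
next
note I = idealD[OF ideal_chow]
have sub: "Idl\<^bsub>PR\<^esub> gens_I Sg <= chow_ideal Sg" "Idl\<^bsub>PR\<^esub> gens_J Sg <= chow_ideal Sg"
unfolding chow_ideal_def set_add_def'
using idealD(1)[OF PR.genideal_ideal[OF gens_carrier(1)]] idealD(1)[OF PR.genideal_ideal[OF gens_carrier(2)]]
by force+
hence g: "gens_I Sg <= chow_ideal Sg" "gens_J Sg <= chow_ideal Sg"
using PR.genideal_self[OF gens_carrier(1)] PR.genideal_self[OF gens_carrier(2)] by blast+
have "CZ <= {p. proj p : chow_ideal Sg}"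
unfolding CI_def
proof (rule pideal_minimal)
show "is_ideal {p. proj p : chow_ideal Sg}"
 unfolding is_ideal_def using I carrier_proj by (simp add: proj_simps)
have "proj (xprod R) : chow_ideal Sg" if "finite R" "R ~: KC" for R
proof (cases "R <= Z1")
 case True
 hence "xprod R : gens_I Sg" using that unfolding gens_I_eq by blast
 thus ?thesis using g(1) proj_xprod[OF that(1)] True by auto
next
 case False
 thus ?thesis using I(1) proj_xprod[OF that(1)] by simp
qed
moreover have "proj (lin_form KC l) : chow_ideal Sg" if "l : MC" for l
proof -
 have "lin_form KC l : gens_J Sg" using that unfolding gens_J_eq by blast
 thus ?thesis using subsetD[OF g(2)] proj_id[OF subsetD[OF gens_carrier(2)]] by metis
qed
ultimately show "chow_gens KC MC <= {p. proj p : chow_ideal Sg}" unfolding chow_gens_def by blast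
qed
thus "p : chow_ideal Sg" if "p : carrier PR Int CZ" for p using that proj_id by auto
qed

sublocale CI: ideal "chow_ideal Sg" PR by (rule ideal_chow)

sublocale CR: cring "chow_ring Sg" unfolding chow_ring_def by (rule CI.quotient_is_cring[OF cring_PR])

lemma cls_eq_iff: "p : carrier PR ==> q : carrier PR ==> cls p = cls q <-> p - q : CZ"
proof -
assume pq: "p : carrier PR" "q : carrier PR"
have "\<ominus>\<^bsub>PR\<^esub> q = - q" using pq PR_uminus by (intro PR.minus_equality) auto
hence "p \<ominus>\<^bsub>PR\<^esub> q = p - q" by (simp add: a_minus_def)
thus ?thesis
using PR.quotient_eq_iff_same_a_r_cos[OF ideal_chow pq] carrier_PR_diff[OF pq]
by (simp add: chow_class_def chow_ideal_eq)
qed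

lemma cls_add: "p : carrier PR ==> q : carrier PR ==> cls p \<oplus>\<^bsub>chow_ring Sg\<^esub> cls q = cls (p + q)"
using CI.a_rcos_sum[of p q] by (simp add: chow_class_def chow_ring_def FactRing_def)

lemma cls_mult: "p : carrier PR ==> q : carrier PR ==> cls p \<otimes>\<^bsub>chow_ring Sg\<^esub> cls q = cls (p * q)"
using CI.rcoset_mult_add[of p q] by (simp add: chow_class_def chow_ring_def FactRing_def)

lemma cls_one: "\<one>\<^bsub>chow_ring Sg\<^esub> = cls 1" by (simp add: chow_class_def chow_ring_def FactRing_def)

lemma cls_zero: "\<zero>\<^bsub>chow_ring Sg\<^esub> = cls 0"
using PR.a_rcos_zero[OF ideal_chow idealD(1)[OF ideal_chow]]
by (simp add: chow_class_def chow_ring_def FactRing_def)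

lemma cls_closed: "p : carrier PR ==> cls p : carrier (chow_ring Sg)"
by (auto simp: chow_class_def chow_ring_def FactRing_def A_RCOSETS_def' intro: bexI[of _ p])

lemma cls_xprod: "finite A ==> A <= Z1 ==> finprod (chow_ring Sg) (%ze. cls (pvar ze)) A = cls (xprod A)"
proof (induction A rule: finite_induct)
case empty
thus ?case by (simp add: cls_one xprod_def)
next
case (insert a A)
thus ?case
by (simp add: pvar_eq_Var cls_closed carrier_PR_Var subset_iff cls_mult carrier_PR_xprod xprod_def Pi_def)
 (simp add: xprod_def[symmetric] cls_mult carrier_PR_Var carrier_PR_xprod subset_iff)
qed

definition HP :: "nat => cone_poly set" where "HP k = {p : carrier PR. homog k p}"

lemma HP_closed: "p : HP k ==> q : HP k ==> p + q : HP k" "p : HP k ==> - p : HP k" "0 : HP k"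
"p : HP k ==> Cst c * p : HP k" "p : HP k ==> q : HP j ==> p * q : HP (k + j)" "homog k r ==> proj r : HP k"
by (auto simp: HP_def carrier_PR_add homog_add PR_uminus homog_uminus carrier_PR_0 PR_mult
 carrier_PR_Cst homog_Cst_mult homog_mult carrier_proj homog_proj)

lemma HP_carrier: "p : HP k ==> p : carrier PR" by (simp add: HP_def)

lemma AG_simps: "carrier (AG k) = cls ` HP k" "\<one>\<^bsub>AG k\<^esub> = cls 0"
"p : HP k ==> q : HP k ==> cls p \<otimes>\<^bsub>AG k\<^esub> cls q = cls (p + q)"
by (auto simp: chow_group_def HP_def homogeneous_eq_homog cls_zero cls_add)

lemma comm_group_AG: "comm_group (AG k)"
proof (rule comm_groupI)
fix x assume "x : carrier (AG k)"
then obtain p where p: "p : HP k" "x = cls p" by (auto simp: AG_simps)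
show "\<one>\<^bsub>AG k\<^esub> \<otimes>\<^bsub>AG k\<^esub> x = x" using p AG_simps(3)[OF HP_closed(3) p(1)] by (simp add: AG_simps(2))
show "EX y:carrier (AG k). y \<otimes>\<^bsub>AG k\<^esub> x = \<one>\<^bsub>AG k\<^esub>"
using p HP_closed(2) AG_simps(3)[OF HP_closed(2)[OF p(1)] p(1)] by (intro bexI[of _ "cls (- p)"]) (auto simp: AG_simps(1,2))
fix y assume "y : carrier (AG k)"
then obtain q where q: "q : HP k" "y = cls q" by (auto simp: AG_simps)
show "x \<otimes>\<^bsub>AG k\<^esub> y : carrier (AG k)" using p q HP_closed(1) by (auto simp: AG_simps)
show "x \<otimes>\<^bsub>AG k\<^esub> y = y \<otimes>\<^bsub>AG k\<^esub> x" using p q by (simp add: AG_simps add.commute)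
fix z assume "z : carrier (AG k)"
then obtain r where r: "r : HP k" "z = cls r" by (auto simp: AG_simps)
show "x \<otimes>\<^bsub>AG k\<^esub> y \<otimes>\<^bsub>AG k\<^esub> z = x \<otimes>\<^bsub>AG k\<^esub> (y \<otimes>\<^bsub>AG k\<^esub> z)" using p q r by (simp add: AG_simps HP_closed add.assoc)
qed (use HP_closed(3) in "auto simp: AG_simps")

lemma AG_pow: "p : HP k ==> cls p [^]\<^bsub>AG k\<^esub> (i::nat) = cls (Cst (int i) * p)"
proof (induction i)
case 0
interpret comm_group "AG k" by (rule comm_group_AG)
show ?case by (simp add: AG_simps)
next
case (Suc i)
interpret comm_group "AG k" by (rule comm_group_AG)
have "Cst (1 + int i) * p = Cst (int i) * p + p" unfolding Cst_add by (simp add: algebra_simps)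
thus ?case using Suc by (simp add: AG_simps(3) HP_closed(4))
qed

lemma AG_pow_one_iff: "p : HP k ==> cls p [^]\<^bsub>AG k\<^esub> (i::nat) = \<one>\<^bsub>AG k\<^esub> <-> Cst (int i) * p : CZ"
by (simp add: AG_pow AG_simps(2) cls_eq_iff HP_carrier carrier_PR_0 PR_mult carrier_PR_Cst)

lemma cls_cong: "p : HP k ==> q : HP k ==> p - q : CZ ==> cls p = cls q"
by (simp add: cls_eq_iff HP_carrier)

definition rep :: "nat => cone_poly set => cone_poly" where
"rep k x = (SOME p. p : HP k & x = cls p)"

lemma rep: "x : carrier (AG k) ==> rep k x : HP k" "x : carrier (AG k) ==> cls (rep k x) = x"
proof -
assume "x : carrier (AG k)"
hence "EX p. p : HP k & x = cls p" by (auto simp: AG_simps)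
from someI_ex[OF this] show "rep k x : HP k" "cls (rep k x) = x" by (auto simp: rep_def)
qed

lemma rep_cls: "p : HP k ==> rep k (cls p) - p : CZ"
using rep[of "cls p" k] by (simp add: AG_simps(1) cls_eq_iff[symmetric] HP_carrier)

lemma additive_on_rep:
assumes "!!p q. f (p + q) = f p + (f q :: 'c::ab_group_add)" "!!p. p : CZ ==> f p = 0"
shows "addit (AG k) (%x. f (rep k x))" "p : HP k ==> f (rep k (cls p)) = f p"
proof -
have cong: "f p = f q" if "p - q : CZ" for p q using assms(1)[of "p - q" q] assms(2)[OF that] by simp
show c: "f (rep k (cls p)) = f p" if "p : HP k" for p using cong[OF rep_cls[OF that]] .
show "addit (AG k) (%x. f (rep k x))"
unfolding addit_def by (auto simp: AG_simps c HP_closed assms(1))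
qed

text \<open>Extends a functional on a graded piece of the Chow group to all polynomials.\<close>

definition lift :: "nat => (cone_poly set => 'c) => cone_poly => 'c" where
"lift k ph p = ph (cls (proj (hcomp k p)))"

context
fixes k and ph :: "cone_poly set => 'c::comm_ring_1"
assumes ph: "addit (AG k) ph"
begin

lemma lift_add: "lift k ph (p + q) = lift k ph p + lift k ph q"
unfolding lift_def hcomp_add proj_simps
using additive_onD[OF ph, of "cls (proj (hcomp k p))" "cls (proj (hcomp k q))"]
by (simp add: AG_simps HP_closed)

lemma lift_CI: "p : CZ ==> lift k ph p = 0"
proof -
assume "p : CZ"
hence "proj (hcomp k p) - 0 : CZ" by (simp add: proj_CI_iff UC.hcomp_CI)
hence "cls (proj (hcomp k p)) = \<one>\<^bsub>AG k\<^esub>" unfolding AG_simps(2) using cls_cong[OF HP_closed(6)[OF homog_hcomp, of k p] HP_closed(3)] by blast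
thus ?thesis unfolding lift_def using additive_on_simps(1)[OF _ ph] comm_group_AG[of k] by (simp add: comm_group_def)
qed

lemma lift_Cst: "lift k ph (Cst c * p) = of_int c * lift k ph p"
proof -
have 0: "lift k ph 0 = 0" by (rule lift_CI) (rule UC.CI_closed)
have nat: "lift k ph (Cst (int i) * p) = of_nat i * lift k ph p" for i p
by (induction i) (simp_all add: 0 Cst_add distrib_right lift_add)
have neg: "lift k ph (- p) = - lift k ph p" for p using lift_add[of p "- p"] 0 by (simp add: eq_neg_iff_add_eq_0 add.commute)
show ?thesis
proof (cases c rule: int_cases2)
case (nonneg i)
thus ?thesis by (simp add: nat)
next
case (nonpos i)
thus ?thesis by (simp add: nat neg Cst_uminus)
qed
qed

lemma lift_HP: "p : HP k ==> lift k ph p = ph (cls p)"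
using hcomp_homog[of k p k] by (simp add: lift_def HP_def proj_id)

end

end

subsection \<open>The degree map and the two forms of Poincare duality\<close>

context utrop
begin

lemma Z_linfun: "linfun (lift k ph)" if "addit (AG k) ph" for ph :: "_ => int"
using lift_add[OF that] lift_Cst[OF that] by (intro linfunI) auto

definition DZ :: "cone_poly => int" where "DZ = (SOME D. is_deg KC MC d wC D)"

lemma is_deg_DZ: "is_deg KC MC d wC DZ"
proof -
have "EX D. is_deg KC MC d wC (D :: cone_poly => int)" using ex_degree_KC[where 'a = int] by (simp add: image_image)
thus ?thesis unfolding DZ_def by (rule someI_ex)
qed

lemma DZ: "linfun DZ" "p : CZ ==> DZ p = 0" "A : KC ==> card A = d ==> DZ (xprod A) = wC A"
using is_deg_DZ by (auto simp: is_deg_def)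

lemma DZ_cong: "p - q : CZ ==> DZ p = DZ q" by (rule lf_eq_mod[OF DZ(1,2)])

lemma facet_cone:
assumes B: "B : K" "card B = d"
shows "ray ` B : KC" "card (ray ` B) = d" "x_cone Sg (cn B) = cls (xprod (ray ` B))" "wC (ray ` B) = wt Sg (cn B)"
"xprod (ray ` B) : HP d"
proof -
show KC: "ray ` B : KC" using B by blast
have "inj_on ray B" by (rule inj_on_subset[OF inj_ray]) (use B(1) in blast)
thus c: "card (ray ` B) = d" using B by (simp add: card_image)
have sub: "ray ` B <= Z1" using B(1) unfolding Z1_eq by blast
have "{ze : Z1. ze <= cn B} = ray ` B"
proof (intro equalityI subsetI)
fix ze assume "ze : {ze : Z1. ze <= cn B}"
hence z: "ze : ray ` \<Union>K" "ze <= cn B" unfolding Z1_eq by blast+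
then obtain v where v: "v : \<Union>K" "ze = ray v" by blast
have "{v} <= B" by (rule cone_subset[OF vertex_face[OF v(1)] B(1)]) (use z v in simp)
thus "ze : ray ` B" using v(2) by blast
next
fix ze assume z: "ze : ray ` B"
then obtain v where v: "v : B" "ze = ray v" by blast
have "ray v <= cn B" using v(1) by (intro hull_mono) blast
thus "ze : {ze : Z1. ze <= cn B}" using z sub v(2) by blast
qed
thus "x_cone Sg (cn B) = cls (xprod (ray ` B))"
unfolding x_cone_def using cls_xprod[OF finite_imageI[OF fin_face[OF B(1)]] sub] by simp
show "wC (ray ` B) = wt Sg (cn B)" by (simp add: wC_def prim_rays[OF B(1)])
show "xprod (ray ` B) : HP d"
using carrier_PR_xprod[OF sub] homog_xprod[OF finite_imageI[OF fin_face[OF B(1)]], of ray] c by (simp add: HP_def)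
qed

text \<open>\<open>DZ\<close> on representatives shows that an admissible degree map exists; any
  such map, lifted to polynomials, agrees with \<open>DZ\<close> on facets and hence in degree
  \<open>d\<close>.\<close>

lemma chow_deg_cls: assumes p: "p : HP d" shows "chow_deg Sg (cls p) = DZ p"
proof -
have hom: "h : hom (AG d) integer_group <-> addit (AG d) h" for h
by (auto simp: hom_def addit_def integer_group_def)
define P where "P h <-> h : hom (AG d) integer_group & (ALL sg:cones_dim Sg d. h (x_cone Sg sg) = wt Sg sg)" for h
have "P (%x. DZ (rep d x))"
unfolding P_def hom
using additive_on_rep[where f = DZ and k = d] lf_simps(1)[OF DZ(1)] DZ(2) facet_cone DZ(3) by (auto simp: cones_dim_eq)
hence P: "P (chow_deg Sg)" unfolding chow_deg_def P_def by (rule someI[of P, unfolded P_def])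
hence add: "addit (AG d) (chow_deg Sg)" by (simp add: P_def hom)
have "lift d (chow_deg Sg) p = DZ p"
proof (rule UC.deg_unique[OF Z_linfun[OF add] lift_CI[OF add] DZ(1,2)])
fix A assume A: "A : KC" "card A = d"
then obtain B where B: "B : K" "A = ray ` B" by blast
have "inj_on ray B" by (rule inj_on_subset[OF inj_ray]) (use B(1) in blast)
hence c: "card B = d" using A B by (simp add: card_image)
have "cn B : cones_dim Sg d" using B(1) c by (auto simp: cones_dim_eq)
hence "chow_deg Sg (cls (xprod (ray ` B))) = wt Sg (cn B)" using P facet_cone(3)[OF B(1) c] unfolding P_def by metis
thus "lift d (chow_deg Sg) (xprod A) = DZ (xprod A)"
 using lift_HP[OF add facet_cone(5)[OF B(1) c]] facet_cone(4)[OF B(1) c] DZ(3)[OF A] B(2) by simp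
qed (use p in "auto simp: HP_def")
thus ?thesis using lift_HP[OF add p] by simp
qed

lemma deg_pairing_cls:
assumes "p : HP k" "q : HP (d - k)" "k <= d" shows "deg_pairing Sg (cls p) (cls q) = DZ (p * q)"
using HP_closed(5)[OF assms(1,2)] assms by (simp add: deg_pairing_def cls_mult HP_carrier chow_deg_cls)

lemma additive_deg_pairing:
assumes k: "k <= d"
shows "x : carrier (AG k) ==> addit (AG (d - k)) (deg_pairing Sg x)"
"y : carrier (AG (d - k)) ==> addit (AG k) (%x. deg_pairing Sg x y)"
proof -
have dp: "deg_pairing Sg (cls p) (cls q) = DZ (p * q)" if "p : HP k" "q : HP (d - k)" for p q
using deg_pairing_cls[OF that k] .
show "x : carrier (AG k) ==> addit (AG (d - k)) (deg_pairing Sg x)"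
unfolding addit_def by (auto simp: AG_simps dp HP_closed distrib_left lf_simps[OF DZ(1)])
show "y : carrier (AG (d - k)) ==> addit (AG k) (%x. deg_pairing Sg x y)"
unfolding addit_def by (auto simp: AG_simps dp HP_closed distrib_right lf_simps[OF DZ(1)])
qed

lemma deg_pairing_commute:
assumes "k <= d" "x : carrier (AG k)" "y : carrier (AG (d - k))"
shows "deg_pairing Sg x y = deg_pairing Sg y x"
proof -
obtain p q where pq: "p : HP k" "x = cls p" "q : HP (d - k)" "y = cls q" using assms by (auto simp: AG_simps)
thus ?thesis using deg_pairing_cls[OF pq(1,3) assms(1)] deg_pairing_cls[of q "d - k" p] assms(1)
by (simp add: mult.commute)
qed

text \<open>Every polynomial over \<open>'a\<close> is integral up to a denominator in
  \<open>N\<close>, and so is membership in the ideal. Degrees and functionals given on integral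
  polynomials extend linearly from monomials; in both directions witnesses are cleared of
  denominators and projected to ray variables.\<close>

theorem PDc_iff_nondegenerate:
assumes N: "denominators TYPE('a::{idom, ring_char_0}) N"
shows "PDc KC LC d (wC :: _ => 'a) <->
(ALL k<=d. nondeg TYPE('a) N (AG k) (AG (d - k)) (deg_pairing Sg))"
proof -
interpret A: ucx KC "LC :: (vec set => 'a) set" by (rule ucomplex_KC)
let ?I = "CI KC LC :: (vec set, 'a) mp set"
note den = denominatorsD[OF N]
define D :: "(vec set, 'a) mp => 'a" where "D = monfun (%m. of_int (DZ (single m 1)))"
have linD: "linfun D" unfolding D_def by (rule linfun_monfun)
have D_int: "D (mp_int p) = of_int (DZ p)" for p
proof (induction p rule: pm_induct)
case zero
thus ?case by (simp add: mpi_simps lf_simps[OF linD] lf_simps[OF DZ(1)])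
next
case (add m c p)
have "DZ (single m c) = c * DZ (single m 1)"
 by (subst single_Cst) (simp add: lf_simps[OF DZ(1)])
thus ?case using add
 by (simp add: mpi_simps mp_int_single lf_simps[OF linD] lf_simps[OF DZ(1)]) (simp add: D_def)
qed
have kill: "D p = 0" if p: "p : ?I" for p
proof -
obtain i p' where i: "i : N" "Cst (of_nat i) * p = mp_int p'" "p' : CZ" by (rule clear_CI[OF N p])
have "of_nat i * D p = D (mp_int p')" unfolding i(2)[symmetric] by (simp add: lf_simps[OF linD])
thus ?thesis using den(1)[OF i(1)] by (simp add: D_int DZ(2)[OF i(3)])
qed
have deg: "is_deg KC LC d wC D"
unfolding is_deg_def
proof (intro conjI ballI impI)
fix A assume "A : KC" "card A = d"
thus "D (xprod A) = wC A" using D_int[of "xprod A"] DZ(3) by (simp add: wC_def)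
qed (use linD kill in auto)
have int_mod: "mp_int p - mp_int (proj p) : ?I" for p
using mp_int_CI[OF proj_mod[of p], where 'a = 'a] by (simp add: mpi_simps)
have tors: "EX i:N. cls p [^]\<^bsub>AG k\<^esub> i = \<one>\<^bsub>AG k\<^esub>" if p: "p : HP k" "(mp_int p :: (vec set, 'a) mp) : ?I" for p k
proof -
obtain i p' where i: "i : N" "Cst (of_nat i) * mp_int p = (mp_int p' :: (vec set, 'a) mp)" "p' : CZ" by (rule clear_CI[OF N p(2)])
have "mp_int p' = (mp_int (Cst (int i) * p) :: (vec set, 'a) mp)" using i(2) by (simp add: mpi_simps)
hence "p' = Cst (int i) * p" by (rule mp_int_inj)
thus ?thesis using i(1,3) AG_pow_one_iff[OF p(1)] by blast
qed
show ?thesis unfolding A.PDc_iff[OF deg]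
proof (intro iffI allI impI)
fix k assume PD: "PD_on ?I D d" and k: "k <= d"
hence kd: "k + (d - k) = d" by simp
show "nondeg TYPE('a) N (AG k) (AG (d - k)) (deg_pairing Sg)"
 unfolding nondeg_def
proof (intro conjI ballI impI allI)
 fix x assume x: "x : carrier (AG k)" "ALL y:carrier (AG (d - k)). deg_pairing Sg x y = 0"
 then obtain p where p: "p : HP k" "x = cls p" by (auto simp: AG_simps)
 have z: "DZ (p * q) = 0" if "q : HP (d - k)" for q
  using x(2) deg_pairing_cls[OF p(1) that k] that p(2) by (auto simp: AG_simps)
 have "mp_int p : ?I"
 proof (rule PD_on_inj[OF PD kd])
  show "homog k (mp_int p :: (vec set, 'a) mp)" using p by (simp add: homog_mp_int HP_def)
  fix q :: "(vec set, 'a) mp" assume "homog (d - k) q"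
  then obtain i q' where i: "i : N" "Cst (of_nat i) * q = mp_int q'" "homog (d - k) q'" by (rule clear_homog[OF N])
  have "of_nat i * D (mp_int p * q) = D (mp_int p * (Cst (of_nat i) * q))"
   by (simp add: lf_simps[OF linD, symmetric] algebra_simps)
  also have "... = of_int (DZ (p * q'))" unfolding i(2) by (simp add: D_int flip: mpi_simps(2))
  also have "DZ (p * q') = DZ (p * proj q')"
   by (rule DZ_cong) (simp add: right_diff_distrib[symmetric] UC.CI_closed(3) proj_mod)
  also have "... = 0" by (rule z[OF HP_closed(6)[OF i(3)]])
  finally show "D (mp_int p * q) = 0" using den(1)[OF i(1)] by simp
 qed
 from tors[OF p(1) this] show "EX i:N. x [^]\<^bsub>AG k\<^esub> i = \<one>\<^bsub>AG k\<^esub>" unfolding p(2) .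
next
 fix ph :: "cone_poly set => 'a" assume ph: "addit (AG (d - k)) ph"
 define ps :: "(vec set, 'a) mp => 'a" where "ps = monfun (%m. lift (d - k) ph (single m 1))"
 have linps: "linfun ps" unfolding ps_def by (rule linfun_monfun)
 have ps_int: "ps (mp_int p) = lift (d - k) ph p" for p
 proof (induction p rule: pm_induct)
  case zero
  thus ?case using lift_CI[OF ph UC.CI_closed(1)] by (simp add: mpi_simps lf_simps[OF linps])
 next
  case (add m c p)
  have "lift (d - k) ph (single m c) = of_int c * lift (d - k) ph (single m 1)"
   by (subst single_Cst) (simp add: lift_Cst[OF ph])
  thus ?case using add
   by (simp add: mpi_simps mp_int_single lf_simps[OF linps] lift_add[OF ph]) (simp add: ps_def)
 qed
 have "ps p = 0" if p: "p : ?I" for p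
 proof -
  obtain i p' where i: "i : N" "Cst (of_nat i) * p = mp_int p'" "p' : CZ" by (rule clear_CI[OF N p])
  have "of_nat i * ps p = ps (mp_int p')" unfolding i(2)[symmetric] by (simp add: lf_simps[OF linps])
  thus ?thesis using den(1)[OF i(1)] by (simp add: ps_int lift_CI[OF ph i(3)])
 qed
 then obtain P where P: "homog k P" "!!q. homog (d - k) q ==> ps q = D (P * q)" using PD_on_surj[OF PD kd linps] by metis
 obtain i p' where i: "i : N" "Cst (of_nat i) * P = mp_int p'" "homog k p'" by (rule clear_homog[OF N P(1)])
 have p: "proj p' : HP k" using HP_closed(6)[OF i(3)] .
 have "of_int (deg_pairing Sg (cls (proj p')) (cls q)) = of_nat i * ph (cls q)" if q: "q : HP (d - k)" for q
 proof -
  have "deg_pairing Sg (cls (proj p')) (cls q) = DZ (proj p' * q)" by (rule deg_pairing_cls[OF p q k])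
  also have "... = DZ (p' * q)"
   by (rule DZ_cong[symmetric]) (simp add: left_diff_distrib[symmetric] UC.CI_closed(4) proj_mod)
  finally have "of_int (deg_pairing Sg (cls (proj p')) (cls q)) = D (mp_int p' * mp_int q)"
   by (simp add: D_int flip: mpi_simps(2))
  also have "... = of_nat i * D (P * mp_int q)" unfolding i(2)[symmetric] by (simp add: lf_simps[OF linD] mult.assoc)
  also have "D (P * mp_int q) = ps (mp_int q)" by (rule P(2)[symmetric]) (use q in "simp add: homog_mp_int HP_def")
  finally show ?thesis by (simp add: ps_int lift_HP[OF ph q])
 qed
 thus "EX x:carrier (AG k). EX i:N. ALL y:carrier (AG (d - k)). of_int (deg_pairing Sg x y) = of_nat i * ph y"
  using p i(1) by (intro bexI[of _ "cls (proj p')"] bexI[of _ i]) (auto simp: AG_simps)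
qed
next
assume nd: "ALL k<=d. nondeg TYPE('a) N (AG k) (AG (d - k)) (deg_pairing Sg)"
show "PD_on ?I D d"
proof (rule PD_onI)
 fix k j and P :: "(vec set, 'a) mp"
 assume kj: "k + j = d" and P: "homog k P" and z: "!!q. homog j q ==> D (P * q) = 0"
 have k: "k <= d" "d - k = j" using kj by auto
 obtain i p' where i: "i : N" "Cst (of_nat i) * P = mp_int p'" "homog k p'" by (rule clear_homog[OF N P])
 have p: "proj p' : HP k" using HP_closed(6)[OF i(3)] .
 have "deg_pairing Sg (cls (proj p')) (cls q) = 0" if q: "q : HP (d - k)" for q
 proof -
  have "deg_pairing Sg (cls (proj p')) (cls q) = DZ (proj p' * q)" by (rule deg_pairing_cls[OF p q k(1)])
  also have "... = DZ (p' * q)"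
   by (rule DZ_cong[symmetric]) (simp add: left_diff_distrib[symmetric] UC.CI_closed(4) proj_mod)
  finally have "of_int (deg_pairing Sg (cls (proj p')) (cls q)) = D (mp_int p' * mp_int q)"
   by (simp add: D_int flip: mpi_simps(2))
  also have "... = of_nat i * D (P * mp_int q)" unfolding i(2)[symmetric] by (simp add: lf_simps[OF linD] mult.assoc)
  also have "D (P * mp_int q) = 0" by (rule z) (use q k in "simp add: homog_mp_int HP_def")
  finally show ?thesis by simp
 qed
 hence "ALL y:carrier (AG (d - k)). deg_pairing Sg (cls (proj p')) y = 0" by (auto simp: AG_simps)
 moreover have "cls (proj p') : carrier (AG k)" using p by (simp add: AG_simps)
 ultimately obtain j where j: "j : N" "cls (proj p') [^]\<^bsub>AG k\<^esub> j = \<one>\<^bsub>AG k\<^esub>" using nd k(1) unfolding nondeg_def by blast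
 hence "proj (Cst (int j) * p') : CZ" using AG_pow_one_iff[OF p] by (simp add: proj_simps)
 hence "mp_int (Cst (int j) * p') : ?I" unfolding proj_CI_iff by (rule mp_int_CI)
 hence I: "Cst (of_nat (j * i)) * P : ?I" by (simp add: mpi_simps i(2)[symmetric] Cst_mult mult.assoc)
 obtain c :: 'a where c: "of_nat (j * i) * c = 1" using den(3)[OF den(2)[OF j(1) i(1)]] by blast
 have "Cst c * (Cst (of_nat (j * i)) * P) = Cst (of_nat (j * i) * c) * P" by (simp only: Cst_mult mult.assoc mult.left_commute)
 also have "... = P" unfolding c by simp
 finally show "P : ?I" using A.CI_closed(3)[OF I, of "Cst c"] by simp
next
 fix k j and ph :: "(vec set, 'a) mp => 'a"
 assume kj: "k + j = d" and ph: "linfun ph" "!!p. p : ?I ==> ph p = 0"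
 have k: "k <= d" "d - k = j" using kj by auto
 let ?f = "%q. ph (mp_int q)"
 have f: "?f (p + q) = ?f p + ?f q" "p : CZ ==> ?f p = 0" for p q
  using mp_int_CI[of p KC MC, where 'a = 'a] by (auto simp: mpi_simps lf_simps[OF ph(1)] ph(2))
 have add1: "addit (AG j) (%x. ?f (rep j x))" by (rule additive_on_rep(1)[where f = ?f]) (erule f | rule f)+
 have add2: "?f (rep j (cls q)) = ?f q" if "q : HP j" for q
  by (rule additive_on_rep(2)[where f = ?f, OF _ _ that]) (erule f | rule f)+
 obtain x i where x: "x : carrier (AG k)" "i : N" "ALL y:carrier (AG j). of_int (deg_pairing Sg x y) = of_nat i * ?f (rep j y)"
  using nd k add1 unfolding nondeg_def by blast
 obtain p where p: "p : HP k" "x = cls p" using x(1) by (auto simp: AG_simps)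
 obtain c :: 'a where c: "of_nat i * c = 1" using den(3)[OF x(2)] by blast
 have "ph Q = D (Cst c * mp_int p * Q)" if Q: "homog j Q" for Q
 proof -
  obtain l q' where l: "l : N" "Cst (of_nat l) * Q = mp_int q'" "homog j q'" by (rule clear_homog[OF N Q])
  have q: "proj q' : HP j" using HP_closed(6)[OF l(3)] .
  have "of_nat l * D (Cst c * mp_int p * Q) = c * D (mp_int p * (Cst (of_nat l) * Q))"
   by (simp add: lf_simps[OF linD, symmetric] algebra_simps)
  also have "... = c * of_int (DZ (p * q'))" unfolding l(2) by (simp add: D_int flip: mpi_simps(2))
  also have "DZ (p * q') = DZ (p * proj q')"
   by (rule DZ_cong) (simp add: right_diff_distrib[symmetric] UC.CI_closed(3) proj_mod)
  also have "... = deg_pairing Sg x (cls (proj q'))" using deg_pairing_cls[OF p(1), of "proj q'"] q k p(2) by simp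
  also have "of_int ... = of_nat i * ?f (proj q')" using x(3) q add2[OF q] by (simp add: AG_simps)
  also have "?f (proj q') = ?f q'" by (rule lf_eq_mod[OF ph(1) ph(2) int_mod, symmetric])
  also have "c * (of_nat i * ?f q') = ?f q'" using c by (simp add: mult.assoc[symmetric] mult.commute)
  also have "... = of_nat l * ph Q" unfolding l(2)[symmetric] by (simp add: lf_simps[OF ph(1)])
  finally show ?thesis using den(1)[OF l(1)] by simp
 qed
 moreover have "homog k (Cst c * mp_int p)" using p by (intro homog_Cst_mult) (simp add: homog_mp_int HP_def)
 ultimately show "EX p. homog k p & (ALL q. homog j q --> ph q = D (p * q))" by blast
qed
qed
qed

text \<open>The detecting map sends a class to a representative, viewed as a rational polynomial
  modulo the rational ideal. If the image is zero, clearing denominators puts a positive multiple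
  into the integral ideal.\<close>

lemma torsion_detected_AG:
"tors_det (AG k) (%x. mp_int (rep k x)) Cst (CI KC LC :: (vec set, rat) mp set)"
proof -
interpret A: ucx KC "LC :: (vec set => rat) set" by (rule ucomplex_KC)
have "mp_int (rep k (x \<otimes>\<^bsub>AG k\<^esub> y)) - mp_int (rep k x) - mp_int (rep k y) : (CI KC LC :: (vec set, rat) mp set)"
if x: "x : carrier (AG k)" and y: "y : carrier (AG k)" for x y
proof -
obtain p where p: "p : HP k" "x = cls p" using x by (auto simp: AG_simps)
obtain q where q: "q : HP k" "y = cls q" using y by (auto simp: AG_simps)
have "rep k (cls (p + q)) - rep k (cls p) - rep k (cls q)
  = (rep k (cls (p + q)) - (p + q)) - (rep k (cls p) - p) - (rep k (cls q) - q)" by simp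
also have "... : CZ" using p q by (intro UC.CI_closed(6) rep_cls HP_closed)
finally show ?thesis using mp_int_CI p q by (simp add: AG_simps mpi_simps(6)[symmetric])
qed
moreover have "EX i>0. x [^]\<^bsub>AG k\<^esub> (i::nat) = \<one>\<^bsub>AG k\<^esub>"
if x: "x : carrier (AG k)" "mp_int (rep k x) : (CI KC LC :: (vec set, rat) mp set)" for x
proof -
obtain i p' where i: "i : {n. n > 0}" "Cst (of_nat i) * mp_int (rep k x) = (mp_int p' :: (vec set, rat) mp)" "p' : CZ"
 by (rule clear_CI[OF denominators_rat x(2)])
have "mp_int p' = (mp_int (Cst (int i) * rep k x) :: (vec set, rat) mp)" using i(2) by (simp add: mpi_simps)
hence "p' = Cst (int i) * rep k x" by (rule mp_int_inj)
hence "cls (rep k x) [^]\<^bsub>AG k\<^esub> i = \<one>\<^bsub>AG k\<^esub>" using i(3) AG_pow_one_iff[OF rep(1)[OF x(1)]] by blast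
thus ?thesis using i(1) rep(2)[OF x(1)] by auto
qed
ultimately show ?thesis using A.is_ideal_CI by (simp add: tors_det_def ringhom_Cst)
qed

lemma nondegenerate_flip:
assumes "k <= d"
shows "nondeg TYPE('a::ring_1) N (AG (d - k)) (AG k) (%y x. deg_pairing Sg x y) <->
nondeg TYPE('a) N (AG (d - k)) (AG (d - (d - k))) (deg_pairing Sg)"
using deg_pairing_commute[OF assms] assms unfolding nondeg_def by (simp cong: ball_cong bex_cong)

text \<open>The second half of perfectness at \<open>k\<close> is the first half at
  \<open>d - k\<close>, so over all \<open>k\<close> the first half is enough.\<close>

lemma PD_Z_iff: "PD_Z Sg <-> PD_over TYPE(int) Sg"
proof -
have "perfect_pairing (AG k) (AG (d - k)) integer_group (deg_pairing Sg) <->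
nondeg TYPE(int) {1} (AG k) (AG (d - k)) (deg_pairing Sg) &
nondeg TYPE(int) {1} (AG (d - k)) (AG (d - (d - k))) (deg_pairing Sg)" if k: "k <= d" for k
unfolding nondegenerate_flip[OF k, symmetric]
by (rule perfect_pairing_int_iff) (use comm_group_AG comm_group_def additive_deg_pairing[OF k] in auto)
hence "PD_Z Sg <-> (ALL k<=d. nondeg TYPE(int) {1} (AG k) (AG (d - k)) (deg_pairing Sg))"
unfolding PD_Z_def by (metis diff_le_self)
thus ?thesis
unfolding PD_over_def PDc_KC PDc_iff_nondegenerate[OF denominators_int] .
qed

lemma PD_Q_iff: "PD_Q Sg <-> PD_over TYPE(rat) Sg"
proof -
have "perfect_pairing (tensor_Q (AG k)) (tensor_Q (AG (d - k))) rat_group (rat_pairing (AG k) (AG (d - k)) (deg_pairing Sg)) <->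
nondeg TYPE(rat) {n. n > 0} (AG k) (AG (d - k)) (deg_pairing Sg) &
nondeg TYPE(rat) {n. n > 0} (AG (d - k)) (AG (d - (d - k))) (deg_pairing Sg)" if k: "k <= d" for k
unfolding nondegenerate_flip[OF k, symmetric]
by (rule perfect_pairing_rat_iff[OF comm_group_AG comm_group_AG additive_deg_pairing[OF k] torsion_detected_AG torsion_detected_AG])
hence "PD_Q Sg <-> (ALL k<=d. nondeg TYPE(rat) {n. n > 0} (AG k) (AG (d - k)) (deg_pairing Sg))"
unfolding PD_Q_def by (metis diff_le_self)
thus ?thesis
unfolding PD_over_def PDc_KC PDc_iff_nondegenerate[OF denominators_rat] .
qed

end

section \<open>The complex of a product fan is a join\<close>

section \<open>Cartesian products\<close>

lemma mink_sum_cone_of: "mink_sum (cn A) (cn B) = cn (A Un B)"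
unfolding convex_cone_hull_Un mink_sum_def by blast

lemma ubasis_image:
assumes B: "ubasis n B" and ph: "linear ph" "inj_on ph (span B)" "ph ` B <= Zlat n'"
and lift: "!!y. y : Zlat n' ==> y : span (ph ` B) ==> EX x:Zlat n Int span B. y = ph x"
shows "ubasis n' (ph ` B)"
proof (rule ubasisI)
note Bs = ubasisD[OF B]
show "finite (ph ` B)" using Bs(1) by simp
show "ph ` B <= Zlat n'" by fact
show "independent (ph ` B)" by (rule linear_independent_injective_image[OF ph(1) Bs(2) ph(2)])
have inj: "inj_on ph B" by (rule inj_on_subset[OF ph(2)]) (auto intro: span_base)
fix y assume "y : Zlat n'" "y : span (ph ` B)"
then obtain x where x: "x : Zlat n" "x : span B" "y = ph x" using lift by blast
have "y = (SUM b:B. of_int \<lfloor>co B b x\<rfloor> *\<^sub>R ph b)"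
unfolding x(3) by (subst ub_coords[OF B x(1,2)]) (simp add: linear_sum[OF ph(1)] linear_scale[OF ph(1)])
also have "... = (SUM c:ph ` B. of_int \<lfloor>co B (inv_into B ph c) x\<rfloor> *\<^sub>R c)"
by (subst sum.reindex[OF inj]) (auto simp: inv_into_f_f[OF inj])
finally show "EX c. y = (SUM b:ph ` B. of_int (c b) *\<^sub>R b)" by (rule exI[where x = "%c. \<lfloor>co B (inv_into B ph c) x\<rfloor>"])
qed

lemma ubasis_Rspace: "ubasis n B ==> span B <= Rspace n"
using ubasisD(3) Zlat_Rspace sub_Rspace by (intro span_minimal) blast+

definition unshift :: "nat => nat => vec => vec" where "unshift n m v = (SUM i<m. single i (lookup v (n + i)))"

lemma lookup_unshift: "lookup (unshift n m v) j = (if j < m then lookup v (n + j) else 0)"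
proof -
have "lookup (unshift n m v) j = (SUM i<m. if i = j then lookup v (n + j) else 0)"
unfolding unshift_def lookup_sum by (intro sum.cong) (auto simp: lookup_single when_def)
thus ?thesis by simp
qed

lemma lookup_shift: "lookup (shift n y) j = (if n <= j then lookup y (j - n) else 0)"
proof -
have "lookup (shift n y) j = (SUM i:keys y. if i = j - n & n <= j then lookup y (j - n) else 0)"
unfolding shift_def lookup_sum by (intro sum.cong) (auto simp: lookup_single when_def)
also have "... = (if n <= j then SUM i:keys y. if i = j - n then lookup y (j - n) else 0 else 0)" by simp
also have "... = (if n <= j then lookup y (j - n) else 0)" by (auto simp: in_keys_iff)
finally show ?thesis .
qed

lemma linear_shift: "linear (shift n)"
by (rule linearI; rule poly_mapping_eqI) (auto simp: lookup_shift lookup_add lookup_scaleR)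

lemma inj_shift: "inj (shift n)"
proof (rule injI, rule poly_mapping_eqI)
fix x y k assume "shift n x = shift n y"
hence "lookup (shift n x) (n + k) = lookup (shift n y) (n + k)" by simp
thus "lookup x k = lookup y k" by (simp add: lookup_shift)
qed

lemma trunc_add: "trunc n (x + y) = trunc n x + trunc n y"
by (rule poly_mapping_eqI) (simp add: lookup_trunc lookup_add)
lemma unshift_add: "unshift n m (x + y) = unshift n m x + unshift n m y"
by (rule poly_mapping_eqI) (simp add: lookup_unshift lookup_add)
lemma trunc_shift: "trunc n (shift n y) = 0"
by (rule poly_mapping_eqI) (simp add: lookup_trunc lookup_shift)
lemma unshift_Rspace: "x : Rspace n ==> unshift n m x = 0"
by (rule poly_mapping_eqI) (simp add: lookup_unshift Rspace_def)
lemma unshift_shift: "y : Rspace m ==> unshift n m (shift n y) = y"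
by (rule poly_mapping_eqI) (simp add: lookup_unshift lookup_shift Rspace_def)
lemma Zlat_trunc: "x : Zlat n' ==> trunc n x : Zlat n" by (auto simp: mem_Zlat lookup_trunc)
lemma Zlat_unshift: "x : Zlat n' ==> unshift n m x : Zlat m" by (auto simp: mem_Zlat lookup_unshift)
lemma Zlat_shift: "y : Zlat m ==> shift n y : Zlat (n + m)" by (auto simp: mem_Zlat lookup_shift)
lemma Zlat_mono: "n <= m ==> Zlat n <= Zlat m" by (auto simp: mem_Zlat)

text \<open>Splitting a vector into its coordinates below \<open>n\<close> and from \<open>n\<close>
  on separates the factors, for linear relations as well as for lattice points.\<close>

lemma ubasis_prod:
assumes A: "ubasis n A" and B: "ubasis m B" shows "ubasis (n + m) (A Un shift n ` B)"
proof (rule ubasisI)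
note As = ubasisD[OF A] and Bs = ubasisD[OF B]
have R: "A <= Rspace n" "B <= Rspace m" using As(3) Bs(3) Zlat_Rspace by blast+
have disj: "A Int shift n ` B = {}"
proof -
have "b = 0" if b: "b : B" "shift n b : A" for b
 using unshift_shift[of b m n] unshift_Rspace[of "shift n b" n m] b subsetD[OF R(1)] subsetD[OF R(2)] by metis
moreover have "0 ~: B" using Bs(2) dependent_zero by blast
ultimately show ?thesis by blast
qed
have inj: "inj_on (shift n) B" using inj_shift by (rule inj_on_subset) simp
have sum: "(SUM x:A Un shift n ` B. f x *\<^sub>R x) = (SUM a:A. f a *\<^sub>R a) + shift n (SUM b:B. f (shift n b) *\<^sub>R b)" for f
using As(1) Bs(1) disj by (simp add: sum.union_disjoint sum.reindex[OF inj] linear_sum[OF linear_shift] linear_scale[OF linear_shift])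
have Rs: "(SUM a:A. f a *\<^sub>R a) : Rspace n" "(SUM b:B. h b *\<^sub>R b) : Rspace m" for f h
using R by (auto intro!: subspace_sum[OF sub_Rspace] subspace_scale[OF sub_Rspace])
show "finite (A Un shift n ` B)" using As(1) Bs(1) by simp
show "A Un shift n ` B <= Zlat (n + m)" using As(3) Bs(3) Zlat_shift Zlat_mono[of n "n + m"] by auto
show "independent (A Un shift n ` B)"
proof (rule independent_if_scalars_zero)
fix f x assume s: "(SUM x:A Un shift n ` B. f x *\<^sub>R x) = 0" and x: "x : A Un shift n ` B"
have "trunc n (SUM x:A Un shift n ` B. f x *\<^sub>R x) = (SUM a:A. f a *\<^sub>R a)"
 unfolding sum trunc_add trunc_shift trunc_Rspace[OF Rs(1)] by simp
hence 1: "(SUM a:A. f a *\<^sub>R a) = 0" unfolding s using trunc_Rspace[of 0 n] by (simp add: Rspace_def)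
have "unshift n m (SUM x:A Un shift n ` B. f x *\<^sub>R x) = (SUM b:B. f (shift n b) *\<^sub>R b)"
 unfolding sum unshift_add unshift_shift[OF Rs(2)] unshift_Rspace[OF Rs(1)] by simp
hence 2: "(SUM b:B. f (shift n b) *\<^sub>R b) = 0" unfolding s using unshift_Rspace[of 0 n m] by (simp add: Rspace_def)
show "f x = 0" using x co_sum[OF As(2,1), of x f] co_sum[OF Bs(2,1), of _ "%b. f (shift n b)"]
  linear_0[OF co(1)[OF As(2)]] linear_0[OF co(1)[OF Bs(2)]] unfolding 1 2 by auto
qed (use As(1) Bs(1) in simp)
fix x assume x: "x : Zlat (n + m)" "x : span (A Un shift n ` B)"
have fin: "finite (A Un shift n ` B)" using As(1) Bs(1) by simp
then obtain f where f: "x = (SUM v:A Un shift n ` B. f v *\<^sub>R v)" using x(2) by (auto simp: span_finite)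
define a b where "a = (SUM a:A. f a *\<^sub>R a)" and "b = (SUM b:B. f (shift n b) *\<^sub>R b)"
have xab: "x = a + shift n b" unfolding f sum a_def b_def ..
have Rab: "a : Rspace n" "b : Rspace m" unfolding a_def b_def by (rule Rs)+
have "a = trunc n x" "b = unshift n m x"
unfolding xab by (simp_all add: trunc_add trunc_shift trunc_Rspace Rab unshift_add unshift_shift unshift_Rspace)
hence Z: "a : Zlat n" "b : Zlat m" using x(1) Zlat_trunc Zlat_unshift by auto
have sp: "a : span A" "b : span B" unfolding a_def b_def by (auto intro!: span_sum span_scale intro: span_base)
define c where "c v = (if v : A then \<lfloor>co A v a\<rfloor> else \<lfloor>co B (inv_into B (shift n) v) b\<rfloor>)" for v
have "c (shift n v) = \<lfloor>co B v b\<rfloor>" if "v : B" for v using disj that by (auto simp: c_def inv_into_f_f[OF inj])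
hence "x = (SUM v:A Un shift n ` B. of_int (c v) *\<^sub>R v)"
unfolding sum xab using ub_coords[OF A Z(1) sp(1)] ub_coords[OF B Z(2) sp(2)] by (simp add: c_def)
thus "EX c. x = (SUM v:A Un shift n ` B. of_int (c v) *\<^sub>R v)" by blast
qed

lemma cone_prod_cone_of: "cone_prod n (cn A) (cn B) = cn (A Un shift n ` B)"
proof -
have "cone_prod n (cn A) (cn B) = mink_sum (cn A) (shift n ` cn B)"
unfolding cone_prod_def mink_sum_def by blast
also have "... = mink_sum (cn A) (cn (shift n ` B))" by (simp only: convex_cone_hull_linear_image[OF linear_shift])
finally show ?thesis unfolding mink_sum_cone_of .
qed

lemma disjoint_Un_cancel:
assumes "A <= U" "A' <= U" "B <= V" "B' <= V" "U Int V = {}" "A Un B = A' Un B'"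
shows "A = A' & B = B'"
using assms by blast

lemma setcompr2_image: "{f x y |x y. x : g ` X & y : h ` Y} = {f (g a) (h b) |a b. a : X & b : Y}"
by blast

lemma image_setcompr2: "f ` {g a b |a b. a : X & b : Y} = {f (g a b) |a b. a : X & b : Y}"
by blast

text \<open>The complex is the join of the two complexes, so dimensions add and facet weights
  multiply; forms of a factor extend by zero. Then \<open>PD_product\<close> applies.\<close>

theorem PD_over_fan_prod:
fixes Sg Sg' :: tfan
assumes S: "utrop Sg" "utrop Sg'" "utrop (fan_prod Sg Sg')"
and PD: "PD_over TYPE('a::{euclidean_ring, ring_char_0}) Sg" "PD_over TYPE('a) Sg'"
shows "PD_over TYPE('a) (fan_prod Sg Sg')"
proof -
interpret A: utrop Sg by fact
interpret B: utrop Sg' by fact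
interpret C: utrop "fan_prod Sg Sg'" by fact
let ?n = "A.n" and ?m = "B.n" and ?P = "fan_prod Sg Sg'"
let ?K = "{A Un shift ?n ` B |A B. A : A.K & B : B.K}"
have rank: "lat_rank ?P = ?n + ?m" by (simp add: fan_prod_def)
have AR: "v : Rspace ?n" if "v : \<Union>A.K" for v using A.vertex_Zlat[OF that] Zlat_Rspace by blast
have BR: "v : Rspace ?m" if "v : \<Union>B.K" for v using B.vertex_Zlat[OF that] Zlat_Rspace by blast
have KP: "C.K = ?K"
proof (rule fan_complex_eqI)
have "cones ?P = {cone_prod ?n (cn A) (cn B) |A B. A : A.K & B : B.K}"
 unfolding setcompr2_image[symmetric] A.cones_eq[symmetric] B.cones_eq[symmetric] by (simp add: fan_prod_def)
also have "... = cn ` ?K" unfolding cone_prod_cone_of image_setcompr2 ..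
finally show "cones ?P = cn ` ?K" .
fix X assume "X : ?K"
then obtain A B where X: "X = A Un shift ?n ` B" "A : A.K" "B : B.K" by (elim CollectE exE conjE)
show "ubasis (lat_rank ?P) X" unfolding rank X(1) by (rule ubasis_prod[OF A.face_ub[OF X(2)] B.face_ub[OF X(3)]])
qed
have nz: "0 ~: \<Union>B.K"
proof
assume "0 : \<Union>B.K"
hence "independent {0::vec}" using B.vertex_face B.face_ub ubasisD(2) by blast
thus False by (simp add: dependent_single)
qed
have disj0: "shift ?n b ~: Rspace ?n" if "b : \<Union>B.K" for b
proof
assume "shift ?n b : Rspace ?n"
hence "b = 0" using unshift_shift[OF BR[OF that], of ?n] unshift_Rspace by metis
thus False using nz that by simp
qed
have disj: "\<Union>A.K Int shift ?n ` \<Union>B.K = {}" using disj0 AR by blast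
have inj: "inj_on (shift ?n) X" for X using inj_shift by (rule inj_on_subset) simp
have eqs: "A = A'" "B = B'" if "A : A.K" "A' : A.K" "B : B.K" "B' : B.K" "A Un shift ?n ` B = A' Un shift ?n ` B'" for A A' B B'
proof -
have s: "A <= \<Union>A.K" "A' <= \<Union>A.K" "shift ?n ` B <= shift ?n ` \<Union>B.K" "shift ?n ` B' <= shift ?n ` \<Union>B.K" using that(1-4) by blast+
have *: "A = A' & shift ?n ` B = shift ?n ` B'" by (rule disjoint_Un_cancel[OF s disj that(5)])
show "A = A'" using * by simp
show "B = B'" using * by (simp add: inj_image_eq_iff[OF inj_shift])
qed
have card: "card (A Un shift ?n ` B) = card A + card B" if "A : A.K" "B : B.K" for A B
proof -
have "A Int shift ?n ` B = {}" using disj that by blast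
thus ?thesis using A.fin_face[OF that(1)] B.fin_face[OF that(2)]
 by (simp add: card_Un_disjoint card_image[OF inj])
qed
obtain FA where FA: "FA : A.K" "{} <= FA" "card FA = A.d" by (rule A.facet_ex[OF A.empty_complex])
obtain FB where FB: "FB : B.K" "{} <= FB" "card FB = B.d" by (rule B.facet_ex[OF B.empty_complex])
have dimP: "fan_dim ?P = A.d + B.d"
unfolding C.fan_dim_eq KP
proof (rule Max_eqI)
show "finite (card ` ?K)" using C.fincx unfolding KP by simp
show "y <= A.d + B.d" if "y : card ` ?K" for y
proof -
 obtain Z where "Z : ?K" "y = card Z" using \<open>y : card ` ?K\<close> by (elim imageE)
 then obtain X Y where XY: "X : A.K" "Y : B.K" "y = card (X Un shift ?n ` Y)" by (elim CollectE exE conjE) simp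
 thus ?thesis using A.card_le[OF XY(1)] B.card_le[OF XY(2)] card[OF XY(1,2)] by simp
qed
show "A.d + B.d : card ` ?K" using card[OF FA(1) FB(1)] FA FB by (intro image_eqI[of _ _ "FA Un shift ?n ` FB"]) auto
qed
have wtP: "wt ?P (cn (X Un shift ?n ` Y)) = wt Sg (cn X) * wt Sg' (cn Y)"
if X: "X : A.K" "card X = A.d" and Y: "Y : B.K" "card Y = B.d" for X Y
proof -
have "(THE w. EX sg:cones_dim Sg A.d. EX sg':cones_dim Sg' B.d. cn (X Un shift ?n ` Y) = cone_prod ?n sg sg' & w = wt Sg sg * wt Sg' sg')
 = wt Sg (cn X) * wt Sg' (cn Y)"
proof (rule the_equality)
 show "EX sg:cones_dim Sg A.d. EX sg':cones_dim Sg' B.d. cn (X Un shift ?n ` Y) = cone_prod ?n sg sg' &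
   wt Sg (cn X) * wt Sg' (cn Y) = wt Sg sg * wt Sg' sg'"
  using X Y unfolding A.cones_dim_eq B.cones_dim_eq
  by (intro bexI[of _ "cn X"] bexI[of _ "cn Y"]) (auto simp: cone_prod_cone_of)
 fix w assume "EX sg:cones_dim Sg A.d. EX sg':cones_dim Sg' B.d. cn (X Un shift ?n ` Y) = cone_prod ?n sg sg' & w = wt Sg sg * wt Sg' sg'"
 then obtain X' Y' where *: "X' : A.K" "Y' : B.K" "cn (X Un shift ?n ` Y) = cn (X' Un shift ?n ` Y')"
  "w = wt Sg (cn X') * wt Sg' (cn Y')"
  unfolding A.cones_dim_eq B.cones_dim_eq by (auto simp: cone_prod_cone_of)
 have "X Un shift ?n ` Y = X' Un shift ?n ` Y'"
  by (rule inj_onD[OF C.inj_cone_of *(3)]) (use X Y * in "auto simp: KP")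
 thus "w = wt Sg (cn X) * wt Sg' (cn Y)" using eqs[OF X(1) *(1) Y(1) *(2)] *(4) by simp
qed
thus ?thesis by (simp add: fan_prod_def)
qed
obtain D1 :: "(vec, 'a) mp => 'a" where D1: "is_deg A.K (dforms ?n) A.d A.wK D1" "PD_on (CI A.K (dforms ?n)) D1 A.d"
using PD(1) unfolding PD_over_def PDc_def by blast
obtain D2 :: "(vec, 'a) mp => 'a" where D2: "is_deg B.K (dforms ?m) B.d B.wK D2" "PD_on (CI B.K (dforms ?m)) D2 B.d"
using PD(2) unfolding PD_over_def PDc_def by blast
obtain D12 :: "(vec, 'a) mp => 'a" where D12: "is_deg C.K (dforms (?n + ?m)) (A.d + B.d) C.wK D12"
using C.ex_degree[where 'a = 'a] unfolding rank dimP by blast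
have uC: "ucx C.K (dforms (?n + ?m) :: (vec => 'a) set)" using C.ucx[where 'a = 'a] unfolding rank .
interpret P: product_complex A.K "dforms ?n :: (vec => 'a) set" B.K "dforms ?m" C.K "dforms (?n + ?m)"
id "shift ?n" A.d B.d A.wK B.wK C.wK D1 D2 D12
proof (intro product_complex.intro product_complex_axioms.intro A.ucx B.ucx uC)
show "inj_on id (\<Union>A.K)" by simp
show "inj_on (shift ?n) (\<Union>B.K)" by (rule inj)
show "id ` \<Union>A.K Int shift ?n ` \<Union>B.K = {}" using disj by simp
show "C.K = {id ` A Un shift ?n ` B |A B. A : A.K & B : B.K}" unfolding KP by simp
show "EX l':dforms (?n + ?m). (ALL v:\<Union>A.K. l' (id v) = l v) & (ALL v:\<Union>B.K. l' (shift ?n v) = 0)"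
 if l: "l : dforms ?n" for l :: "vec => 'a"
proof -
 obtain m where m: "m : Zdual ?n" "l = (%v. of_int (m v))" using l by (auto simp: dforms_def)
 have "(%v. m (trunc ?n v)) : Zdual (?n + ?m)"
  using Zdual_D(1)[OF m(1)] Zlat_trunc by (auto simp: Zdual_def[of "_ + _"] trunc_add)
 thus ?thesis using AR Zdual_D(2)[OF m(1)]
  by (intro bexI[of _ "%v. of_int (m (trunc ?n v))"]) (auto simp: m(2) dforms_def trunc_Rspace trunc_shift)
qed
show "EX l':dforms (?n + ?m). (ALL v:\<Union>A.K. l' (id v) = 0) & (ALL v:\<Union>B.K. l' (shift ?n v) = l v)"
 if l: "l : dforms ?m" for l :: "vec => 'a"
proof -
 obtain m where m: "m : Zdual ?m" "l = (%v. of_int (m v))" using l by (auto simp: dforms_def)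
 have "(%v. m (unshift ?n ?m v)) : Zdual (?n + ?m)"
  using Zdual_D(1)[OF m(1)] Zlat_unshift by (auto simp: Zdual_def[of "_ + _"] unshift_add)
 thus ?thesis using AR BR Zdual_D(2)[OF m(1)]
  by (intro bexI[of _ "%v. of_int (m (unshift ?n ?m v))"]) (auto simp: m(2) dforms_def unshift_Rspace unshift_shift)
qed
show "C.wK (id ` X Un shift ?n ` Y) = (A.wK X * B.wK Y :: 'a)" if "X : A.K" "Y : B.K" "card X = A.d" "card Y = B.d" for X Y
 using wtP[OF that(1,3,2,4)] by simp
qed (use A.card_le B.card_le D1 D2 D12 in auto)
show ?thesis unfolding PD_over_def PDc_def rank dimP using D12 P.PD_product by blast
qed

section \<open>The complex of a tropical modification and its orders of vanishing\<close>

section \<open>Tropical modifications\<close>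

lemma PDc_cong:
assumes "!!A. A : K ==> card A = d ==> w A = w' A" shows "PDc K L d w <-> PDc K L d w'"
using assms by (simp add: PDc_def is_deg_def)

lemma lookup_u: "lookup (single n t :: vec) j = (if j = n then t else 0)"
by (simp add: lookup_single when_def)

lemma cone_of_single: "cn {single n (1::real)} = {single n t |t. t >= 0}"
proof -
have s: "single n t = t *\<^sub>R single n (1::real)" for t by (rule poly_mapping_eqI) (simp add: lookup_u lookup_scaleR)
have "single n (1::real) ~= 0" by (metis lookup_single_eq lookup_zero zero_neq_one)
hence "independent {single n (1::real)}" by (simp add: dependent_single)
hence m: "x : cn {single n 1} <-> x : span {single n 1} & 0 <= co {single n 1} (single n 1) x" for x
using mem_cone_of[of "{single n (1::real)}"] by simp
have c: "co {single n 1} (single n 1) (t *\<^sub>R single n (1::real)) = t" for t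
using co_sum[of "{single n (1::real)}" "single n 1" "%_. t"] `independent _` by simp
show ?thesis
proof (intro equalityI subsetI)
fix x assume "x : cn {single n 1}"
hence x: "x : span {single n 1}" "0 <= co {single n 1} (single n 1) x" unfolding m by auto
obtain t where t: "x = t *\<^sub>R single n 1" using x(1) unfolding span_singleton by blast
hence "0 <= t" using x(2) c by simp
moreover have "x = single n t" unfolding t by (rule s[symmetric])
ultimately show "x : {single n t |t. t >= 0}" by blast
next
fix x :: vec assume "x : {single n t |t. t >= 0}"
then obtain t :: real where "x = single n t" "0 <= t" by blast
hence "x = t *\<^sub>R single n 1" "0 <= t" using s[of t] by simp_all
thus "x : cn {single n 1}" unfolding m by (auto simp: c intro: span_scale span_base)
qed
qed

locale modification = utrop Sg + M: utrop "trop_mod Sg f" for Sg f +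
assumes f: "meromorphic_fun Sg f"
begin

abbreviation "TM == trop_mod Sg f"
abbreviation "u == single n (1::real)"
definition g :: "vec => vec" where "g x = x + single n (f x)"
definition De :: "vec set set" where
"De = {B : K. EX ta:K. Suc (card ta) = d & ord_at Sg f (cn ta) ~= 0 & B <= ta}"
abbreviation "KM == (`) g ` K Un (%B. insert u (g ` B)) ` De"
abbreviation "lf B == local_form Sg f (cn B)"
text \<open>The graph map \<open>g\<close> is only piecewise linear; \<open>gl B\<close> is the
  linear map that agrees with it on the cone of \<open>B\<close>.\<close>

definition gl :: "vec set => vec => vec" where "gl B x = x + single n (lf B x)"

lemma linear_gl: "B : K ==> linear (gl B)"
using local_formD(1)[OF f, of B]
by (intro linearI; intro poly_mapping_eqI) (simp_all add: gl_def lookup_add lookup_scaleR lookup_u linear_add linear_scale algebra_simps)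

lemma g_gl: "B : K ==> x : cn B ==> g x = gl B x" by (simp add: g_def gl_def local_formD(2)[OF f])

lemma g_gl_image: "B : K ==> g ` B = gl B ` B" using g_gl by (intro image_cong refl) (simp add: hull_inc)

lemma KR: "B : K ==> span B <= Rspace n" using ubasis_Rspace face_ub by blast

lemma trunc_gl: "x : Rspace n ==> trunc n (gl B x) = x"
by (rule poly_mapping_eqI) (simp add: lookup_trunc gl_def lookup_add lookup_u Rspace_def)

lemma trunc_g: "x : Rspace n ==> trunc n (g x) = x"
by (rule poly_mapping_eqI) (simp add: lookup_trunc g_def lookup_add lookup_u Rspace_def)

lemma vertex_R: "v : \<Union>K ==> v : Rspace n" using vertex_Zlat Zlat_Rspace by blast

lemma inj_g: "inj_on g (\<Union>K)" by (rule inj_on_inverseI[of _ "trunc n"]) (rule trunc_g[OF vertex_R])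

lemma vertex_nz: "v : \<Union>K ==> v ~= 0"
proof
assume "v : \<Union>K" "v = 0"
hence "independent {0::vec}" using vertex_face face_ub ubasisD(2) by metis
thus False by (simp add: dependent_single)
qed

lemma trunc_u: "trunc n u = 0" by (rule poly_mapping_eqI) (simp add: lookup_trunc lookup_u)

lemma u_notin: "u ~: g ` \<Union>K"
proof
assume "u : g ` \<Union>K"
then obtain v where v: "v : \<Union>K" "u = g v" by (rule imageE)
hence "v = 0" using trunc_g[OF vertex_R[OF v(1)]] trunc_u by simp
thus False using vertex_nz v(1) by blast
qed

lemma single_int: "single n (of_int c) = of_int c *\<^sub>R u"
by (rule poly_mapping_eqI) (simp add: lookup_u lookup_scaleR)

lemma lf_int: "B : K ==> x : Zlat n ==> x : span B ==> lf B x : \<int>" by (rule local_formD(3)[OF f])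

lemma gl_Zlat: "B : K ==> x : Zlat n ==> x : span B ==> gl B x : Zlat (n + 1)"
using lf_int[of B x] by (auto simp: mem_Zlat gl_def lookup_add lookup_u)

lemma trunc_inj_span: "B : K ==> y : span (gl B ` B) ==> trunc n y : span B & y = gl B (trunc n y)"
proof -
assume B: "B : K" and "y : span (gl B ` B)"
then obtain x where "x : span B" "y = gl B x" by (auto simp: linear_span_image[OF linear_gl])
thus ?thesis using trunc_gl KR[OF B] by auto
qed

lemma ubasis_g: "B : K ==> ubasis (n + 1) (g ` B)"
unfolding g_gl_image
proof (rule ubasis_image[OF face_ub linear_gl])
assume B: "B : K"
show "inj_on (gl B) (span B)" by (rule inj_on_inverseI[of _ "trunc n"]) (use trunc_gl KR[OF B] in blast)
show "gl B ` B <= Zlat (n + 1)" using gl_Zlat[OF B] ubasisD(3)[OF face_ub[OF B]] by (auto intro: span_base)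
fix y assume y: "y : Zlat (n + 1)" "y : span (gl B ` B)"
thus "EX x:Zlat n Int span B. y = gl B x" using trunc_inj_span[OF B y(2)] Zlat_trunc by blast
qed

lemma ubasis_u: "B : K ==> ubasis (n + 1) (insert u (g ` B))"
proof (rule ubasisI)
assume B: "B : K"
note Gs = ubasisD[OF ubasis_g[OF B]]
have un: "u ~: span (g ` B)"
proof
assume "u : span (g ` B)"
hence "u = gl B 0" using trunc_inj_span[OF B, of u] trunc_u by (simp add: g_gl_image[OF B])
hence "lookup u n = lookup (gl B 0) n" by simp
thus False by (simp add: lookup_u gl_def lookup_add linear_0[OF local_formD(1)[OF f B]])
qed
show "finite (insert u (g ` B))" using Gs(1) by simp
show "insert u (g ` B) <= Zlat (n + 1)" using Gs(3) by (auto simp: mem_Zlat lookup_u)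
show "independent (insert u (g ` B))" using Gs(2) un by (simp add: independent_insert)
fix y assume y: "y : Zlat (n + 1)" "y : span (insert u (g ` B))"
obtain k where k: "y - k *\<^sub>R u : span (g ` B)" using y(2) span_breakdown_eq by blast
define x where "x = trunc n y"
have tr: "trunc n (y - k *\<^sub>R u) = x"
by (rule poly_mapping_eqI) (simp add: x_def lookup_trunc lookup_minus lookup_scaleR lookup_u)
have x: "x : Zlat n" "x : span B" "y - k *\<^sub>R u = gl B x"
using trunc_inj_span[OF B, of "y - k *\<^sub>R u"] k y(1) Zlat_trunc unfolding tr by (auto simp: g_gl_image[OF B] x_def)
have "lookup y n - k = lookup (y - k *\<^sub>R u) n" by (simp add: lookup_minus lookup_scaleR lookup_u)
also have "... = lf B x" unfolding x(3) using x(1) by (simp add: gl_def lookup_add lookup_u mem_Zlat)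
finally have "k = lookup y n - lf B x" by simp
hence "k : \<int>" using y(1) lf_int[OF B x(1,2)] by (auto simp: mem_Zlat)
then obtain j where j: "k = of_int j" by (rule Ints_cases)
have "gl B x : Zlat (n + 1)" "gl B x : span (g ` B)" using gl_Zlat[OF B x(1,2)] k x(3) by auto
define c where "c b = \<lfloor>co (g ` B) b (gl B x)\<rfloor>" for b
have c: "gl B x = (SUM b:g ` B. of_int (c b) *\<^sub>R b)"
unfolding c_def by (rule ub_coords[OF ubasis_g[OF B]]) fact+
have nu: "u ~: g ` B" by (rule contra_subsetD[OF span_superset un])
have "y = of_int j *\<^sub>R u + (SUM b:g ` B. of_int (c b) *\<^sub>R b)" unfolding c[symmetric] x(3)[symmetric] j by simp
also have "(SUM b:g ` B. of_int (c b) *\<^sub>R b) = (SUM b:g ` B. of_int ((c(u := j)) b) *\<^sub>R b)"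
using nu by (intro sum.cong refl) (metis fun_upd_other)
also have "of_int j *\<^sub>R u + ... = (SUM b:insert u (g ` B). of_int ((c(u := j)) b) *\<^sub>R b)"
unfolding sum.insert[OF Gs(1) nu] fun_upd_same ..
finally show "EX c. y = (SUM b:insert u (g ` B). of_int (c b) *\<^sub>R b)" by (rule exI[where x = "c(u := j)"])
qed

lemma graph_cone_eq: "B : K ==> graph_cone Sg f (cn B) = cn (g ` B)"
proof -
assume B: "B : K"
have "graph_cone Sg f (cn B) = g ` cn B" unfolding graph_cone_def g_def by blast
also have "... = gl B ` cn B" using g_gl[OF B] by (intro image_cong refl)
finally show ?thesis by (simp only: convex_cone_hull_linear_image[OF linear_gl[OF B], symmetric] g_gl_image[OF B])
qed

lemma up_cone_eq: "B : K ==> up_cone Sg f (cn B) = cn (insert u (g ` B))"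
proof -
assume B: "B : K"
have "up_cone Sg f (cn B) = mink_sum (cn (g ` B)) (cn {u})"
unfolding up_cone_def graph_cone_eq[OF B] cone_of_single ..
thus ?thesis unfolding mink_sum_cone_of by simp
qed

lemma De_K: "B : De ==> B : K" by (simp add: De_def)

lemma codim1: "codim1_cones Sg = cn ` {ta : K. Suc (card ta) = d}"
using dim_face by (force simp: codim1_cones_def cones_eq)

lemma cones_div: "cones (div_fan Sg f) = cn ` De"
proof (intro equalityI subsetI)
fix de assume "de : cones (div_fan Sg f)"
then obtain ta where t: "ta : K" "Suc (card ta) = d" "ord_at Sg f (cn ta) ~= 0" "cone_face de (cn ta)"
by (auto simp: div_fan_def codim1)
obtain B where B: "B <= ta" "de = cn B" using cone_face_imp[OF ubasisD(2,1)[OF face_ub[OF t(1)]] t(4)] by blast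
hence "B : De" using t dcx[OF t(1)] unfolding De_def by blast
thus "de : cn ` De" using B(2) by blast
next
fix de assume "de : cn ` De"
then obtain B ta where t: "ta : K" "Suc (card ta) = d" "ord_at Sg f (cn ta) ~= 0" "B <= ta" "de = cn B"
by (auto simp: De_def)
have "cone_face de (cn ta)" unfolding t(5) by (rule cone_face_sub[OF ubasisD(2,1)[OF face_ub[OF t(1)]] t(4)])
thus "de : cones (div_fan Sg f)" using t(1-3) by (auto simp: div_fan_def codim1)
qed

lemma rank_M: "lat_rank TM = n + 1" by (simp add: trop_mod_def)

lemma complex_M: "M.K = KM"
proof (rule fan_complex_eqI)
have "cones TM = graph_cone Sg f ` cn ` K Un up_cone Sg f ` cn ` De"
unfolding cones_eq[symmetric] cones_div[symmetric] by (simp add: trop_mod_def)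
also have "graph_cone Sg f ` cn ` K = cn ` (`) g ` K"
unfolding image_image using graph_cone_eq by (intro image_cong refl)
also have "up_cone Sg f ` cn ` De = cn ` (%B. insert u (g ` B)) ` De"
unfolding image_image using up_cone_eq De_K by (intro image_cong refl) blast
finally show "cones TM = cn ` KM" by (simp only: image_Un)
fix X assume "X : KM"
thus "ubasis (lat_rank TM) X" unfolding rank_M using ubasis_g ubasis_u De_K by (elim UnE imageE) simp_all
qed

lemma inj_face: "inj_on g B" if "B : K" using inj_g by (rule inj_on_subset) (use that in blast)

lemma u_face: "B : K ==> u ~: g ` B" using u_notin by blast

lemma card_g: "B : K ==> card (g ` B) = card B" using inj_face by (simp add: card_image)

lemma card_u: "B : K ==> card (insert u (g ` B)) = Suc (card B)"
using u_face fin_face card_g by simp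

lemma dim_M: "fan_dim TM = d"
unfolding M.fan_dim_eq complex_M
proof (rule Max_eqI)
show "finite (card ` KM)" using M.fincx unfolding complex_M by simp
show "y <= d" if "y : card ` KM" for y
proof -
obtain X where X: "X : KM" "y = card X" using \<open>y : card ` KM\<close> by (elim imageE)
from X(1) consider B where "B : K" "X = g ` B" | B where "B : De" "X = insert u (g ` B)" by (elim UnE imageE)
thus ?thesis
proof cases
 case 1
 thus ?thesis using X(2) card_g card_le by simp
next
 case 2
 then obtain ta where "ta : K" "Suc (card ta) = d" "B <= ta" by (auto simp: De_def)
 thus ?thesis using X(2) 2 card_u[OF De_K[OF 2(1)]] card_mono[of ta B] fin_face by simp
qed
qed
obtain F where F: "F : K" "{} <= F" "card F = d" by (rule facet_ex[OF empty_complex])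
show "d : card ` KM" using F card_g[OF F(1)] by (intro image_eqI[of _ _ "g ` F"]) auto
qed

lemma g_eq_iff: "A : K ==> B : K ==> g ` A = g ` B <-> A = B"
by (rule inj_on_image_eq_iff[OF inj_g]) blast+

text \<open>The two kinds of facets are distinguished by whether they contain the vertical vector,
  so the definite description has one value.\<close>

lemma THE_wt:
assumes X: "X : KM"
and 1: "!!A. A : K ==> card A = d ==> X = g ` A ==> w = wt Sg (cn A)"
and 2: "!!A. A : De ==> Suc (card A) = d ==> X = insert u (g ` A) ==> w = ord_at Sg f (cn A)"
and ex: "(EX A:K. card A = d & X = g ` A) | (EX A:De. Suc (card A) = d & X = insert u (g ` A))"
shows "wt TM (cn X) = w"
proof -
define P where "P v <-> (EX A:K. card A = d & X = g ` A & v = wt Sg (cn A)) |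
(EX A:De. Suc (card A) = d & X = insert u (g ` A) & v = ord_at Sg f (cn A))" for v
have inj: "cn X = cn Y <-> X = Y" if "Y : KM" for Y
using inj_onD[OF M.inj_cone_of, of X Y] X that unfolding complex_M by blast
have g1: "cn X = graph_cone Sg f (cn A) <-> X = g ` A" if "A : K" for A
unfolding graph_cone_eq[OF that] using inj[of "g ` A"] that by blast
have g2: "cn X = up_cone Sg f (cn A) <-> X = insert u (g ` A)" if "A : De" for A
unfolding up_cone_eq[OF De_K[OF that]] using inj[of "insert u (g ` A)"] that by blast
have dd: "cones (div_fan Sg f) Int codim1_cones Sg = cn ` {A : De. Suc (card A) = d}"
unfolding cones_div codim1 using inj_onD[OF inj_cone_of] De_K by blast
have "((EX sg:cones_dim Sg d. cn X = graph_cone Sg f sg & v = wt Sg sg) |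
 (EX de:cones (div_fan Sg f) Int codim1_cones Sg. cn X = up_cone Sg f de & v = ord_at Sg f de)) <-> P v" for v
unfolding dd cones_dim_eq P_def using g1 g2 by auto
hence "wt TM (cn X) = (THE v. P v)" by (simp add: trop_mod_def)
also have "... = w"
proof (rule the_equality)
show "v = w" if "P v" for v using that 1 2 unfolding P_def by blast
show "P w" using ex 1 2 unfolding P_def by blast
qed
finally show ?thesis .
qed

lemma wt_M1: "A : K ==> card A = d ==> wt TM (cn (g ` A)) = wt Sg (cn A)"
proof (rule THE_wt)
assume A: "A : K" "card A = d"
show "g ` A : KM" using A by blast
show "wt Sg (cn A) = wt Sg (cn B)" if "B : K" "card B = d" "g ` A = g ` B" for B
using g_eq_iff[OF A(1) that(1)] that by simp
show "wt Sg (cn A) = ord_at Sg f (cn B)" if "g ` A = insert u (g ` B)" for B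
using u_face[OF A(1)] that by blast
qed blast

lemma wt_M2: "A : De ==> Suc (card A) = d ==> wt TM (cn (insert u (g ` A))) = ord_at Sg f (cn A)"
proof (rule THE_wt)
assume A: "A : De" "Suc (card A) = d"
show "insert u (g ` A) : KM" using A by blast
show "ord_at Sg f (cn A) = wt Sg (cn B)" if "B : K" "insert u (g ` A) = g ` B" for B
using u_face[OF that(1)] that by blast
show "ord_at Sg f (cn A) = ord_at Sg f (cn B)" if "B : De" "insert u (g ` A) = insert u (g ` B)" for B
proof -
have "g ` A = g ` B" using that(2) u_face[OF De_K[OF A(1)]] u_face[OF De_K[OF that(1)]] by (simp add: insert_ident)
thus ?thesis using g_eq_iff[OF De_K[OF A(1)] De_K[OF that(1)]] by simp
qed
qed blast

lemma floor_f: "v : \<Union>K ==> real_of_int \<lfloor>f v\<rfloor> = f v"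
using meromorphic_vertex_Ints[OF f] by simp

lemma g_int: "v : \<Union>K ==> g v = v + of_int \<lfloor>f v\<rfloor> *\<^sub>R u"
unfolding g_def single_int[symmetric] by (simp only: floor_f)

lemma uZ: "u : Zlat (n + 1)" by (auto simp: mem_Zlat lookup_u)

text \<open>The last coordinate is the form with value 1 on the vertical ray, and its value at
  \<open>g v\<close> is \<open>f v\<close>. The degree of F times a codimension one face is minus
  the order, by \<open>deg_relation\<close> and \<open>ord_formula\<close>; the rest is
  \<open>PDc_modification\<close>.\<close>

theorem PD_over_trop_mod:
assumes PD: "PD_over TYPE('a::{idom, ring_char_0}) Sg"
shows "PD_over TYPE('a) TM"
proof -
interpret U: ucx K "dforms n :: (vec => 'a) set" by (rule ucx)
obtain D :: "(vec, 'a) mp => 'a" where D: "is_deg K (dforms n) d wK D" "PD_on (CI K (dforms n)) D d"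
using PD unfolding PD_over_def PDc_def by blast
have linD: "linfun D" using D(1) by (simp add: is_deg_def)
have KM: "M.K = (`) g ` K Un (%B. insert u (g ` B)) ` De" by (rule complex_M)
have Zn: "v : Zlat n" "v : Zlat (n + 1)" if "v : \<Union>K" for v using vertex_Zlat[OF that] Zlat_mono[of n "n + 1"] by auto
have "PDc M.K (dforms (n + 1) :: (vec => 'a) set) d M.wK"
proof (rule PDc_modification[where f = "%v. of_int \<lfloor>f v\<rfloor>" and ord = "%A. of_int (ord_at Sg f (cn A))",
  OF ucx inj_g u_notin _ _ KM _ _ _ card_le D])
show "De <= K" using De_K by blast
show "B : De" if A: "A : De" and "B <= A" for A B
proof -
 obtain ta where "ta : K" "Suc (card ta) = d" "ord_at Sg f (cn ta) ~= 0" "A <= ta" using A by (auto simp: De_def)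
 thus ?thesis using `B <= A` dcx[of ta B] unfolding De_def by blast
qed
show "EX l:dforms n. ALL v:\<Union>K. l' (g v) = l v + l' u * of_int \<lfloor>f v\<rfloor>" if l: "l' : dforms (n + 1)" for l' :: "vec => 'a"
proof -
 obtain m where m: "m : Zdual (n + 1)" "l' = (%v. of_int (m v))" using l by (auto simp: dforms_def)
 have "m : Zdual n" using m(1) Zlat_mono[of n "n + 1"] by (auto simp: Zdual_def)
 moreover have "m (g v) = m v + m u * \<lfloor>f v\<rfloor>" if v: "v : \<Union>K" for v
  using Zdual_D(1)[OF m(1) Zn(2)[OF v] Zlat_scale[OF uZ]] Zdual_D(4)[OF m(1) uZ] by (simp add: g_int[OF v])
 ultimately show ?thesis
  by (intro bexI[of _ "%v. of_int (m v)"]) (auto simp: m(2) dforms_def)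
qed
show "EX l':dforms (n + 1). l' u = 0 & (ALL v:\<Union>K. l' (g v) = l v)" if l: "l : dforms n" for l :: "vec => 'a"
proof -
 obtain m where m: "m : Zdual n" "l = (%v. of_int (m v))" using l by (auto simp: dforms_def)
 have "(%v. m (trunc n v)) : Zdual (n + 1)"
  using Zdual_D(1)[OF m(1)] Zlat_trunc unfolding Zdual_def by (simp add: trunc_add)
 thus ?thesis using Zdual_D(2)[OF m(1)]
  by (intro bexI[of _ "%v. of_int (m (trunc n v))"]) (auto simp: m(2) dforms_def trunc_u trunc_g vertex_R)
qed
have "linear (%x :: vec. lookup x n)" by (rule linearI) (simp_all add: lookup_add lookup_scaleR)
hence "(%x. \<lfloor>lookup x n\<rfloor>) : Zdual (n + 1)" by (rule Zdual_linear) (simp add: mem_Zlat)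
moreover have "lookup (g v) n = f v" if "v : \<Union>K" for v
 using vertex_R[OF that] by (simp add: g_def lookup_add lookup_u Rspace_def)
ultimately show "EX l':dforms (n + 1). l' u = (1::'a) & (ALL v:\<Union>K. l' (g v) = of_int \<lfloor>f v\<rfloor>)"
 by (intro bexI[of _ "%x. of_int \<lfloor>lookup x n\<rfloor>"]) (auto simp: dforms_def lookup_u)
next
fix A assume A: "A : K" "Suc (card A) = d"
obtain gm where gm: "ALL v. v ~: A --> gm v = (if insert v A : K then wt Sg (cn (insert v A)) else 0)"
 "ALL m:Zdual n. (SUM v:\<Union>K. m v * gm v) = 0"
 "(SUM b:link K A. of_int (wt Sg (cn (insert b A))) *\<^sub>R b) = (SUM a:A. of_int (- gm a) *\<^sub>R a)"
 by (rule balanced_relation[OF balanced[OF A] A(1)])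
have rel: "D (Var v * xprod A) = of_int (gm v)" if "v : \<Union>K" for v
proof (rule U.deg_relation[OF D(1) A _ _ that])
 show "of_int (gm v) = (if insert v A : K then wK (insert v A) else (0::'a))" if "v : \<Union>K - A" for v
  using gm(1) that by simp
 fix l :: "vec => 'a" assume "l : dforms n"
 then obtain m where m: "m : Zdual n" "l = (%v. of_int (m v))" by (auto simp: dforms_def)
 have "(SUM v:\<Union>K. l v * of_int (gm v)) = of_int (SUM v:\<Union>K. m v * gm v)" unfolding m(2) by (simp only: of_int_sum of_int_mult)
 thus "(SUM v:\<Union>K. l v * of_int (gm v)) = 0" using gm(2) m(1) by simp
qed
have AL: "A Un link K A <= \<Union>K" "A Int link K A = {}" using A(1) by (auto simp: link_def)
have "real_of_int (SUM v:\<Union>K. \<lfloor>f v\<rfloor> * gm v) = (SUM v:\<Union>K. f v * gm v)"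
 unfolding of_int_sum by (intro sum.cong refl) (simp only: of_int_mult floor_f)
also have "... = (SUM v:A Un link K A. f v * of_int (gm v))"
 by (rule sum.mono_neutral_right) (use U.finite_V AL gm(1) in "auto simp: link_def")
also have "... = (SUM v:A. f v * gm v) + (SUM v:link K A. f v * gm v)"
 by (rule sum.union_disjoint) (use AL finite_link fin_face A(1) in auto)
also have "(SUM v:link K A. f v * gm v) = (SUM v:link K A. of_int (wt Sg (cn (insert v A))) * f v)"
 using gm(1) by (intro sum.cong) (auto simp: link_def)
also have "(SUM v:A. f v * gm v) + ... = - of_int (ord_at Sg f (cn A))"
 unfolding ord_formula[OF f A gm(3)] by (simp add: sum_negf mult.commute)
finally have s: "(SUM v:\<Union>K. \<lfloor>f v\<rfloor> * gm v) = - ord_at Sg f (cn A)" by linarith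
have "D ((SUM v:\<Union>K. Cst (of_int \<lfloor>f v\<rfloor>) * Var v) * xprod A) = (SUM v:\<Union>K. of_int \<lfloor>f v\<rfloor> * D (Var v * xprod A))"
 by (simp add: sum_distrib_right lf_simps[OF linD] mult.assoc)
also have "... = of_int (SUM v:\<Union>K. \<lfloor>f v\<rfloor> * gm v)"
 unfolding of_int_sum by (intro sum.cong refl) (simp only: of_int_mult rel)
finally show "D ((SUM v:\<Union>K. Cst (of_int \<lfloor>f v\<rfloor>) * Var v) * xprod A) = - of_int (ord_at Sg f (cn A))"
 unfolding s by simp
next
fix A assume "A : K" "Suc (card A) = d" "A ~: De"
thus "of_int (ord_at Sg f (cn A)) = (0::'a)" unfolding De_def by auto
qed (simp_all add: wt_M1 wt_M2)
thus ?thesis unfolding PD_over_def rank_M dim_M .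
qed

end

section \<open>Subdivision at a ray inside a cone: the new vector, the new complex, the new
  weights\<close>

section \<open>Stellar subdivisions\<close>

text \<open>A small step against \<open>b\<close> stays inside the cone.\<close>

lemma relint_cone_of_pos:
assumes B: "independent B" "finite B" and x: "x : rel_interior (cn B)" and b: "b : B"
shows "0 < co B b x"
proof -
obtain e where e: "e > 0" "ball x e Int affine hull (cn B) <= cn B" and xc: "x : cn B"
using x unfolding rel_interior_def mem_Collect_eq openin_contains_ball by blast
have aff: "affine hull (cn B) = span B"
using affine_hull_span_0[of "cn B"] hull_inc[of 0 "cn B" affine] convex_cone_hull_contains_0 by auto
have xs: "x : span B" using xc mem_cone_of[OF B] by blast
have b0: "norm b > 0" using b B(1) dependent_zero by auto
define t where "t = e / (2 * norm b)"
have t: "t > 0" "t * norm b < e" using e(1) b0 by (auto simp: t_def)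
have "x - t *\<^sub>R b : ball x e" using t by (simp add: dist_norm)
moreover have "x - t *\<^sub>R b : span B" using xs b by (intro span_diff span_scale) (auto intro: span_base)
ultimately have "x - t *\<^sub>R b : cn B" using e(2) aff by blast
hence "0 <= co B b (x - t *\<^sub>R b)" using mem_cone_of[OF B] b by blast
also have "... = co B b x - t" using co[OF B(1), where b = b] b by (simp add: linear_diff linear_scale)
finally show ?thesis using t by simp
qed

locale stellar = ustar Sg S + M: utrop "blow_up Sg (cn S) ro" for Sg S ro +
assumes relint: "ray_in_relint Sg (cn S) ro"
begin

abbreviation "BU == blow_up Sg (cn S) ro"

lemmas Ss = ubasisD[OF face_ub[OF S]]

lemma rank_BU: "lat_rank BU = n" by (simp add: blow_up_def)

lemma S_nonempty: "S ~= {}"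
proof
assume "S = {}"
hence "ro - {0} <= {0::vec}" using relint rel_interior_subset by (auto simp: ray_in_relint_def)
moreover obtain v where "v ~= 0" "ro = cn {v}" using relint by (auto simp: ray_in_relint_def rational_ray_def)
moreover have "v : cn {v}" by (rule hull_inc) simp
ultimately show False by blast
qed

lemma S_sub_cone: "cn S <= cn B <-> S <= B" if "B : K" using cone_subset_iff[OF S that] .

lemma cones_BU:
"cones BU = cn ` {B : K. ~ S <= B} Un (%B. mink_sum (cn B) ro) ` {B. ~ S <= B & B Un S : K}"
proof -
have 1: "{ta : cones Sg. ~ cn S <= ta} = cn ` {B : K. ~ S <= B}"
unfolding cones_eq using S_sub_cone by (intro equalityI subsetI) auto
have 2: "~ cn S <= ta & (EX et:cones Sg. cn S <= et & cone_face ta et) <->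
 ta : cn ` {B. ~ S <= B & B Un S : K}" for ta
proof
assume "~ cn S <= ta & (EX et:cones Sg. cn S <= et & cone_face ta et)"
then obtain C where C: "C : K" "cn S <= cn C" "cone_face ta (cn C)" and ns: "~ cn S <= ta"
 by (auto simp: cones_eq)
obtain B where B: "B <= C" "ta = cn B" using cone_face_imp[OF ubasisD(2,1)[OF face_ub[OF C(1)]] C(3)] by blast
have "S <= C" using S_sub_cone[OF C(1)] C(2) by blast
hence "B Un S : K" using dcx[OF C(1)] B(1) by simp
moreover have "~ S <= B" using ns B(2) hull_mono by blast
ultimately show "ta : cn ` {B. ~ S <= B & B Un S : K}" using B(2) by blast
next
assume "ta : cn ` {B. ~ S <= B & B Un S : K}"
then obtain B where B: "~ S <= B" "B Un S : K" "ta = cn B" by blast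
have "B : K" by (rule dcx[OF B(2)]) blast
hence "~ cn S <= ta" using S_sub_cone B by blast
moreover have "cone_face ta (cn (B Un S))" unfolding B(3)
 by (rule cone_face_sub[OF ubasisD(2,1)[OF face_ub[OF B(2)]]]) blast
moreover have "cn S <= cn (B Un S)" by (rule hull_mono) blast
ultimately show "~ cn S <= ta & (EX et:cones Sg. cn S <= et & cone_face ta et)" using cone_in[OF B(2)] by blast
qed
show ?thesis unfolding blow_up_def tfan.simps 1 2 by blast
qed

lemma ray_in_BU: "ro : cones BU"
proof -
have "mink_sum (cn {}) ro = ro" by (auto simp: mink_sum_def)
moreover have "{} : {B. ~ S <= B & B Un S : K}" using S_nonempty S by simp
ultimately show ?thesis unfolding cones_BU by (metis (no_types, lifting) UnI2 imageI)
qed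

definition e :: vec where "e = (SOME e. {e} : M.K & ro = cn {e})"

lemma e: "{e} : M.K" "ro = cn {e}"
proof -
obtain B where B: "B : M.K" "ro = cn B" using ray_in_BU M.cone_basis by blast
obtain v where v: "v : Zlat n" "v ~= 0" "ro = cn {v}" using relint by (auto simp: ray_in_relint_def rational_ray_def)
have "card B = dim (cn {v})" using M.dim_face[OF B(1)] B(2) v(3) by simp
also have "... = dim {v}" by (metis dim_span span_cone_of)
also have "... = 1" using v(2) dim_eq_card_independent[of "{v}"] by (simp add: dependent_single)
finally obtain w where "B = {w}" by (auto simp: card_1_singleton_iff)
hence "EX e. {e} : M.K & ro = cn {e}" using B by blast
from someI_ex[OF this] show "{e} : M.K" "ro = cn {e}" by (auto simp: e_def)
qed

lemma e_Zlat: "e : Zlat n" using ubasisD(3)[OF M.face_ub[OF e(1)]] by (simp add: rank_BU)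

lemma e_relint: "e : rel_interior (cn S)"
proof -
have "e ~= 0" using ubasisD(2)[OF M.face_ub[OF e(1)]] by (auto simp: dependent_single)
moreover have "e : cn {e}" by (rule hull_inc) simp
hence "e : ro" by (rule subsetD[OF equalityD2[OF e(2)]])
ultimately show ?thesis using relint by (auto simp: ray_in_relint_def)
qed

lemma e_pos: "s : S ==> 0 < co S s e" by (rule relint_cone_of_pos[OF Ss(2,1) e_relint])

lemma e_cone: "e : cn S" using e_relint rel_interior_subset by blast

lemma e_span: "e : span S" using e_cone mem_cone_of[OF Ss(2,1)] by blast

text \<open>\<open>e\<close> has positive coordinates on all of \<open>S\<close>, so it lies in no
  proper face of the cone of \<open>S\<close>.\<close>

lemma e_in_cone: "C : K ==> e : cn C ==> S <= C"
proof
fix s assume C: "C : K" "e : cn C" and s: "s : S"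
have "e : cn (S Int C)" using C e_cone inter_complex[OF S C(1)] by blast
hence "ALL b:S - S Int C. co S b e = 0" using cone_of_sub_iff[OF Ss(2,1), of "S Int C"] by blast
thus "s : C" using e_pos[OF s] s by force
qed

lemma mink_ray: "mink_sum (cn B) ro = cn (insert e B)"
proof -
have "mink_sum (cn B) ro = mink_sum (cn B) (cn {e})" by (rule arg_cong[OF e(2)])
thus ?thesis by (simp only: mink_sum_cone_of Un_insert_right Un_empty_right)
qed

text \<open>A ray is its own subdivision, with the same primitive vector. This case is separate
  because \<open>blowup\<close> concerns centres with at least two vertices.\<close>

lemma singleton_case:
assumes "card S = 1" shows "M.K = K"
proof -
obtain s where s: "S = {s}" using assms by (auto simp: card_1_singleton_iff)
have us: "ubasis n {s}" "ubasis n {e}" using face_ub[OF S] s M.face_ub[OF e(1), unfolded rank_BU] by simp_all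
have es: "e = co S s e *\<^sub>R s" using co_span[OF Ss(2,1) e_span] s by simp
have a: "0 < co S s e" using e_pos s by simp
have "cn {e} = cn {s}"
proof
show "cn {e} <= cn {s}"
 by (rule hull_minimal) (use e_cone s convex_cone_convex_cone_hull in auto)
have "s = (1 / co S s e) *\<^sub>R e" by (subst (2) es) (use a in simp)
hence "s : cn {e}" using a by (metis convex_cone_hull_mul hull_inc insertI1 less_imp_le zero_le_divide_1_iff)
thus "cn {s} <= cn {e}"
 by (intro hull_minimal) (use convex_cone_convex_cone_hull in auto)
qed
hence e_s: "e = s" using cone_of_inj[OF us(2,1)] by simp
have "{B : K. ~ S <= B} Un insert e ` {B. ~ S <= B & B Un S : K} = K"
proof (intro equalityI subsetI)
fix B assume B: "B : K"
show "B : {B : K. ~ S <= B} Un insert e ` {B. ~ S <= B & B Un S : K}"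
proof (cases "S <= B")
 case True
 hence "B = insert e (B - {s})" "~ S <= B - {s}" "(B - {s}) Un S : K" using B e_s s by (auto simp: insert_absorb)
 thus ?thesis by blast
qed (use B in blast)
qed (use e_s s in auto)
moreover have "cones BU = cn ` ({B : K. ~ S <= B} Un insert e ` {B. ~ S <= B & B Un S : K})"
unfolding cones_BU image_Un image_image mink_ray ..
ultimately have "cones BU = cn ` K" by simp
thus ?thesis by (rule fan_complex_eqI) (simp add: rank_BU face_ub)
qed

lemma ray_face:
assumes S2: "2 <= card S" and "b : \<Union>K" shows "{b} : M.K"
proof -
have "~ S <= {b}" using S2 card_mono[of "{b}" S] by auto
hence "cn {b} : cones BU" unfolding cones_BU using vertex_face[OF assms(2)] by blast
thus ?thesis using face_ub[OF vertex_face[OF assms(2)]] by (simp add: fcx_def rank_BU)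
qed

text \<open>The cone is one of the blow-up, which is unimodular, and all its proposed generators are
  primitive vectors of rays of the blow-up.\<close>

lemma insert_e_ubasis:
assumes S2: "2 <= card S" and B: "~ S <= B" "B Un S : K" shows "ubasis n (insert e B)"
proof -
have "cn (insert e B) : cones BU" unfolding cones_BU mink_ray using B by blast
then obtain C where C: "C : M.K" "cn (insert e B) = cn C" by (rule M.cone_basis)
have sub: "insert e B <= C"
proof
fix b assume b: "b : insert e B"
have "{b} : M.K"
proof (cases "b = e")
 case False
 hence "b : \<Union>K" using b B(2) by blast
 thus ?thesis by (rule ray_face[OF S2])
qed (use e(1) in simp)
moreover have "cn {b} <= cn C" unfolding C(2)[symmetric] using b by (intro hull_mono) simp
ultimately have "{b} <= C" using M.cone_subset C(1) by blast
thus "b : C" by simp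
qed
have "ubasis n C" using M.face_ub[OF C(1)] by (simp add: rank_BU)
thus ?thesis using sub by (rule ubasis_mono)
qed

lemma complex_BU:
assumes S2: "2 <= card S" shows "M.K = bcx K S e"
proof (rule fan_complex_eqI)
have "cones BU = cn ` ({B : K. ~ S <= B} Un insert e ` {B. ~ S <= B & B Un S : K})"
unfolding cones_BU image_Un image_image mink_ray ..
also have "{B : K. ~ S <= B} Un insert e ` {B. ~ S <= B & B Un S : K} = bcx K S e"
unfolding bcx_def by blast
finally show "cones BU = cn ` bcx K S e" .
fix X assume "X : bcx K S e"
then consider "X : K" | B where "X = insert e B" "~ S <= B" "B Un S : K" unfolding bcx_def by blast
thus "ubasis (lat_rank BU) X"
unfolding rank_BU by cases (use face_ub insert_e_ubasis[OF S2] in auto)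
qed

lemma e_notin: assumes S2: "2 <= card S" shows "e ~: \<Union>K"
proof
assume "e : \<Union>K"
hence K: "{e} : K" by (rule vertex_face)
have "S <= {e}" by (rule e_in_cone[OF K]) (simp add: hull_inc)
thus False using S2 card_mono[of "{e}" S] by simp
qed

text \<open>Exchanging a vertex \<open>s\<close> of \<open>S\<close> for \<open>e\<close> gives
  again a lattice basis, since the blow-up is unimodular. So the coefficient of \<open>s\<close> in
  \<open>e\<close> is a unit, and it is positive.\<close>

lemma e_sum: assumes S2: "2 <= card S" shows "e = \<Sum>S"
proof -
have "co S s e = 1" if s: "s : S" for s
proof -
let ?B = "insert e (S - {s})"
have "S - {s} Un S = S" by blast
hence u: "ubasis n ?B" using s S by (intro insert_e_ubasis[OF S2]) auto
note Bs = ubasisD[OF u]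
have eS: "e ~: S" using e_notin[OF S2] S by blast
have es: "e = co S s e *\<^sub>R s + (SUM b:S - {s}. co S b e *\<^sub>R b)"
 using co_span[OF Ss(2,1) e_span] sum.remove[OF Ss(1) s, of "%b. co S b e *\<^sub>R b"] by simp
have a: "0 < co S s e" by (rule e_pos[OF s])
have sp: "(SUM b:S - {s}. co S b e *\<^sub>R b) : span ?B" by (intro span_sum span_scale span_base) blast
have "co S s e *\<^sub>R s = e - (SUM b:S - {s}. co S b e *\<^sub>R b)" using es by (simp add: algebra_simps)
also have "... : span ?B" using sp by (intro span_diff) (auto intro: span_base)
finally have "(1 / co S s e) *\<^sub>R (co S s e *\<^sub>R s) : span ?B" by (rule span_scale)
hence ss: "s : span ?B" using a by simp
have z: "co ?B e b = 0" if "b : S - {s}" for b using co(2)[OF Bs(2), of b e] that eS by auto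
have "co ?B e e = co S s e * co ?B e s + (SUM b:S - {s}. co S b e * co ?B e b)"
 by (subst (2) es) (simp add: linear_add[OF co(1)[OF Bs(2)]] linear_scale[OF co(1)[OF Bs(2)]] linear_sum[OF co(1)[OF Bs(2)]])
hence one: "co S s e * co ?B e s = 1" using co(2)[OF Bs(2), of e e] by (simp add: z)
have "co ?B e s : \<int>" "co S s e : \<int>"
 using Bs(4)[of s e] ss s Ss(3) Ss(4)[OF e_Zlat e_span s] by auto
then obtain i j where ij: "co S s e = of_int i" "co ?B e s = of_int j" by (auto elim!: Ints_cases)
have "real_of_int (i * j) = 1" using one ij by simp
hence "i * j = 1" by linarith
moreover have "i > 0" using a ij by simp
ultimately show ?thesis using ij(1) by (simp add: pos_zmult_eq_1_iff)
qed
thus ?thesis using co_span[OF Ss(2,1) e_span] by simp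
qed

lemma wt_BU:
assumes C: "C : K" "card C = d" "X <= cn C" and u: "!!C'. C' : K ==> card C' = d ==> X <= cn C' ==> C' = C"
shows "wt BU X = wt Sg (cn C)"
proof -
have "(THE w. EX et:cones_dim Sg d. X <= et & w = wt Sg et) = wt Sg (cn C)"
proof (rule the_equality)
show "EX et:cones_dim Sg d. X <= et & wt Sg (cn C) = wt Sg et" using C unfolding cones_dim_eq by blast
show "w = wt Sg (cn C)" if "EX et:cones_dim Sg d. X <= et & w = wt Sg et" for w
 using that u unfolding cones_dim_eq by blast
qed
thus ?thesis by (simp add: blow_up_def)
qed

lemma wt_BU1: "A : K ==> card A = d ==> wt BU (cn A) = wt Sg (cn A)"
proof (rule wt_BU)
fix C' assume A: "A : K" "card A = d" and C: "C' : K" "card C' = d" "cn A <= cn C'"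
have "A <= C'" using cone_subset[OF A(1) C(1,3)] .
thus "C' = A" using card_subset_eq[OF fin_face[OF C(1)]] A(2) C(2) by metis
qed auto

text \<open>A facet containing the new cone contains \<open>e\<close>, hence \<open>S\<close> and
  \<open>B\<close>, and has the size of \<open>B Un S\<close>; so the weight is unambiguous.\<close>

lemma wt_BU2:
assumes B: "~ S <= B" "B Un S : K" "Suc (card B) = d"
shows "wt BU (cn (insert e B)) = wt Sg (cn (B Un S))" "card (B Un S) = d"
proof -
have fin: "finite (B Un S)" using fin_face B(2) by blast
have "B \<subset> B Un S" using B(1) by blast
hence "card B < card (B Un S)" by (rule psubset_card_mono[OF fin])
thus c: "card (B Un S) = d" using B(3) card_le[OF B(2)] by simp
have "cn S <= cn (B Un S)" by (rule hull_mono) blast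
hence "insert e B <= cn (B Un S)" using e_cone by (auto intro: hull_inc)
hence sub: "cn (insert e B) <= cn (B Un S)" by (rule hull_minimal) (rule convex_cone_convex_cone_hull)
show "wt BU (cn (insert e B)) = wt Sg (cn (B Un S))"
proof (rule wt_BU[OF B(2) c sub])
fix C assume C: "C : K" "card C = d" "cn (insert e B) <= cn C"
have "e : cn C" by (rule subsetD[OF C(3) hull_inc]) simp
hence 1: "S <= C" by (rule e_in_cone[OF C(1)])
have BK: "B : K" by (rule dcx[OF B(2)]) blast
have "cn B <= cn C" by (rule order_trans[OF hull_mono C(3)]) blast
hence "B <= C" by (rule cone_subset[OF BK C(1)])
hence "B Un S <= C" using 1 by blast
thus "C = B Un S" using card_subset_eq[OF fin_face[OF C(1)]] c C(2) by metis
qed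
qed

lemma dim_BU: "fan_dim BU = d"
proof (cases "card S = 1")
case True
show ?thesis unfolding M.fan_dim_eq singleton_case[OF True] fan_dim_eq ..
next
case False
hence S2: "2 <= card S" using S_nonempty Ss(1) by (simp add: Suc_le_eq less_Suc_eq_le card_gt_0_iff numeral_2_eq_2 le_neq_implies_less)
have KM: "M.K = bcx K S e" by (rule complex_BU[OF S2])
show ?thesis
unfolding M.fan_dim_eq KM
proof (rule Max_eqI)
show "finite (card ` bcx K S e)" using M.fincx unfolding KM by simp
show "y <= d" if y: "y : card ` bcx K S e" for y
proof -
 obtain X where X: "X : bcx K S e" "y = card X" using y by (elim imageE)
 from X(1) consider "X : K" | B where "X = insert e B" "~ S <= B" "B Un S : K" unfolding bcx_def by blast
 thus ?thesis
 proof cases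
  case 1
  thus ?thesis using X(2) card_le by simp
 next
  case 2
  have fin: "finite (B Un S)" using fin_face 2(3) by blast
  have "B \<subset> B Un S" using 2(2) by blast
  hence "card B < card (B Un S)" by (rule psubset_card_mono[OF fin])
  moreover have "card X <= Suc (card B)" unfolding 2(1) by (rule card_insert_le_m1) simp_all
  ultimately show ?thesis using card_le[OF 2(3)] X(2) by simp
 qed
qed
obtain C where C: "C : K" "S <= C" "card C = d" by (rule facet_ex[OF S])
obtain s where s: "s : S" using S_nonempty by blast
have CS: "(C - {s}) Un S = C" using s C(2) by blast
have "~ S <= C - {s}" "(C - {s}) Un S : K" unfolding CS using s C(1) by blast+
hence "insert e (C - {s}) : bcx K S e" unfolding bcx_def by blast
moreover have "e ~: C - {s}" using e_notin[OF S2] C(1) by blast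
hence "card (insert e (C - {s})) = d"
 using fin_face[OF C(1)] s C(2,3) card_Suc_Diff1[of C s] by auto
ultimately show "d : card ` bcx K S e" by (rule rev_image_eqI[OF _ sym])
qed
qed

text \<open>\<open>star_transfer\<close> turns the star fan into the star ideal, supplying both the
  vanishing above its dimension and the duality that \<open>PD_blowup_iff\<close> takes as
  input.\<close>

theorem PD_over_blow_up:
assumes PD: "PD_over TYPE('a::{idom, ring_char_0}) T"
shows "PD_over TYPE('a) Sg <-> PD_over TYPE('a) BU"
proof (cases "card S = 1")
case True
have "PDc K (dforms n) d (wK :: _ => 'a) <-> PDc K (dforms n) d (M.wK :: _ => 'a)"
by (rule PDc_cong) (simp add: wt_BU1)
thus ?thesis unfolding PD_over_def rank_BU dim_BU singleton_case[OF True] .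
next
case False
hence S2: "2 <= card S" using S_nonempty Ss(1) by (simp add: Suc_le_eq less_Suc_eq_le card_gt_0_iff numeral_2_eq_2 le_neq_implies_less)
have KM: "M.K = bcx K S e" by (rule complex_BU[OF S2])
interpret U: ucx K "dforms n :: (vec => 'a) set" by (rule ucx)
have UM: "ucx (bcx K S e) (dforms n :: (vec => 'a) set)" using M.ucx[where 'a = 'a] unfolding KM rank_BU .
obtain D :: "(vec, 'a) mp => 'a" where D: "is_deg K (dforms n) d wK D" using ex_degree by blast
have Sl: "link K S = {v. v ~: S & insert v S : K}" by (simp add: link_def)
have L'_L: "EX l:dforms n. (ALL i:S. l i = 0) & (ALL v:link K S. l' (pp v) = l v)"
if l: "l' : dforms (lat_rank T)" for l' :: "vec => 'a"
proof -
obtain m where m: "m : Zdual (n - k)" "l' = (%v. of_int (m v))" using l unfolding rank_T by (auto simp: dforms_def)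
have "(%v. m (pp v)) : Zdual n"
 using Zdual_D(1)[OF m(1)] quot(2) unfolding Zdual_def by (auto simp: linear_add[OF quot(1)])
thus ?thesis
 using Zdual_D(2)[OF m(1)] pp_S by (intro bexI[of _ "%v. of_int (m (pp v))"]) (auto simp: m(2) dforms_def span_base)
qed
have KT: "fcx T = {pp ` (B - S) |B. B : K & S <= B}" by (rule complex_T)
have wT: "of_int (wt T (cn (pp ` (B - S)))) = (wK B :: 'a)" if "B : K" "S <= B" for B using wt_T[OF that] by simp
note tr = star_transfer[where w' = "%A. of_int (wt T (cn A))", OF ucx S Sl inj_pp KT star.ucx L'_L card_le D wT]
have PDT: "PDc (fcx T) (dforms (lat_rank T) :: (vec => 'a) set) (d - k) (%A. of_int (wt T (cn A)))"
using PD unfolding PD_over_def dim_T .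
interpret B: blowup K "dforms n :: (vec => 'a) set" S e d wK
proof (intro blowup.intro blowup_axioms.intro ucx UM S S2 e_notin[OF S2] card_le)
show "l e = (SUM i:S. l i)" if l: "l : dforms n" for l :: "vec => 'a"
proof -
 obtain m where m: "m : Zdual n" "l = (%v. of_int (m v))" using l by (auto simp: dforms_def)
 have "m (\<Sum>S) = sum m S" by (rule Zdual_D(5)[OF m(1)]) (rule subsetD[OF Ss(3)])
 thus ?thesis unfolding m(2) e_sum[OF S2] by simp
qed
show "p : star_ideal K (dforms n) S" if "homog c p" "d < c + card S" for c and p :: "(vec, 'a) mp"
 by (rule tr(1)) (assumption | fact that)+
qed
have star: "PD_on (star_ideal K (dforms n) S) (%p. D (xprod S * p)) (d - card S)"
by (rule tr(2)) (assumption | fact PDT)+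
have degB: "is_deg (bcx K S e) (dforms n) d M.wK (%p. D (B.piS (B.Ph p)))"
proof (rule B.is_deg_blowup[OF D])
show "M.wK A = (wK A :: 'a)" if "A : K" "~ S <= A" "card A = d" for A using wt_BU1[OF that(1,3)] by simp
show "M.wK (insert e B) = (wK (B Un S) :: 'a)" if "~ S <= B" "B Un S : K" "Suc (card B) = d" for B using wt_BU2[OF that] by simp
qed
show ?thesis
unfolding PD_over_def rank_BU dim_BU KM U.PDc_iff[OF D] B.B.PDc_iff[OF degB]
by (rule B.PD_blowup_iff[OF D star])
qed

end

section \<open>Invariance under isomorphisms of tropical fans\<close>

section \<open>Isomorphisms of tropical fans\<close>

lemma continuous_on_lookup: "continuous_on A (%x :: vec. lookup x i)"
proof -
have "bounded_linear (%x :: vec. lookup x i)"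
by (rule bounded_linear_intro[where K = 1]) (simp_all add: lookup_add lookup_scaleR abs_lookup_le_norm)
thus ?thesis using bounded_linear.continuous_on continuous_on_id by blast
qed

text \<open>A linear map need not be continuous on the space of all finitely supported sequences.\<close>

lemma continuous_on_linear_Rspace:
fixes ps :: "vec => vec"
assumes "linear ps" "A <= Rspace n" shows "continuous_on A ps"
proof -
have eq: "(SUM i<n. lookup x i *\<^sub>R ps (single i 1)) = ps x" if "x : A" for x
proof -
have "(SUM i<n. lookup x i *\<^sub>R single i (1::real)) = trunc n x"
 unfolding trunc_def by (intro sum.cong refl poly_mapping_eqI) (simp add: lookup_scaleR lookup_single when_def)
also have "... = x" using assms(2) that by (intro trunc_Rspace) blast
finally have "ps x = ps (SUM i<n. lookup x i *\<^sub>R single i 1)" by simp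
thus ?thesis by (simp add: linear_sum[OF assms(1)] linear_scale[OF assms(1)])
qed
have "continuous_on A (%x. SUM i<n. lookup x i *\<^sub>R ps (single i 1))"
by (intro continuous_on_sum continuous_on_scaleR continuous_on_lookup continuous_on_const)
thus ?thesis by (rule continuous_on_eq) (rule eq)
qed

locale trop_isom = utrop Sg for Sg +
fixes Sg' :: tfan and ph :: "vec => vec"
assumes tropical': "tropical_fan Sg'"
and lin: "linear ph" and inj: "inj_on ph (span (support Sg))"
and lattice: "ph ` (Zlat (lat_rank Sg) Int span (support Sg)) = Zlat (lat_rank Sg') Int span (support Sg')"
and cones': "(%sg. ph ` sg) ` cones Sg = cones Sg'"
and wt': "!!sg. sg : cones_dim Sg (fan_dim Sg) ==> wt Sg' (ph ` sg) = wt Sg sg"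
begin

abbreviation "W == span (support Sg)"
abbreviation "n' == lat_rank Sg'"

lemma span_W: "B : K ==> span B <= W"
proof (rule span_mono)
assume "B : K"
thus "B <= support Sg" unfolding support_def using cone_in hull_subset[of B convex_cone] by blast
qed

lemma image_cone: "ph ` cn B = cn (ph ` B)" by (rule convex_cone_hull_linear_image[OF lin, symmetric])

lemma support_image: "support Sg' = ph ` support Sg" unfolding support_def cones'[symmetric] by blast

lemma span_support_image: "span (support Sg') = ph ` W" unfolding support_image by (rule linear_span_image[OF lin])

lemma ubasis_image': "B : K ==> ubasis n' (ph ` B)"
proof (rule ubasis_image[OF face_ub lin])
assume B: "B : K"
show "inj_on ph (span B)" using inj span_W[OF B] by (rule inj_on_subset)
show "ph ` B <= Zlat n'"
using lattice ubasisD(3)[OF face_ub[OF B]] span_W[OF B] span_superset[of B] by blast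
fix y assume y: "y : Zlat n'" "y : span (ph ` B)"
obtain x where x: "x : span B" "y = ph x" using y(2) by (auto simp: linear_span_image[OF lin])
have "y : span (support Sg')" unfolding span_support_image using x span_W[OF B] by blast
hence "y : ph ` (Zlat n Int W)" unfolding lattice using y(1) by blast
then obtain z where z: "z : Zlat n" "z : W" "y = ph z" by blast
have "z = x" by (rule inj_onD[OF inj]) (use x z span_W[OF B] in auto)
thus "EX x:Zlat n Int span B. y = ph x" using x z by blast
qed

lemma cones_image: "cones Sg' = cn ` (`) ph ` K"
unfolding cones'[symmetric] cones_eq image_image image_cone ..

lemma unimodular': "unimodular Sg'"
unfolding unimodular_def
proof
fix sg assume "sg : cones Sg'"
then obtain B where B: "B : K" "sg = cn (ph ` B)" unfolding cones_image by blast
thus "EX B. lattice_basis B (Nsub n' sg) & sg = cn B"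
using ubasis_image'[OF B(1)] by (auto simp: ubasis_def Nsub_cone_of)
qed

sublocale N: utrop Sg'
proof
show "rational_fan Sg'" "tropical_fan Sg'" using tropical' by (auto simp: tropical_fan_def)
qed (rule unimodular')

lemma complex': "N.K = (`) ph ` K"
by (rule fan_complex_eqI[OF cones_image]) (use ubasis_image' in blast)

lemma vertex_W: "v : \<Union>K ==> v : W" using span_W span_superset by blast

lemma inj_vertices: "inj_on ph (\<Union>K)" by (rule inj_on_subset[OF inj]) (use vertex_W in blast)

lemma span_vertices: "span (\<Union>K) = W"
proof
show "span (\<Union>K) <= W" by (rule span_minimal) (use vertex_W in auto)
have "support Sg <= span (\<Union>K)"
proof
fix x assume "x : support Sg"
then obtain B where B: "B : K" "x : cn B" by (auto simp: support_def cones_eq)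
have "x : span B" using B(2) mem_cone_of[OF ubasisD(2,1)[OF face_ub[OF B(1)]]] by blast
thus "x : span (\<Union>K)" using span_mono[of B "\<Union>K"] B(1) by blast
qed
thus "W <= span (\<Union>K)" by (rule span_minimal) simp
qed

lemma finite_vertices: "finite (\<Union>K)" using fincx fin_face by blast

lemma Union_complex': "\<Union>N.K = ph ` \<Union>K" unfolding complex' by blast

lemma span_vertices': "span (\<Union>N.K) = span (support Sg')"
unfolding Union_complex' span_support_image span_vertices[symmetric] by (rule linear_span_image[OF lin])

lemma dim': "N.d = d"
proof -
have "card (ph ` B) = card B" if "B : K" for B
by (rule card_image) (rule inj_on_subset[OF inj_vertices], use that in blast)
hence "card ` N.K = card ` K" unfolding complex' image_image by (intro image_cong refl)
thus ?thesis unfolding fan_dim_eq N.fan_dim_eq by simp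
qed

lemma wt_iso: "A : K ==> card A = d ==> wt Sg' (cn (ph ` A)) = wt Sg (cn A)"
unfolding image_cone[symmetric] by (rule wt') (auto simp: cones_dim_eq)

text \<open>An isomorphism matches only the lattices of the spans of the supports. Forms are carried
  over there and extended by \<open>Zdual_extend\<close>; the ideals see forms only at
  vertices.\<close>

theorem PD_over_iso:
assumes PD: "PD_over TYPE('a::{idom, ring_char_0}) Sg" shows "PD_over TYPE('a) Sg'"
proof -
have uN: "ucx ((`) ph ` K) (dforms n' :: (vec => 'a) set)" using N.ucx[where 'a = 'a] unfolding complex' .
have W': "Zlat n' Int span (\<Union>N.K) = ph ` (Zlat n Int W)" unfolding span_vertices' lattice ..
have "PDc ((`) ph ` K) (dforms n' :: (vec => 'a) set) d N.wK"
proof (rule PDc_rename[OF ucx uN inj_vertices _ _ _ PD[unfolded PD_over_def]])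
show "EX l':dforms n'. ALL v:\<Union>K. l' (ph v) = l v" if l: "l : dforms n" for l :: "vec => 'a"
proof -
 obtain m where m: "m : Zdual n" "l = (%v. of_int (m v))" using l by (auto simp: dforms_def)
 define h where "h = inv_into (Zlat n Int W) ph"
 have inj': "inj_on ph (Zlat n Int W)" using inj by (rule inj_on_subset) blast
 have h: "h (ph x) = x" if "x : Zlat n Int W" for x unfolding h_def by (rule inv_into_f_f[OF inj' that])
 have "EX m':Zdual n'. ALL y:Zlat n' Int span (\<Union>N.K). m' y = m (h y)"
 proof (rule Zdual_extend)
  show "finite (\<Union>N.K)" unfolding Union_complex' using finite_vertices by blast
  show "\<Union>N.K <= Zlat n'" using N.vertex_Zlat by blast
  fix x y assume "x : Zlat n' Int span (\<Union>N.K)" "y : Zlat n' Int span (\<Union>N.K)"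
  then obtain a b where ab: "a : Zlat n Int W" "x = ph a" "b : Zlat n Int W" "y = ph b" unfolding W' by blast
  have "a + b : Zlat n Int W" using ab by (auto intro: Zlat_add span_add)
  hence "h (x + y) = a + b" unfolding ab using h by (simp add: linear_add[OF lin, symmetric])
  thus "m (h (x + y)) = m (h x) + m (h y)" using ab h Zdual_D(1)[OF m(1), of a b] by simp
 qed
 then obtain m' where m': "m' : Zdual n'" "ALL y:Zlat n' Int span (\<Union>N.K). m' y = m (h y)" by blast
 have "m' (ph v) = m v" if v: "v : \<Union>K" for v
 proof -
  have "v : Zlat n Int W" using vertex_Zlat[OF v] vertex_W[OF v] by blast
  thus ?thesis using m'(2) h unfolding W' by auto
 qed
 thus ?thesis using m'(1) by (intro bexI[of _ "%v. of_int (m' v)"]) (auto simp: m(2) dforms_def)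
qed
show "EX l:dforms n. ALL v:\<Union>K. l' (ph v) = l v" if l: "l' : dforms n'" for l' :: "vec => 'a"
proof -
 obtain m' where m': "m' : Zdual n'" "l' = (%v. of_int (m' v))" using l by (auto simp: dforms_def)
 have "EX m:Zdual n. ALL x:Zlat n Int span (\<Union>K). m x = m' (ph x)"
 proof (rule Zdual_extend[OF finite_vertices])
  show "\<Union>K <= Zlat n" using vertex_Zlat by blast
  fix x y assume xy: "x : Zlat n Int span (\<Union>K)" "y : Zlat n Int span (\<Union>K)"
  hence "ph x : Zlat n'" "ph y : Zlat n'" using lattice unfolding span_vertices by blast+
  thus "m' (ph (x + y)) = m' (ph x) + m' (ph y)" using Zdual_D(1)[OF m'(1)] by (simp add: linear_add[OF lin])
 qed
 then obtain m where m: "m : Zdual n" "ALL x:Zlat n Int span (\<Union>K). m x = m' (ph x)" by blast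
 have "m v = m' (ph v)" if "v : \<Union>K" for v using m(2) vertex_Zlat[OF that] span_base[OF that] by blast
 thus ?thesis using m(1) by (intro bexI[of _ "%v. of_int (m v)"]) (auto simp: m'(2) dforms_def)
qed
show "N.wK (ph ` A) = (wK A :: 'a)" if "A : K" "card A = d" for A using wt_iso[OF that] by simp
qed
thus ?thesis unfolding PD_over_def complex' dim' .
qed

text \<open>The isomorphism induces a linear map \<open>ps\<close> between the quotients that
  matches cones, weights and orders. A function with trivial divisor is pulled back along
  \<open>ps\<close>, becomes linear by assumption, and is transported forward by a left inverse of
  \<open>ps\<close>.\<close>

lemma star_iso:
assumes S: "S : K" and df: "!!f. meromorphic_fun (star_fan Sg (cn S)) f ==> div_trivial (star_fan Sg (cn S)) f ==>
 EX l::vec => real. linear l & (ALL x:support (star_fan Sg (cn S)). f x = l x)"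
and f: "meromorphic_fun (star_fan Sg' (cn (ph ` S))) f" "div_trivial (star_fan Sg' (cn (ph ` S))) f"
shows "EX l::vec => real. linear l & (ALL x:support (star_fan Sg' (cn (ph ` S))). f x = l x)"
proof -
interpret A: ustar Sg S using S by unfold_locales
have S': "ph ` S : N.K" unfolding complex' using S by blast
interpret B: ustar Sg' "ph ` S" using S' by unfold_locales
let ?T = "star_fan Sg (cn S)" and ?T' = "star_fan Sg' (cn (ph ` S))"
let ?pp = "quot_map Sg (cn S)" and ?pp' = "quot_map Sg' (cn (ph ` S))"
have WR: "W <= Rspace n"
proof -
have "\<Union>K <= Rspace n" using vertex_Zlat Zlat_Rspace by blast
thus ?thesis unfolding span_vertices[symmetric] by (rule span_minimal) (rule sub_Rspace)
qed
have WR': "ph x : Rspace n'" if "x : W" for x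
proof -
have "\<Union>N.K <= Rspace n'" using N.vertex_Zlat Zlat_Rspace by blast
hence "span (\<Union>N.K) <= Rspace n'" by (rule span_minimal) (rule sub_Rspace)
thus ?thesis using that unfolding span_vertices' span_support_image by blast
qed
\<comment> \<open>A linear section of the projection on the span of the support; \<open>ps\<close>
  is independent of it there because its ambiguity lies in the span of \<open>S\<close>.\<close>
obtain h where h: "range h <= W" "linear h" "ALL v:?pp ` W. ?pp (h v) = v"
using linear_exists_right_inverse_on[OF A.quot(1) subspace_span, of "support Sg"] by blast
define ps where "ps y = ?pp' (ph (h y))" for y
have linps: "linear ps" unfolding ps_def
by (rule linearI) (simp_all add: linear_add[OF h(2)] linear_add[OF lin] linear_add[OF B.quot(1)]
  linear_scale[OF h(2)] linear_scale[OF lin] linear_scale[OF B.quot(1)])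
have ker: "x : span S" if "x : W" "?pp x = 0" for x using A.quot(3) WR that by blast
have ps: "ps (?pp x) = ?pp' (ph x)" if x: "x : W" for x
proof -
have hx: "h (?pp x) : W" "?pp (h (?pp x)) = ?pp x" using h x by blast+
have "h (?pp x) - x : span S"
 using hx x by (intro ker) (auto simp: linear_diff[OF A.quot(1)] intro: span_diff)
hence "ph (h (?pp x) - x) : span (ph ` S)" unfolding linear_span_image[OF lin] by blast
hence "?pp' (ph (h (?pp x) - x)) = 0" by (rule B.pp_S)
thus ?thesis unfolding ps_def by (simp add: linear_diff[OF lin] linear_diff[OF B.quot(1)])
qed
have injps: "inj_on ps (?pp ` W)"
proof (rule inj_onI)
fix a b assume "a : ?pp ` W" "b : ?pp ` W" and eq: "ps a = ps b"
then obtain x y where xy: "x : W" "a = ?pp x" "y : W" "b = ?pp y" by blast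
have xyW: "x - y : W" using xy by (intro span_diff)
have "?pp' (ph (x - y)) = 0"
 using eq xy ps by (simp add: linear_diff[OF lin] linear_diff[OF B.quot(1)])
hence "ph (x - y) : span (ph ` S)" using B.quot(3)[OF WR'[OF xyW]] by blast
then obtain z where z: "z : span S" "ph (x - y) = ph z" by (auto simp: linear_span_image[OF lin])
have "x - y = z" by (rule inj_onD[OF inj z(2) xyW]) (use z(1) span_W[OF S] in blast)
hence "?pp (x - y) = 0" using A.pp_S z(1) by blast
thus "a = b" using xy by (simp add: linear_diff[OF A.quot(1)])
qed
have face: "ps ` ?pp ` (B - S) = ?pp' ` (ph ` B - ph ` S)" if B: "B : K" for B
proof -
have "ph ` B - ph ` S = ph ` (B - S)"
 by (rule inj_on_image_set_diff[OF inj_vertices, symmetric]) (use B S in blast)+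
moreover have "ps (?pp b) = ?pp' (ph b)" if "b : B - S" for b using ps vertex_W B that by blast
ultimately show ?thesis by (simp add: image_image)
qed
have sub: "ph ` S <= ph ` B <-> S <= B" if "B : K" for B
by (rule inj_on_image_subset_iff[OF inj_vertices]) (use that S in blast)+
have KT: "B.star.K = (`) ps ` A.star.K"
proof (intro equalityI subsetI)
fix X assume "X : B.star.K"
then obtain B' where B': "B' : N.K" "ph ` S <= B'" "X = ?pp' ` (B' - ph ` S)"
 unfolding B.complex_T by (elim CollectE exE conjE)
then obtain B where B: "B : K" "B' = ph ` B" unfolding complex' by (elim imageE)
have "S <= B" using B'(2) sub[OF B(1)] B(2) by simp
hence "?pp ` (B - S) : A.star.K" unfolding A.complex_T using B(1) by (intro CollectI exI[of _ B] conjI refl)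
moreover have "X = ps ` ?pp ` (B - S)" using face[OF B(1)] B'(3) B(2) by simp
ultimately show "X : (`) ps ` A.star.K" by (rule rev_image_eqI)
next
fix X assume "X : (`) ps ` A.star.K"
then obtain Y where Y: "Y : A.star.K" "X = ps ` Y" by (elim imageE)
then obtain B where B: "B : K" "S <= B" "Y = ?pp ` (B - S)" unfolding A.complex_T by (elim CollectE exE conjE)
have "ph ` B : N.K" unfolding complex' by (rule imageI[OF B(1)])
moreover have "ph ` S <= ph ` B" using B(2) by (rule image_mono)
moreover have "X = ?pp' ` (ph ` B - ph ` S)" unfolding Y(2) B(3) by (rule face[OF B(1)])
ultimately show "X : B.star.K" unfolding B.complex_T by (intro CollectI exI[of _ "ph ` B"] conjI)
qed
have supW: "support ?T <= ?pp ` W"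
proof
fix x assume "x : support ?T"
then obtain X where X: "X : A.star.K" "x : cn X" unfolding support_def A.star.cones_eq by (elim UnionE imageE) simp
obtain B where B: "B : K" "S <= B" "X = ?pp ` (B - S)" using X(1) unfolding A.complex_T by (elim CollectE exE conjE)
have "cn B <= W"
 using cone_in[OF B(1)] span_superset[of "support Sg"] unfolding support_def by blast
hence "?pp ` cn B <= ?pp ` W" by (rule image_mono)
moreover have "x : ?pp ` cn B" using X(2) unfolding B(3) A.pp_cone[OF B(2)] .
ultimately show "x : ?pp ` W" by (rule subsetD)
qed
have img: "ps ` cn B = cn (ps ` B)" for B by (rule convex_cone_hull_linear_image[OF linps, symmetric])
have supp': "support ?T' = ps ` support ?T"
unfolding support_def B.star.cones_eq A.star.cones_eq KT image_image img[symmetric] image_Union ..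
have A_R: "X <= ?pp ` W" if "X : A.star.K" for X
proof -
obtain B where B: "B : K" "S <= B" "X = ?pp ` (B - S)" using `X : A.star.K` unfolding A.complex_T by (elim CollectE exE conjE)
have "B - S <= W" using vertex_W B(1) by blast
thus ?thesis unfolding B(3) by (rule image_mono)
qed
have mer: "meromorphic_fun ?T (%x. f (ps x))"
unfolding meromorphic_fun_def
proof (intro conjI ballI)
have "support ?T <= Rspace A.star.n"
proof
 fix x assume "x : support ?T"
 then obtain B where B: "B : A.star.K" "x : cn B" by (auto simp: support_def A.star.cones_eq)
 have "x : span B" using B(2) mem_cone_of[OF ubasisD(2,1)[OF A.star.face_ub[OF B(1)]]] by blast
 thus "x : Rspace A.star.n" using ubasis_Rspace[OF A.star.face_ub[OF B(1)]] by blast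
qed
hence "continuous_on (support ?T) ps" by (rule continuous_on_linear_Rspace[OF linps])
moreover have "continuous_on (ps ` support ?T) f" using f(1) unfolding supp'[symmetric] by (simp add: meromorphic_fun_def)
ultimately show "continuous_on (support ?T) (%x. f (ps x))" using continuous_on_compose by (simp add: comp_def)
fix sg assume "sg : cones ?T"
then obtain B where B: "B : A.star.K" "sg = cn B" unfolding A.star.cones_eq by blast
have B': "ps ` B : B.star.K" unfolding KT using B(1) by blast
note l = B.star.local_formD[OF f(1) B']
let ?l = "local_form ?T' f (cn (ps ` B))"
have "is_local_form ?T (%x. f (ps x)) sg (%x. ?l (ps x))"
 unfolding is_local_form_def B(2) Nsub_cone_of
proof (intro conjI ballI)
 show "linear (%x. ?l (ps x))" using linear_compose[OF linps l(1)] by (simp add: comp_def)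
 show "f (ps x) = ?l (ps x)" if "x : cn B" for x using l(2)[of "ps x"] that unfolding img[symmetric] by simp
 fix v assume v: "v : Zlat (lat_rank ?T) Int span B"
 have vc: "v = (SUM b:B. of_int \<lfloor>co B b v\<rfloor> *\<^sub>R b)"
  by (rule ub_coords[OF A.star.face_ub[OF B(1)]]) (use v in auto)
 have "?l (ps b) : \<int>" if "b : B" for b
  using ubasisD(3)[OF B.star.face_ub[OF B']] that by (intro l(3)) (auto intro: span_base)
 moreover have "?l (ps v) = (SUM b:B. of_int \<lfloor>co B b v\<rfloor> * ?l (ps b))"
  by (subst vc) (simp add: linear_sum[OF linps] linear_scale[OF linps] linear_sum[OF l(1)] linear_scale[OF l(1)])
 ultimately show "?l (ps v) : \<int>" by auto
qed
thus "EX l. is_local_form ?T (%x. f (ps x)) sg l" by blast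
qed
have "S <= \<Union>K" using S by blast
hence "card (ph ` S) = card S" using inj_on_subset[OF inj_vertices] card_image by blast
hence dimT: "B.star.d = A.star.d" using A.dim_T B.dim_T dim' by simp
have injB: "inj_on ps B" if "B <= ?pp ` W" for B using injps that by (rule inj_on_subset)
have wtT: "wt ?T' (cn (ps ` X)) = wt ?T (cn X)" if X: "X : A.star.K" "card X = A.star.d" for X
proof -
obtain C where C: "C : K" "S <= C" "X = ?pp ` (C - S)" using X(1) unfolding A.complex_T by blast
have "card S <= card C" using card_mono[OF fin_face[OF C(1)] C(2)] .
moreover have "card C - card S = d - card S" using A.card_T[OF C(1,2)] X(2) C(3) A.dim_T by simp
moreover have "card S <= d" using card_le[OF S] .
ultimately have cd: "card C = d" by simp
have C': "ph ` C : N.K" "ph ` S <= ph ` C" unfolding complex' using C by blast+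
have "wt ?T' (cn (ps ` X)) = wt Sg' (cn (ph ` C))"
 unfolding C(3) face[OF C(1)] by (rule B.wt_T[OF C'])
also have "... = wt Sg (cn C)" by (rule wt_iso[OF C(1) cd])
also have "... = wt ?T (cn X)" unfolding C(3) by (rule A.wt_T[OF C(1,2), symmetric])
finally show ?thesis .
qed
have ord: "ord_at ?T (%x. f (ps x)) (cn A) = ord_at ?T' f (cn (ps ` A))"
if A: "A : A.star.K" "Suc (card A) = A.star.d" for A
proof -
have A': "ps ` A : B.star.K" unfolding KT using A(1) by blast
have cA': "Suc (card (ps ` A)) = B.star.d" using card_image[OF injB[OF A_R[OF A(1)]]] A(2) dimT by simp
obtain mu :: "vec => int" where mu: "(SUM b:link A.star.K A. of_int (wt ?T (cn (insert b A))) *\<^sub>R b) = (SUM a:A. of_int (mu a) *\<^sub>R a)"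
 using A.star.balanced_coeffs[OF A.star_balanced[OF A] A(1)] by blast
have linkW: "link A.star.K A <= ?pp ` W" using A_R by (auto simp: link_def)
have link: "link B.star.K (ps ` A) = ps ` link A.star.K A"
proof (intro equalityI subsetI)
 fix c assume "c : link B.star.K (ps ` A)"
 hence c: "c ~: ps ` A" "insert c (ps ` A) : (`) ps ` A.star.K" unfolding link_def KT by auto
 obtain C where C: "C : A.star.K" "insert c (ps ` A) = ps ` C" using c(2) by (elim imageE)
 then obtain b where b: "b : C" "c = ps b" by blast
 have "ps ` A <= ps ` C" using C(2) by blast
 hence "A <= C" using inj_on_image_subset_iff[OF injps A_R[OF A(1)] A_R[OF C(1)]] by blast
 hence "insert b A : A.star.K" using A.star.dcx[OF C(1)] b(1) by blast
 thus "c : ps ` link A.star.K A" using c(1) b(2) by (auto simp: link_def)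
next
 fix c assume "c : ps ` link A.star.K A"
 then obtain b where b: "b ~: A" "insert b A : A.star.K" "c = ps b" by (auto simp: link_def)
 have "ps b ~: ps ` A"
  using inj_on_image_mem_iff[OF injps, of b A] A_R[OF A(1)] A_R[OF b(2)] b(1) by blast
 moreover have "insert (ps b) (ps ` A) : B.star.K" unfolding KT using b(2) by (metis image_insert imageI)
 ultimately show "c : link B.star.K (ps ` A)" unfolding b(3) by (simp add: link_def)
qed
have injL: "inj_on ps (link A.star.K A)" by (rule injB[OF linkW])
have wl: "wt ?T' (cn (insert (ps b) (ps ` A))) = wt ?T (cn (insert b A))" if b: "b : link A.star.K A" for b
 using wtT[of "insert b A"] b A A.star.fin_face[OF A(1)] by (auto simp: link_def)
have sumL: "(SUM c:link B.star.K (ps ` A). of_int (wt ?T' (cn (insert c (ps ` A)))) *\<^sub>R c)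
 = (SUM b:link A.star.K A. of_int (wt ?T (cn (insert b A))) *\<^sub>R ps b)"
 unfolding link sum.reindex[OF injL] comp_def by (intro sum.cong refl) (simp add: wl)
have sumL': "(SUM c:link B.star.K (ps ` A). of_int (wt ?T' (cn (insert c (ps ` A)))) * f c)
 = (SUM b:link A.star.K A. of_int (wt ?T (cn (insert b A))) * f (ps b))"
 unfolding link sum.reindex[OF injL] comp_def by (intro sum.cong refl) (simp add: wl)
have injA: "inj_on ps A" by (rule injB[OF A_R[OF A(1)]])
define mu' where "mu' c = mu (inv_into A ps c)" for c
have mu': "mu' (ps a) = mu a" if "a : A" for a using inv_into_f_f[OF injA that] by (simp add: mu'_def)
have "(SUM c:link B.star.K (ps ` A). of_int (wt ?T' (cn (insert c (ps ` A)))) *\<^sub>R c) = ps (SUM a:A. of_int (mu a) *\<^sub>R a)"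
 unfolding sumL mu[symmetric] by (simp add: linear_sum[OF linps] linear_scale[OF linps])
also have "... = (SUM a:ps ` A. of_int (mu' a) *\<^sub>R a)"
 unfolding sum.reindex[OF injA] by (simp add: linear_sum[OF linps] linear_scale[OF linps] mu')
finally have 2: "(SUM c:link B.star.K (ps ` A). of_int (wt ?T' (cn (insert c (ps ` A)))) *\<^sub>R c) = (SUM a:ps ` A. of_int (mu' a) *\<^sub>R a)" .
have "real_of_int (ord_at ?T (%x. f (ps x)) (cn A)) = of_int (ord_at ?T' f (cn (ps ` A)))"
 unfolding A.star.ord_formula[OF mer A mu] B.star.ord_formula[OF f(1) A' cA' 2] sumL' sum.reindex[OF injA] comp_def
 by (simp add: mu')
thus ?thesis by simp
qed
have triv: "div_trivial ?T (%x. f (ps x))"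
unfolding div_trivial_def
proof
fix ta assume "ta : codim1_cones ?T"
then obtain A where A: "A : A.star.K" "ta = cn A" "Suc (card A) = A.star.d"
 by (auto simp: codim1_cones_def A.star.cones_eq A.star.dim_face)
have A': "ps ` A : B.star.K" unfolding KT using A(1) by blast
have "Suc (card (ps ` A)) = B.star.d" using card_image[OF injB[OF A_R[OF A(1)]]] A(3) dimT by simp
hence "cn (ps ` A) : codim1_cones ?T'"
 using B.star.cone_in[OF A'] B.star.dim_face[OF A'] by (simp add: codim1_cones_def)
thus "ord_at ?T (%x. f (ps x)) ta = 0" using ord[OF A(1,3)] f(2) A(2) by (simp add: div_trivial_def)
qed
obtain l :: "vec => real" where l: "linear l" "ALL x:support ?T. f (ps x) = l x" using df[OF mer triv] by blast
have subW: "subspace (?pp ` W)" by (rule linear_subspace_image[OF A.quot(1) subspace_span])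
obtain xi where xi: "linear xi" "ALL v:?pp ` W. xi (ps v) = v"
using linear_exists_left_inverse_on[OF linps subW injps] by blast
have "f y = l (xi y)" if y: "y : support ?T'" for y
proof -
obtain x where x: "x : support ?T" "y = ps x" using y unfolding supp' by blast
have "xi y = x" using xi(2) x supW by blast
thus ?thesis using l(2) x by simp
qed
thus ?thesis using linear_compose[OF xi(1) l(1)] by (intro exI[of _ "%y. l (xi y)"]) (auto simp: comp_def)
qed

lemma div_faithful_iso:
assumes "div_faithful Sg" shows "div_faithful Sg'"
unfolding div_faithful_def
proof (intro ballI allI impI)
fix et f assume "et : cones Sg'" and f: "meromorphic_fun (star_fan Sg' et) f & div_trivial (star_fan Sg' et) f"
then obtain S where S: "S : K" "et = cn (ph ` S)" unfolding cones_image by blast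
show "EX l::vec => real. linear l & (ALL x:support (star_fan Sg' et). f x = l x)"
unfolding S(2)
by (rule star_iso[OF S(1)]) (use assms cone_in[OF S(1)] f S(2) in "auto simp: div_faithful_def")
qed

end

section \<open>Assembly of the stability clauses\<close>

section \<open>Stability\<close>

lemma utrop_class: "Sg : div_faithful_unimodular_fans ==> utrop Sg"
by (simp add: div_faithful_unimodular_fans_def utrop_def utrop_axioms_def ufan_def tropical_fan_def)

lemma tropical_isomorphism_if_iso:
assumes "utrop Sg" "tropical_fan Sg'" "tropical_iso Sg Sg'"
obtains ph where "trop_isom Sg Sg' ph"
proof -
obtain ph where ph: "linear ph" "inj_on ph (span (support Sg))"
"ph ` (Zlat (lat_rank Sg) Int span (support Sg)) = Zlat (lat_rank Sg') Int span (support Sg')"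
"(%sg. ph ` sg) ` cones Sg = cones Sg'" "ALL sg:cones_dim Sg (fan_dim Sg). wt Sg' (ph ` sg) = wt Sg sg"
using assms(3) unfolding tropical_iso_def by (elim exE conjE)
have "trop_isom Sg Sg' ph"
by (intro trop_isom.intro trop_isom_axioms.intro assms(1,2) ph(1-4) bspec[OF ph(5)])
thus ?thesis by (rule that)
qed

text \<open>The clauses are the transfer theorems for products, modifications and blow-ups, and
  closure under isomorphism is \<open>PD_over_iso\<close> with \<open>div_faithful_iso\<close>. The
  property enters only through its equivalence with \<open>PD_over\<close>, so both coefficient
  rings are served.\<close>

theorem T_stable_property_PD_over:
fixes P :: "tfan => bool"
assumes P: "!!Sg. utrop Sg ==> P Sg <-> PD_over TYPE('a::{euclidean_ring, ring_char_0}) Sg"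
shows "T_stable_property P div_faithful_unimodular_fans"
proof -
let ?C = "div_faithful_unimodular_fans"
have iso: "Sg' : ?C" "PD_over TYPE('a) Sg ==> PD_over TYPE('a) Sg'"
if S: "Sg : ?C" and S': "tropical_fan Sg'" "tropical_iso Sg Sg'" for Sg Sg'
proof -
obtain ph where "trop_isom Sg Sg' ph"
 by (rule tropical_isomorphism_if_iso[OF utrop_class[OF S] S'])
then interpret I: trop_isom Sg Sg' ph .
show "Sg' : ?C" using S S' I.unimodular' I.div_faithful_iso by (simp add: div_faithful_unimodular_fans_def)
show "PD_over TYPE('a) Sg ==> PD_over TYPE('a) Sg'" by (rule I.PD_over_iso)
qed
have PC: "P Sg <-> PD_over TYPE('a) Sg" if "Sg : ?C" for Sg by (rule P[OF utrop_class[OF that]])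
have class_C: "tropical_class ?C"
unfolding tropical_class_def
proof (intro conjI ballI allI impI)
show "tropical_fan Sg" if "Sg : ?C" for Sg using that by (simp add: div_faithful_unimodular_fans_def)
show "Sg' : ?C" if "Sg : ?C" "tropical_fan Sg' & tropical_iso Sg Sg'" for Sg Sg'
 by (rule iso(1)[OF that(1) conjunct1[OF that(2)] conjunct2[OF that(2)]])
qed
have class_S: "tropical_class {Sg : ?C. P Sg}"
unfolding tropical_class_def
proof (intro conjI ballI allI impI)
fix Sg assume S: "Sg : {Sg : ?C. P Sg}"
thus "tropical_fan Sg" by (simp add: div_faithful_unimodular_fans_def)
fix Sg' assume "tropical_fan Sg' & tropical_iso Sg Sg'"
hence i: "Sg' : ?C" "PD_over TYPE('a) Sg ==> PD_over TYPE('a) Sg'" using S iso[of Sg Sg'] by simp_all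
have "PD_over TYPE('a) Sg" using S PC[of Sg] by simp
thus "Sg' : {Sg : ?C. P Sg}" using i PC[of Sg'] by simp
qed
have prod: "fan_prod Sg Sg' : {Sg : ?C. P Sg}"
if "Sg : {Sg : ?C. P Sg}" "Sg' : {Sg : ?C. P Sg}" "fan_prod Sg Sg' : ?C" for Sg Sg'
proof -
have C: "Sg : ?C" "Sg' : ?C" using that by simp_all
have PD: "PD_over TYPE('a) Sg" "PD_over TYPE('a) Sg'" using that PC[OF C(1)] PC[OF C(2)] by simp_all
have "PD_over TYPE('a) (fan_prod Sg Sg')"
 by (rule PD_over_fan_prod[OF utrop_class[OF C(1)] utrop_class[OF C(2)] utrop_class[OF that(3)] PD])
thus ?thesis using that(3) PC by simp
qed
have modif: "trop_mod Sg f : {Sg : ?C. P Sg}"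
if "Sg : {Sg : ?C. P Sg}" "meromorphic_fun Sg f" "trop_mod Sg f : ?C" for Sg f
proof -
have "modification Sg f" using that utrop_class by (simp add: modification_def modification_axioms_def)
moreover have C: "Sg : ?C" using that(1) by simp
moreover have "PD_over TYPE('a) Sg" using that(1) PC[OF C] by simp
ultimately have "PD_over TYPE('a) (trop_mod Sg f)" using modification.PD_over_trop_mod by blast
thus ?thesis using that(3) PC[OF that(3)] by simp
qed
have blow: "Sg : {Sg : ?C. P Sg} <-> blow_up Sg sg ro : {Sg : ?C. P Sg}"
if S: "Sg : ?C" "sg : cones Sg" "ray_in_relint Sg sg ro" "star_fan Sg sg : {Sg : ?C. P Sg}" "blow_up Sg sg ro : ?C" for Sg sg ro
proof -
interpret U: utrop Sg by (rule utrop_class[OF S(1)])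
obtain B where B: "B : fcx Sg" "sg = cn B" using U.cone_basis[OF S(2)] .
have "stellar Sg B ro"
 using S B utrop_class U.utrop_axioms
 by (simp add: stellar_def stellar_axioms_def ustar_def ustar_axioms_def)
moreover have C: "star_fan Sg sg : ?C" using S(4) by simp
moreover have "PD_over TYPE('a) (star_fan Sg sg)" using S(4) PC[OF C] by simp
ultimately have "PD_over TYPE('a) Sg <-> PD_over TYPE('a) (blow_up Sg sg ro)"
 using stellar.PD_over_blow_up[of Sg B ro] B(2) by simp
thus ?thesis using S(1,5) PC[OF S(1)] PC[OF S(5)] by simp
qed
show ?thesis
unfolding T_stable_property_def T_stable_def
proof (intro conjI class_C class_S ballI allI impI)
show "{Sg : ?C. P Sg} <= ?C" by blast
show "fan_prod Sg Sg' : {Sg : ?C. P Sg}"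
 if "Sg : {Sg : ?C. P Sg}" "Sg' : {Sg : ?C. P Sg}" "fan_prod Sg Sg' : ?C" for Sg Sg' using that by (rule prod)
show "trop_mod Sg f : {Sg : ?C. P Sg}"
 if "Sg : {Sg : ?C. P Sg}"
  "meromorphic_fun Sg f & (div_trivial Sg f | div_fan Sg f : {Sg : ?C. P Sg}) & trop_mod Sg f : ?C" for Sg f
 using modif[OF that(1)] that(2) by blast
show "Sg : {Sg : ?C. P Sg} <-> blow_up Sg sg ro : {Sg : ?C. P Sg}"
 if "Sg : ?C" "sg : cones Sg" "ray_in_relint Sg sg ro & star_fan Sg sg : {Sg : ?C. P Sg} & blow_up Sg sg ro : ?C" for Sg sg ro
 using blow[OF that(1,2)] that(3) by blast
qed
qed

theorem theorem1p7:
  shows "T_stable_property PD_Z div_faithful_unimodular_fans \<and>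
         T_stable_property PD_Q div_faithful_unimodular_fans"
using T_stable_property_PD_over[where 'a = int, OF utrop.PD_Z_iff]
T_stable_property_PD_over[where 'a = rat, OF utrop.PD_Q_iff] by blast

end
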